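(* Let $M$ be a compact smooth $n$-manifold and $E\to M$ a smooth vector bundle of rank $r$. Let $e\in\mathbb{R}$, $q\in(1,\infty)$, and let $\Lambda=\{(U_\alpha,\varphi_\alpha,\rho_\alpha,\psi_\alpha)\}_{\alpha=1}^N$ be an augmented total trivialization atlas for $E\to M$. If $e$ is a noninteger less than $-1$, assume further that $\Lambda$ is GL compatible with itself. Let $1\le\beta\le N$ and let $V$ be an open set with $V\subseteq\bar V\subseteq U_\beta$. If $u\in W^{e,q}(M,E;\Lambda)$ satisfies $\mathrm{supp}\,u\subseteq V$, then $[H_\beta(u)]^i\in W^{e,q}(\varphi_\beta(U_\beta))$ for all $1\le i\le r$; indeed $$\|[H_\beta(u)]^i\|_{W^{e,q}(\varphi_\beta(U_\beta))}\le C\,\|u\|_{W^{e,q}(M,E;\Lambda)}$$ with a constant $C$ independent of $u$.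
   Context: Manifolds are smooth, Hausdorff and second countable; $E_U=\pi^{-1}(U)$ for a bundle $\pi:E\to M$. Trivializations. A total trivialization triple $(U,\varphi,\rho)$ for $E$ consists of a smooth chart $(U,\varphi)$ of $M$ and a smooth map $\rho=(\rho^1,\dots,\rho^r):E_U\to\mathbb{R}^r$ that is a linear isomorphism on each fibre and such that $(\pi,\rho):E_U\to U\times\mathbb{R}^r$ is a diffeomorphism. An augmented total trivialization atlas is a finite collection $\{(U_\alpha,\varphi_\alpha,\rho_\alpha,\psi_\alpha)\}_{1\le\alpha\le N}$ of such triples, whose charts form a smooth atlas of $M$, together with a smooth nonnegative partition of unity $\{\psi_\alpha\}$ with $\mathrm{supp}\,\psi_\alpha\subseteq U_\alpha$. Euclidean spaces. Let $\Omega\subseteq\mathbb{R}^n$ be nonempty open, $1<p<\infty$. For $k\in\mathbb{N}_0$, $\|u\|_{W^{k,p}(\Omega)}=\sum_{|\nu|\le k}\|\partial^\nu u\|_{L^p(\Omega)}$; for $s=k+\theta$, $\theta\in(0,1)$, $\|u\|_{W^{s,p}(\Omega)}=\|u\|_{W^{k,p}(\Omega)}+\sum_{|\nu|=k}\big(\iint_{\Omega\times\Omega}\frac{|\partial^\nu u(x)-\partial^\nu u(y)|^p}{|x-y|^{n+\theta p}}dx\,dy\big)^{1/p}$; $W^{s,p}(\Omega)$ is the set of $u\in L^p(\Omega)$ with finite norm. For $s\ge0$, $W^{s,p}_0(\Omega)$ is the closure of $C_c^\infty(\Omega)$ in $W^{s,p}(\Omega)$. For $s<0$, $W^{s,p}(\Omega)=(W_0^{-s,p'}(\Omega))^*$,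 $1/p+1/p'=1$, viewed as a subspace of $D'(\Omega)$ by restriction to $C_c^\infty(\Omega)$. Distributions. Let $\mathcal{D}$ be the density bundle of $M$ and $E^\vee=\mathrm{Hom}(E,\mathcal{D})$. $D'(M,E)$ is the topological dual of $D(M,E^\vee)=C^\infty_c(M,E^\vee)$ with its usual test-function topology. For $u\in D'(M,E)$, the local representation $H_\alpha(u)\in D'(\varphi_\alpha(U_\alpha))^r$ has components $[H_\alpha(u)]^l(\xi)=\langle u,g_{l,\xi}\rangle$, where $g_{l,\xi}$ is the section of $E^\vee$ supported in $U_\alpha$ with $g_{l,\xi}(x)(a)=\xi(\varphi_\alpha(x))\,\rho_\alpha^l(a)\,|dx^1\wedge\cdots\wedge dx^n|_x$ for $a\in E_x$, $\varphi_\alpha=(x^i)$. If $u$ is the regular distribution $\eta\mapsto\int_M\eta(f)$ given by a section $f$, then $[H_\alpha(u)]^l=\rho_\alpha^l\circ f\circ\varphi_\alpha^{-1}$. Sobolev spaces. $W^{e,q}(M,E;\Lambda)=\{u\in D'(M,E):\|u\|_{W^{e,q}(M,E;\Lambda)}:=\sum_{\alpha=1}^N\sum_{l=1}^r\|[H_\alpha(\psi_\alpha u)]^l\|_{W^{e,q}(\varphi_\alpha(U_\alpha))}<\infty\}$. GL compatibility. $\Lambda$ is GL compatible with itself if every $\varphi_\alpha(U_\alpha)$ is either $\mathbb{R}^n$ or a nonempty bounded open set with Lipschitz boundary, and whenever $U_\alpha\cap U_\beta\ne\emptyset$ each of $\varphi_\alpha(U_\alpha\cap U_\beta)$ and $\varphi_\beta(U_\alpha\cap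 U_\beta)$ is a nonempty bounded open set with Lipschitz boundary or all of $\mathbb{R}^n$. *)

theory Defs
  imports "HOL-Analysis.Analysis"
begin

section \<open>Smooth functions and partial derivatives on Euclidean spaces\<close>

text \<open>Only meant for open \<open>S\<close>.\<close>

primrec Ck_on ::
  "nat \<Rightarrow> 'a::euclidean_space set \<Rightarrow> ('a \<Rightarrow> 'b::real_normed_vector) \<Rightarrow> bool"
where
  "Ck_on 0 S f \<longleftrightarrow> continuous_on S f"
| "Ck_on (Suc k) S f \<longleftrightarrow> (\<forall>x\<in>S. f differentiable (at x)) \<and>
     (\<forall>v\<in>Basis. Ck_on k S (\<lambda>x. frechet_derivative f (at x) v))"

definition smooth_on ::
  "'a::euclidean_space set \<Rightarrow> ('a \<Rightarrow> 'b::real_normed_vector) \<Rightarrow> bool"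
  where "smooth_on S f \<longleftrightarrow> (\<forall>k. Ck_on k S f)"

primrec iter_pderiv :: "'n::finite list \<Rightarrow> (real^'n \<Rightarrow> real) \<Rightarrow> real^'n \<Rightarrow> real" where
  "iter_pderiv [] f = f"
| "iter_pderiv (i # is) f = (\<lambda>x. frechet_derivative (iter_pderiv is f) (at x) (axis i 1))"

type_synonym 'n multi_index = "'n \<Rightarrow> nat"

abbreviation mi_order :: "'n::finite multi_index \<Rightarrow> nat"
  where "mi_order \<nu> \<equiv> (\<Sum>i\<in>UNIV. \<nu> i)"

text \<open>The index type carries no order, so some enumeration of \<open>\<nu>\<close> is chosen; for smooth
  functions all enumerations give the same derivative.\<close>

definition pderiv_mi :: "'n::finite multi_index \<Rightarrow> (real^'n \<Rightarrow> real) \<Rightarrow> real^'n \<Rightarrow> real"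
  where "pderiv_mi \<nu> f = iter_pderiv (SOME is. \<forall>i. count_list is i = \<nu> i) f"


section \<open>Spaces of test functions and their duals\<close>

text \<open>Test functions and test sections are both encoded as real functions on some type \<open>'x\<close>.
  A family \<open>DD\<close> of function spaces \<open>D\<^sub>K\<close> and a set \<open>P\<close> of seminorms give the usual
  topology on the union of the \<open>D\<^sub>K\<close>: it is generated by the translates of the convex
  balanced sets whose trace on each \<open>D\<^sub>K\<close> is open for the seminorms.\<close>

definition seminorm_topology ::
  "('x \<Rightarrow> real) set \<Rightarrow> (('x \<Rightarrow> real) \<Rightarrow> real) set \<Rightarrow> ('x \<Rightarrow> real) topology"
  where "seminorm_topology S P =
    topology_generated_by {{g\<in>S. p (\<lambda>x. g x - f x) < \<epsilon>} | f p \<epsilon>. f \<in> S \<and> p \<in> P \<and> 0 < \<epsilon>}"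

definition convex_balanced :: "('x \<Rightarrow> real) set \<Rightarrow> bool"
  where "convex_balanced W \<longleftrightarrow>
    (\<forall>f\<in>W. \<forall>g\<in>W. \<forall>t\<in>{0..1}. (\<lambda>x. (1 - t) * f x + t * g x) \<in> W) \<and>
    (\<forall>f\<in>W. \<forall>t. \<bar>t\<bar> \<le> 1 \<longrightarrow> (\<lambda>x. t * f x) \<in> W)"

definition test_topology ::
  "('x \<Rightarrow> real) set set \<Rightarrow> (('x \<Rightarrow> real) \<Rightarrow> real) set \<Rightarrow> ('x \<Rightarrow> real) topology"
  where "test_topology DD P =
    topology_generated_by {{(\<lambda>x. f x + w x) | w. w \<in> W} | f W.
      f \<in> \<Union>DD \<and> W \<subseteq> \<Union>DD \<and> convex_balanced W \<and>
      (\<forall>S\<in>DD. openin (seminorm_topology S P) (W \<inter> S))}"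

definition linear_functional_on :: "('x \<Rightarrow> real) set \<Rightarrow> (('x \<Rightarrow> real) \<Rightarrow> real) \<Rightarrow> bool"
  where "linear_functional_on D u \<longleftrightarrow>
    (\<forall>f\<in>D. \<forall>g\<in>D. u (\<lambda>x. f x + g x) = u f + u g) \<and>
    (\<forall>f\<in>D. \<forall>c. u (\<lambda>x. c * f x) = c * u f)"

text \<open>Values of a functional off the test space are irrelevant and left unconstrained.\<close>

definition topological_dual ::
  "('x \<Rightarrow> real) set set \<Rightarrow> (('x \<Rightarrow> real) \<Rightarrow> real) set \<Rightarrow> (('x \<Rightarrow> real) \<Rightarrow> real) set"
  where "topological_dual DD P =
    {u. linear_functional_on (\<Union>DD) u \<and> continuous_map (test_topology DD P) euclideanreal u}"


section \<open>Distributions on open subsets of Euclidean space\<close>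

definition test_functions_in :: "(real^'n::finite) set \<Rightarrow> (real^'n \<Rightarrow> real) set"
  where "test_functions_in K = {\<xi>. smooth_on UNIV \<xi> \<and> closure {x. \<xi> x \<noteq> 0} \<subseteq> K}"

definition test_functions :: "(real^'n::finite) set \<Rightarrow> (real^'n \<Rightarrow> real) set"
  where "test_functions \<Omega> = \<Union>{test_functions_in K | K. compact K \<and> K \<subseteq> \<Omega>}"

definition distributions ::
  "(real^'n::finite) set \<Rightarrow> ((real^'n \<Rightarrow> real) \<Rightarrow> real) set"
  where "distributions \<Omega> = topological_dual
    {test_functions_in K | K. compact K \<and> K \<subseteq> \<Omega>}
    (range (\<lambda>\<nu> \<xi>. SUP x. \<bar>pderiv_mi \<nu> \<xi> x\<bar>))"

definition regular_distribution ::
  "(real^'n::finite) set \<Rightarrow> (real^'n \<Rightarrow> real) \<Rightarrow> (real^'n \<Rightarrow> real) \<Rightarrow> real"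
  where "regular_distribution \<Omega> f \<xi> = (LINT x:\<Omega>|lborel. f x * \<xi> x)"


section \<open>Sobolev spaces on open subsets of Euclidean space\<close>

definition ennreal_root :: "real \<Rightarrow> ennreal \<Rightarrow> ennreal"
  where "ennreal_root p a = (if a = \<infinity> then \<infinity> else ennreal (enn2real a powr (1 / p)))"

definition Lp_norm :: "real \<Rightarrow> (real^'n::finite) set \<Rightarrow> (real^'n \<Rightarrow> real) \<Rightarrow> ennreal"
  where "Lp_norm p \<Omega> f = ennreal_root p (\<integral>\<^sup>+x\<in>\<Omega>. ennreal (\<bar>f x\<bar> powr p) \<partial>lborel)"

definition Lp_space :: "real \<Rightarrow> (real^'n::finite) set \<Rightarrow> (real^'n \<Rightarrow> real) set"
  where "Lp_space p \<Omega> = {f. set_borel_measurable lborel \<Omega> f \<and> Lp_norm p \<Omega> f < \<infinity>}"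

definition slobodeckij ::
  "real \<Rightarrow> real \<Rightarrow> (real^'n::finite) set \<Rightarrow> (real^'n \<Rightarrow> real) \<Rightarrow> ennreal"
  where "slobodeckij \<theta> p \<Omega> g = ennreal_root p
    (\<integral>\<^sup>+x\<in>\<Omega>. (\<integral>\<^sup>+y\<in>\<Omega>.
      ennreal (\<bar>g x - g y\<bar> powr p / norm (x - y) powr (real CARD('n) + \<theta> * p))
      \<partial>lborel) \<partial>lborel)"

definition weak_derivs ::
  "(real^'n::finite) set \<Rightarrow> 'n multi_index \<Rightarrow> (real^'n \<Rightarrow> real) \<Rightarrow> (real^'n \<Rightarrow> real) set"
  where "weak_derivs \<Omega> \<nu> f = {g.
    (\<forall>K. compact K \<and> K \<subseteq> \<Omega> \<longrightarrow> set_integrable lborel K g) \<and>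
    (\<forall>\<xi>\<in>test_functions \<Omega>.
      regular_distribution \<Omega> f (pderiv_mi \<nu> \<xi>)
        = (-1) ^ mi_order \<nu> * regular_distribution \<Omega> g \<xi>)}"

text \<open>Functions are not identified almost everywhere. A weak derivative is unique up to null
  sets, on which the norms below do not depend, so the infima range over at most one value;
  they are \<open>\<infinity>\<close> if there is no weak derivative.\<close>

definition sobolev_norm ::
  "real \<Rightarrow> real \<Rightarrow> (real^'n::finite) set \<Rightarrow> (real^'n \<Rightarrow> real) \<Rightarrow> ennreal"
  where "sobolev_norm s p \<Omega> f =
    (let k = nat \<lfloor>s\<rfloor>; \<theta> = frac s in
      (\<Sum>\<nu> | mi_order \<nu> \<le> k. INF g\<in>weak_derivs \<Omega> \<nu> f. Lp_norm p \<Omega> g) +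
      (if \<theta> = 0 then 0
       else \<Sum>\<nu> | mi_order \<nu> = k. INF g\<in>weak_derivs \<Omega> \<nu> f. slobodeckij \<theta> p \<Omega> g))"

definition sobolev_space ::
  "real \<Rightarrow> real \<Rightarrow> (real^'n::finite) set \<Rightarrow> (real^'n \<Rightarrow> real) set"
  where "sobolev_space s p \<Omega> = {f \<in> Lp_space p \<Omega>. sobolev_norm s p \<Omega> f < \<infinity>}"

definition sobolev_space0 ::
  "real \<Rightarrow> real \<Rightarrow> (real^'n::finite) set \<Rightarrow> (real^'n \<Rightarrow> real) set"
  where "sobolev_space0 s p \<Omega> = {f \<in> sobolev_space s p \<Omega>.
    \<forall>\<epsilon>>0. \<exists>\<xi>\<in>test_functions \<Omega>. sobolev_norm s p \<Omega> (\<lambda>x. f x - \<xi> x) < ennreal \<epsilon>}"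

text \<open>The \<open>W\<^sup>s\<^sup>,\<^sup>p\<close> norm of a distribution \<open>T\<close>. For \<open>s \<ge> 0\<close> it is the norm of the function
  representing \<open>T\<close>, and for \<open>s < 0\<close> the operator norm of the bounded functional \<open>F\<close> on the
  zero-trace space with the conjugate exponent that restricts to \<open>T\<close>. The function is unique
  almost everywhere and \<open>F\<close> is unique by density; the norm is \<open>\<infinity>\<close> if they do not exist.\<close>

definition distr_norm ::
  "real \<Rightarrow> real \<Rightarrow> (real^'n::finite) set \<Rightarrow> ((real^'n \<Rightarrow> real) \<Rightarrow> real) \<Rightarrow> ennreal"
  where "distr_norm s p \<Omega> T =
    (if 0 \<le> s then
       Inf {sobolev_norm s p \<Omega> f | f. f \<in> Lp_space p \<Omega> \<and>
              (\<forall>\<xi>\<in>test_functions \<Omega>. T \<xi> = regular_distribution \<Omega> f \<xi>)}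
     else
       (let p' = p / (p - 1); W0 = sobolev_space0 (-s) p' \<Omega> in
       Inf {ennreal C | C F. 0 \<le> C \<and> linear_functional_on W0 F \<and>
              (\<forall>f\<in>W0. ennreal \<bar>F f\<bar> \<le> ennreal C * sobolev_norm (-s) p' \<Omega> f) \<and>
              (\<forall>\<xi>\<in>test_functions \<Omega>. F \<xi> = T \<xi>)}))"

definition sobolev_distributions ::
  "real \<Rightarrow> real \<Rightarrow> (real^'n::finite) set \<Rightarrow> ((real^'n \<Rightarrow> real) \<Rightarrow> real) set"
  where "sobolev_distributions s p \<Omega> = {T \<in> distributions \<Omega>. distr_norm s p \<Omega> T < \<infinity>}"


section \<open>Smooth manifolds\<close>

text \<open>A chart is a pair of a domain and a coordinate map, whose values off the domain are
  irrelevant. The atlas of a manifold need not be maximal; \<open>smooth_chart\<close> ranges over the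
  maximal atlas it generates.\<close>

type_synonym ('m, 'a) chart = "'m set \<times> ('m \<Rightarrow> 'a)"

record ('m, 'a) manifold =
  mtop :: "'m topology"
  atlas :: "('m, 'a) chart set"

abbreviation points :: "('m, 'a, 'z) manifold_scheme \<Rightarrow> 'm set"
  where "points M \<equiv> topspace (mtop M)"

definition chart_on :: "'m topology \<Rightarrow> ('m, 'a::euclidean_space) chart \<Rightarrow> bool"
  where "chart_on X c \<longleftrightarrow> openin X (fst c) \<and> open (snd c ` fst c) \<and>
    homeomorphic_map (subtopology X (fst c)) (top_of_set (snd c ` fst c)) (snd c)"

definition transition :: "('m, 'a) chart \<Rightarrow> ('m, 'a) chart \<Rightarrow> 'a \<Rightarrow> 'a"
  where "transition c d = snd d \<circ> inv_into (fst c) (snd c)"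

definition compatible :: "('m, 'a::euclidean_space) chart \<Rightarrow> ('m, 'a) chart \<Rightarrow> bool"
  where "compatible c d \<longleftrightarrow>
    smooth_on (snd c ` (fst c \<inter> fst d)) (transition c d) \<and>
    smooth_on (snd d ` (fst c \<inter> fst d)) (transition d c)"

definition smooth_manifold :: "('m, 'a::euclidean_space) manifold \<Rightarrow> bool"
  where "smooth_manifold M \<longleftrightarrow>
    Hausdorff_space (mtop M) \<and> second_countable (mtop M) \<and>
    (\<forall>c\<in>atlas M. chart_on (mtop M) c) \<and> \<Union>(fst ` atlas M) = points M \<and>
    (\<forall>c\<in>atlas M. \<forall>d\<in>atlas M. compatible c d)"

definition smooth_chart :: "('m, 'a::euclidean_space) manifold \<Rightarrow> ('m, 'a) chart \<Rightarrow> bool"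
  where "smooth_chart M c \<longleftrightarrow> chart_on (mtop M) c \<and> (\<forall>d\<in>atlas M. compatible c d)"

text \<open>Smoothness on an open subset \<open>W\<close> of \<open>M\<close>.\<close>

definition smooth_map_on ::
  "('m, 'a::euclidean_space) manifold \<Rightarrow> 'm set \<Rightarrow> ('k, 'b::euclidean_space) manifold
    \<Rightarrow> ('m \<Rightarrow> 'k) \<Rightarrow> bool"
  where "smooth_map_on M W M' F \<longleftrightarrow>
    continuous_map (subtopology (mtop M) W) (mtop M') F \<and>
    (\<forall>(U, \<phi>)\<in>atlas M. \<forall>(U', \<phi>')\<in>atlas M'.
      smooth_on (\<phi> ` (U \<inter> W \<inter> F -` U')) (\<phi>' \<circ> F \<circ> inv_into U \<phi>))"

definition diffeomorphism_on ::
  "('m, 'a::euclidean_space) manifold \<Rightarrow> 'm set \<Rightarrow> ('k, 'b::euclidean_space) manifold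
    \<Rightarrow> 'k set \<Rightarrow> ('m \<Rightarrow> 'k) \<Rightarrow> bool"
  where "diffeomorphism_on M W M' W' F \<longleftrightarrow> bij_betw F W W' \<and>
    smooth_map_on M W M' F \<and> smooth_map_on M' W' M (inv_into W F)"

definition euclidean_manifold :: "('a::euclidean_space, 'a) manifold"
  where "euclidean_manifold = \<lparr>mtop = euclidean, atlas = {(UNIV, id)}\<rparr>"

definition prod_manifold ::
  "('m, 'a) manifold \<Rightarrow> ('k, 'b) manifold \<Rightarrow> ('m \<times> 'k, 'a \<times> 'b) manifold"
  where "prod_manifold M M' = \<lparr>mtop = prod_topology (mtop M) (mtop M'),
    atlas = {(U \<times> U', map_prod \<phi> \<phi>') | U \<phi> U' \<phi>'. (U, \<phi>) \<in> atlas M \<and> (U', \<phi>') \<in> atlas M'}\<rparr>"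


section \<open>Tangent spaces and densities\<close>

definition charts_at ::
  "('m, 'a::euclidean_space) manifold \<Rightarrow> 'm \<Rightarrow> ('m, 'a) chart set"
  where "charts_at M x = {c. smooth_chart M c \<and> x \<in> fst c}"

text \<open>A tangent vector at \<open>x\<close> is the family of its component vectors in all smooth charts
  around \<open>x\<close>, extended by \<open>0\<close> to the remaining pairs.\<close>

type_synonym ('m, 'n) tvec = "('m, real^'n) chart \<Rightarrow> real^'n"

definition tangent_space :: "('m, real^'n::finite) manifold \<Rightarrow> 'm \<Rightarrow> ('m, 'n) tvec set"
  where "tangent_space M x = {v.
    (\<forall>c\<in>charts_at M x. \<forall>d\<in>charts_at M x.
      v d = frechet_derivative (transition c d) (at (snd c x)) (v c)) \<and>
    (\<forall>c. c \<notin> charts_at M x \<longrightarrow> v c = 0)}"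

definition tangent_of_coords ::
  "('m, real^'n::finite) manifold \<Rightarrow> 'm \<Rightarrow> ('m, real^'n) chart \<Rightarrow> real^'n \<Rightarrow> ('m, 'n) tvec"
  where "tangent_of_coords M x c w = (\<lambda>d.
    if d \<in> charts_at M x then frechet_derivative (transition c d) (at (snd c x)) w else 0)"

text \<open>Densities on \<open>T\<^sub>xM\<close>: functions \<open>\<mu>\<close> of \<open>n\<close> tangent vectors with
  \<open>\<mu> (T v\<^sub>1, \<dots>, T v\<^sub>n) = \<bar>det T\<bar> \<mu> (v\<^sub>1, \<dots>, v\<^sub>n)\<close> for every endomorphism \<open>T\<close> of the tangent
  space; \<open>T\<close> is given by its matrix \<open>A\<close> in a chart.\<close>

definition density_space ::
  "('m, real^'n::finite) manifold \<Rightarrow> 'm \<Rightarrow> (('n \<Rightarrow> ('m, 'n) tvec) \<Rightarrow> real) set"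
  where "density_space M x = {\<mu>.
    (\<forall>c\<in>charts_at M x. \<forall>A::real^'n^'n. \<forall>v. (\<forall>i. v i \<in> tangent_space M x) \<longrightarrow>
      \<mu> (\<lambda>i. tangent_of_coords M x c (A *v v i c)) = \<bar>det A\<bar> * \<mu> v) \<and>
    (\<forall>v. \<not> (\<forall>i. v i \<in> tangent_space M x) \<longrightarrow> \<mu> v = 0)}"


section \<open>Smooth vector bundles\<close>

text \<open>\<open>fadd\<close> and \<open>fscale\<close> are only meaningful within a fibre.\<close>

record ('e, 'm, 'n, 'r) vector_bundle =
  base :: "('m, real^'n::finite) manifold"
  total :: "('e, (real^'n) \<times> (real^'r::finite)) manifold"
  proj :: "'e \<Rightarrow> 'm"
  fadd :: "'e \<Rightarrow> 'e \<Rightarrow> 'e"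
  fscale :: "real \<Rightarrow> 'e \<Rightarrow> 'e"

definition fibre :: "('e, 'm, 'n::finite, 'r::finite) vector_bundle \<Rightarrow> 'm \<Rightarrow> 'e set"
  where "fibre E x = {a \<in> points (total E). proj E a = x}"

definition bundle_over :: "('e, 'm, 'n::finite, 'r::finite) vector_bundle \<Rightarrow> 'm set \<Rightarrow> 'e set"
  where "bundle_over E U = {a \<in> points (total E). proj E a \<in> U}"

definition real_vector_space_on ::
  "'e set \<Rightarrow> ('e \<Rightarrow> 'e \<Rightarrow> 'e) \<Rightarrow> (real \<Rightarrow> 'e \<Rightarrow> 'e) \<Rightarrow> bool"
  where "real_vector_space_on S add scl \<longleftrightarrow>
    (\<forall>a\<in>S. \<forall>b\<in>S. add a b \<in> S \<and> add a b = add b a) \<and>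
    (\<forall>a\<in>S. \<forall>b\<in>S. \<forall>c\<in>S. add (add a b) c = add a (add b c)) \<and>
    (\<exists>z\<in>S. \<forall>a\<in>S. add z a = a \<and> (\<exists>b\<in>S. add a b = z)) \<and>
    (\<forall>a\<in>S. \<forall>s. scl s a \<in> S) \<and>
    (\<forall>a\<in>S. \<forall>b\<in>S. \<forall>s. scl s (add a b) = add (scl s a) (scl s b)) \<and>
    (\<forall>a\<in>S. \<forall>s t. scl (s + t) a = add (scl s a) (scl t a) \<and> scl s (scl t a) = scl (s * t) a) \<and>
    (\<forall>a\<in>S. scl 1 a = a)"

definition fibre_linear ::
  "('e, 'm, 'n::finite, 'r::finite) vector_bundle \<Rightarrow> 'm \<Rightarrow> ('e \<Rightarrow> 'b::real_vector) \<Rightarrow> bool"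
  where "fibre_linear E x h \<longleftrightarrow>
    (\<forall>a\<in>fibre E x. \<forall>b\<in>fibre E x. h (fadd E a b) = h a + h b) \<and>
    (\<forall>a\<in>fibre E x. \<forall>s. h (fscale E s a) = s *\<^sub>R h a)"

definition local_trivialization ::
  "('e, 'm, 'n::finite, 'r::finite) vector_bundle \<Rightarrow> 'm set \<Rightarrow> ('e \<Rightarrow> real^'r) \<Rightarrow> bool"
  where "local_trivialization E U \<rho> \<longleftrightarrow>
    smooth_map_on (total E) (bundle_over E U) euclidean_manifold \<rho> \<and>
    (\<forall>x\<in>U. fibre_linear E x \<rho> \<and> bij_betw \<rho> (fibre E x) UNIV) \<and>
    diffeomorphism_on (total E) (bundle_over E U)
      (prod_manifold (base E) euclidean_manifold) (U \<times> UNIV) (\<lambda>a. (proj E a, \<rho> a))"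

definition smooth_vector_bundle ::
  "('e, 'm, 'n::finite, 'r::finite) vector_bundle \<Rightarrow> bool"
  where "smooth_vector_bundle E \<longleftrightarrow>
    smooth_manifold (base E) \<and> smooth_manifold (total E) \<and>
    smooth_map_on (total E) (points (total E)) (base E) (proj E) \<and>
    proj E ` points (total E) = points (base E) \<and>
    (\<forall>x\<in>points (base E).
      real_vector_space_on (fibre E x) (fadd E) (fscale E) \<and>
      (\<exists>U \<rho>. openin (mtop (base E)) U \<and> x \<in> U \<and> local_trivialization E U \<rho>))"

definition total_triv_triple ::
  "('e, 'm, 'n::finite, 'r::finite) vector_bundle
    \<Rightarrow> 'm set \<Rightarrow> ('m \<Rightarrow> real^'n) \<Rightarrow> ('e \<Rightarrow> real^'r) \<Rightarrow> bool"
  where "total_triv_triple E U \<phi> \<rho> \<longleftrightarrow>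
    smooth_chart (base E) (U, \<phi>) \<and> local_trivialization E U \<rho>"

record ('e, 'm, 'n, 'r) aug_triv =
  tdomain :: "'m set"
  tcoord :: "'m \<Rightarrow> real^'n::finite"
  tfibre :: "'e \<Rightarrow> real^'r::finite"
  tweight :: "'m \<Rightarrow> real"

definition aug_total_triv_atlas ::
  "('e, 'm, 'n::finite, 'r::finite) vector_bundle \<Rightarrow> nat
    \<Rightarrow> (nat \<Rightarrow> ('e, 'm, 'n, 'r) aug_triv) \<Rightarrow> bool"
  where "aug_total_triv_atlas E N \<Lambda> \<longleftrightarrow>
    (\<forall>\<alpha>\<in>{1..N}. total_triv_triple E (tdomain (\<Lambda> \<alpha>)) (tcoord (\<Lambda> \<alpha>)) (tfibre (\<Lambda> \<alpha>))) \<and>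
    (\<Union>\<alpha>\<in>{1..N}. tdomain (\<Lambda> \<alpha>)) = points (base E) \<and>
    (\<forall>\<alpha>\<in>{1..N}.
      smooth_map_on (base E) (points (base E)) euclidean_manifold (tweight (\<Lambda> \<alpha>)) \<and>
      (\<forall>x\<in>points (base E). 0 \<le> tweight (\<Lambda> \<alpha>) x) \<and>
      mtop (base E) closure_of {x \<in> points (base E). tweight (\<Lambda> \<alpha>) x \<noteq> 0} \<subseteq> tdomain (\<Lambda> \<alpha>)) \<and>
    (\<forall>x\<in>points (base E). (\<Sum>\<alpha>=1..N. tweight (\<Lambda> \<alpha>) x) = 1)"


section \<open>Distributions with values in a vector bundle\<close>

text \<open>A section \<open>\<eta>\<close> of \<open>Hom(E, D)\<close>, where \<open>D\<close> is the density bundle of the base, is encoded as the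
  function \<open>(x, a, v) \<mapsto> \<eta>(x)(a)(v)\<close> of a point, a fibre element and a tuple of tangent
  vectors, extended by \<open>0\<close>.\<close>

type_synonym ('e, 'm, 'n) dual_section = "'m \<times> 'e \<times> ('n \<Rightarrow> ('m, 'n) tvec) \<Rightarrow> real"

definition dual_sections ::
  "('e, 'm, 'n::finite, 'r::finite) vector_bundle \<Rightarrow> ('e, 'm, 'n) dual_section set"
  where "dual_sections E = {\<eta>.
    (\<forall>x\<in>points (base E).
      (\<forall>a\<in>fibre E x. (\<lambda>v. \<eta> (x, a, v)) \<in> density_space (base E) x) \<and>
      (\<forall>v. fibre_linear E x (\<lambda>a. \<eta> (x, a, v)))) \<and>
    (\<forall>x a v. x \<notin> points (base E) \<or> a \<notin> fibre E x \<longrightarrow> \<eta> (x, a, v) = 0)}"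

text \<open>The \<open>l\<close>-th component of \<open>\<eta>\<close> in the trivialization of \<open>Hom(E, D)\<close> induced by a total
  trivialization triple, as a function of the coordinates: \<open>\<eta>\<close> is applied to the \<open>l\<close>-th
  element of the frame of \<open>E\<close> given by \<open>\<rho>\<close> and to the coordinate vector fields of \<open>\<phi>\<close>.\<close>

definition dual_component ::
  "('e, 'm, 'n::finite, 'r::finite) vector_bundle
    \<Rightarrow> 'm set \<Rightarrow> ('m \<Rightarrow> real^'n) \<Rightarrow> ('e \<Rightarrow> real^'r) \<Rightarrow> 'r
    \<Rightarrow> ('e, 'm, 'n) dual_section \<Rightarrow> real^'n \<Rightarrow> real"
  where "dual_component E U \<phi> \<rho> l \<eta> = (\<lambda>y. let x = inv_into U \<phi> y in
    \<eta> (x, inv_into (fibre E x) \<rho> (axis l 1),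
       \<lambda>i. tangent_of_coords (base E) x (U, \<phi>) (axis i 1)))"

definition smooth_dual_sections ::
  "('e, 'm, 'n::finite, 'r::finite) vector_bundle \<Rightarrow> ('e, 'm, 'n) dual_section set"
  where "smooth_dual_sections E = {\<eta> \<in> dual_sections E.
    \<forall>U \<phi> \<rho> l. total_triv_triple E U \<phi> \<rho> \<longrightarrow>
      smooth_on (\<phi> ` U) (dual_component E U \<phi> \<rho> l \<eta>)}"

definition section_support ::
  "('e, 'm, 'n::finite, 'r::finite) vector_bundle \<Rightarrow> ('e, 'm, 'n) dual_section \<Rightarrow> 'm set"
  where "section_support E \<eta> = mtop (base E) closure_of {x. \<exists>a v. \<eta> (x, a, v) \<noteq> 0}"

definition test_sections_in ::
  "('e, 'm, 'n::finite, 'r::finite) vector_bundle \<Rightarrow> 'm set \<Rightarrow> ('e, 'm, 'n) dual_section set"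
  where "test_sections_in E K = {\<eta> \<in> smooth_dual_sections E. section_support E \<eta> \<subseteq> K}"

definition section_seminorms ::
  "('e, 'm, 'n::finite, 'r::finite) vector_bundle
    \<Rightarrow> (('e, 'm, 'n) dual_section \<Rightarrow> real) set"
  where "section_seminorms E =
    {(\<lambda>\<eta>. SUP y\<in>L. \<bar>pderiv_mi \<nu> (dual_component E U \<phi> \<rho> l \<eta>) y\<bar>) | U \<phi> \<rho> L \<nu> l.
      total_triv_triple E U \<phi> \<rho> \<and> compact L \<and> L \<noteq> {} \<and> L \<subseteq> \<phi> ` U}"

definition bundle_distributions ::
  "('e, 'm, 'n::finite, 'r::finite) vector_bundle
    \<Rightarrow> (('e, 'm, 'n) dual_section \<Rightarrow> real) set"
  where "bundle_distributions E = topological_dual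
    {test_sections_in E K | K. compactin (mtop (base E)) K} (section_seminorms E)"

definition mult_distribution ::
  "('m \<Rightarrow> real) \<Rightarrow> (('e, 'm, 'n::finite) dual_section \<Rightarrow> real)
    \<Rightarrow> ('e, 'm, 'n) dual_section \<Rightarrow> real"
  where "mult_distribution \<psi> u = (\<lambda>\<eta>. u (\<lambda>(x, a, v). \<psi> x * \<eta> (x, a, v)))"

definition distribution_support ::
  "('e, 'm, 'n::finite, 'r::finite) vector_bundle
    \<Rightarrow> (('e, 'm, 'n) dual_section \<Rightarrow> real) \<Rightarrow> 'm set"
  where "distribution_support E u = points (base E) -
    \<Union>{W. openin (mtop (base E)) W \<and>
        (\<forall>\<eta> K. compactin (mtop (base E)) K \<and> K \<subseteq> W \<and> \<eta> \<in> test_sections_in E K \<longrightarrow> u \<eta> = 0)}"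

text \<open>The determinant is \<open>\<bar>dx\<^sup>1 \<and> \<dots> \<and> dx\<^sup>n\<bar>\<close> evaluated at \<open>v\<close>.\<close>

definition local_test_section ::
  "('e, 'm, 'n::finite, 'r::finite) vector_bundle \<Rightarrow> ('e, 'm, 'n, 'r) aug_triv
    \<Rightarrow> 'r \<Rightarrow> (real^'n \<Rightarrow> real) \<Rightarrow> ('e, 'm, 'n) dual_section"
  where "local_test_section E \<tau> l \<xi> = (\<lambda>(x, a, v).
    if x \<in> tdomain \<tau> \<and> a \<in> fibre E x \<and> (\<forall>i. v i \<in> tangent_space (base E) x)
    then \<xi> (tcoord \<tau> x) * (tfibre \<tau> a $ l) * \<bar>det (\<chi> i. v i (tdomain \<tau>, tcoord \<tau>))\<bar>
    else 0)"

definition local_rep ::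
  "('e, 'm, 'n::finite, 'r::finite) vector_bundle \<Rightarrow> ('e, 'm, 'n, 'r) aug_triv
    \<Rightarrow> (('e, 'm, 'n) dual_section \<Rightarrow> real) \<Rightarrow> 'r \<Rightarrow> (real^'n \<Rightarrow> real) \<Rightarrow> real"
  where "local_rep E \<tau> u l \<xi> = u (local_test_section E \<tau> l \<xi>)"


section \<open>Sobolev spaces of sections\<close>

abbreviation coord_range :: "('e, 'm, 'n::finite, 'r::finite) aug_triv \<Rightarrow> (real^'n) set"
  where "coord_range \<tau> \<equiv> tcoord \<tau> ` tdomain \<tau>"

definition bundle_sobolev_norm ::
  "real \<Rightarrow> real \<Rightarrow> ('e, 'm, 'n::finite, 'r::finite) vector_bundle \<Rightarrow> nat
    \<Rightarrow> (nat \<Rightarrow> ('e, 'm, 'n, 'r) aug_triv) \<Rightarrow> (('e, 'm, 'n) dual_section \<Rightarrow> real) \<Rightarrow> ennreal"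
  where "bundle_sobolev_norm e q E N \<Lambda> u =
    (\<Sum>\<alpha>=1..N. \<Sum>l\<in>UNIV. distr_norm e q (coord_range (\<Lambda> \<alpha>))
      (local_rep E (\<Lambda> \<alpha>) (mult_distribution (tweight (\<Lambda> \<alpha>)) u) l))"

definition bundle_sobolev_space ::
  "real \<Rightarrow> real \<Rightarrow> ('e, 'm, 'n::finite, 'r::finite) vector_bundle \<Rightarrow> nat
    \<Rightarrow> (nat \<Rightarrow> ('e, 'm, 'n, 'r) aug_triv) \<Rightarrow> (('e, 'm, 'n) dual_section \<Rightarrow> real) set"
  where "bundle_sobolev_space e q E N \<Lambda> =
    {u \<in> bundle_distributions E. bundle_sobolev_norm e q E N \<Lambda> u < \<infinity>}"


section \<open>GL compatibility\<close>

text \<open>Near each boundary point, and in suitable orthogonal coordinates with last axis along the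
  unit vector \<open>b\<close>, the set is the region above the graph of a Lipschitz function \<open>\<gamma>\<close> on the
  orthogonal complement of \<open>b\<close>.\<close>

definition lipschitz_boundary :: "(real^'n::finite) set \<Rightarrow> bool"
  where "lipschitz_boundary \<Omega> \<longleftrightarrow>
    (\<forall>z\<in>frontier \<Omega>. \<exists>r>0. \<exists>b \<gamma> C. norm b = 1 \<and> C-lipschitz_on {y. y \<bullet> b = 0} \<gamma> \<and>
      \<Omega> \<inter> ball z r = {x \<in> ball z r. \<gamma> (x - (x \<bullet> b) *\<^sub>R b) < x \<bullet> b})"

definition GL_domain :: "(real^'n::finite) set \<Rightarrow> bool"
  where "GL_domain \<Omega> \<longleftrightarrow> \<Omega> = UNIV \<or>
    (\<Omega> \<noteq> {} \<and> bounded \<Omega> \<and> open \<Omega> \<and> lipschitz_boundary \<Omega>)"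

definition GL_compatible :: "nat \<Rightarrow> (nat \<Rightarrow> ('e, 'm, 'n::finite, 'r::finite) aug_triv) \<Rightarrow> bool"
  where "GL_compatible N \<Lambda> \<longleftrightarrow>
    (\<forall>\<alpha>\<in>{1..N}. GL_domain (coord_range (\<Lambda> \<alpha>))) \<and>
    (\<forall>\<alpha>\<in>{1..N}. \<forall>\<beta>\<in>{1..N}. tdomain (\<Lambda> \<alpha>) \<inter> tdomain (\<Lambda> \<beta>) \<noteq> {} \<longrightarrow>
      GL_domain (tcoord (\<Lambda> \<alpha>) ` (tdomain (\<Lambda> \<alpha>) \<inter> tdomain (\<Lambda> \<beta>))) \<and>
      GL_domain (tcoord (\<Lambda> \<beta>) ` (tdomain (\<Lambda> \<alpha>) \<inter> tdomain (\<Lambda> \<beta>))))"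

end

theory Submission
  imports Defs
begin

text \<open>Let \<open>T = [H\<^sub>\<beta>(u)]\<^sup>i\<close>. The idea is to express \<open>T\<close> by the finitely many distributions
  \<open>S\<^sub>\<alpha>\<^sub>l = [H\<^sub>\<alpha>(\<psi>\<^sub>\<alpha> u)]\<^sup>l\<close> whose norms add up to the norm of \<open>u\<close>, by means of changes of coordinates and
  frames that are cut off to compact subsets of the chart overlaps.

  Choose a cut-off function \<open>\<kappa>\<close> with compact support in the range of \<open>\<phi>\<^sub>\<beta>\<close> that is \<open>1\<close> near the image of
  the closure of \<open>V\<close>. Since \<open>u\<close> is supported in \<open>V\<close>, \<open>T(\<xi>) = T(\<kappa> \<xi>)\<close> (\<open>local_rep_vanish\<close>); since the
  \<open>\<psi>\<^sub>\<alpha>\<close> add up to \<open>1\<close>, the section on which \<open>u\<close> is evaluated is the sum of its products with the \<open>\<psi>\<^sub>\<alpha>\<close>.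
  On the support of \<open>\<psi>\<^sub>\<alpha>\<close> it can be written in the frame and the coordinates of the trivialization \<open>\<alpha>\<close>
  (\<open>local_test_section_transfer\<close>). The result is \<open>T(\<xi>) = \<Sum>\<^sub>\<alpha>\<^sub>,\<^sub>l S\<^sub>\<alpha>\<^sub>l(a\<^sub>\<alpha>\<^sub>l \<cdot> (\<xi> \<circ> \<Phi>\<^sub>\<alpha>))\<close>, where \<open>\<Phi>\<^sub>\<alpha>\<close> is the transition
  from \<open>\<phi>\<^sub>\<alpha>\<close> to \<open>\<phi>\<^sub>\<beta>\<close> and the weight \<open>a\<^sub>\<alpha>\<^sub>l\<close> is a product of cut-off functions, an entry of the transition
  matrix of the frames and a Jacobian determinant. It is smooth with compact support in the overlap
  (\<open>transition_weight_test\<close>).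

  It remains to bound the transpose of the localised pull-back \<open>\<xi> \<mapsto> a \<cdot> (\<xi> \<circ> \<Phi>)\<close> on \<open>W\<^sup>e\<^sup>,\<^sup>q\<close>, for a
  diffeomorphism \<open>\<Phi>\<close> of open sets \<open>W\<close>, \<open>W'\<close> and \<open>a \<in> C\<^sub>c\<^sup>\<infinity>(W)\<close> (\<open>distr_norm_pullback_le\<close>). Its transpose is an
  operator of the same kind for the inverse of \<open>\<Phi>\<close>. So for \<open>e \<ge> 0\<close>, and by duality for \<open>e < 0\<close>, the claim
  follows from the boundedness of localised pull-backs on \<open>W\<^sup>s\<^sup>,\<^sup>p\<close> with \<open>s \<ge> 0\<close>
  (\<open>sobolev_norm_pullback_le\<close>). A weak derivative of \<open>a \<cdot> (f \<circ> \<Phi>)\<close> is a sum of localised pull-backs of weak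
  derivatives of \<open>f\<close> of at most the same order (\<open>weak_derivs_pullback\<close>), which leaves the following
  estimates. \<open>L\<^sup>p\<close> norms are treated by change of variables. For Slobodeckij seminorms of the derivatives of
  top order, compactness of the support of \<open>a\<close> makes \<open>\<Phi>\<close> Lipschitz where it matters and confines the
  remaining part of the double integral to integrable kernels (\<open>slob_int_pullback_le\<close>). A derivative of
  lower order has weak derivatives in \<open>L\<^sup>p\<close>; after multiplication by a cut-off function it lies in \<open>W\<^sup>1\<^sup>,\<^sup>p\<close>
  of the whole space, where the first order norm dominates the fractional one
  (\<open>slob_int_le_weak_derivatives\<close>, \<open>slobodeckij_pullback_lower_le\<close>).

  Finally \<open>T\<close> is a distribution because it is linear and of finite norm: on test functions with support
  in a fixed compact set, all Sobolev norms are dominated by suprema of finitely many derivatives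
  (\<open>finite_distr_norm_distributions\<close>).\<close>

section \<open>Calculus of smooth functions\<close>

abbreviation fderiv :: "('a::real_normed_vector \<Rightarrow> 'b::real_normed_vector) \<Rightarrow> 'a \<Rightarrow> 'a \<Rightarrow> 'b"
  where "fderiv f x \<equiv> frechet_derivative f (at x)"

lemma Ck_on_cong:
  assumes "open S" "\<And>x. x \<in> S \<Longrightarrow> f x = g x" "Ck_on k S f"
  shows "Ck_on k S g"
  using assms(2,3)
proof (induction k arbitrary: f g)
  case 0
  then show ?case by (auto cong: continuous_on_cong)
next
  case (Suc k)
  have d: "(g has_derivative fderiv f x) (at x)" if "x \<in> S" for x using Suc.prems that assms(1)
    by (auto simp: frechet_derivative_works[symmetric]
        intro!: has_derivative_transform_within_open[of f _ x UNIV S g])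
  have "fderiv g x = fderiv f x" if "x \<in> S" for x using frechet_derivative_at[OF d[OF that]] by simp
  moreover have "Ck_on k S (\<lambda>x. fderiv g x v)" if "v \<in> Basis" for v
    by (rule Suc.IH[of "\<lambda>x. fderiv f x v"]) (use Suc.prems that calculation in auto)
  ultimately show ?case using d by (auto simp: differentiable_def)
qed

text \<open>The recursion in \<open>Ck_on\<close> refers to \<open>frechet_derivative\<close>; here any family of derivatives may be given.\<close>

lemma Ck_on_SucI:
  assumes "open S" "\<And>x. x \<in> S \<Longrightarrow> (f has_derivative D x) (at x)"
    and "\<And>v. v \<in> Basis \<Longrightarrow> Ck_on k S (\<lambda>x. D x v)"
  shows "Ck_on (Suc k) S f"
proof -
  have "D x = fderiv f x" if "x \<in> S" for x using frechet_derivative_at[OF assms(2)[OF that]] .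
  then have "Ck_on k S (\<lambda>x. fderiv f x v)" if "v \<in> Basis" for v
    by (intro Ck_on_cong[OF assms(1) _ assms(3)[OF that]]) auto
  then show ?thesis using assms(2) by (auto simp: differentiable_def)
qed

lemma Ck_on_SucD:
  assumes "Ck_on (Suc k) S f" "x \<in> S"
  shows "(f has_derivative fderiv f x) (at x)"
  using assms by (auto simp: frechet_derivative_works[symmetric])

lemma Ck_on_Suc_imp: "Ck_on (Suc k) S f \<Longrightarrow> Ck_on k S f"
proof (induction k arbitrary: f)
  case 0
  then show ?case by (auto simp: differentiable_imp_continuous_within continuous_at_imp_continuous_on)
next
  case (Suc k)
  then show ?case by (simp only: Ck_on.simps) blast
qed

lemma Ck_on_subset: "Ck_on k S f \<Longrightarrow> T \<subseteq> S \<Longrightarrow> Ck_on k T f"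
  by (induction k arbitrary: f) (auto intro: continuous_on_subset)

lemma Ck_on_const: "Ck_on k S (\<lambda>x. c)"
  by (induction k arbitrary: c) auto

lemma Ck_on_bounded_linear:
  assumes "open S" "bounded_linear L" "Ck_on k S f"
  shows "Ck_on k S (\<lambda>x. L (f x))"
  using assms(3)
proof (induction k arbitrary: f)
  case 0
  then show ?case by (simp add: bounded_linear.continuous_on[OF assms(2)])
next
  case (Suc k)
  show ?case by (rule Ck_on_SucI[OF assms(1), where D = "\<lambda>x v. L (fderiv f x v)"],
        rule bounded_linear.has_derivative[OF assms(2) Ck_on_SucD[OF Suc.prems]], assumption, rule Suc.IH)
      (use Suc.prems in auto)
qed

lemma Ck_on_add:
  assumes "open S" "Ck_on k S f" "Ck_on k S g"
  shows "Ck_on k S (\<lambda>x. f x + g x)"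
  using assms(2,3)
proof (induction k arbitrary: f g)
  case 0
  then show ?case by (auto intro!: continuous_intros)
next
  case (Suc k)
  show ?case by (rule Ck_on_SucI[OF assms(1), where
          D = "\<lambda>x v. fderiv f x v + fderiv g x v"],
        intro has_derivative_add Ck_on_SucD[OF Suc.prems(1)] Ck_on_SucD[OF Suc.prems(2)],
        assumption, assumption, rule Suc.IH)
      (use Suc.prems in auto)
qed

lemma Ck_on_bilinear:
  assumes "open S" "bounded_bilinear h" "Ck_on k S f" "Ck_on k S g"
  shows "Ck_on k S (\<lambda>x. h (f x) (g x))"
  using assms(3,4)
proof (induction k arbitrary: f g)
  case 0
  then show ?case by (simp add: bounded_bilinear.continuous_on[OF assms(2)])
next
  case (Suc k)
  show ?case by (rule Ck_on_SucI[OF assms(1), where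
          D = "\<lambda>x v. h (f x) (fderiv g x v) + h (fderiv f x v) (g x)"],
        intro bounded_bilinear.FDERIV[OF assms(2)] Ck_on_SucD[OF Suc.prems(1)] Ck_on_SucD[OF Suc.prems(2)],
        assumption, assumption, intro Ck_on_add[OF assms(1)] Suc.IH)
      (use Suc.prems Ck_on_Suc_imp[OF Suc.prems(1)] Ck_on_Suc_imp[OF Suc.prems(2)] in auto)
qed

lemma Ck_on_sum:
  assumes "open S" "\<And>i. i \<in> I \<Longrightarrow> Ck_on k S (f i)"
  shows "Ck_on k S (\<lambda>x. \<Sum>i\<in>I. f i x)"
  using assms(2) by (induction I rule: infinite_finite_induct) (auto intro!: Ck_on_add assms(1) Ck_on_const)

text \<open>Induction on \<open>k\<close>: by the chain rule a directional derivative of \<open>g \<circ> f\<close> is a sum over the basis \<open>b\<close> of products of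
  \<open>f'(x)(v) \<bullet> b\<close> with \<open>(g'(\<cdot>)(b)) \<circ> f\<close>, both of class \<open>C\<^sup>k\<close>.\<close>

lemma Ck_on_compose:
  fixes f :: "'a::euclidean_space \<Rightarrow> 'b::euclidean_space"
  assumes "open S" "open T" "Ck_on k S f" "Ck_on k T g" "f ` S \<subseteq> T"
  shows "Ck_on k S (\<lambda>x. g (f x))"
  using assms(3,4)
proof (induction k arbitrary: g)
  case 0
  then show ?case using assms(5) by (auto intro: continuous_on_compose2)
next
  case (Suc k)
  have f: "Ck_on k S f" using Ck_on_Suc_imp Suc.prems by blast
  have d: "((\<lambda>x. g (f x)) has_derivative
      (\<lambda>v. fderiv g (f x) (fderiv f x v))) (at x)"
    if "x \<in> S" for x using Ck_on_SucD[OF Suc.prems(1) that] Ck_on_SucD[OF Suc.prems(2), of "f x"] assms(5) that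
    by (auto intro: has_derivative_compose)
  have l: "fderiv g (f x) w = (\<Sum>b\<in>Basis. (w \<bullet> b) *\<^sub>R fderiv g (f x) b)"
    if "x \<in> S" for x w
  proof -
    have "linear (fderiv g (f x))" using Ck_on_SucD[OF Suc.prems(2), of "f x"] assms(5) that
      by (auto intro: has_derivative_linear)
    then show ?thesis by (subst euclidean_representation[of w, symmetric])
        (simp only: linear_sum linear_scale)
  qed
  have "Ck_on (Suc k) S (\<lambda>x. g (f x))"
  proof (rule Ck_on_SucI[OF assms(1) d])
    fix v :: 'a assume v: "v \<in> Basis"
    have "Ck_on k S (\<lambda>x. \<Sum>b\<in>Basis. (fderiv f x v \<bullet> b) *\<^sub>R fderiv g (f x) b)"
    proof (intro Ck_on_sum assms(1) Ck_on_bilinear[OF assms(1) bounded_bilinear_scaleR])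
      fix b :: 'b assume "b \<in> Basis"
      then show "Ck_on k S (\<lambda>x. fderiv g (f x) b)" by (intro Suc.IH[OF f]) (use Suc.prems in auto)
      show "Ck_on k S (\<lambda>x. fderiv f x v \<bullet> b)"
        by (rule Ck_on_bounded_linear[OF assms(1) bounded_linear_inner_left]) (use Suc.prems v in auto)
    qed
    then show "Ck_on k S (\<lambda>x. fderiv g (f x) (fderiv f x v))"
      by (rule Ck_on_cong[OF assms(1), rotated]) (use l in auto)
  qed
  then show ?case .
qed

lemma smooth_on_cong:
  assumes "open S" "\<And>x. x \<in> S \<Longrightarrow> f x = g x" "smooth_on S f"
  shows "smooth_on S g"
  using assms Ck_on_cong unfolding smooth_on_def by blast

lemma smooth_on_subset: "smooth_on S f \<Longrightarrow> T \<subseteq> S \<Longrightarrow> smooth_on T f"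
  using Ck_on_subset unfolding smooth_on_def by blast

lemma smooth_on_const [simp]: "smooth_on S (\<lambda>x. c)"
  by (simp add: smooth_on_def Ck_on_const)

lemma smooth_on_bounded_linear:
  "open S \<Longrightarrow> bounded_linear L \<Longrightarrow> smooth_on S f \<Longrightarrow> smooth_on S (\<lambda>x. L (f x))"
  by (simp add: smooth_on_def Ck_on_bounded_linear)

lemma smooth_on_add:
  "open S \<Longrightarrow> smooth_on S f \<Longrightarrow> smooth_on S g \<Longrightarrow> smooth_on S (\<lambda>x. f x + g x)" by (simp add: smooth_on_def Ck_on_add)

lemma smooth_on_bilinear:
  "open S \<Longrightarrow> bounded_bilinear h \<Longrightarrow> smooth_on S f \<Longrightarrow> smooth_on S g \<Longrightarrow> smooth_on S (\<lambda>x. h (f x) (g x))"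
  by (simp add: smooth_on_def Ck_on_bilinear)

lemmas smooth_on_mult = smooth_on_bilinear[OF _ bounded_bilinear_mult]
lemmas smooth_on_scaleR = smooth_on_bilinear[OF _ bounded_bilinear_scaleR]

lemma smooth_on_uminus: "open S \<Longrightarrow> smooth_on S f \<Longrightarrow> smooth_on S (\<lambda>x. - f x)"
  by (rule smooth_on_bounded_linear[OF _ bounded_linear_minus[OF bounded_linear_ident]])

lemma smooth_on_diff:
  "open S \<Longrightarrow> smooth_on S f \<Longrightarrow> smooth_on S g \<Longrightarrow> smooth_on S (\<lambda>x. f x - g x)"
  using smooth_on_add[of S f "\<lambda>x. - g x"] smooth_on_uminus by auto

lemma smooth_on_sum:
  "open S \<Longrightarrow> (\<And>i. i \<in> I \<Longrightarrow> smooth_on S (f i)) \<Longrightarrow> smooth_on S (\<lambda>x. \<Sum>i\<in>I. f i x)" by (simp add: smooth_on_def Ck_on_sum)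

lemma smooth_on_prod:
  fixes f :: "'i \<Rightarrow> 'a::euclidean_space \<Rightarrow> real"
  assumes "open S" "\<And>i. i \<in> I \<Longrightarrow> smooth_on S (f i)"
  shows "smooth_on S (\<lambda>x. \<Prod>i\<in>I. f i x)"
  using assms(2) by (induction I rule: infinite_finite_induct) (auto intro!: smooth_on_mult assms(1))

lemma smooth_on_compose:
  fixes f :: "'a::euclidean_space \<Rightarrow> 'b::euclidean_space"
  assumes "smooth_on S f" "smooth_on T g" "open S" "open T" "f ` S \<subseteq> T"
  shows "smooth_on S (\<lambda>x. g (f x))"
  using assms Ck_on_compose unfolding smooth_on_def by blast

lemma smooth_on_differentiable:
  assumes "smooth_on S f" "x \<in> S"
  shows "f differentiable (at x)"
    and "(f has_derivative fderiv f x) (at x)"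
proof -
  have "Ck_on (Suc 0) S f" using assms by (simp add: smooth_on_def)
  then show "f differentiable (at x)" using assms by auto
  then show "(f has_derivative fderiv f x) (at x)" by (simp add: frechet_derivative_works)
qed

lemma smooth_on_imp_continuous_on: "smooth_on S f \<Longrightarrow> continuous_on S f"
  unfolding smooth_on_def using Ck_on.simps(1) by blast

lemma smooth_on_ident: "open S \<Longrightarrow> smooth_on S (\<lambda>x. x)"
proof -
  assume S: "open S"
  have "Ck_on k S (\<lambda>x. x)" for k
  proof (cases k)
    case (Suc m)
    show ?thesis unfolding Suc by (rule Ck_on_SucI[OF S, where D = "\<lambda>x v. v"]) (auto intro: Ck_on_const)
  qed simp
  then show ?thesis by (simp add: smooth_on_def)
qed

lemma smooth_on_frechet_derivative:
  assumes "open S" "smooth_on S f"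
  shows "smooth_on S (\<lambda>x. fderiv f x v)"
proof -
  have b: "smooth_on S (\<lambda>x. fderiv f x b)" if "b \<in> Basis" for b unfolding smooth_on_def
  proof
    fix k
    have "Ck_on (Suc k) S f" using assms(2) unfolding smooth_on_def by blast
    then show "Ck_on k S (\<lambda>x. fderiv f x b)" using that by simp
  qed
  have "fderiv f x v = (\<Sum>b\<in>Basis. (v \<bullet> b) *\<^sub>R fderiv f x b)"
    if "x \<in> S" for x
  proof -
    have "linear (fderiv f x)" using smooth_on_differentiable[OF assms(2) that] by (auto intro: has_derivative_linear)
    then show ?thesis by (subst euclidean_representation[of v, symmetric]) (simp only: linear_sum linear_scale)
  qed
  then show ?thesis by (intro smooth_on_cong[OF assms(1) _ smooth_on_sum[OF assms(1)
          smooth_on_scaleR[OF assms(1) smooth_on_const b]]]) auto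
qed

lemma smooth_on_local:
  assumes "\<And>x. x \<in> S \<Longrightarrow> \<exists>U. x \<in> U \<and> open U \<and> smooth_on U f"
  shows "smooth_on S f"
proof -
  have "Ck_on k S f" if "\<And>x. x \<in> S \<Longrightarrow> \<exists>U. x \<in> U \<and> open U \<and> Ck_on k U f" for k f using that
  proof (induction k arbitrary: f)
    case 0
    then show ?case by (force intro!: continuous_at_imp_continuous_on simp: continuous_on_eq_continuous_at)
  next
    case (Suc k)
    then show ?case by (fastforce simp: Ck_on.simps(2))
  qed
  then show ?thesis using assms unfolding smooth_on_def by metis
qed

lemma smooth_on_Un:
  "open S \<Longrightarrow> open T \<Longrightarrow> smooth_on S f \<Longrightarrow> smooth_on T f \<Longrightarrow> smooth_on (S \<union> T) f" by (rule smooth_on_local) auto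

lemma smooth_on_vec_nth: "open S \<Longrightarrow> smooth_on S f \<Longrightarrow> smooth_on S (\<lambda>x. (f x :: real^'i) $ i)"
  by (rule smooth_on_bounded_linear[OF _ bounded_linear_vec_nth])

lemma smooth_on_Pair:
  assumes "open S" "smooth_on S f" "smooth_on S g"
  shows "smooth_on S (\<lambda>x. (f x, g x))"
proof -
  have "smooth_on S (\<lambda>x. (f x, 0) + (0, g x))"
    by (intro smooth_on_add smooth_on_bounded_linear[where L = "\<lambda>x. (x, 0)"]
        smooth_on_bounded_linear[where L = "\<lambda>x. (0, x)"] assms bounded_linear_intros)
  then show ?thesis by simp
qed

lemma smooth_on_inverse_real: "smooth_on (-{0}) (inverse :: real \<Rightarrow> real)"
proof -
  have "Ck_on k (-{0}) (inverse :: real \<Rightarrow> real)" for k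
  proof (induction k)
    case 0
    then show ?case by (auto intro!: continuous_intros)
  next
    case (Suc k)
    show ?case
    proof (rule Ck_on_SucI[where D = "\<lambda>x v. - (inverse x * v * inverse x)"])
      show "Ck_on k (- {0}) (\<lambda>x::real. - (inverse x * v * inverse x))" for v
        by (intro Ck_on_bounded_linear[OF _ bounded_linear_minus[OF bounded_linear_ident]]
            Ck_on_bilinear[OF _ bounded_bilinear_mult] Ck_on_const Suc) auto
    qed (auto intro!: has_derivative_inverse')
  qed
  then show ?thesis by (simp add: smooth_on_def)
qed

lemma smooth_on_inverse:
  fixes f :: "'a::euclidean_space \<Rightarrow> real"
  assumes "open S" "smooth_on S f" "\<And>x. x \<in> S \<Longrightarrow> f x \<noteq> 0"
  shows "smooth_on S (\<lambda>x. inverse (f x))"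
  by (rule smooth_on_compose[OF assms(2) smooth_on_inverse_real assms(1)]) (use assms(3) in auto)

text \<open>Locally \<open>f\<close> has constant sign.\<close>

lemma smooth_on_abs:
  fixes f :: "'a::euclidean_space \<Rightarrow> real"
  assumes S: "open S" and f: "smooth_on S f" and nz: "\<And>x. x \<in> S \<Longrightarrow> f x \<noteq> 0"
  shows "smooth_on S (\<lambda>x. \<bar>f x\<bar>)"
proof (rule smooth_on_local)
  fix x assume x: "x \<in> S"
  have c: "continuous_on S f" using f by (rule smooth_on_imp_continuous_on)
  let ?P = "{x\<in>S. 0 < f x}" and ?N = "{x\<in>S. f x < 0}"
  have o: "open ?P" "open ?N" using continuous_open_preimage[OF c S open_greaterThan[of 0]]
      continuous_open_preimage[OF c S open_lessThan[of 0]] by (simp_all add: vimage_def Collect_conj_eq)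
  have P: "smooth_on ?P (\<lambda>x. \<bar>f x\<bar>)" by (rule smooth_on_cong[OF o(1), of f]) (auto intro: smooth_on_subset[OF f])
  have N: "smooth_on ?N (\<lambda>x. \<bar>f x\<bar>)" by (rule smooth_on_cong[OF o(2), of "\<lambda>x. - f x"])
      (auto intro: smooth_on_subset[OF smooth_on_uminus[OF S f]])
  show "\<exists>U. x \<in> U \<and> open U \<and> smooth_on U (\<lambda>x. \<bar>f x\<bar>)"
  proof (cases "0 < f x")
    case True
    then show ?thesis using P x o by (intro exI[of _ ?P]) simp
  next
    case False
    then show ?thesis using N x o nz[OF x] by (intro exI[of _ ?N]) simp
  qed
qed

lemma smooth_on_det:
  assumes "open S" "\<And>i j. smooth_on S (\<lambda>x. A x $ i $ j)"
  shows "smooth_on S (\<lambda>x. det (A x :: real^'n^'n))"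
  unfolding det_def by (intro smooth_on_sum smooth_on_mult smooth_on_prod assms smooth_on_const)


section \<open>Iterated partial derivatives\<close>

text \<open>The mean value theorem is applied to \<open>s \<mapsto> f(x + su + tv) - f(x + su)\<close> and then to the resulting difference
  of derivatives in direction \<open>u\<close>.\<close>

lemma double_difference_mvt:
  fixes f :: "'a::euclidean_space \<Rightarrow> real"
  assumes S: "open S" and f: "smooth_on S f" and ball: "ball x \<delta> \<subseteq> S"
    and t: "0 < t" "t * (norm u + norm v) < \<delta>"
  obtains s r where "0 \<le> s" "s \<le> t" "0 \<le> r" "r \<le> t"
    and "f (x + t *\<^sub>R u + t *\<^sub>R v) - f (x + t *\<^sub>R u) - f (x + t *\<^sub>R v) + f x =
      t * t * fderiv (\<lambda>y. fderiv f y u) (x + s *\<^sub>R u + r *\<^sub>R v) v"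
proof -
  let ?D = "\<lambda>y. fderiv f y u"
  have in_S: "x + s *\<^sub>R u + r *\<^sub>R v \<in> S" if "0 \<le> s" "s \<le> t" "0 \<le> r" "r \<le> t" for s r
  proof -
    have "norm (s *\<^sub>R u + r *\<^sub>R v) \<le> s * norm u + r * norm v"
      using that by (metis norm_triangle_ineq norm_scaleR abs_of_nonneg)
    also have "\<dots> \<le> t * norm u + t * norm v" using that by (intro add_mono mult_right_mono) auto
    also have "\<dots> < \<delta>" using t by (simp add: algebra_simps)
    finally have "norm (x - (x + s *\<^sub>R u + r *\<^sub>R v)) < \<delta>"
      by (metis add.assoc add_diff_cancel_left' norm_minus_commute)
    then show ?thesis using ball by (auto simp: dist_norm)
  qed
  have D: "(f has_derivative fderiv f y) (at y)" if "y \<in> S" for y using smooth_on_differentiable[OF f that] by simp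
  have DD: "(?D has_derivative fderiv ?D y) (at y)" if "y \<in> S" for y
    using smooth_on_differentiable[OF smooth_on_frechet_derivative[OF S f] that] by simp
  have "\<exists>s\<in>{0<..<t}. (f (x + t *\<^sub>R u + t *\<^sub>R v) - f (x + t *\<^sub>R u + 0 *\<^sub>R v))
      - (f (x + 0 *\<^sub>R u + t *\<^sub>R v) - f (x + 0 *\<^sub>R u + 0 *\<^sub>R v)) =
      fderiv f (x + s *\<^sub>R u + t *\<^sub>R v) ((t - 0) *\<^sub>R u)
        - fderiv f (x + s *\<^sub>R u + 0 *\<^sub>R v) ((t - 0) *\<^sub>R u)"
    by (rule mvt_simple[OF t(1), where f = "\<lambda>s. f (x + s *\<^sub>R u + t *\<^sub>R v) - f (x + s *\<^sub>R u + 0 *\<^sub>R v)"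
        and f' = "\<lambda>s h. fderiv f (x + s *\<^sub>R u + t *\<^sub>R v) (h *\<^sub>R u)
            - fderiv f (x + s *\<^sub>R u + 0 *\<^sub>R v) (h *\<^sub>R u)"])
      (intro has_derivative_diff has_derivative_compose[OF _ D, THEN has_derivative_at_withinI]
        in_S; use t in \<open>auto intro!: derivative_eq_intros\<close>)
  then obtain s where s: "0 < s" "s < t" and 1:
    "f (x + t *\<^sub>R u + t *\<^sub>R v) - f (x + t *\<^sub>R u) - (f (x + t *\<^sub>R v) - f x) =
      fderiv f (x + s *\<^sub>R u + t *\<^sub>R v) (t *\<^sub>R u)
        - fderiv f (x + s *\<^sub>R u) (t *\<^sub>R u)" by auto
  have lin: "fderiv f y (t *\<^sub>R u) = t * ?D y" if "y \<in> S" for y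
    using has_derivative_linear[OF D[OF that]] by (simp add: linear_scale)
  have "\<exists>r\<in>{0<..<t}. ?D (x + s *\<^sub>R u + t *\<^sub>R v) - ?D (x + s *\<^sub>R u + 0 *\<^sub>R v) =
      fderiv ?D (x + s *\<^sub>R u + r *\<^sub>R v) ((t - 0) *\<^sub>R v)"
    by (rule mvt_simple[OF t(1), where f = "\<lambda>r. ?D (x + s *\<^sub>R u + r *\<^sub>R v)"
        and f' = "\<lambda>r h. fderiv ?D (x + s *\<^sub>R u + r *\<^sub>R v) (h *\<^sub>R v)"])
      (intro has_derivative_compose[OF _ DD, THEN has_derivative_at_withinI] in_S;
        use s t in \<open>auto intro!: derivative_eq_intros\<close>)
  then obtain r where r: "0 < r" "r < t" and 2:
    "?D (x + s *\<^sub>R u + t *\<^sub>R v) - ?D (x + s *\<^sub>R u) =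
      fderiv ?D (x + s *\<^sub>R u + r *\<^sub>R v) (t *\<^sub>R v)" by auto
  have "fderiv ?D (x + s *\<^sub>R u + r *\<^sub>R v) (t *\<^sub>R v) =
      t * fderiv ?D (x + s *\<^sub>R u + r *\<^sub>R v) v"
    using has_derivative_linear[OF DD[OF in_S[of s r]]] s r by (simp add: linear_scale)
  then show ?thesis using 1 2 lin[OF in_S[of s t]] lin[OF in_S[of s 0]] s r t
    by (intro that[of s r]) (auto simp: algebra_simps)
qed

text \<open>Both mixed derivatives are the limit of the same second difference quotient.\<close>

lemma smooth_on_derivative_commute:
  fixes f :: "'a::euclidean_space \<Rightarrow> real"
  assumes S: "open S" and f: "smooth_on S f" and x: "x \<in> S"
  shows "fderiv (\<lambda>y. fderiv f y u) x v =
    fderiv (\<lambda>y. fderiv f y v) x u" (is "?A x = ?B x")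
proof (rule ccontr)
  assume ne: "?A x \<noteq> ?B x"
  define \<epsilon> where "\<epsilon> = \<bar>?A x - ?B x\<bar> / 2"
  have \<epsilon>: "\<epsilon> > 0" using ne by (simp add: \<epsilon>_def)
  have "smooth_on S ?A" "smooth_on S ?B" by (intro smooth_on_frechet_derivative S f)+
  then have "isCont ?A x" "isCont ?B x"
    using smooth_on_imp_continuous_on continuous_on_eq_continuous_at[OF S] x by blast+
  then obtain d1 d2 where d: "d1 > 0" "d2 > 0"
    "\<And>y. dist y x < d1 \<Longrightarrow> dist (?A y) (?A x) < \<epsilon>" "\<And>y. dist y x < d2 \<Longrightarrow> dist (?B y) (?B x) < \<epsilon>"
    unfolding continuous_at_eps_delta using \<epsilon> by (metis dist_norm)
  obtain d3 where d3: "d3 > 0" "ball x d3 \<subseteq> S" using S x open_contains_ball by blast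
  define \<delta> where "\<delta> = min d1 (min d2 d3)"
  have \<delta>: "\<delta> > 0" "ball x \<delta> \<subseteq> S" using d d3 by (auto simp: \<delta>_def)
  define t where "t = \<delta> / (norm u + norm v + 1)"
  have t: "t > 0" "t * (norm u + norm v) < \<delta>"
  proof -
    have p: "norm u + norm v + 1 > 0" by (simp add: add_nonneg_pos)
    then show "t > 0" using \<delta> by (simp add: t_def)
    show "t * (norm u + norm v) < \<delta>" using p \<delta>(1) by (simp add: t_def field_simps)
  qed
  then have t': "t * (norm v + norm u) < \<delta>" by (simp add: add.commute)
  have near: "dist (x + s *\<^sub>R u + r *\<^sub>R v) x < \<delta>" if "0 \<le> s" "s \<le> t" "0 \<le> r" "r \<le> t" for s r
  proof -
    have "dist (x + s *\<^sub>R u + r *\<^sub>R v) x \<le> s * norm u + r * norm v"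
      using that norm_triangle_ineq[of "s *\<^sub>R u" "r *\<^sub>R v"] by (simp add: dist_norm add.assoc)
    also have "\<dots> \<le> t * norm u + t * norm v" using that by (intro add_mono mult_right_mono) auto
    finally show ?thesis using t by (simp add: algebra_simps)
  qed
  obtain s r where 1: "0 \<le> s" "s \<le> t" "0 \<le> r" "r \<le> t" 
    "f (x + t *\<^sub>R u + t *\<^sub>R v) - f (x + t *\<^sub>R u) - f (x + t *\<^sub>R v) + f x = t * t * ?A (x + s *\<^sub>R u + r *\<^sub>R v)"
    by (rule double_difference_mvt[OF S f \<delta>(2) t])
  obtain s' r' where 2: "0 \<le> s'" "s' \<le> t" "0 \<le> r'" "r' \<le> t" 
    "f (x + t *\<^sub>R v + t *\<^sub>R u) - f (x + t *\<^sub>R v) - f (x + t *\<^sub>R u) + f x = t * t * ?B (x + s' *\<^sub>R v + r' *\<^sub>R u)"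
    by (rule double_difference_mvt[OF S f \<delta>(2) t(1) t'])
  have "x + t *\<^sub>R v + t *\<^sub>R u = x + t *\<^sub>R u + t *\<^sub>R v" by simp
  with 2(5) have "f (x + t *\<^sub>R u + t *\<^sub>R v) - f (x + t *\<^sub>R u) - f (x + t *\<^sub>R v) + f x
      = t * t * ?B (x + s' *\<^sub>R v + r' *\<^sub>R u)" by simp
  with 1(5) have "t * t * ?A (x + s *\<^sub>R u + r *\<^sub>R v) = t * t * ?B (x + s' *\<^sub>R v + r' *\<^sub>R u)" by linarith
  then have "?A (x + s *\<^sub>R u + r *\<^sub>R v) = ?B (x + s' *\<^sub>R v + r' *\<^sub>R u)" using t by simp
  moreover have "dist (?A (x + s *\<^sub>R u + r *\<^sub>R v)) (?A x) < \<epsilon>" using near[of s r] 1 by (intro d(3)) (auto simp: \<delta>_def)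
  moreover have "dist (?B (x + s' *\<^sub>R v + r' *\<^sub>R u)) (?B x) < \<epsilon>"
    using near[of r' s'] 2 by (intro d(4)) (auto simp: \<delta>_def add.commute add.left_commute)
  ultimately show False by (simp add: dist_real_def \<epsilon>_def abs_if split: if_splits)
qed

lemma frechet_derivative_cong_open:
  assumes "open S" "x \<in> S" "\<And>y. y \<in> S \<Longrightarrow> f y = g y"
  shows "fderiv f x = fderiv g x"
proof -
  have "(f has_derivative D) (at x) \<longleftrightarrow> (g has_derivative D) (at x)" for D
    using assms by (metis has_derivative_transform_within_open)
  then show ?thesis by (simp add: frechet_derivative_def)
qed

lemma iter_pderiv_cong_open:
  assumes "open S" "x \<in> S" "\<And>y. y \<in> S \<Longrightarrow> f y = g y"
  shows "iter_pderiv is f x = iter_pderiv is g x"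
  using assms(2)
proof (induction "is" arbitrary: x)
  case (Cons i "is")
  then show ?case by (simp add: frechet_derivative_cong_open[OF assms(1) Cons.prems Cons.IH])
qed (use assms in auto)

lemma smooth_on_iter_pderiv: "open S \<Longrightarrow> smooth_on S f \<Longrightarrow> smooth_on S (iter_pderiv is f)"
  by (induction "is") (auto intro: smooth_on_frechet_derivative)

lemma iter_pderiv_append: "iter_pderiv (xs @ ys) f = iter_pderiv xs (iter_pderiv ys f)"
  by (induction xs) auto

text \<open>Neighbouring derivatives commute, so the head of the first list can be moved to the front of the second.\<close>

lemma iter_pderiv_mset:
  assumes "smooth_on UNIV f" "mset xs = mset ys"
  shows "iter_pderiv xs f = iter_pderiv ys f"
  using assms(2)
proof (induction xs arbitrary: ys)
  case (Cons i xs)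
  have move: "iter_pderiv (zs @ i # ws) f = iter_pderiv (i # zs @ ws) f" for zs ws
  proof (induction zs)
    case (Cons j zs)
    let ?g = "iter_pderiv (zs @ ws) f"
    have "smooth_on UNIV ?g" using assms(1) by (simp add: smooth_on_iter_pderiv)
    then show ?case using smooth_on_derivative_commute[of UNIV ?g] by (simp add: Cons)
  qed simp
  from Cons.prems have "i \<in> set ys" by (metis list.set_intros(1) set_mset_mset)
  then obtain zs ws where ys: "ys = zs @ i # ws" by (meson split_list)
  then have "iter_pderiv xs f = iter_pderiv (zs @ ws) f" using Cons by simp
  then show ?case using move ys by simp
qed simp

lemma ex_list_count: "\<exists>is. \<forall>i. count_list is i = (\<nu> :: 'n::finite multi_index) i"
proof -
  obtain "is" where "mset is = (\<Sum>i\<in>UNIV. replicate_mset (\<nu> i) i)" using ex_mset by blast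
  then have "count (mset is) j = (\<Sum>i\<in>UNIV. if i = j then \<nu> i else 0)" for j by (simp add: count_sum)
  then show ?thesis by (auto simp: count_mset)
qed

lemma pderiv_mi_eq_iter_pderiv:
  assumes "smooth_on UNIV f" "\<And>i. count_list is i = \<nu> i"
  shows "pderiv_mi \<nu> f = iter_pderiv is f"
proof -
  let ?js = "SOME js. \<forall>i. count_list js i = \<nu> i"
  have "\<forall>i. count_list ?js i = \<nu> i" by (rule someI_ex[OF ex_list_count])
  then have "mset ?js = mset is" using assms(2) by (auto intro!: multiset_eqI simp: count_mset)
  then show ?thesis unfolding pderiv_mi_def by (intro iter_pderiv_mset assms)
qed

lemma pderiv_mi_0 [simp]: "pderiv_mi (\<lambda>_. 0) f = f"
proof -
  have "(SOME js. \<forall>i. count_list js i = 0) = ([] :: 'a list)"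
  proof (rule some_equality)
    fix js :: "'a list" assume "\<forall>i. count_list js i = 0"
    then show "js = []" by (cases js) (auto dest: spec[of _ "hd js"])
  qed simp
  then show ?thesis by (simp add: pderiv_mi_def)
qed

lemma smooth_on_pderiv_mi: "smooth_on UNIV f \<Longrightarrow> smooth_on UNIV (pderiv_mi \<nu> f)"
  unfolding pderiv_mi_def by (intro smooth_on_iter_pderiv) auto

lemma pderiv_mi_cong_open:
  assumes "open S" "x \<in> S" "\<And>y. y \<in> S \<Longrightarrow> f y = g y"
  shows "pderiv_mi \<nu> f x = pderiv_mi \<nu> g x"
  unfolding pderiv_mi_def by (rule iter_pderiv_cong_open[OF assms])

abbreviation pderiv1 :: "'n::finite \<Rightarrow> (real^'n \<Rightarrow> real) \<Rightarrow> real^'n \<Rightarrow> real"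
  where "pderiv1 j f \<equiv> \<lambda>x. fderiv f x (axis j 1)"

definition mi_inc :: "'n::finite multi_index \<Rightarrow> 'n \<Rightarrow> 'n multi_index"
  where "mi_inc \<nu> j = \<nu>(j := Suc (\<nu> j))"

text \<open>An additional derivative may be taken last or first, according to the end of the enumeration at which
  \<open>j\<close> is placed.\<close>

lemma pderiv_mi_inc:
  assumes "smooth_on UNIV f"
  shows "pderiv_mi (mi_inc \<nu> j) f = pderiv1 j (pderiv_mi \<nu> f)"
    and "pderiv_mi (mi_inc \<nu> j) f = pderiv_mi \<nu> (pderiv1 j f)"
proof -
  obtain "is" where "is": "\<And>i. count_list is i = \<nu> i" using ex_list_count by metis
  have "pderiv_mi (mi_inc \<nu> j) f = iter_pderiv (j # is) f"
    by (rule pderiv_mi_eq_iter_pderiv) (use assms "is" in \<open>auto simp: mi_inc_def\<close>)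
  then show "pderiv_mi (mi_inc \<nu> j) f = pderiv1 j (pderiv_mi \<nu> f)"
    using pderiv_mi_eq_iter_pderiv[of f "is" \<nu>] assms "is" by simp
  have "pderiv_mi (mi_inc \<nu> j) f = iter_pderiv (is @ [j]) f"
    by (rule pderiv_mi_eq_iter_pderiv) (use assms "is" in \<open>auto simp: mi_inc_def\<close>)
  then show "pderiv_mi (mi_inc \<nu> j) f = pderiv_mi \<nu> (pderiv1 j f)"
    using pderiv_mi_eq_iter_pderiv[of "pderiv1 j f" "is" \<nu>] "is"
      smooth_on_frechet_derivative[OF open_UNIV assms] by (simp add: iter_pderiv_append)
qed

lemma mi_order_inc: "mi_order (mi_inc \<nu> j) = Suc (mi_order \<nu>)"
proof -
  have "mi_order (mi_inc \<nu> j) = (\<Sum>i\<in>UNIV. \<nu> i + (if i = j then 1 else 0))" by (rule sum.cong) (auto simp: mi_inc_def)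
  then show ?thesis by (simp add: sum.distrib)
qed

lemma mi_induct [case_names zero inc]:
  assumes "P (\<lambda>_. 0)" "\<And>\<nu> j. P \<nu> \<Longrightarrow> P (mi_inc \<nu> j)"
  shows "P (\<nu> :: 'n::finite multi_index)"
proof (induction "mi_order \<nu>" arbitrary: \<nu>)
  case 0
  then have "\<nu> = (\<lambda>_. 0)" by auto
  then show ?case using assms(1) by simp
next
  case (Suc n)
  then obtain j where j: "\<nu> j \<noteq> 0" by (metis sum.neutral nat.distinct(1))
  define \<mu> where "\<mu> = \<nu>(j := \<nu> j - 1)"
  have \<nu>: "\<nu> = mi_inc \<mu> j" using j by (auto simp: \<mu>_def mi_inc_def)
  then have "mi_order \<mu> = n" using Suc(2) mi_order_inc[of \<mu> j] by (metis Suc_inject)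
  then show ?case using Suc(1) assms(2) \<nu> by metis
qed

lemma finite_mi_order_le: "finite {\<nu> :: 'n::finite multi_index. mi_order \<nu> \<le> k}"
proof -
  have "{\<nu> :: 'n multi_index. mi_order \<nu> \<le> k} \<subseteq> (UNIV \<rightarrow>\<^sub>E {..k})"
  proof
    fix \<nu> :: "'n multi_index" assume "\<nu> \<in> {\<nu>. mi_order \<nu> \<le> k}"
    then have "\<nu> i \<le> k" for i using member_le_sum[of i UNIV \<nu>] by simp
    then show "\<nu> \<in> UNIV \<rightarrow>\<^sub>E {..k}" by auto
  qed
  then show ?thesis by (rule finite_subset) (auto intro: finite_PiE)
qed

lemma finite_mi_order_eq: "finite {\<nu> :: 'n::finite multi_index. mi_order \<nu> = k}"
  by (rule finite_subset[OF _ finite_mi_order_le[of k]]) auto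

lemma pderiv1_add:
  "smooth_on UNIV f \<Longrightarrow> smooth_on UNIV g \<Longrightarrow> pderiv1 j (\<lambda>x. f x + g x) = (\<lambda>x. pderiv1 j f x + pderiv1 j g x)"
  by (rule ext, subst frechet_derivative_at[OF has_derivative_add, symmetric])
    (auto intro: smooth_on_differentiable)

lemma pderiv1_mult:
  fixes f g :: "real^'n::finite \<Rightarrow> real"
  assumes "smooth_on UNIV f" "smooth_on UNIV g"
  shows "pderiv1 j (\<lambda>x. f x * g x) = (\<lambda>x. f x * pderiv1 j g x + pderiv1 j f x * g x)"
  by (rule ext, subst frechet_derivative_at[OF has_derivative_mult, symmetric])
    (use assms in \<open>auto intro: smooth_on_differentiable\<close>)

lemma pderiv1_cmult:
  fixes f :: "real^'n::finite \<Rightarrow> real"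
  assumes "smooth_on UNIV f"
  shows "pderiv1 j (\<lambda>x. c * f x) = (\<lambda>x. c * pderiv1 j f x)"
  using pderiv1_mult[of "\<lambda>_. c" f j] assms by simp

lemma pderiv_mi_cmult:
  assumes "smooth_on UNIV f"
  shows "pderiv_mi \<nu> (\<lambda>x. c * f x) = (\<lambda>x. c * pderiv_mi \<nu> f x)"
proof (induction \<nu> rule: mi_induct)
  case (inc \<nu> j)
  then show ?case by (simp add: pderiv_mi_inc(1) assms smooth_on_mult pderiv1_cmult smooth_on_pderiv_mi)
qed simp

section \<open>Test functions and cut-offs\<close>

abbreviation supp :: "('a::topological_space \<Rightarrow> real) \<Rightarrow> 'a set"
  where "supp f \<equiv> closure {x. f x \<noteq> 0}"

lemma test_functionsI:
  assumes "smooth_on UNIV \<xi>" "compact K" "K \<subseteq> \<Omega>" "\<And>x. \<xi> x \<noteq> 0 \<Longrightarrow> x \<in> K"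
  shows "\<xi> \<in> test_functions \<Omega>"
proof -
  have "supp \<xi> \<subseteq> K" using assms by (intro closure_minimal) (auto intro: compact_imp_closed)
  then show ?thesis using assms by (auto simp: test_functions_def test_functions_in_def)
qed

lemma test_functions_iff:
  "\<xi> \<in> test_functions \<Omega> \<longleftrightarrow>
    smooth_on UNIV \<xi> \<and> compact (supp \<xi>) \<and> supp \<xi> \<subseteq> \<Omega>"
proof
  assume "\<xi> \<in> test_functions \<Omega>"
  then obtain K where "compact K" "K \<subseteq> \<Omega>" "smooth_on UNIV \<xi>" "supp \<xi> \<subseteq> K"
    by (auto simp: test_functions_def test_functions_in_def)
  then show "smooth_on UNIV \<xi> \<and> compact (supp \<xi>) \<and> supp \<xi> \<subseteq> \<Omega>"
    using compact_Int_closed[of K "supp \<xi>"] by (auto simp: Int_absorb1)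
next
  assume "smooth_on UNIV \<xi> \<and> compact (supp \<xi>) \<and> supp \<xi> \<subseteq> \<Omega>"
  then show "\<xi> \<in> test_functions \<Omega>" by (intro test_functionsI[of _ "supp \<xi>"]) (auto intro: subsetD[OF closure_subset])
qed

lemma test_functionsD:
  assumes "\<xi> \<in> test_functions \<Omega>"
  shows "smooth_on UNIV \<xi>" "compact (supp \<xi>)" "supp \<xi> \<subseteq> \<Omega>"
    "\<And>x. \<xi> x \<noteq> 0 \<Longrightarrow> x \<in> \<Omega>" using assms closure_subset[of "{x. \<xi> x \<noteq> 0}"] unfolding test_functions_iff by auto

lemma test_functions_mono: "\<Omega> \<subseteq> \<Omega>' \<Longrightarrow> \<xi> \<in> test_functions \<Omega> \<Longrightarrow> \<xi> \<in> test_functions \<Omega>'"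
  by (auto simp: test_functions_iff)

lemma test_functions_add:
  assumes "\<xi> \<in> test_functions \<Omega>" "\<zeta> \<in> test_functions \<Omega>"
  shows "(\<lambda>x. \<xi> x + \<zeta> x) \<in> test_functions \<Omega>"
proof (rule test_functionsI[of _ "supp \<xi> \<union> supp \<zeta>"])
  fix x assume "\<xi> x + \<zeta> x \<noteq> 0"
  then have "\<xi> x \<noteq> 0 \<or> \<zeta> x \<noteq> 0" by auto
  then show "x \<in> supp \<xi> \<union> supp \<zeta>" using closure_subset[of "{x. \<xi> x \<noteq> 0}"] closure_subset[of "{x. \<zeta> x \<noteq> 0}"] by blast
next
  show "smooth_on UNIV (\<lambda>x. \<xi> x + \<zeta> x)"
    by (intro smooth_on_add test_functionsD(1)[OF assms(1)] test_functionsD(1)[OF assms(2)] open_UNIV)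
  show "compact (supp \<xi> \<union> supp \<zeta>)"
    by (intro compact_Un test_functionsD(2)[OF assms(1)] test_functionsD(2)[OF assms(2)])
  show "supp \<xi> \<union> supp \<zeta> \<subseteq> \<Omega>" using test_functionsD(3)[OF assms(1)] test_functionsD(3)[OF assms(2)] by (rule Un_least)
qed

text \<open>\<open>W\<close> and the complement of \<open>K\<close> are two open sets that cover the space, and \<open>f\<close> is smooth on both.\<close>

lemma smooth_on_extend_zero:
  assumes "open W" "closed K" "K \<subseteq> W" "smooth_on W f" "\<And>x. x \<notin> K \<Longrightarrow> f x = 0"
  shows "smooth_on UNIV f"
proof -
  have "smooth_on (-K) f" by (rule smooth_on_cong[of _ "\<lambda>_. 0"]) (use assms in auto)
  then have "smooth_on (W \<union> -K) f" by (intro smooth_on_Un assms open_Compl)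
  then show ?thesis by (rule smooth_on_subset) (use assms(3) in auto)
qed

lemma test_functions_mult_smooth:
  assumes "open W" "smooth_on W f" "\<xi> \<in> test_functions W"
  shows "(\<lambda>x. f x * \<xi> x) \<in> test_functions W"
proof (rule test_functionsI[of _ "supp \<xi>"])
  note \<xi> = test_functionsD[OF assms(3)]
  show "smooth_on UNIV (\<lambda>x. f x * \<xi> x)" by (rule smooth_on_extend_zero[OF assms(1) _ \<xi>(3)])
      (use assms \<xi>(1) closure_subset[of "{x. \<xi> x \<noteq> 0}"] in
        \<open>auto intro!: smooth_on_mult intro: smooth_on_subset\<close>)
qed (use assms(3) closure_subset[of "{x. \<xi> x \<noteq> 0}"] in \<open>auto simp: test_functions_iff\<close>)

lemma test_functions_smooth_mult:
  assumes "open W" "smooth_on W f" "\<xi> \<in> test_functions W"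
  shows "(\<lambda>x. \<xi> x * f x) \<in> test_functions W"
  using test_functions_mult_smooth[OF assms] by (simp add: mult.commute)

lemma test_functions_cmult: "\<xi> \<in> test_functions \<Omega> \<Longrightarrow> (\<lambda>x. c * \<xi> x) \<in> test_functions \<Omega>"
  by (rule test_functionsI[of _ "supp \<xi>"])
    (auto simp: test_functions_iff intro!: smooth_on_mult intro: subsetD[OF closure_subset])

lemma pderiv_mi_support:
  assumes "pderiv_mi \<nu> \<xi> x \<noteq> 0"
  shows "x \<in> supp \<xi>"
proof (rule ccontr)
  assume "x \<notin> supp \<xi>"
  then have x: "x \<in> - supp \<xi>" by simp
  have "pderiv_mi \<nu> \<xi> x = pderiv_mi \<nu> (\<lambda>_. 0) x"
    by (rule pderiv_mi_cong_open[OF _ x]) (use closure_subset[of "{x. \<xi> x \<noteq> 0}"] in auto)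
  then show False using assms pderiv_mi_cmult[of "\<lambda>_. 0" \<nu> 0] by (metis mult_zero_left smooth_on_const)
qed

lemma test_functions_pderiv_mi:
  assumes "\<xi> \<in> test_functions \<Omega>"
  shows "pderiv_mi \<nu> \<xi> \<in> test_functions \<Omega>"
  by (rule test_functionsI) (use test_functionsD[OF assms] pderiv_mi_support in
      \<open>auto intro: smooth_on_pderiv_mi\<close>)

lemma pderiv_mi_unit: "pderiv_mi (mi_inc (\<lambda>_. 0) j) \<xi> = pderiv1 j \<xi>" if "smooth_on UNIV \<xi>"
  using pderiv_mi_inc(1)[OF that, of "\<lambda>_. 0" j] by simp

lemma test_functions_pderiv1:
  "\<xi> \<in> test_functions \<Omega> \<Longrightarrow> pderiv1 j \<xi> \<in> test_functions \<Omega>"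
  using test_functions_pderiv_mi[of \<xi> \<Omega> "mi_inc (\<lambda>_. 0) j"] pderiv_mi_unit[of \<xi> j] by (simp add: test_functionsD(1))

text \<open>The derivative of \<open>t\<^sup>-\<^sup>m e\<^sup>-\<^sup>1\<^sup>/\<^sup>t\<close> is a combination of such functions with larger \<open>m\<close>, so that the whole family
  can be treated by one induction on the order of differentiability.\<close>

lemma smooth_on_exp_inverse:
  "smooth_on UNIV (\<lambda>t::real. if t > 0 then inverse t ^ m * exp (- inverse t) else 0)"
proof -
  define g where "g m t = (if t > 0 then inverse t ^ m * exp (- inverse t) else (0::real))" for m t
  have lim0: "(g m \<longlongrightarrow> 0) (at 0)" for m
  proof -
    have "((\<lambda>t. inverse t ^ m / exp (inverse t)) \<longlongrightarrow> 0) (at_right (0::real))"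
      by (rule filterlim_compose[OF tendsto_power_div_exp_0 filterlim_inverse_at_top_right])
    then have "(g m \<longlongrightarrow> 0) (at_right 0)" by (rule tendsto_cong[THEN iffD1, rotated])
        (auto simp: g_def eventually_at_filter exp_minus field_simps)
    moreover have "(g m \<longlongrightarrow> 0) (at_left 0)" by (rule tendsto_eventually) (auto simp: g_def eventually_at_filter)
    ultimately show ?thesis by (simp add: filterlim_at_split)
  qed
  have der: "(g m has_real_derivative (g (m + 2) t - of_nat m * g (m + 1) t)) (at t)" for m t
  proof (cases t "0::real" rule: linorder_cases)
    case less
    have "((\<lambda>_. 0) has_real_derivative 0) (at t)" by simp
    then have "(g m has_real_derivative 0) (at t)"
      by (rule has_field_derivative_transform_within_open[of _ _ _ "{..<0}"])
        (use less in \<open>auto simp: g_def\<close>)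
    then show ?thesis using less by (simp add: g_def)
  next
    case equal
    have "((\<lambda>h. (g m (0 + h) - g m 0) / h) \<longlongrightarrow> 0) (at 0)" by (rule tendsto_cong[THEN iffD1, OF _ lim0[of "Suc m"]])
        (auto simp: g_def field_simps eventually_at_filter)
    then have "(g m has_real_derivative 0) (at 0)" by (simp add: DERIV_def)
    then show ?thesis using equal by (simp add: g_def)
  next
    case greater
    have "((\<lambda>t. inverse t ^ m * exp (- inverse t)) has_real_derivative
        (g (m + 2) t - of_nat m * g (m + 1) t)) (at t)"
      using greater by (auto intro!: derivative_eq_intros simp: g_def power2_eq_square)
        (cases m; simp add: algebra_simps)
    then show ?thesis by (rule has_field_derivative_transform_within_open[of _ _ _ "{0<..}"])
        (use greater in \<open>auto simp: g_def\<close>)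
  qed
  have "Ck_on k UNIV (g m)" for k m
  proof (induction k arbitrary: m)
    case 0
    then show ?case by (auto intro!: continuous_at_imp_continuous_on DERIV_isCont[OF der])
  next
    case (Suc k)
    show ?case
    proof (rule Ck_on_SucI[OF open_UNIV der[unfolded has_field_derivative_def]])
      fix v :: real
      have "Ck_on k UNIV (\<lambda>x. (g (m + 2) x + (- of_nat m) * g (m + 1) x) * v)"
        by (intro Ck_on_bilinear[OF _ bounded_bilinear_mult] Ck_on_add Ck_on_const Suc) auto
      then show "Ck_on k UNIV (\<lambda>x. (g (m + 2) x - real m * g (m + 1) x) * v)" by simp
    qed
  qed
  then have "smooth_on UNIV (g m)" by (simp add: smooth_on_def)
  then show ?thesis unfolding g_def by simp
qed

lemma smooth_bump_ball:
  fixes x :: "'a::euclidean_space"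
  assumes "0 < r"
  obtains f where "smooth_on UNIV f" "\<And>y. f y \<ge> (0::real)" "\<And>y. f y > 0 \<longleftrightarrow> y \<in> ball x r"
proof -
  define h where "h t = (if t > 0 then exp (- inverse t) else (0::real))" for t
  have h: "smooth_on UNIV h" using smooth_on_exp_inverse[of 0] by (simp add: h_def[abs_def] cong: if_cong)
  let ?f = "\<lambda>y. h (r\<^sup>2 - (y - x) \<bullet> (y - x))"
  have "smooth_on UNIV ?f" by (rule smooth_on_compose[OF _ h])
      (auto intro!: smooth_on_diff smooth_on_bilinear[OF _ bounded_bilinear_inner] smooth_on_ident)
  moreover have "?f y > 0 \<longleftrightarrow> y \<in> ball x r" for y
  proof -
    have "(y - x) \<bullet> (y - x) = (dist x y)\<^sup>2" by (simp add: dot_square_norm dist_norm norm_minus_commute)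
    then show ?thesis using assms abs_le_square_iff[of r "dist x y"] by (auto simp: h_def not_le[symmetric] )
  qed
  ultimately show ?thesis using that[of ?f] by (simp add: h_def)
qed

text \<open>A finite sum \<open>S\<close> of bumps on balls that cover \<open>K\<close> is at least \<open>2c > 0\<close> on \<open>K\<close>. The quotient
  \<open>h(t) / (h(t) + h(c - t))\<close>, with \<open>h(t) = e\<^sup>-\<^sup>1\<^sup>/\<^sup>t\<close> for \<open>t > 0\<close> and \<open>0\<close> otherwise, turns it into a function that
  equals \<open>1\<close> where \<open>S > c\<close> and vanishes where \<open>S = 0\<close>.\<close>

lemma smooth_cutoff:
  fixes K :: "(real^'n::finite) set"
  assumes K: "compact K" and U: "open U" and KU: "K \<subseteq> U"
  obtains \<eta> V where "\<eta> \<in> test_functions U" "open V" "K \<subseteq> V" "V \<subseteq> U" "\<And>x. x \<in> V \<Longrightarrow> \<eta> x = 1"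
    "\<And>x. 0 \<le> \<eta> x" "\<And>x. \<eta> x \<le> 1"
proof (cases "K = {}")
  case True
  then show ?thesis by (intro that[of "\<lambda>_. 0" "{}"]) (auto simp: test_functions_iff)
next
  case False
  have "\<exists>r>0. cball x r \<subseteq> U" if "x \<in> K" for x using U KU that open_contains_cball by blast
  then obtain r where r: "\<And>x. x \<in> K \<Longrightarrow> r x > 0" "\<And>x. x \<in> K \<Longrightarrow> cball x (r x) \<subseteq> U" by metis
  obtain I where I: "I \<subseteq> K" "finite I" "K \<subseteq> (\<Union>x\<in>I. ball x (r x))"
  proof (rule compactE_image[OF K, of K "\<lambda>x. ball x (r x)"])
    show "K \<subseteq> (\<Union>x\<in>K. ball x (r x))" using r(1) by auto
  qed (use that in auto)
  have "\<exists>f. smooth_on UNIV f \<and> (\<forall>y. f y \<ge> (0::real)) \<and> (\<forall>y. f y > 0 \<longleftrightarrow> y \<in> ball x (r x))" if "x \<in> K" for x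
    using smooth_bump_ball[OF r(1)[OF that]] by metis
  then obtain f where f: "\<And>x. x \<in> K \<Longrightarrow> smooth_on UNIV (f x)" "\<And>x y. x \<in> K \<Longrightarrow> f x y \<ge> (0::real)"
    "\<And>x y. x \<in> K \<Longrightarrow> f x y > 0 \<longleftrightarrow> y \<in> ball x (r x)" by metis
  \<comment> \<open>a sum of bumps that is positive on \<open>K\<close>\<close>
  define S where "S y = (\<Sum>x\<in>I. f x y)" for y
  have S: "smooth_on UNIV S" unfolding S_def using I by (auto intro!: smooth_on_sum f)
  have S0: "S y \<ge> 0" for y unfolding S_def using I f by (auto intro!: sum_nonneg)
  have Spos: "S y > 0" if y: "y \<in> K" for y
  proof -
    obtain x where "x \<in> I" "y \<in> ball x (r x)" using I y by blast
    then show ?thesis unfolding S_def using I f by (intro sum_pos2[of _ x]) auto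
  qed
  have Ssupp: "y \<in> (\<Union>x\<in>I. cball x (r x))" if "S y > 0" for y
  proof (rule ccontr)
    assume "\<not> ?thesis"
    then have "f x y = 0" if "x \<in> I" for x using f(2,3)[of x y] that I by (force simp: less_le)
    then show False using that by (simp add: S_def)
  qed
  obtain z where z: "z \<in> K" "\<And>y. y \<in> K \<Longrightarrow> S z \<le> S y"
    using continuous_attains_inf[OF K False] smooth_on_imp_continuous_on[OF S] by (metis continuous_on_subset subset_UNIV)
  \<comment> \<open>half of the minimum of \<open>S\<close> on \<open>K\<close>\<close>
  define c where "c = S z / 2"
  have c: "c > 0" using Spos z by (simp add: c_def)
  define h where "h t = (if t > 0 then exp (- inverse t) else (0::real))" for t
  have h: "smooth_on UNIV h" using smooth_on_exp_inverse[of 0] by (simp add: h_def[abs_def] cong: if_cong)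
  have den: "h t + h (c - t) > 0" for t using c by (auto simp: h_def add_pos_pos)
  define g where "g t = h t * inverse (h t + h (c - t))" for t
  have hc: "smooth_on UNIV (\<lambda>t. h (c - t))"
    by (rule smooth_on_compose[OF _ h]) (auto intro!: smooth_on_diff smooth_on_ident)
  have g: "smooth_on UNIV g" unfolding g_def
    by (intro smooth_on_mult smooth_on_inverse smooth_on_add h hc open_UNIV) (use den in \<open>auto simp: less_le\<close>)
  have g1: "g t = 1" if "t > c" for t using that c by (simp add: g_def h_def)
  have g01: "0 \<le> g t" "g t \<le> 1" for t using den[of t] by (auto simp: g_def h_def field_simps)
  have gpos: "t > 0" if "g t \<noteq> 0" for t using that by (auto simp: g_def h_def split: if_splits)
  show ?thesis
  proof (rule that[of "\<lambda>y. g (S y)" "{y. S y > c}"])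
    show "(\<lambda>y. g (S y)) \<in> test_functions U"
    proof (rule test_functionsI)
      show "smooth_on UNIV (\<lambda>y. g (S y))" by (rule smooth_on_compose[OF S g]) auto
      show "compact (\<Union>x\<in>I. cball x (r x))" using I by auto
      show "(\<Union>x\<in>I. cball x (r x)) \<subseteq> U" using I r by blast
    qed (use Ssupp gpos in auto)
    show "open {y. S y > c}" using smooth_on_imp_continuous_on[OF S] by (intro open_Collect_less) auto
    show "K \<subseteq> {y. S y > c}" using z c by (fastforce simp: c_def)
    show "{y. S y > c} \<subseteq> U" proof
      fix y assume "y \<in> {y. S y > c}"
      then obtain x where "x \<in> I" "y \<in> cball x (r x)" using Ssupp[of y] c by auto
      then show "y \<in> U" using r(2)[of x] I(1) by blast
    qed
  qed (use g1 g01 in auto)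
qed

definition pullback ::
  "(real^'n::finite) set \<Rightarrow> (real^'n \<Rightarrow> real) \<Rightarrow> (real^'n \<Rightarrow> real^'n) \<Rightarrow> (real^'n \<Rightarrow> real) \<Rightarrow> real^'n \<Rightarrow> real"
  where "pullback W a \<Phi> f = (\<lambda>x. if x \<in> W then a x * f (\<Phi> x) else 0)"

lemma test_functions_pullback:
  assumes W: "open W" "open W'" "smooth_on W \<Phi>" "\<Phi> ` W \<subseteq> W'" and a: "a \<in> test_functions W"
    and f: "smooth_on W' f"
  shows "pullback W a \<Phi> f \<in> test_functions W"
proof -
  have "(\<lambda>x. f (\<Phi> x) * a x) \<in> test_functions W"
    by (rule test_functions_mult_smooth[OF W(1) _ a]) (rule smooth_on_compose[OF W(3) f W(1,2,4)])
  moreover have "pullback W a \<Phi> f = (\<lambda>x. f (\<Phi> x) * a x)"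
    using test_functionsD(4)[OF a] by (auto simp: pullback_def fun_eq_iff)
  ultimately show ?thesis by simp
qed


section \<open>Change of variables\<close>

text \<open>The change of variables theorem for \<open>real^'m\<close> concerns index types of class \<open>wellorder\<close>. An arbitrary
  finite index type is therefore replaced by a copy of itself that carries the order of some
  enumeration; the relabelling of coordinates preserves Lebesgue measure and determinants.\<close>

typedef 'a ranked = "UNIV :: 'a set" morphisms unrank rank ..

lemma bij_unrank: "bij unrank"
  by (metis bij_betw_def inj_on_def rangeI unrank_inject rank_inverse UNIV_I surj_def)

lemma bij_rank: "bij rank"
  by (metis bij_betw_byWitness rank_inverse subset_UNIV unrank_inverse UNIV_I)

instance ranked :: (finite) finite
proof
  show "finite (UNIV :: 'a ranked set)" using bij_betw_finite[OF bij_unrank[where 'a = 'a]] by simp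
qed

definition rank_index :: "'a::finite ranked \<Rightarrow> nat"
  where "rank_index = (SOME f. inj f) \<circ> unrank"

lemma inj_rank_index: "inj rank_index"
proof -
  have "\<exists>f :: 'a \<Rightarrow> nat. inj f" using finite_imp_inj_to_nat_seg[of "UNIV :: 'a set"] by auto
  then show ?thesis unfolding rank_index_def by (intro inj_compose[OF someI_ex[of inj]] bij_is_inj[OF bij_unrank])
qed

instantiation ranked :: (finite) wellorder
begin

definition less_eq_ranked :: "'a ranked \<Rightarrow> 'a ranked \<Rightarrow> bool"
  where "less_eq_ranked x y \<longleftrightarrow> rank_index x \<le> rank_index y"

definition less_ranked :: "'a ranked \<Rightarrow> 'a ranked \<Rightarrow> bool"
  where "less_ranked x y \<longleftrightarrow> rank_index x < rank_index y"

instance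
proof
  fix P :: "'a ranked \<Rightarrow> bool" and a :: "'a ranked"
  assume step: "\<And>x. (\<And>y. y < x \<Longrightarrow> P y) \<Longrightarrow> P x"
  show "P a"
  proof (induction a rule: measure_induct_rule[of rank_index])
    case (less x)
    show ?case by (rule step, rule less) (simp add: less_ranked_def)
  qed
qed (auto simp: less_eq_ranked_def less_ranked_def dest: injD[OF inj_rank_index])

end

definition relabel :: "real^'n::finite \<Rightarrow> real^('n ranked)"
  where "relabel x = (\<chi> i. x $ unrank i)"

definition unrelabel :: "real^('n ranked) \<Rightarrow> real^'n::finite"
  where "unrelabel y = (\<chi> i. y $ rank i)"

lemma relabel_nth: "relabel x $ i = x $ unrank i"
  by (simp add: relabel_def)

lemma relabel_inverse [simp]: "unrelabel (relabel x) = x" "relabel (unrelabel y) = y"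
  by (simp_all add: relabel_def unrelabel_def rank_inverse unrank_inverse vec_eq_iff)

lemma relabel_linear: "bounded_linear relabel \<and> bounded_linear unrelabel"
  by (auto intro!: linear_conv_bounded_linear[THEN iffD1] linearI simp: relabel_def unrelabel_def vec_eq_iff)

lemma prod_Basis_vec: "(\<Prod>b\<in>(Basis :: (real^'n::finite) set). f b) = (\<Prod>i\<in>UNIV. f (axis i 1))"
proof -
  have "(Basis :: (real^'n) set) = (\<lambda>i. axis i 1) ` UNIV" by (auto simp: Basis_vec_def)
  then have "(\<Prod>b\<in>(Basis :: (real^'n) set). f b) = (\<Prod>b\<in>(\<lambda>i. axis i 1) ` UNIV. f b)" by (rule prod.cong) simp
  also have "\<dots> = (\<Prod>i\<in>UNIV. f (axis i 1))" by (subst prod.reindex) (auto simp: inj_on_def axis_eq_axis)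
  finally show ?thesis .
qed

text \<open>Lebesgue measure is determined by its values on boxes, and the relabelling maps boxes to boxes with the
  same side lengths.\<close>

lemma distr_relabel: "distr lborel borel relabel = (lborel :: (real^('n::finite ranked)) measure)"
proof (rule lborel_eqI[symmetric])
  fix l u :: "real^('n ranked)"
  assume lu: "\<And>b. b \<in> Basis \<Longrightarrow> l \<bullet> b \<le> u \<bullet> b"
  have le: "l $ i \<le> u $ i" for i using lu[of "axis i 1"] by (simp add: inner_axis axis_in_Basis_iff)
  have [measurable]: "relabel \<in> borel_measurable borel"
    by (intro borel_measurable_continuous_onI linear_continuous_on relabel_linear[THEN conjunct1])
  have "relabel -` box l u = box (unrelabel l) (unrelabel u)"
  proof -
    have "(\<forall>i. l $ i < x $ unrank i \<and> x $ unrank i < u $ i) \<longleftrightarrow>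
        (\<forall>i. l $ rank i < x $ i \<and> x $ i < u $ rank i)" for x :: "real^'n"
      by (metis rank_inverse unrank_inverse UNIV_I)
    then show ?thesis by (auto simp: mem_box_cart relabel_def unrelabel_def)
  qed
  then have "emeasure (distr lborel borel relabel) (box l u) = emeasure lborel (box (unrelabel l) (unrelabel u))"
    by (simp add: emeasure_distr)
  also have "\<dots> = (\<Prod>b\<in>Basis. (unrelabel u - unrelabel l) \<bullet> b)"
  proof (rule emeasure_lborel_box)
    fix b :: "real^'n" assume "b \<in> Basis"
    then show "unrelabel l \<bullet> b \<le> unrelabel u \<bullet> b" using le by (auto simp: Basis_vec_def inner_axis unrelabel_def)
  qed
  also have "(\<Prod>b\<in>Basis. (unrelabel u - unrelabel l) \<bullet> b) = (\<Prod>i\<in>UNIV. (u - l) $ rank i)"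
  by (simp add: prod_Basis_vec inner_axis unrelabel_def)
  also have "\<dots> = (\<Prod>i\<in>UNIV. (u - l) $ i)" by (rule prod.reindex_bij_betw[OF bij_rank])
  also have "\<dots> = (\<Prod>b\<in>Basis. (u - l) \<bullet> b)" by (simp add: prod_Basis_vec inner_axis)
  finally show "emeasure (distr lborel borel relabel) (box l u) = (\<Prod>b\<in>Basis. (u - l) \<bullet> b)" .
qed simp

lemma permutes_UNIV_iff_bij: "p permutes UNIV \<longleftrightarrow> bij p"
  by (auto intro: bij_imp_permutes permutes_bij)

lemma sign_relabel:
  assumes "p permutes (UNIV :: 'n::finite set)"
  shows "sign (rank \<circ> p \<circ> unrank) = sign p"
  using assms finite_class.finite_UNIV
proof (induction p rule: permutes_induct)
  case id
  have "rank \<circ> id \<circ> unrank = (id :: 'n ranked \<Rightarrow> _)" by (auto simp: unrank_inverse)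
  then show ?case by simp
next
  case (swap a b p)
  have *: "rank \<circ> (Transposition.transpose a b \<circ> p) \<circ> unrank =
      Transposition.transpose (rank a) (rank b) \<circ> (rank \<circ> p \<circ> unrank)"
    by (auto simp: Transposition.transpose_def fun_eq_iff rank_inject)
  have "permutation p" using swap by (auto simp: permutation_permutes)
  moreover have "permutation (rank \<circ> p \<circ> unrank)" unfolding permutation_permutes
    using swap bij_rank bij_unrank by (intro exI[of _ UNIV]) (auto simp: permutes_UNIV_iff_bij intro!: bij_comp)
  moreover have "rank a \<noteq> rank b" using swap by (simp add: rank_inject)
  ultimately have
    "sign (Transposition.transpose (rank a) (rank b) \<circ> (rank \<circ> p \<circ> unrank)) = - sign (rank \<circ> p \<circ> unrank)"
    "sign (Transposition.transpose a b \<circ> p) = - sign p"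
    using swap by (simp_all add: sign_compose[OF permutation_swap_id] sign_swap_id del: comp_apply)
  then show ?case unfolding * by (simp only: swap.IH)
qed

text \<open>Conjugation by the relabelling is a bijection of permutations that preserves signs, hence of the Leibniz
  sums.\<close>

lemma det_relabel:
  fixes A :: "real^'n::finite^'n"
  shows "det (\<chi> i j. A $ unrank i $ unrank j) = det A"
proof -
  have "det A = (\<Sum>p | p permutes (UNIV::'n set). of_int (sign p) * (\<Prod>i\<in>UNIV. A $ i $ p i))" by (simp add: det_def)
  also have "\<dots> = (\<Sum>q | q permutes (UNIV::'n ranked set). of_int (sign q) *
      (\<Prod>i\<in>UNIV. A $ unrank i $ unrank (q i)))"
  proof (rule sum.reindex_bij_witness[where i = "\<lambda>q. unrank \<circ> q \<circ> rank" and j = "\<lambda>p. rank \<circ> p \<circ> unrank"])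
    fix p :: "'n \<Rightarrow> 'n" assume p: "p \<in> {p. p permutes UNIV}"
    show "rank \<circ> p \<circ> unrank \<in> {q. q permutes UNIV}"
      using p bij_rank bij_unrank by (auto simp: permutes_UNIV_iff_bij intro!: bij_comp)
    have "(\<Prod>i\<in>UNIV. A $ unrank i $ p (unrank i)) = (\<Prod>i\<in>UNIV. A $ i $ p i)"
      by (rule prod.reindex_bij_betw[OF bij_unrank])
    then show "of_int (sign (rank \<circ> p \<circ> unrank)) *
        (\<Prod>i\<in>UNIV. A $ unrank i $ unrank ((rank \<circ> p \<circ> unrank) i)) =
        of_int (sign p) * (\<Prod>i\<in>UNIV. A $ i $ p i)" using p by (simp add: sign_relabel rank_inverse)
  next
    fix q :: "'n ranked \<Rightarrow> 'n ranked" assume q: "q \<in> {q. q permutes UNIV}"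
    show "unrank \<circ> q \<circ> rank \<in> {p. p permutes UNIV}"
      using q bij_rank bij_unrank by (auto simp: permutes_UNIV_iff_bij intro!: bij_comp)
  qed (auto simp: fun_eq_iff rank_inverse unrank_inverse)
  finally show ?thesis by (simp add: det_def)
qed

abbreviation jac_det :: "(real^'n::finite \<Rightarrow> real^'n) \<Rightarrow> real^'n \<Rightarrow> real"
  where "jac_det g x \<equiv> \<bar>det (matrix (fderiv g x))\<bar>"

lemma smooth_on_det_derivative:
  fixes g :: "real^'n::finite \<Rightarrow> real^'n"
  assumes "open S" "smooth_on S g"
  shows "smooth_on S (\<lambda>x. det (matrix (fderiv g x)))"
  using assms by (intro smooth_on_det) (auto simp: matrix_def intro!: smooth_on_vec_nth smooth_on_frechet_derivative)

text \<open>This is the change of variables theorem for Henstock-Kurzweil integrals, rewritten for non-negative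
  Lebesgue integrals; if the image has infinite measure then the integral is infinite as well, because
  otherwise the Jacobian would be integrable and the image of finite measure.\<close>

lemma emeasure_image_wellorder:
  fixes g :: "real^'n::{finite,wellorder} \<Rightarrow> real^'n::_"
  assumes S: "S \<in> sets borel" "g ` S \<in> sets borel" 
    and g: "\<And>x. x \<in> S \<Longrightarrow> (g has_derivative g' x) (at x)" and inj: "inj_on g S"
    and meas: "(\<lambda>x. indicator S x * \<bar>det (matrix (g' x))\<bar>) \<in> borel_measurable borel"
  shows "emeasure lborel (g ` S) = (\<integral>\<^sup>+x\<in>S. \<bar>det (matrix (g' x))\<bar> \<partial>lborel)"
proof -
  let ?d = "\<lambda>x. \<bar>det (matrix (g' x))\<bar>"
  have SL: "S \<in> sets lebesgue" using S by simp
  note iff = has_measure_differentiable_image[OF SL has_derivative_at_withinI[OF g] inj]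
  have eq: "(\<integral>\<^sup>+x\<in>S. ?d x \<partial>lborel) = (\<integral>\<^sup>+x. ennreal (indicator S x * ?d x) \<partial>lborel)"
    by (intro nn_integral_cong) (auto simp: indicator_def)
  show ?thesis
  proof (cases "g ` S \<in> lmeasurable")
    case True
    then have int: "?d integrable_on S" "integral S ?d = measure lebesgue (g ` S)"
      using iff[of "measure lebesgue (g ` S)"] by auto
    have "((\<lambda>x. indicator S x * ?d x) has_integral measure lebesgue (g ` S)) UNIV"
    proof -
      have "(?d has_integral measure lebesgue (g ` S)) S" using int by (simp add: has_integral_iff)
      then have "((\<lambda>x. if x \<in> S then ?d x else 0) has_integral measure lebesgue (g ` S)) UNIV"
        by (simp add: has_integral_restrict_UNIV)
      then show ?thesis by (rule has_integral_eq[rotated]) auto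
    qed
    then have "(\<integral>\<^sup>+x. ennreal (indicator S x * ?d x) \<partial>lborel) = ennreal (measure lebesgue (g ` S))"
      using meas by (intro nn_integral_has_integral_lborel) auto
    moreover have "emeasure lborel (g ` S) = ennreal (measure lebesgue (g ` S))"
      using emeasure_eq_measure2[OF True] S by simp
    ultimately show ?thesis using eq by simp
  next
    case False
    have "\<not> ?d integrable_on S" using iff[of "integral S ?d"] False by auto
    have "(\<integral>\<^sup>+x. ennreal (indicator S x * ?d x) \<partial>lborel) = \<infinity>"
    proof (rule ccontr)
      assume fin: "(\<integral>\<^sup>+x. ennreal (indicator S x * ?d x) \<partial>lborel) \<noteq> \<infinity>"
      then have "integrable lborel (\<lambda>x. indicator S x * ?d x)"
        using meas by (intro integrableI_nonneg) (auto simp: less_top)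
      then have "(\<lambda>x. indicator S x * ?d x) integrable_on UNIV" by (rule integrable_on_lborel)
      then have "(\<lambda>x. if x \<in> S then ?d x else 0) integrable_on UNIV" by (rule integrable_eq) auto
      then show False using \<open>\<not> ?d integrable_on S\<close> by (simp add: integrable_restrict_UNIV)
    qed
    moreover have "emeasure lborel (g ` S) = \<infinity>" using False S by (simp add: fmeasurable_def less_top[symmetric])
    ultimately show ?thesis using eq by simp
  qed
qed

definition diffeo ::
  "(real^'n::finite) set \<Rightarrow> (real^'n) set \<Rightarrow> (real^'n \<Rightarrow> real^'n) \<Rightarrow> (real^'n \<Rightarrow> real^'n) \<Rightarrow> bool"
  where "diffeo W W' \<Phi> \<Psi> \<longleftrightarrow> open W \<and> open W' \<and> smooth_on W \<Phi> \<and> smooth_on W' \<Psi> \<and>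
    (\<forall>x\<in>W. \<Phi> x \<in> W' \<and> \<Psi> (\<Phi> x) = x) \<and> (\<forall>y\<in>W'. \<Psi> y \<in> W \<and> \<Phi> (\<Psi> y) = y)"

lemma diffeo_sym: "diffeo W W' \<Phi> \<Psi> \<Longrightarrow> diffeo W' W \<Psi> \<Phi>"
  by (auto simp: diffeo_def)

lemma diffeo_borel_image:
  assumes d: "diffeo W W' \<Phi> \<Psi>" and A: "A \<in> sets borel" "A \<subseteq> W"
  shows "\<Phi> ` A \<in> sets borel"
proof -
  have "\<Psi> \<in> borel_measurable (restrict_space borel W')"
    using d by (intro borel_measurable_continuous_on_restrict smooth_on_imp_continuous_on) (simp add: diffeo_def)
  from measurable_sets[OF this A(1)] have "\<Psi> -` A \<inter> W' \<in> sets borel"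
    using d by (subst (asm) sets_restrict_space_iff) (auto simp: diffeo_def space_restrict_space)
  moreover have "\<Psi> -` A \<inter> W' = \<Phi> ` A" using d A(2) by (auto simp: diffeo_def image_iff subset_iff) metis
  ultimately show ?thesis by simp
qed

lemma relabel_image: "relabel ` B = unrelabel -` B"
  by (force simp: image_iff intro: relabel_inverse(2)[symmetric])

lemma relabel_measurable [measurable]: "relabel \<in> borel_measurable borel" "unrelabel \<in> borel_measurable borel"
  using relabel_linear by (auto intro!: borel_measurable_continuous_onI linear_continuous_on)

lemma borel_relabel_image: "B \<in> sets borel \<Longrightarrow> relabel ` B \<in> sets borel"
  unfolding relabel_image using measurable_sets[OF relabel_measurable(2), of B] by simp

lemma emeasure_relabel_image:
  assumes "B \<in> sets borel"
  shows "emeasure lborel (relabel ` B) = emeasure lborel B"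
proof -
  have "emeasure lborel (relabel ` B) = emeasure (distr lborel borel relabel) (relabel ` B)"
    by (simp add: distr_relabel)
  also have "\<dots> = emeasure lborel (relabel -` (relabel ` B))"
    using borel_relabel_image[OF assms] by (simp add: emeasure_distr)
  also have "relabel -` (relabel ` B) = B" by (auto simp: image_iff) (metis relabel_inverse(1))
  finally show ?thesis .
qed

text \<open>The map is conjugated with the relabelling of coordinates, which changes neither the measures nor the
  Jacobian determinant.\<close>

lemma diffeo_emeasure_image:
  assumes d: "diffeo W W' \<Phi> \<Psi>" and A: "A \<in> sets borel" "A \<subseteq> W"
  shows "emeasure lborel (\<Phi> ` A) = (\<integral>\<^sup>+x\<in>A. ennreal (jac_det \<Phi> x) \<partial>lborel)"
proof -
  let ?g = "\<lambda>y. relabel (\<Phi> (unrelabel y))" and ?A = "relabel ` A"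
  let ?g' = "\<lambda>y h. relabel (fderiv \<Phi> (unrelabel y) (unrelabel h))"
  have mat: "\<bar>det (matrix (?g' (relabel x)))\<bar> = jac_det \<Phi> x" if "x \<in> A" for x
  proof -
    have u: "unrelabel (axis i 1) = axis (unrank i) (1::real)" for i :: "'a ranked"
      by (auto simp: unrelabel_def axis_def vec_eq_iff rank_inverse unrank_inverse)
    have "matrix (?g' (relabel x)) $ i $ j = matrix (fderiv \<Phi> x) $ unrank i $ unrank j" for i j
      by (simp add: matrix_def u relabel_nth)
    then have "matrix (?g' (relabel x)) =
        (\<chi> i j. matrix (fderiv \<Phi> x) $ unrank i $ unrank j)" by (simp add: vec_eq_iff)
    then show ?thesis by (simp add: det_relabel)
  qed
  have J: "(\<lambda>x. indicator A x * jac_det \<Phi> x) \<in> borel_measurable borel"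
  proof -
    have "continuous_on W (\<lambda>x. jac_det \<Phi> x)" using d smooth_on_imp_continuous_on[OF smooth_on_det_derivative]
      by (intro continuous_on_rabs) (auto simp: diffeo_def)
    then have "continuous_on A (\<lambda>x. jac_det \<Phi> x)" using A(2) by (rule continuous_on_subset)
    then have "(\<lambda>x. indicator A x *\<^sub>R jac_det \<Phi> x) \<in> borel_measurable borel"
      by (intro borel_measurable_continuous_on_indicator A)
    then show ?thesis by simp
  qed
  have J': "indicator ?A y * \<bar>det (matrix (?g' y))\<bar> = indicator A (unrelabel y) * jac_det \<Phi> (unrelabel y)" for y
    using mat[of "unrelabel y"] by (auto simp: indicator_def relabel_image)
  have "emeasure lborel (\<Phi> ` A) = emeasure lborel (relabel ` (\<Phi> ` A))"
    using diffeo_borel_image[OF assms] by (simp add: emeasure_relabel_image)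
  also have "relabel ` (\<Phi> ` A) = ?g ` ?A" by (simp add: image_image)
  also have "emeasure lborel (?g ` ?A) = (\<integral>\<^sup>+y\<in>?A. \<bar>det (matrix (?g' y))\<bar> \<partial>lborel)"
  proof (rule emeasure_image_wellorder)
    show "?A \<in> sets borel" using A(1) by (rule borel_relabel_image)
    show "?g ` ?A \<in> sets borel" using borel_relabel_image[OF diffeo_borel_image[OF assms]] by (simp add: image_image)
    show "(?g has_derivative ?g' y) (at y)" if "y \<in> ?A" for y
    proof -
      have "unrelabel y \<in> W" using that A(2) by auto
      then have D: "(\<Phi> has_derivative fderiv \<Phi> (unrelabel y)) (at (unrelabel y))"
        using d smooth_on_differentiable by (auto simp: diffeo_def)
      show ?thesis using has_derivative_compose[OF has_derivative_compose[OF
            bounded_linear_imp_has_derivative[OF relabel_linear[THEN conjunct2]] D]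
            bounded_linear_imp_has_derivative[OF relabel_linear[THEN conjunct1]]] by simp
    qed
    show "inj_on ?g ?A"
    proof (rule inj_onI)
      fix y z assume yz: "y \<in> ?A" "z \<in> ?A" "?g y = ?g z"
      then have "\<Phi> (unrelabel y) = \<Phi> (unrelabel z)" by (metis relabel_inverse(1))
      moreover have "unrelabel y \<in> W" "unrelabel z \<in> W" using yz A(2) by auto
      ultimately have "unrelabel y = unrelabel z" using d by (metis diffeo_def)
      then show "y = z" by (metis relabel_inverse(2))
    qed
    show "(\<lambda>y. indicator ?A y * \<bar>det (matrix (?g' y))\<bar>) \<in> borel_measurable borel"
      unfolding J' by (rule measurable_compose[OF relabel_measurable(2) J])
  qed
  also have "\<dots> = (\<integral>\<^sup>+y. ennreal (indicator A (unrelabel y) * jac_det \<Phi> (unrelabel y)) \<partial>lborel)"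
    by (intro nn_integral_cong) (subst J'[symmetric], simp add: indicator_def)
  also have "\<dots> = (\<integral>\<^sup>+x. ennreal (indicator A x * jac_det \<Phi> x) \<partial>lborel)"
  proof -
    have m: "(\<lambda>y. indicator A (unrelabel y) * jac_det \<Phi> (unrelabel y)) \<in> borel_measurable borel"
      by (rule measurable_compose[OF relabel_measurable(2) J])
    show ?thesis by (subst distr_relabel[symmetric], subst nn_integral_distr) (simp_all add: m)
  qed
  also have "\<dots> = (\<integral>\<^sup>+x\<in>A. ennreal (jac_det \<Phi> x) \<partial>lborel)" by (intro nn_integral_cong) (simp add: indicator_def)
  finally show ?thesis .
qed

text \<open>The values of \<open>\<Phi>\<close> off \<open>W\<close> are arbitrary; the indicator makes it a Borel function on the whole space.\<close>

lemma diffeo_measurable: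
  assumes "diffeo W W' \<Phi> \<Psi>"
  shows "(\<lambda>x. indicator W x *\<^sub>R \<Phi> x) \<in> borel_measurable borel"
    "(\<lambda>x. indicator W x * jac_det \<Phi> x) \<in> borel_measurable borel"
proof -
  show "(\<lambda>x. indicator W x *\<^sub>R \<Phi> x) \<in> borel_measurable borel"
    using assms by (intro borel_measurable_continuous_on_indicator smooth_on_imp_continuous_on)
      (auto simp: diffeo_def)
  have "continuous_on W (\<lambda>x. jac_det \<Phi> x)" using assms smooth_on_imp_continuous_on[OF smooth_on_det_derivative]
    by (intro continuous_on_rabs) (auto simp: diffeo_def)
  then have "(\<lambda>x. indicator W x *\<^sub>R jac_det \<Phi> x) \<in> borel_measurable borel"
    using assms by (intro borel_measurable_continuous_on_indicator) (auto simp: diffeo_def)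
  then show "(\<lambda>x. indicator W x * jac_det \<Phi> x) \<in> borel_measurable borel" by simp
qed

text \<open>The previous formula for measures of images, stated as an equality of measures so that integrals of
  arbitrary functions can be transported.\<close>

lemma diffeo_distr:
  assumes d: "diffeo W W' \<Phi> \<Psi>"
  shows "distr (density lborel (\<lambda>x. ennreal (indicator W x * jac_det \<Phi> x))) borel (\<lambda>x. indicator W x *\<^sub>R \<Phi> x)
    = density lborel (\<lambda>y. ennreal (indicator W' y))" (is "?L = ?R")
proof (rule measure_eqI)
  note [measurable] = diffeo_measurable[OF d]
  have [measurable]: "W \<in> sets borel" "W' \<in> sets borel" using d by (auto simp: diffeo_def)
  fix B assume "B \<in> sets ?L"
  then have B [measurable]: "B \<in> sets borel" by simp
  let ?A = "(\<lambda>x. indicator W x *\<^sub>R \<Phi> x) -` B \<inter> W"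
  have A: "?A \<in> sets borel" using measurable_sets[OF diffeo_measurable(1)[OF d] B] by auto
  have im: "\<Phi> ` ?A = B \<inter> W'"
  proof (intro equalityI subsetI)
    fix y assume "y \<in> B \<inter> W'"
    then show "y \<in> \<Phi> ` ?A" using d by (intro image_eqI[of _ _ "\<Psi> y"]) (simp_all add: diffeo_def)
  qed (use d in \<open>auto simp: diffeo_def\<close>)
  let ?w = "\<lambda>x. ennreal (indicator W x * jac_det \<Phi> x)" and ?F = "\<lambda>x. indicator W x *\<^sub>R \<Phi> x"
  have FB: "?F -` B \<in> sets borel" using measurable_sets[OF diffeo_measurable(1)[OF d] B] by simp
  have "emeasure ?L B = emeasure (density lborel ?w) (?F -` B)" by (subst emeasure_distr) simp_all
  also have "\<dots> = (\<integral>\<^sup>+x. ?w x * indicator (?F -` B) x \<partial>lborel)"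
  proof (rule emeasure_density)
    show "?w \<in> borel_measurable lborel" by measurable
    show "?F -` B \<in> sets lborel" using FB by simp
  qed
  also have "\<dots> = (\<integral>\<^sup>+x\<in>?A. ennreal (jac_det \<Phi> x) \<partial>lborel)" by (intro nn_integral_cong) (auto simp: indicator_def)
  also have "\<dots> = emeasure lborel (B \<inter> W')" using diffeo_emeasure_image[OF d A] im by simp
  also have "\<dots> = (\<integral>\<^sup>+y. indicator (B \<inter> W') y \<partial>lborel)" by simp
  also have "\<dots> = (\<integral>\<^sup>+y. ennreal (indicator W' y) * indicator B y \<partial>lborel)"
    by (intro nn_integral_cong) (auto simp: indicator_def)
  also have "\<dots> = emeasure ?R B" by (rule emeasure_density[symmetric]) simp_all
  finally show "emeasure ?L B = emeasure ?R B" .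
qed simp

lemma nn_integral_diffeo:
  fixes h :: "real^'n::finite \<Rightarrow> ennreal"
  assumes d: "diffeo W W' \<Phi> \<Psi>" and h: "(\<lambda>y. h y * indicator W' y) \<in> borel_measurable borel"
  shows "(\<integral>\<^sup>+x\<in>W. ennreal (jac_det \<Phi> x) * h (\<Phi> x) \<partial>lborel) = (\<integral>\<^sup>+y\<in>W'. h y \<partial>lborel)"
proof -
  define H where "H y = h y * indicator W' y" for y
  have [measurable]: "H \<in> borel_measurable borel" using h by (simp add: H_def[abs_def])
  note [measurable] = diffeo_measurable[OF d]
  have [measurable]: "W \<in> sets borel" "W' \<in> sets borel" using d by (auto simp: diffeo_def)
  have "(\<integral>\<^sup>+y\<in>W'. h y \<partial>lborel) = (\<integral>\<^sup>+y. H y \<partial>density lborel (\<lambda>y. ennreal (indicator W' y)))"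
    by (subst nn_integral_density) (auto intro!: nn_integral_cong simp: indicator_def H_def)
  also have "\<dots> = (\<integral>\<^sup>+x. H (indicator W x *\<^sub>R \<Phi> x)
      \<partial>density lborel (\<lambda>x. ennreal (indicator W x * jac_det \<Phi> x)))"
    by (subst diffeo_distr[OF d, symmetric], subst nn_integral_distr) simp_all
  also have "\<dots> = (\<integral>\<^sup>+x. ennreal (indicator W x * jac_det \<Phi> x) * H (indicator W x *\<^sub>R \<Phi> x) \<partial>lborel)"
    by (rule nn_integral_density) measurable
  also have "\<dots> = (\<integral>\<^sup>+x\<in>W. ennreal (jac_det \<Phi> x) * h (\<Phi> x) \<partial>lborel)"
    using d by (intro nn_integral_cong) (auto simp: indicator_def diffeo_def H_def)
  finally show ?thesis by simp
qed

text \<open>Borel measurability of the restriction to \<open>S\<close>.\<close>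

abbreviation borel_on :: "'a::topological_space set \<Rightarrow> ('a \<Rightarrow> real) \<Rightarrow> bool"
  where "borel_on S f \<equiv> (\<lambda>x. indicator S x * f x) \<in> borel_measurable borel"

lemma set_integral_diffeo:
  fixes h :: "real^'n::finite \<Rightarrow> real"
  assumes d: "diffeo W W' \<Phi> \<Psi>" and h: "borel_on W' h"
  shows "(LINT x:W|lborel. jac_det \<Phi> x * h (\<Phi> x)) = (LINT y:W'|lborel. h y)"
proof -
  define H where "H y = indicator W' y * h y" for y
  have [measurable]: "H \<in> borel_measurable borel" unfolding H_def by (rule h)
  note [measurable] = diffeo_measurable[OF d]
  have [measurable]: "W \<in> sets borel" "W' \<in> sets borel" using d by (auto simp: diffeo_def)
  have eq: "(indicator W x * jac_det \<Phi> x) *\<^sub>R H (indicator W x *\<^sub>R \<Phi> x) =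
      indicator W x *\<^sub>R (jac_det \<Phi> x * h (\<Phi> x))" for x using d by (auto simp: indicator_def diffeo_def H_def)
  have eq': "indicator W' y *\<^sub>R H y = indicator W' y *\<^sub>R h y" for y by (auto simp: indicator_def H_def)
  have "(LINT y:W'|lborel. h y) = (\<integral>y. H y \<partial>density lborel (\<lambda>y. ennreal (indicator W' y)))"
    unfolding set_lebesgue_integral_def eq'[symmetric] by (subst integral_density) auto
  also have "\<dots> = (\<integral>x. H (indicator W x *\<^sub>R \<Phi> x) \<partial>density lborel (\<lambda>x. ennreal (indicator W x * jac_det \<Phi> x)))"
    by (subst diffeo_distr[OF d, symmetric], subst integral_distr) simp_all
  also have "\<dots> = (LINT x:W|lborel. jac_det \<Phi> x * h (\<Phi> x))"
    unfolding set_lebesgue_integral_def eq[symmetric] by (subst integral_density) auto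
  finally show "(LINT x:W|lborel. jac_det \<Phi> x * h (\<Phi> x)) = (LINT y:W'|lborel. h y)" by simp
qed


section \<open>Local integrability and the fundamental lemma of the calculus of variations\<close>

definition locally_integrable :: "(real^'n::finite) set \<Rightarrow> (real^'n \<Rightarrow> real) \<Rightarrow> bool"
  where "locally_integrable \<Omega> g \<longleftrightarrow> (\<forall>K. compact K \<and> K \<subseteq> \<Omega> \<longrightarrow> set_integrable lborel K g)"

lemma test_function_bounded:
  assumes "\<xi> \<in> test_functions \<Omega>"
  obtains B where "B > 0" "\<And>x. \<bar>\<xi> x\<bar> \<le> B"
proof -
  let ?K = "supp \<xi>"
  have "compact (\<xi> ` ?K)" using test_functionsD(1,2)[OF assms]
    by (intro compact_continuous_image) (auto intro: continuous_on_subset smooth_on_imp_continuous_on)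
  then obtain B where B: "B > 0" "\<And>x. x \<in> ?K \<Longrightarrow> norm (\<xi> x) \<le> B" by (auto dest!: compact_imp_bounded simp: bounded_pos)
  have "\<bar>\<xi> x\<bar> \<le> B" for x using B closure_subset[of "{x. \<xi> x \<noteq> 0}"] by (cases "\<xi> x = 0") auto
  then show ?thesis using that B by blast
qed

lemma test_function_measurable [measurable_dest]:
  "\<xi> \<in> test_functions \<Omega> \<Longrightarrow> \<xi> \<in> borel_measurable borel"
  by (intro borel_measurable_continuous_onI smooth_on_imp_continuous_on test_functionsD(1))

lemma set_integrable_mult_test:
  assumes g: "locally_integrable \<Omega> g" and \<xi>: "\<xi> \<in> test_functions \<Omega>"
  shows "integrable lborel (\<lambda>x. g x * \<xi> x)"
    and "(LINT x:\<Omega>|lborel. g x * \<xi> x) = (\<integral>x. g x * \<xi> x \<partial>lborel)"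
proof -
  let ?K = "supp \<xi>"
  have K: "\<xi> x \<noteq> 0 \<Longrightarrow> x \<in> ?K" for x using closure_subset[of "{x. \<xi> x \<noteq> 0}"] by auto
  obtain B where B: "B > 0" "\<And>x. \<bar>\<xi> x\<bar> \<le> B" by (rule test_function_bounded[OF \<xi>]) (rule that)
  have i: "integrable lborel (\<lambda>x. indicator ?K x * g x)"
    using g test_functionsD[OF \<xi>] by (auto simp: locally_integrable_def set_integrable_def)
  have [measurable]: "\<xi> \<in> borel_measurable borel" using \<xi> by (rule test_function_measurable)
  have "integrable lborel (\<lambda>x. (indicator ?K x * g x) * \<xi> x)"
  proof (rule Bochner_Integration.integrable_bound)
    show "integrable lborel (\<lambda>x. B * (indicator ?K x * g x))" using i by simp
    show "(\<lambda>x. (indicator ?K x * g x) * \<xi> x) \<in> borel_measurable lborel"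
      using borel_measurable_integrable[OF i] by measurable
    show "AE x in lborel. norm ((indicator ?K x * g x) * \<xi> x) \<le> norm (B * (indicator ?K x * g x))"
      using B by (auto simp: abs_mult intro!: AE_I2 mult_mono simp: mult.commute[of B])
  qed
  moreover have "(\<lambda>x. (indicator ?K x * g x) * \<xi> x) = (\<lambda>x. g x * \<xi> x)"
    using K by (auto simp: indicator_def fun_eq_iff)
  ultimately show "integrable lborel (\<lambda>x. g x * \<xi> x)" by simp
  show "(LINT x:\<Omega>|lborel. g x * \<xi> x) = (\<integral>x. g x * \<xi> x \<partial>lborel)"
    unfolding set_lebesgue_integral_def using test_functionsD(4)[OF \<xi>]
    by (intro Bochner_Integration.integral_cong) (auto simp: indicator_def)
qed

text \<open>\<open>\<Omega>\<close> is a countable union of compact sets, on each of which \<open>g\<close> is integrable.\<close>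

lemma locally_integrable_measurable:
  assumes "open \<Omega>" "locally_integrable \<Omega> g"
  shows "borel_on \<Omega> g"
proof -
  obtain C where C: "\<And>n. compact (C n)" "\<And>n. C n \<subseteq> \<Omega>" "\<And>n. C n \<subseteq> interior (C (Suc n))" "\<Union>(range C) = \<Omega>"
    by (rule open_Union_compact_subsets[OF assms(1)]) (rule that)
  have mono: "C m \<subseteq> C n" if "m \<le> n" for m n
    using that order_trans[OF C(3) interior_subset] by (intro lift_Suc_mono_le[of C m n])
  show ?thesis
  proof (rule borel_measurable_LIMSEQ_real)
    show "(\<lambda>x. indicator (C n) x * g x) \<in> borel_measurable borel" for n
      using assms(2) C(1,2)[of n] borel_measurable_integrable[of lborel "\<lambda>x. indicator (C n) x * g x"]
      by (simp add: locally_integrable_def set_integrable_def)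
    fix x
    show "(\<lambda>n. indicator (C n) x * g x) \<longlonglongrightarrow> indicator \<Omega> x * g x"
    proof (cases "x \<in> \<Omega>")
      case True
      then obtain m where "x \<in> C m" using C by auto
      then have "\<forall>\<^sub>F n in sequentially. indicator (C n) x * g x = indicator \<Omega> x * g x"
        using mono True by (auto simp: eventually_sequentially indicator_def intro!: exI[of _ m])
      then show ?thesis by (rule tendsto_eventually)
    next
      case False
      then have "x \<notin> C n" for n using C by auto
      then show ?thesis using False by simp
    qed
  qed
qed

lemma locally_integrable_continuous:
  "continuous_on \<Omega> g \<Longrightarrow> locally_integrable \<Omega> g" unfolding locally_integrable_def set_integrable_def
  using borel_integrable_compact continuous_on_subset by blast

lemma locally_integrable_add:
  "locally_integrable \<Omega> f \<Longrightarrow> locally_integrable \<Omega> g \<Longrightarrow> locally_integrable \<Omega> (\<lambda>x. f x + g x)"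
  by (auto simp: locally_integrable_def)

lemma locally_integrable_cmult:
  "locally_integrable \<Omega> f \<Longrightarrow> locally_integrable \<Omega> (\<lambda>x. c * f x)" by (auto simp: locally_integrable_def)

lemma locally_integrable_subset:
  "locally_integrable \<Omega> g \<Longrightarrow> \<Omega>' \<subseteq> \<Omega> \<Longrightarrow> locally_integrable \<Omega>' g" by (auto simp: locally_integrable_def)

lemma integrable_imp_locally_integrable: "integrable lborel u \<Longrightarrow> locally_integrable \<Omega> u"
  unfolding locally_integrable_def set_integrable_def
  by (intro allI impI integrable_mult_indicator) (auto intro: borel_compact)

text \<open>Cut-off functions of \<open>K\<close> that are supported in shrinking neighbourhoods converge to the
  indicator function of \<open>K\<close>; the integrals converge by dominated convergence.\<close>

lemma integral_compact_eq_0: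
  assumes \<Omega>: "open \<Omega>" and w: "locally_integrable \<Omega> w"
    and 0: "\<And>\<xi>. \<xi> \<in> test_functions \<Omega> \<Longrightarrow> (LINT x:\<Omega>|lborel. w x * \<xi> x) = 0"
    and K: "compact K" "K \<subseteq> \<Omega>"
  shows "(LINT x:K|lborel. w x) = 0"
proof -
  obtain \<eta> V where \<eta>: "\<eta> \<in> test_functions \<Omega>" "open V" "K \<subseteq> V" "V \<subseteq> \<Omega>" "\<And>x. x \<in> V \<Longrightarrow> \<eta> x = 1"
    using smooth_cutoff[OF K(1) \<Omega> K(2)] by metis
  let ?L = "supp \<eta>"
  have L: "compact ?L" "?L \<subseteq> \<Omega>" using test_functionsD[OF \<eta>(1)] by auto
  have VL: "V \<subseteq> ?L" using \<eta>(5) closure_subset[of "{x. \<eta> x \<noteq> 0}"] by auto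
  \<comment> \<open>neighbourhoods that shrink to \<open>K\<close>, inside a set where \<open>w\<close> is integrable\<close>
  define U where "U m = V \<inter> (\<Union>x\<in>K. ball x (1 / real (Suc m)))" for m
  have U: "open (U m)" "K \<subseteq> U m" for m using \<eta> by (auto simp: U_def intro!: open_Int)
  have "\<exists>\<xi>. \<xi> \<in> test_functions (U m) \<and> (\<forall>x\<in>K. \<xi> x = 1) \<and> (\<forall>x. 0 \<le> \<xi> x \<and> \<xi> x \<le> 1)" for m
    using smooth_cutoff[OF K(1) U(1)[of m] U(2)[of m]] by (metis subsetD)
  then obtain \<xi> where \<xi>: "\<And>m. \<xi> m \<in> test_functions (U m)" "\<And>m x. x \<in> K \<Longrightarrow> \<xi> m x = 1"
    "\<And>m x. 0 \<le> \<xi> m x" "\<And>m x. \<xi> m x \<le> (1::real)" by metis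
  have \<xi>\<Omega>: "\<xi> m \<in> test_functions \<Omega>" for m
    by (rule test_functions_mono[OF _ \<xi>(1)[of m]]) (use \<eta>(4) in \<open>auto simp: U_def\<close>)
  have iL: "integrable lborel (\<lambda>x. indicator ?L x * w x)"
    using w L by (auto simp: locally_integrable_def set_integrable_def)
  have [measurable]: "\<xi> m \<in> borel_measurable borel" for m using \<xi>(1) by (rule test_function_measurable)
  have "K \<in> sets borel" using K by (auto intro: borel_compact)
  have "(\<lambda>m. \<integral>x. (indicator ?L x * w x) * \<xi> m x \<partial>lborel) \<longlonglongrightarrow> (\<integral>x. (indicator ?L x * w x) * indicator K x \<partial>lborel)"
  proof (rule integral_dominated_convergence)
    show "integrable lborel (\<lambda>x. \<bar>indicator ?L x * w x\<bar>)" using iL by simp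
    show "AE x in lborel. norm ((indicator ?L x * w x) * \<xi> m x) \<le> \<bar>indicator ?L x * w x\<bar>" for m
      using \<xi>(3,4) by (auto simp: abs_mult intro!: AE_I2 mult_left_le)
    show "(\<lambda>x. (indicator ?L x * w x) * \<xi> m x) \<in> borel_measurable lborel" for m
      using borel_measurable_integrable[OF iL] by measurable
    show "(\<lambda>x. (indicator ?L x * w x) * indicator K x) \<in> borel_measurable lborel"
      using borel_measurable_integrable[OF iL] \<open>K \<in> sets borel\<close> by measurable
    show "AE x in lborel. (\<lambda>m. (indicator ?L x * w x) * \<xi> m x) \<longlonglongrightarrow> (indicator ?L x * w x) * indicator K x"
    proof (intro AE_I2 tendsto_mult tendsto_const)
      fix x
      show "(\<lambda>m. \<xi> m x) \<longlonglongrightarrow> indicator K x"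
      proof (cases "x \<in> K")
        case True
        then show ?thesis using \<xi>(2) by simp
      next
        case False
        then obtain e where e: "e > 0" "\<And>y. y \<in> K \<Longrightarrow> e \<le> dist x y"
          using separate_point_closed[OF compact_imp_closed[OF K(1)]] by blast
        obtain N where N: "1 / real (Suc N) < e" using e(1) by (metis inverse_eq_divide reals_Archimedean)
        have "\<xi> m x = 0" if "N \<le> m" for m
        proof (rule ccontr)
          assume "\<xi> m x \<noteq> 0"
          then obtain y where y: "y \<in> K" "dist y x < 1 / real (Suc m)"
            using test_functionsD(4)[OF \<xi>(1)] by (auto simp: U_def)
          have "1 / real (Suc m) \<le> 1 / real (Suc N)" using that by (simp add: frac_le)
          then show False using e(2)[OF y(1)] y N by (simp add: dist_commute)
        qed
        then show ?thesis using False by (intro tendsto_eventually) (auto simp: eventually_sequentially)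
      qed
    qed
  qed
  moreover have "(\<integral>x. (indicator ?L x * w x) * \<xi> m x \<partial>lborel) = 0" for m
  proof -
    have "(indicator ?L x * w x) * \<xi> m x = w x * \<xi> m x" for x
      using test_functionsD(4)[OF \<xi>(1), of m x] VL by (auto simp: U_def indicator_def)
    then have "(\<integral>x. (indicator ?L x * w x) * \<xi> m x \<partial>lborel) = (\<integral>x. w x * \<xi> m x \<partial>lborel)"
      by (rule Bochner_Integration.integral_cong[OF refl])
    then show ?thesis using 0[OF \<xi>\<Omega>[of m]] set_integrable_mult_test(2)[OF w \<xi>\<Omega>[of m]] by simp
  qed
  moreover have "(\<integral>x. (indicator ?L x * w x) * indicator K x \<partial>lborel) = (LINT x:K|lborel. w x)"
    unfolding set_lebesgue_integral_def using \<eta>(3) VL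
    by (intro Bochner_Integration.integral_cong) (auto simp: indicator_def)
  ultimately show ?thesis by (simp add: LIMSEQ_const_iff)
qed

text \<open>The closed sets generate the Borel sets and are stable under intersection, so the integral vanishes over
  every Borel set, in particular over \<open>{x. f x > 0}\<close> and \<open>{x. f x < 0}\<close>.\<close>

lemma AE_eq_0_if_compact_integrals_0:
  fixes f :: "real^'n::finite \<Rightarrow> real"
  assumes f: "integrable lborel f" and 0: "\<And>A. closed A \<Longrightarrow> (\<integral>x. indicator A x * f x \<partial>lborel) = 0"
  shows "AE x in lborel. f x = 0"
proof -
  have A0: "(LINT x:A|lborel. f x) = 0" if "A \<in> sets borel" for A
  proof -
    have "A \<in> sigma_sets UNIV (Collect closed)" using that by (simp add: borel_eq_closed)
    show ?thesis
    proof (rule sigma_sets_induct_disjoint[OF _ _ \<open>A \<in> sigma_sets _ _\<close>])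
      show "Int_stable (Collect closed)" by (auto simp: Int_stable_def)
      fix A :: "(real^'n) set"
      show "(LINT x:A|lborel. f x) = 0" if "A \<in> Collect closed" using 0 that by (simp add: set_lebesgue_integral_def)
      show "(LINT x:UNIV - A|lborel. f x) = 0"
        if "A \<in> sigma_sets UNIV (Collect closed)" "(LINT x:A|lborel. f x) = 0"
      proof -
        have A: "A \<in> sets borel" using that by (simp add: borel_eq_closed)
        have i: "integrable lborel (\<lambda>x. indicator A x *\<^sub>R f x)" using A f by (intro integrable_mult_indicator) auto
        have "(LINT x:UNIV - A|lborel. f x) = (\<integral>x. f x - indicator A x *\<^sub>R f x \<partial>lborel)"
          unfolding set_lebesgue_integral_def by (intro Bochner_Integration.integral_cong) (auto simp: indicator_def)
        also have "\<dots> = integral\<^sup>L lborel f - (LINT x:A|lborel. f x)"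
          unfolding set_lebesgue_integral_def using f i by (rule Bochner_Integration.integral_diff)
        also have "integral\<^sup>L lborel f = 0" using 0[of UNIV] by simp
        finally show ?thesis using that by simp
      qed
    next
      fix A :: "nat \<Rightarrow> (real^'n) set"
      assume A: "disjoint_family A" "range A \<subseteq> sigma_sets UNIV (Collect closed)"
        "\<And>i. (LINT x:A i|lborel. f x) = 0"
      have m: "A i \<in> sets lborel" for i using A(2) by (auto simp: borel_eq_closed)
      have "set_integrable lborel (\<Union>i. A i) f"
        unfolding set_integrable_def using f m by (intro integrable_mult_indicator) auto
      then have "(LINT x:(\<Union>i. A i)|lborel. f x) = (\<Sum>i. (LINT x:A i|lborel. f x))"
        using A(1) m by (intro lebesgue_integral_countable_add) (auto simp: disjoint_family_on_def)
      then show "(LINT x:(\<Union>i. A i)|lborel. f x) = 0" using A(3) by simp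
    qed (auto simp: set_lebesgue_integral_def)
  qed
  have [measurable]: "f \<in> borel_measurable borel" using borel_measurable_integrable[OF f] by simp
  have "AE x in lborel. indicator A x * (s * f x) = 0"
    if "A \<in> sets borel" "\<And>x. x \<in> A \<Longrightarrow> s * f x \<ge> 0" for A and s :: real
  proof -
    have i: "integrable lborel (\<lambda>x. indicator A x * (s * f x))"
      using that f integrable_mult_indicator[of A lborel "\<lambda>x. s * f x"] by simp
    have "(\<integral>x. indicator A x * (s * f x) \<partial>lborel) = s * (LINT x:A|lborel. f x)"
      by (simp add: set_lebesgue_integral_def mult.left_commute)
    then show ?thesis using A0[OF that(1)] integral_nonneg_eq_0_iff_AE[OF i] that by (auto simp: indicator_def)
  qed
  from this[of "{x. f x > 0}" 1] this[of "{x. f x < 0}" "-1"]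
  show ?thesis by (auto elim!: AE_mp simp: indicator_def)
qed

text \<open>Both preceding lemmas are applied on the sets of a compact exhaustion of \<open>\<Omega>\<close>.\<close>

lemma fundamental_lemma:
  assumes \<Omega>: "open \<Omega>" and w: "locally_integrable \<Omega> w"
    and 0: "\<And>\<xi>. \<xi> \<in> test_functions \<Omega> \<Longrightarrow> (LINT x:\<Omega>|lborel. w x * \<xi> x) = 0"
  shows "AE x in lborel. x \<in> \<Omega> \<longrightarrow> w x = 0"
proof -
  obtain C where C: "\<And>n. compact (C n)" "\<And>n. C n \<subseteq> \<Omega>" "\<And>n. C n \<subseteq> interior (C (Suc n))" "\<Union>(range C) = \<Omega>"
    by (rule open_Union_compact_subsets[OF \<Omega>]) (rule that)
  have "AE x in lborel. indicator (C n) x * w x = 0" for n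
  proof (rule AE_eq_0_if_compact_integrals_0)
    show "integrable lborel (\<lambda>x. indicator (C n) x * w x)"
      using w C by (auto simp: locally_integrable_def set_integrable_def)
    fix A :: "(real^'a) set" assume "closed A"
    then have "(LINT x:C n \<inter> A|lborel. w x) = 0"
      using C by (intro integral_compact_eq_0[OF \<Omega> w 0]) (auto intro: compact_Int_closed)
    moreover have "(LINT x:C n \<inter> A|lborel. w x) = (\<integral>x. indicator A x * (indicator (C n) x * w x) \<partial>lborel)"
      unfolding set_lebesgue_integral_def by (intro Bochner_Integration.integral_cong) (auto simp: indicator_def)
    ultimately show "(\<integral>x. indicator A x * (indicator (C n) x * w x) \<partial>lborel) = 0" by simp
  qed
  then have "AE x in lborel. \<forall>n. indicator (C n) x * w x = 0" by (intro AE_all_countable[THEN iffD2] allI)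
  then show ?thesis
  proof (rule AE_mp, intro AE_I2 impI)
    fix x assume "\<forall>n. indicator (C n) x * w x = 0" "x \<in> \<Omega>"
    then show "w x = 0" using C(4) by (metis UN_E image_eqI indicator_simps(1) mult_cancel_right1 mult_eq_0_iff UnionE imageE)
  qed
qed

section \<open>Integration by parts and weak derivatives\<close>

lemma lborel_integral_shift:
  fixes f :: "real^'n::finite \<Rightarrow> real"
  assumes [measurable]: "f \<in> borel_measurable borel"
  shows "(\<integral>x. f (c + x) \<partial>lborel) = (\<integral>x. f x \<partial>lborel)"
  by (subst (2) lborel_distr_plus[of c, symmetric], subst integral_distr) simp_all

lemma lborel_integrable_shift:
  fixes f :: "real^'n::finite \<Rightarrow> real"
  assumes [measurable]: "integrable lborel f"
  shows "integrable lborel (\<lambda>x. f (c + x))"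
proof -
  have "integrable (distr lborel borel ((+) c)) f" using assms by (simp add: lborel_distr_plus)
  then show ?thesis by (subst (asm) integrable_distr_eq) (use assms in auto)
qed

lemma test_function_integrable: "\<xi> \<in> test_functions \<Omega> \<Longrightarrow> integrable lborel \<xi>"
  using set_integrable_mult_test(1)[of \<Omega> "\<lambda>_. 1" \<xi>] locally_integrable_continuous[of \<Omega> "\<lambda>_. 1"]
  by (simp add: continuous_on_const)

lemma test_function_has_derivative:
  assumes "\<xi> \<in> test_functions \<Omega>"
  shows "(\<xi> has_derivative fderiv \<xi> x) (at x)"
  using smooth_on_differentiable(2)[OF test_functionsD(1)[OF assms]] by simp

text \<open>The integrals of the difference quotients vanish by translation invariance. The quotients converge
  boundedly, and their supports lie in a common compact set.\<close>

lemma integral_pderiv1_eq_0: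
  assumes "\<xi> \<in> test_functions \<Omega>"
  shows "(\<integral>x. pderiv1 j \<xi> x \<partial>lborel) = 0"
proof -
  let ?K = "supp \<xi>" and ?e = "axis j (1::real)"
  \<comment> \<open>contains the supports of all difference quotients with increment at most \<open>1\<close>\<close>
  let ?L = "(\<lambda>(y, s). y - s *\<^sub>R ?e) ` (?K \<times> {0..1})"
  have L: "compact ?L" using test_functionsD(2)[OF assms] 
    by (intro compact_continuous_image compact_Times) (auto intro!: continuous_intros simp: split_beta)
  obtain B where B: "B > 0" "\<And>x. \<bar>pderiv1 j \<xi> x\<bar> \<le> B"
    using test_function_bounded[OF test_functions_pderiv1[OF assms]] by metis
  have D: "((\<lambda>s. \<xi> (x + s *\<^sub>R ?e)) has_real_derivative pderiv1 j \<xi> (x + s *\<^sub>R ?e)) (at s)" for x s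
  proof -
    have "((\<lambda>s. \<xi> (x + s *\<^sub>R ?e)) has_derivative (\<lambda>h. fderiv \<xi> (x + s *\<^sub>R ?e) (h *\<^sub>R ?e))) (at s)"
      by (rule has_derivative_compose[OF _ test_function_has_derivative[OF assms]])
        (auto intro!: derivative_eq_intros)
    moreover have "fderiv \<xi> y (h *\<^sub>R ?e) = pderiv1 j \<xi> y * h" for y h
      using has_derivative_linear[OF test_function_has_derivative[OF assms, of y]] by (simp add: linear_scale mult.commute)
    ultimately show ?thesis by (simp add: has_field_derivative_def)
  qed
  define t where "t n = 1 / real (Suc n)" for n
  have t: "0 < t n" "t n \<le> 1" for n by (auto simp: t_def)
  define q where "q n x = (\<xi> (t n *\<^sub>R ?e + x) - \<xi> x) / t n" for n x
  have [measurable]: "\<xi> \<in> borel_measurable borel" using assms by (rule test_function_measurable)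
  have "(\<lambda>n. \<integral>x. q n x \<partial>lborel) \<longlonglongrightarrow> (\<integral>x. pderiv1 j \<xi> x \<partial>lborel)"
  proof (rule integral_dominated_convergence)
    show "integrable lborel (\<lambda>x. indicator ?L x * B)"
      using borel_integrable_compact[OF L, of "\<lambda>_. B"] by (simp add: continuous_on_const)
    show "pderiv1 j \<xi> \<in> borel_measurable lborel"
      using test_function_measurable[OF test_functions_pderiv1[OF assms]] by simp
    show "q n \<in> borel_measurable lborel" for n unfolding q_def by measurable
    show "AE x in lborel. (\<lambda>n. q n x) \<longlonglongrightarrow> pderiv1 j \<xi> x"
    proof (intro AE_I2)
      fix x
      have "((\<lambda>h. (\<xi> (x + (0 + h) *\<^sub>R ?e) - \<xi> (x + 0 *\<^sub>R ?e)) / h) \<longlongrightarrow> pderiv1 j \<xi> (x + 0 *\<^sub>R ?e)) (at 0)"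
        using D[of x 0] unfolding DERIV_def .
      moreover have "filterlim t (at 0) sequentially" using LIMSEQ_inverse_real_of_nat t unfolding filterlim_at
        by (auto simp: t_def[abs_def] inverse_eq_divide less_le)
      ultimately have "(\<lambda>n. (\<xi> (x + (0 + t n) *\<^sub>R ?e) - \<xi> (x + 0 *\<^sub>R ?e)) / t n) \<longlonglongrightarrow> pderiv1 j \<xi> (x + 0 *\<^sub>R ?e)"
        by (rule filterlim_compose)
      then show "(\<lambda>n. q n x) \<longlonglongrightarrow> pderiv1 j \<xi> x" by (simp add: q_def add.commute)
    qed
    show "AE x in lborel. norm (q n x) \<le> indicator ?L x * B" for n
    proof (intro AE_I2)
      fix x
      show "norm (q n x) \<le> indicator ?L x * B"
      proof (cases "x \<in> ?L")
        case True
        obtain s where "\<xi> (x + t n *\<^sub>R ?e) - \<xi> (x + 0 *\<^sub>R ?e) = (t n - 0) * pderiv1 j \<xi> (x + s *\<^sub>R ?e)"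
          using MVT2[OF t(1)[of n], where f = "\<lambda>s. \<xi> (x + s *\<^sub>R ?e)" and f' = "\<lambda>s. pderiv1 j \<xi> (x + s *\<^sub>R ?e)"] D by blast
        then have "q n x = pderiv1 j \<xi> (x + s *\<^sub>R ?e)" using t(1)[of n] by (simp add: q_def add.commute)
        then show ?thesis using B True by simp
      next
        case False
        have "x \<notin> ?K"
        proof
          assume "x \<in> ?K"
          then have "x \<in> ?L" by (intro image_eqI[of _ _ "(x, 0)"]) auto
          then show False using False by simp
        qed
        moreover have "t n *\<^sub>R ?e + x \<notin> ?K"
        proof
          assume "t n *\<^sub>R ?e + x \<in> ?K"
          then have "x \<in> ?L" using t[of n] by (intro image_eqI[of _ _ "(t n *\<^sub>R ?e + x, t n)"]) auto
          then show False using False by simp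
        qed
        ultimately have "\<xi> x = 0" "\<xi> (t n *\<^sub>R ?e + x) = 0" using closure_subset[of "{x. \<xi> x \<noteq> 0}"] by auto
        then show ?thesis using B by (simp add: q_def)
      qed
    qed
  qed
  moreover have "(\<integral>x. q n x \<partial>lborel) = 0" for n
  proof -
    have "integrable lborel \<xi>" using assms by (rule test_function_integrable)
    then show ?thesis
      unfolding q_def using lborel_integrable_shift[of \<xi> "t n *\<^sub>R ?e"] lborel_integral_shift[of \<xi> "t n *\<^sub>R ?e"]
      by simp
  qed
  ultimately show ?thesis by (simp add: LIMSEQ_const_iff)
qed

text \<open>The derivative of the test function \<open>u v\<close> has integral \<open>0\<close>.\<close>

lemma integral_by_parts:
  assumes u: "smooth_on UNIV u" and v: "v \<in> test_functions \<Omega>"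
  shows "(\<integral>x. u x * pderiv1 j v x \<partial>lborel) = - (\<integral>x. pderiv1 j u x * v x \<partial>lborel)"
proof -
  have v': "v \<in> test_functions UNIV" using v by (rule test_functions_mono[rotated]) simp
  have 1: "(\<lambda>x. u x * pderiv1 j v x) \<in> test_functions UNIV"
    by (intro test_functions_mult_smooth test_functions_pderiv1 v' u open_UNIV)
  have 2: "(\<lambda>x. pderiv1 j u x * v x) \<in> test_functions UNIV"
    by (intro test_functions_mult_smooth smooth_on_frechet_derivative v' u open_UNIV)
  have "(\<integral>x. pderiv1 j (\<lambda>x. u x * v x) x \<partial>lborel) = 0"
    by (rule integral_pderiv1_eq_0[OF test_functions_mult_smooth[OF open_UNIV u v']])
  then have "(\<integral>x. u x * pderiv1 j v x + pderiv1 j u x * v x \<partial>lborel) = 0"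
    using pderiv1_mult[OF u test_functionsD(1)[OF v], of j] by simp
  then show ?thesis using test_function_integrable[OF 1] test_function_integrable[OF 2] by simp
qed

text \<open>Test functions vanish off \<open>\<Omega>\<close>, so the integrals over \<open>\<Omega>\<close> in \<open>weak_derivs\<close> are integrals over the whole
  space.\<close>

lemma weak_derivs_iff:
  assumes "locally_integrable \<Omega> f"
  shows "g \<in> weak_derivs \<Omega> \<nu> f \<longleftrightarrow> locally_integrable \<Omega> g \<and> (\<forall>\<xi>\<in>test_functions \<Omega>.
    (\<integral>x. f x * pderiv_mi \<nu> \<xi> x \<partial>lborel) = (-1) ^ mi_order \<nu> * (\<integral>x. g x * \<xi> x \<partial>lborel))"
  using assms set_integrable_mult_test(2)[OF assms] set_integrable_mult_test(2)[of \<Omega> g]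
  by (auto simp: weak_derivs_def locally_integrable_def[symmetric] regular_distribution_def
      test_functions_pderiv_mi)

lemma weak_derivsD:
  assumes "g \<in> weak_derivs \<Omega> \<nu> f"
  shows "locally_integrable \<Omega> g"
  using assms by (auto simp: weak_derivs_def locally_integrable_def)

lemma weak_derivs_unique:
  assumes \<Omega>: "open \<Omega>" and g: "g \<in> weak_derivs \<Omega> \<nu> f" and h: "h \<in> weak_derivs \<Omega> \<nu> f"
  shows "AE x in lborel. x \<in> \<Omega> \<longrightarrow> g x = h x"
proof -
  note l = weak_derivsD[OF g] weak_derivsD[OF h]
  have "AE x in lborel. x \<in> \<Omega> \<longrightarrow> g x + (-1) * h x = 0"
  proof (rule fundamental_lemma[OF \<Omega>])
    show l': "locally_integrable \<Omega> (\<lambda>x. g x + (-1) * h x)"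
      by (intro locally_integrable_add locally_integrable_cmult l)
    fix \<xi> assume \<xi>: "\<xi> \<in> test_functions \<Omega>"
    have "(LINT x:\<Omega>|lborel. g x * \<xi> x) = (LINT x:\<Omega>|lborel. h x * \<xi> x)"
      using g h \<xi> by (simp add: weak_derivs_def regular_distribution_def)
    then show "(LINT x:\<Omega>|lborel. (g x + (-1) * h x) * \<xi> x) = 0"
      using set_integrable_mult_test[OF l(1) \<xi>] set_integrable_mult_test[OF l(2) \<xi>]
        set_integrable_mult_test(2)[OF l' \<xi>] by (simp add: left_diff_distrib)
  qed
  then show ?thesis by (auto elim: AE_mp)
qed

lemma weak_derivs_add:
  assumes f: "locally_integrable \<Omega> f" "locally_integrable \<Omega> f'"
    and g: "g \<in> weak_derivs \<Omega> \<nu> f" "g' \<in> weak_derivs \<Omega> \<nu> f'"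
  shows "(\<lambda>x. g x + g' x) \<in> weak_derivs \<Omega> \<nu> (\<lambda>x. f x + f' x)"
  unfolding weak_derivs_iff[OF locally_integrable_add[OF f]]
proof (intro conjI ballI)
  show "locally_integrable \<Omega> (\<lambda>x. g x + g' x)" by (intro locally_integrable_add weak_derivsD[OF g(1)] weak_derivsD[OF g(2)])
  fix \<xi> assume \<xi>: "\<xi> \<in> test_functions \<Omega>"
  note * = set_integrable_mult_test(1)[OF f(1) test_functions_pderiv_mi[OF \<xi>]]
    set_integrable_mult_test(1)[OF f(2) test_functions_pderiv_mi[OF \<xi>]]
    set_integrable_mult_test(1)[OF weak_derivsD[OF g(1)] \<xi>]
    set_integrable_mult_test(1)[OF weak_derivsD[OF g(2)] \<xi>]
  show "(\<integral>x. (f x + f' x) * pderiv_mi \<nu> \<xi> x \<partial>lborel) = (-1) ^ mi_order \<nu> * (\<integral>x. (g x + g' x) * \<xi> x \<partial>lborel)"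
    using g \<xi> * by (simp add: weak_derivs_iff f distrib_right distrib_left)
qed

text \<open>Classical derivatives are weak derivatives, by iterated integration by parts.\<close>

lemma weak_derivs_smooth:
  assumes "smooth_on UNIV f"
  shows "pderiv_mi \<nu> f \<in> weak_derivs \<Omega> \<nu> f"
proof -
  have l: "locally_integrable \<Omega> f" if "smooth_on UNIV f" for f
    using smooth_on_imp_continuous_on[OF that] by (intro locally_integrable_continuous) (auto intro: continuous_on_subset)
  have "(\<integral>x. f x * pderiv_mi \<nu> \<xi> x \<partial>lborel) = (-1) ^ mi_order \<nu> * (\<integral>x. pderiv_mi \<nu> f x * \<xi> x \<partial>lborel)"
    if "\<xi> \<in> test_functions \<Omega>" for \<xi> using that
  proof (induction \<nu> arbitrary: \<xi> rule: mi_induct)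
    case (inc \<nu> j)
    note \<xi> = test_functionsD(1)[OF inc.prems]
    have "(\<integral>x. f x * pderiv_mi (mi_inc \<nu> j) \<xi> x \<partial>lborel) =
        (-1) ^ mi_order \<nu> * (\<integral>x. pderiv_mi \<nu> f x * pderiv1 j \<xi> x \<partial>lborel)"
      using inc.IH[OF test_functions_pderiv1[OF inc.prems]] by (simp add: pderiv_mi_inc(2)[OF \<xi>])
    also have "\<dots> = - ((-1) ^ mi_order \<nu>) * (\<integral>x. pderiv_mi (mi_inc \<nu> j) f x * \<xi> x \<partial>lborel)"
      using integral_by_parts[OF smooth_on_pderiv_mi[OF assms] inc.prems, of \<nu> j]
      by (simp add: pderiv_mi_inc(1)[OF assms])
    finally show ?case by (simp add: mi_order_inc)
  qed simp
  then show ?thesis by (auto simp: weak_derivs_iff l assms smooth_on_pderiv_mi)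
qed


section \<open>Powers, roots and the singular kernels\<close>

lemma ennreal_root_mono:
  assumes "0 < p" "a \<le> b" shows "ennreal_root p a \<le> ennreal_root p b"
proof (cases "b = \<infinity>")
  case False
  then have "a \<noteq> \<infinity>" using assms by (auto simp: top_unique)
  then show ?thesis
    using assms False by (auto simp: ennreal_root_def intro!: ennreal_leI powr_mono2 enn2real_mono simp: less_top)
qed (simp add: ennreal_root_def)

lemma ennreal_root_cmult:
  assumes "0 < p" "0 < c"
  shows "ennreal_root p (ennreal c * a) = ennreal (c powr (1 / p)) * ennreal_root p a"
proof (cases "a = \<infinity>")
  case True
  then show ?thesis using assms by (simp add: ennreal_root_def ennreal_mult_top)
next
  case False
  then have "ennreal c * a \<noteq> \<infinity>" by (simp add: ennreal_mult_eq_top_iff)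
  then show ?thesis using assms False by (simp add: ennreal_root_def enn2real_mult powr_mult ennreal_mult)
qed

lemma ex_max_value:
  fixes J :: "'i \<Rightarrow> 'b::linorder"
  assumes "finite S" "S \<noteq> {}"
  obtains i where "i \<in> S" "\<And>j. j \<in> S \<Longrightarrow> J j \<le> J i"
proof -
  have "Max (J ` S) \<in> J ` S" using assms by (intro Max_in) auto
  then obtain i where i: "i \<in> S" "Max (J ` S) = J i" by blast
  have "J j \<le> J i" if "j \<in> S" for j unfolding i(2)[symmetric] using assms that by (intro Max_ge) auto
  then show ?thesis using that i by blast
qed

text \<open>A crude form of Minkowski's inequality: the sum is at most the number of terms times the largest one. The
  increments by \<open>1\<close> keep the constant positive if \<open>c = 0\<close> or \<open>S\<close> is empty.\<close>

lemma ennreal_root_sum_le: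
  assumes p: "0 < p" and S: "finite S" and c: "0 \<le> c" and le: "I \<le> ennreal c * (\<Sum>i\<in>S. J i)"
  shows "ennreal_root p I \<le> ennreal (((c + 1) * (card S + 1)) powr (1 / p)) * (\<Sum>i\<in>S. ennreal_root p (J i))"
proof (cases "S = {}")
  case True
  then show ?thesis using le by (simp add: ennreal_root_def)
next
  case False
  let ?c = "(c + 1) * (card S + 1)"
  obtain i where i: "i \<in> S" "\<And>j. j \<in> S \<Longrightarrow> J j \<le> J i" by (rule ex_max_value[OF S False, of J]) (rule that)
  have "I \<le> ennreal c * (of_nat (card S) * J i)"
    using le sum_bounded_above[of S J "J i"] i by (meson mult_left_mono order_trans zero_le)
  also have "\<dots> = ennreal (c * card S) * J i"
    using c by (simp add: ennreal_mult ennreal_of_nat_eq_real_of_nat mult.assoc)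
  also have "\<dots> \<le> ennreal ?c * J i" using c by (intro mult_right_mono ennreal_leI mult_mono) auto
  finally have "ennreal_root p I \<le> ennreal_root p (ennreal ?c * J i)" using p by (intro ennreal_root_mono)
  also have "\<dots> = ennreal (?c powr (1 / p)) * ennreal_root p (J i)"
    using c by (intro ennreal_root_cmult p mult_pos_pos) auto
  also have "\<dots> \<le> ennreal (?c powr (1 / p)) * (\<Sum>i\<in>S. ennreal_root p (J i))"
    using i S by (intro mult_left_mono member_le_sum) auto
  finally show ?thesis .
qed

lemma ennreal_root_add_sum_le:
  fixes B :: "'n::finite \<Rightarrow> ennreal"
  assumes "0 < p" "0 \<le> c" "I \<le> ennreal c * (A + (\<Sum>j\<in>UNIV. B j))"
  shows "ennreal_root p I \<le> ennreal (((c + 1) * (card (UNIV :: 'n option set) + 1)) powr (1 / p)) *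
    (ennreal_root p A + (\<Sum>j\<in>UNIV. ennreal_root p (B j)))"
proof -
  have "(\<Sum>z\<in>(UNIV :: 'n option set). h z) = h None + (\<Sum>j\<in>UNIV. h (Some j))" for h :: "'n option \<Rightarrow> ennreal"
    by (simp add: UNIV_option_conv sum.reindex)
  then show ?thesis
    using ennreal_root_sum_le[OF assms(1) finite_class.finite_UNIV assms(2), of I "case_option A B"] assms(3) by simp
qed

lemma abs_sum_powr_le:
  fixes a :: "'i \<Rightarrow> real"
  assumes p: "1 < p" and S: "finite S"
  shows "\<bar>\<Sum>i\<in>S. a i\<bar> powr p \<le> real (card S) powr p * (\<Sum>i\<in>S. \<bar>a i\<bar> powr p)"
proof (cases "S = {}")
  case False
  obtain i where i: "i \<in> S" "\<And>j. j \<in> S \<Longrightarrow> \<bar>a j\<bar> \<le> \<bar>a i\<bar>" by (rule ex_max_value[OF S False, of "\<lambda>j. \<bar>a j\<bar>"]) (rule that)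
  have "\<bar>\<Sum>i\<in>S. a i\<bar> \<le> (\<Sum>i\<in>S. \<bar>a i\<bar>)" by (rule sum_abs)
  also have "\<dots> \<le> real (card S) * \<bar>a i\<bar>" using i by (intro sum_bounded_above) auto
  finally have "\<bar>\<Sum>i\<in>S. a i\<bar> powr p \<le> (real (card S) * \<bar>a i\<bar>) powr p" using p by (intro powr_mono2) auto
  also have "\<dots> = real (card S) powr p * \<bar>a i\<bar> powr p" by (simp add: powr_mult)
  also have "\<dots> \<le> real (card S) powr p * (\<Sum>i\<in>S. \<bar>a i\<bar> powr p)" using i S by (intro mult_left_mono member_le_sum) auto
  finally show ?thesis .
qed (use p in simp)

lemma abs_add_powr_le:
  fixes a b :: real
  assumes "1 < p"
  shows "\<bar>a + b\<bar> powr p \<le> 2 powr p * (\<bar>a\<bar> powr p + \<bar>b\<bar> powr p)"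
  using abs_sum_powr_le[OF assms, of UNIV "\<lambda>c. if c then a else b"] by (simp add: UNIV_bool add.commute)

lemma abs_diff_powr_le:
  fixes a b :: real
  assumes "1 < p"
  shows "\<bar>a - b\<bar> powr p \<le> 2 powr p * (\<bar>a\<bar> powr p + \<bar>b\<bar> powr p)"
  using abs_add_powr_le[OF assms, of a "- b"] by simp

text \<open>Both kernels below are compared with step functions on dyadic balls; the contributions of the balls form
  a geometric series.\<close>

lemma nn_integral_dyadic_finite:
  fixes f :: "real^'n::finite \<Rightarrow> ennreal"
  assumes r: "\<And>k. 0 \<le> r k" and a: "\<And>k. 0 \<le> a k" and \<rho>: "0 \<le> \<rho>" "\<rho> < 1" and M: "0 \<le> M"
    and le: "\<And>k. a k * r k ^ CARD('n) \<le> M * \<rho> ^ k"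
    and f: "\<And>z. f z \<noteq> 0 \<Longrightarrow> \<exists>k. z \<in> ball 0 (r k) \<and> f z \<le> ennreal (a k)"
  shows "(\<integral>\<^sup>+z. f z \<partial>lborel) < \<infinity>"
proof -
  let ?V = "unit_ball_vol (real CARD('n))"
  have "(\<integral>\<^sup>+z. f z \<partial>lborel) \<le> (\<integral>\<^sup>+z. (\<Sum>k. ennreal (a k) * indicator (ball (0::real^'n) (r k)) z) \<partial>lborel)"
  proof (rule nn_integral_mono)
    fix z :: "real^'n"
    show "f z \<le> (\<Sum>k. ennreal (a k) * indicator (ball 0 (r k)) z)"
    proof (cases "f z = 0")
      case False
      then obtain k where k: "z \<in> ball 0 (r k)" "f z \<le> ennreal (a k)" using f by blast
      define g where "g k = ennreal (a k) * indicator (ball 0 (r k)) z" for k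
      have "f z \<le> g k" using k by (simp add: g_def)
      also have "g k \<le> suminf g" using sum_le_suminf[of g "{k}"] by simp
      finally show ?thesis by (simp add: g_def[abs_def])
    qed simp
  qed
  also have "\<dots> = (\<Sum>k. \<integral>\<^sup>+z. ennreal (a k) * indicator (ball (0::real^'n) (r k)) z \<partial>lborel)"
    by (rule nn_integral_suminf) (auto intro!: borel_measurable_times_ennreal borel_measurable_indicator)
  also have "\<dots> = (\<Sum>k. ennreal (a k * (?V * r k ^ CARD('n))))"
    using r a by (simp add: nn_integral_cmult_indicator emeasure_ball ennreal_mult[symmetric])
  also have "\<dots> \<le> (\<Sum>k. ennreal (?V * M * \<rho> ^ k))" using le unit_ball_vol_nonneg[of "real CARD('n)"]
    by (intro suminf_le ennreal_leI) (auto simp: mult.left_commute[of _ ?V] mult.assoc intro!: mult_left_mono)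
  also have "\<dots> = ennreal (\<Sum>k. ?V * M * \<rho> ^ k)" using \<rho> M unit_ball_vol_nonneg[of "real CARD('n)"]
    by (intro suminf_ennreal2) (auto intro!: summable_mult summable_geometric)
  also have "\<dots> < \<infinity>" by simp
  finally show ?thesis .
qed

lemma dyadic_powr:
  assumes "0 < \<delta>" "0 < (c::real)"
  shows "(\<delta> * c ^ k) powr s = \<delta> powr s * (c powr s) ^ k"
  using assms by (simp add: powr_mult powr_power powr_realpow[symmetric] powr_powr mult.commute)

lemma kernel_outside_ball_finite:
  fixes \<sigma> :: real
  assumes \<delta>: "0 < \<delta>" and \<sigma>: "0 < \<sigma>"
  shows "(\<integral>\<^sup>+z\<in>{z :: real^'n::finite. \<delta> \<le> norm z}. ennreal (norm z powr (- (CARD('n) + \<sigma>))) \<partial>lborel) < \<infinity>"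
proof (rule nn_integral_dyadic_finite[where r = "\<lambda>k. \<delta> * 2 ^ (k + 1)"
      and a = "\<lambda>k. (\<delta> * 2 ^ k) powr (- (CARD('n) + \<sigma>))" and \<rho> = "2 powr (- \<sigma>)"
      and M = "2 ^ CARD('n) * \<delta> powr (- \<sigma>)"])
  show "(\<delta> * 2 ^ k) powr (- (CARD('n) + \<sigma>)) * (\<delta> * 2 ^ (k + 1)) ^ CARD('n)
      \<le> 2 ^ CARD('n) * \<delta> powr (- \<sigma>) * (2 powr (- \<sigma>)) ^ k" for k
  proof -
    have r: "0 < \<delta> * 2 ^ k" using \<delta> by simp
    have "(\<delta> * 2 ^ k) powr (- (CARD('n) + \<sigma>)) * (\<delta> * 2 ^ k) ^ CARD('n) = (\<delta> * 2 ^ k) powr (- \<sigma>)"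
      using r by (simp add: powr_realpow[OF r, symmetric] powr_add[symmetric])
    also have "\<dots> = \<delta> powr (- \<sigma>) * (2 powr (- \<sigma>)) ^ k" using \<delta> by (rule dyadic_powr) simp
    finally show ?thesis by (simp add: power_mult_distrib mult_ac)
  qed
  show "2 powr (- \<sigma>) < 1" using \<sigma> by (simp add: powr_less_one)
  fix z :: "real^'n"
  assume "ennreal (norm z powr (- (CARD('n) + \<sigma>))) * indicator {z. \<delta> \<le> norm z} z \<noteq> 0"
  then have z: "\<delta> \<le> norm z" by (auto simp: indicator_def split: if_splits)
  obtain m where "norm z / \<delta> < 2 ^ m" using real_arch_pow[of 2 "norm z / \<delta>"] by auto
  then have "norm z < \<delta> * 2 ^ m" using \<delta> by (simp add: field_simps)
  also have "\<dots> \<le> \<delta> * 2 ^ (m + 1)" using \<delta> by simp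
  finally have "\<exists>k. norm z < \<delta> * 2 ^ (k + 1)" by blast
  \<comment> \<open>the dyadic shell that contains \<open>z\<close>\<close>
  then obtain k where k: "norm z < \<delta> * 2 ^ (k + 1)" "\<And>l. l < k \<Longrightarrow> \<not> norm z < \<delta> * 2 ^ (l + 1)"
    using exists_least_iff[of "\<lambda>k. norm z < \<delta> * 2 ^ (k + 1)"] by blast
  have "\<delta> * 2 ^ k \<le> norm z"
  proof (cases k)
    case (Suc l)
    then show ?thesis using k(2)[of l] by simp
  qed (use z in simp)
  then have "norm z powr (- (CARD('n) + \<sigma>)) \<le> (\<delta> * 2 ^ k) powr (- (CARD('n) + \<sigma>))"
    using \<delta> \<sigma> by (intro powr_mono2') auto
  then show "\<exists>k. z \<in> ball 0 (\<delta> * 2 ^ (k + 1)) \<and>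
      ennreal (norm z powr (- (CARD('n) + \<sigma>))) * indicator {z. \<delta> \<le> norm z} z
      \<le> ennreal ((\<delta> * 2 ^ k) powr (- (CARD('n) + \<sigma>)))" using k(1) z by (intro exI[of _ k]) (auto intro!: ennreal_leI)
qed (use \<delta> in auto)

lemma kernel_ball_finite:
  fixes \<sigma> :: real
  assumes \<delta>: "0 < \<delta>" and \<sigma>: "0 < \<sigma>"
  shows "(\<integral>\<^sup>+z\<in>ball (0 :: real^'n::finite) \<delta>. ennreal (norm z powr (\<sigma> - CARD('n))) \<partial>lborel) < \<infinity>"
proof (rule nn_integral_dyadic_finite[where r = "\<lambda>k. \<delta> * (1/2) ^ k"
      and a = "\<lambda>k. (\<delta> * (1/2) ^ k) powr \<sigma> * (\<delta> * (1/2) ^ (k + 1)) powr (- CARD('n))" and \<rho> = "(1/2) powr \<sigma>"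
      and M = "2 ^ CARD('n) * \<delta> powr \<sigma>"])
  show "(\<delta> * (1/2) ^ k) powr \<sigma> * (\<delta> * (1/2) ^ (k + 1)) powr (- CARD('n)) * (\<delta> * (1/2) ^ k) ^ CARD('n)
      \<le> 2 ^ CARD('n) * \<delta> powr \<sigma> * ((1/2) powr \<sigma>) ^ k" for k
  proof -
    define r where "r = \<delta> * (1/2) ^ (k + 1)"
    have r: "0 < r" using \<delta> by (simp add: r_def)
    have "\<delta> * (1/2) ^ k = 2 * r" by (simp add: r_def)
    then have "r powr (- CARD('n)) * (\<delta> * (1/2) ^ k) ^ CARD('n) = 2 ^ CARD('n)"
      using r by (simp add: power_mult_distrib powr_minus powr_realpow)
    then have "(\<delta> * (1/2) ^ k) powr \<sigma> * r powr (- CARD('n)) * (\<delta> * (1/2) ^ k) ^ CARD('n)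
        = 2 ^ CARD('n) * (\<delta> * (1/2) ^ k) powr \<sigma>" by (simp add: mult_ac)
    then show ?thesis using dyadic_powr[of \<delta> "1/2" k \<sigma>] \<delta> by (simp add: r_def mult_ac)
  qed
  show "(1/2::real) powr \<sigma> < 1" using \<sigma> powr_less_mono2[of \<sigma> "1/2" 1] by simp
  fix z :: "real^'n"
  assume "ennreal (norm z powr (\<sigma> - CARD('n))) * indicator (ball 0 \<delta>) z \<noteq> 0"
  then have z: "norm z < \<delta>" "norm z > 0" by (auto simp: indicator_def split: if_splits)
  obtain m where m: "(1/2) ^ m < norm z / \<delta>" using real_arch_pow_inv[of "norm z / \<delta>" "1/2"] z \<delta> by auto
  have "\<delta> * (1/2) ^ (m + 1) \<le> \<delta> * (1/2) ^ m" using \<delta> by simp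
  also have "\<dots> \<le> norm z" using m \<delta> by (simp add: field_simps)
  finally have "\<exists>k. \<delta> * (1/2) ^ (k + 1) \<le> norm z" by blast
  then obtain k where k: "\<delta> * (1/2) ^ (k + 1) \<le> norm z" "\<And>l. l < k \<Longrightarrow> \<not> \<delta> * (1/2) ^ (l + 1) \<le> norm z"
    using exists_least_iff[of "\<lambda>k. \<delta> * (1/2) ^ (k + 1) \<le> norm z"] by blast
  have k': "norm z < \<delta> * (1/2) ^ k"
  proof (cases k)
    case (Suc l)
    then show ?thesis using k(2)[of l] by simp
  qed (use z in simp)
  have "norm z powr (\<sigma> - CARD('n)) = norm z powr \<sigma> * norm z powr (- CARD('n))" by (simp add: powr_add[symmetric])
  also have "\<dots> \<le> (\<delta> * (1/2) ^ k) powr \<sigma> * (\<delta> * (1/2) ^ (k + 1)) powr (- CARD('n))"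
    using k k' \<sigma> \<delta> by (intro mult_mono powr_mono2 powr_mono2') auto
  finally show "\<exists>k. z \<in> ball 0 (\<delta> * (1/2) ^ k) \<and>
      ennreal (norm z powr (\<sigma> - CARD('n))) * indicator (ball 0 \<delta>) z
      \<le> ennreal ((\<delta> * (1/2) ^ k) powr \<sigma> * (\<delta> * (1/2) ^ (k + 1)) powr (- CARD('n)))"
    using k' z by (intro exI[of _ k]) (auto intro!: ennreal_leI)
qed (use \<delta> in auto)

text \<open>With \<open>M = \<integral>\<bar>X\<bar>\<close> and the conjugate exponent \<open>p'\<close>, Young's inequality bounds \<open>\<bar>X\<bar> M\<^sup>p\<^sup>-\<^sup>1\<close> by
  \<open>\<bar>X\<bar>\<^sup>p / p + M\<^sup>p / p'\<close>. Integration over the unit interval, of length \<open>1\<close>, gives \<open>M\<^sup>p \<le> \<integral>\<bar>X\<bar>\<^sup>p\<close>.\<close>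

lemma jensen_unit_interval:
  fixes X :: "real \<Rightarrow> real"
  assumes p: "1 < p" and X: "integrable lborel (\<lambda>t. indicator {0..1} t * X t)"
  shows "ennreal (\<bar>\<integral>t. indicator {0..1} t * X t \<partial>lborel\<bar> powr p) \<le> (\<integral>\<^sup>+t\<in>{0..1}. ennreal (\<bar>X t\<bar> powr p) \<partial>lborel)"
proof (cases "(\<integral>\<^sup>+t\<in>{0..1}. ennreal (\<bar>X t\<bar> powr p) \<partial>lborel) < \<infinity>")
  case True
  let ?i = "\<lambda>t::real. indicator {0..1} t :: real"
  have eq: "?i t * \<bar>X t\<bar> powr p = \<bar>?i t * X t\<bar> powr p" for t using p by (simp add: indicator_def)
  have [measurable]: "(\<lambda>t. ?i t * X t) \<in> borel_measurable borel" using borel_measurable_integrable[OF X] by simp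
  have m: "(\<lambda>t. ?i t * \<bar>X t\<bar> powr p) \<in> borel_measurable lborel" unfolding eq by measurable
  have nn: "(\<integral>\<^sup>+t\<in>{0..1}. ennreal (\<bar>X t\<bar> powr p) \<partial>lborel) = (\<integral>\<^sup>+t. ennreal (?i t * \<bar>X t\<bar> powr p) \<partial>lborel)"
    by (intro nn_integral_cong) (simp add: indicator_def)
  have Y: "integrable lborel (\<lambda>t. ?i t * \<bar>X t\<bar> powr p)" using True m nn by (intro integrableI_nonneg) auto
  define M where "M = (\<integral>t. ?i t * \<bar>X t\<bar> \<partial>lborel)"
  have Xa: "integrable lborel (\<lambda>t. ?i t * \<bar>X t\<bar>)" using integrable_abs[OF X] by (simp add: abs_mult)
  have M0: "0 \<le> M" unfolding M_def by (intro integral_nonneg_AE) auto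
  define p' where "p' = p / (p - 1)"
  have p': "1 < p'" "1 / p + 1 / p' = 1" using p by (auto simp: p'_def field_simps)
  have i1: "integrable lborel ?i" "(\<integral>t. ?i t \<partial>lborel) = 1" by (auto intro!: integrable_real_indicator)
  have I: "(\<integral>t. ?i t * (M powr p / p') \<partial>lborel) = M powr p / p'" "integrable lborel (\<lambda>t. ?i t * (M powr p / p'))"
    using i1 by (simp, intro integrable_mult_left)
  have "M powr p = (\<integral>t. (?i t * \<bar>X t\<bar>) * M powr (p - 1) \<partial>lborel)"
    using M0 p by (cases "M = 0") (simp_all add: M_def[symmetric] powr_diff)
  also have "\<dots> \<le> (\<integral>t. (?i t * \<bar>X t\<bar> powr p) / p + ?i t * (M powr p / p') \<partial>lborel)"
  proof (rule integral_mono)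
    show "integrable lborel (\<lambda>t. (?i t * \<bar>X t\<bar> powr p) / p + ?i t * (M powr p / p'))"
      by (rule Bochner_Integration.integrable_add[OF integrable_divide[OF Y] I(2)])
    fix t
    have "\<bar>X t\<bar> * M powr (p - 1) \<le> \<bar>X t\<bar> powr p / p + (M powr (p - 1)) powr p' / p'"
      by (rule Youngs_inequality[OF p p'(1,2)]) auto
    also have "(M powr (p - 1)) powr p' = M powr p" using p by (simp add: powr_powr p'_def)
    finally show "(?i t * \<bar>X t\<bar>) * M powr (p - 1) \<le> (?i t * \<bar>X t\<bar> powr p) / p + ?i t * (M powr p / p')"
      by (simp add: indicator_def)
  qed (use Xa in simp)
  also have "\<dots> = (\<integral>t. ?i t * \<bar>X t\<bar> powr p \<partial>lborel) / p + M powr p / p'" using Y I by simp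
  finally have "M powr p * (1 - 1 / p') \<le> (\<integral>t. ?i t * \<bar>X t\<bar> powr p \<partial>lborel) / p" by (simp add: algebra_simps)
  then have "M powr p \<le> (\<integral>t. ?i t * \<bar>X t\<bar> powr p \<partial>lborel)"
  proof -
    have "1 - 1 / p' = 1 / p" using p'(2) by simp
    then have "M powr p / p \<le> (\<integral>t. ?i t * \<bar>X t\<bar> powr p \<partial>lborel) / p" using \<open>M powr p * (1 - 1 / p') \<le> _\<close> by simp
    then show ?thesis using p by (simp add: divide_le_cancel)
  qed
  moreover have "\<bar>\<integral>t. ?i t * X t \<partial>lborel\<bar> \<le> M"
    using integral_abs_bound[of lborel "\<lambda>t. ?i t * X t"] by (simp add: M_def abs_mult)
  then have "\<bar>\<integral>t. ?i t * X t \<partial>lborel\<bar> powr p \<le> M powr p" using p by (intro powr_mono2) auto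
  ultimately have "ennreal (\<bar>\<integral>t. ?i t * X t \<partial>lborel\<bar> powr p) \<le> ennreal (\<integral>t. ?i t * \<bar>X t\<bar> powr p \<partial>lborel)"
    by (intro ennreal_leI) linarith
  also have "\<dots> = (\<integral>\<^sup>+t. ennreal (?i t * \<bar>X t\<bar> powr p) \<partial>lborel)"
    using Y by (intro nn_integral_eq_integral[symmetric]) auto
  finally show ?thesis using nn by simp
next
  case False
  then show ?thesis by (simp add: top.not_eq_extremum[symmetric] not_less top_unique)
qed

text \<open>Bounds by a common multiple, kept as \<open>ennreal c * S\<close> with a real constant \<open>c\<close>.\<close>

lemma ennreal_bound_add:
  assumes "0 \<le> c" "0 \<le> d" "x \<le> ennreal c * S" "y \<le> ennreal d * S"
  shows "x + y \<le> ennreal (c + d) * S"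
  using add_mono[OF assms(3,4)] assms(1,2) by (simp add: ennreal_plus distrib_right)

lemma ennreal_bound_cmult:
  assumes "0 \<le> k" "0 \<le> c" "x \<le> ennreal c * S"
  shows "ennreal k * x \<le> ennreal (k * c) * S"
  using mult_left_mono[OF assms(3), of "ennreal k"] assms(1,2) by (simp add: ennreal_mult mult.assoc)

lemma ennreal_bound_sum:
  assumes "\<And>j. j \<in> J \<Longrightarrow> 0 \<le> c j" "\<And>j. j \<in> J \<Longrightarrow> x j \<le> ennreal (c j) * S"
  shows "(\<Sum>j\<in>J. x j) \<le> ennreal (\<Sum>j\<in>J. c j) * S"
proof -
  have "(\<Sum>j\<in>J. x j) \<le> (\<Sum>j\<in>J. ennreal (c j) * S)" using assms(2) by (rule sum_mono)
  also have "\<dots> = ennreal (\<Sum>j\<in>J. c j) * S" using assms(1) by (simp add: sum_distrib_right[symmetric] sum_ennreal)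
  finally show ?thesis .
qed

text \<open>The \<open>p\<close>-th powers of the \<open>L\<^sup>p\<close> norm and of the Slobodeckij seminorm, as integrals.\<close>

abbreviation Lp_int :: "real \<Rightarrow> (real^'n::finite) set \<Rightarrow> (real^'n \<Rightarrow> real) \<Rightarrow> ennreal"
  where "Lp_int p \<Omega> f \<equiv> \<integral>\<^sup>+x\<in>\<Omega>. ennreal (\<bar>f x\<bar> powr p) \<partial>lborel"

abbreviation slob_int :: "real \<Rightarrow> real \<Rightarrow> (real^'n::finite) set \<Rightarrow> (real^'n \<Rightarrow> real) \<Rightarrow> ennreal"
  where "slob_int \<theta> p \<Omega> g \<equiv> \<integral>\<^sup>+x\<in>\<Omega>. (\<integral>\<^sup>+y\<in>\<Omega>.
      ennreal (\<bar>g x - g y\<bar> powr p / norm (x - y) powr (real CARD('n) + \<theta> * p)) \<partial>lborel) \<partial>lborel"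

lemma Lp_int_sum_le:
  fixes f :: "'i \<Rightarrow> real^'n::finite \<Rightarrow> real"
  assumes p: "1 < p" and S: "finite S" and m: "\<And>i. i \<in> S \<Longrightarrow> borel_on \<Omega> (f i)"
  shows "Lp_int p \<Omega> (\<lambda>x. \<Sum>i\<in>S. f i x) \<le> ennreal (real (card S) powr p) * (\<Sum>i\<in>S. Lp_int p \<Omega> (f i))"
proof -
  have eq: "ennreal (\<bar>f i x\<bar> powr p) * indicator \<Omega> x = ennreal (\<bar>indicator \<Omega> x * f i x\<bar> powr p)" for i x
    using p by (simp add: indicator_def)
  have me: "(\<lambda>x. ennreal (\<bar>indicator \<Omega> x * f i x\<bar> powr p)) \<in> borel_measurable lborel" if "i \<in> S" for i
    using m[OF that] by measurable
  have "Lp_int p \<Omega> (\<lambda>x. \<Sum>i\<in>S. f i x) \<le>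
      (\<integral>\<^sup>+x. ennreal (real (card S) powr p) * (\<Sum>i\<in>S. ennreal (\<bar>f i x\<bar> powr p) * indicator \<Omega> x) \<partial>lborel)"
  proof (rule nn_integral_mono)
    fix x
    have "ennreal (\<bar>\<Sum>i\<in>S. f i x\<bar> powr p) \<le> ennreal (real (card S) powr p * (\<Sum>i\<in>S. \<bar>f i x\<bar> powr p))"
      by (intro ennreal_leI abs_sum_powr_le p S)
    also have "\<dots> = ennreal (real (card S) powr p) * (\<Sum>i\<in>S. ennreal (\<bar>f i x\<bar> powr p))"
      by (simp add: ennreal_mult sum_nonneg)
    finally show "ennreal (\<bar>\<Sum>i\<in>S. f i x\<bar> powr p) * indicator \<Omega> x \<le>
        ennreal (real (card S) powr p) * (\<Sum>i\<in>S. ennreal (\<bar>f i x\<bar> powr p) * indicator \<Omega> x)"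
      by (simp add: indicator_def)
  qed
  also have "\<dots> = ennreal (real (card S) powr p) * (\<integral>\<^sup>+x. (\<Sum>i\<in>S. ennreal (\<bar>f i x\<bar> powr p) * indicator \<Omega> x) \<partial>lborel)"
    unfolding eq by (intro nn_integral_cmult borel_measurable_sum me)
  also have "(\<integral>\<^sup>+x. (\<Sum>i\<in>S. ennreal (\<bar>f i x\<bar> powr p) * indicator \<Omega> x) \<partial>lborel) = (\<Sum>i\<in>S. Lp_int p \<Omega> (f i))"
    unfolding eq by (intro nn_integral_sum me)
  finally show ?thesis .
qed


section \<open>Slobodeckij seminorms of functions with integrable weak derivatives\<close>

lemma frechet_derivative_vec_sum:
  fixes \<xi> :: "real^'n::finite \<Rightarrow> real"
  assumes "smooth_on UNIV \<xi>"
  shows "fderiv \<xi> x h = (\<Sum>j\<in>UNIV. h $ j * pderiv1 j \<xi> x)"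
proof -
  have lin: "linear (fderiv \<xi> x)" using smooth_on_differentiable(2)[OF assms] by (auto intro: has_derivative_linear)
  have h: "h = (\<Sum>j\<in>UNIV. h $ j *\<^sub>R axis j 1)" by (auto simp: vec_eq_iff axis_def if_distrib cong: if_cong)
  show ?thesis by (subst h) (simp only: linear_sum[OF lin] linear_scale[OF lin] real_scaleR_def)
qed

lemma test_functions_sum:
  assumes "\<And>i. i \<in> I \<Longrightarrow> f i \<in> test_functions \<Omega>"
  shows "(\<lambda>x. \<Sum>i\<in>I. f i x) \<in> test_functions \<Omega>"
proof -
  have "(\<lambda>_. 0) \<in> test_functions \<Omega>" by (simp add: test_functions_iff)
  then show ?thesis using assms by (induction I rule: infinite_finite_induct) (simp_all add: test_functions_add)
qed

lemma test_functions_directional: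
  assumes "\<xi> \<in> test_functions \<Omega>"
  shows "(\<lambda>x. fderiv \<xi> x h) \<in> test_functions \<Omega>"
  by (subst frechet_derivative_vec_sum[OF test_functionsD(1)[OF assms]])
    (intro test_functions_sum test_functions_cmult test_functions_pderiv1 assms)

lemma test_functions_shift:
  assumes "\<xi> \<in> test_functions UNIV"
  shows "(\<lambda>x. \<xi> (c + x)) \<in> test_functions UNIV"
    and "fderiv (\<lambda>x. \<xi> (c + x)) x = fderiv \<xi> (c + x)"
proof -
  have "smooth_on UNIV (\<lambda>x. \<xi> (c + x))"
    by (rule smooth_on_compose[OF smooth_on_add[OF open_UNIV smooth_on_const smooth_on_ident[OF open_UNIV]]
          test_functionsD(1)[OF assms]]) auto
  moreover have "compact ((+) (- c) ` supp \<xi>)" using test_functionsD(2)[OF assms] by (rule compact_translation)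
  moreover have "x \<in> (+) (- c) ` supp \<xi>" if "\<xi> (c + x) \<noteq> 0" for x
    using that closure_subset[of "{x. \<xi> x \<noteq> 0}"] by (intro image_eqI[of _ _ "c + x"]) auto
  ultimately show "(\<lambda>x. \<xi> (c + x)) \<in> test_functions UNIV" by (intro test_functionsI) auto
  have "((\<lambda>x. \<xi> (c + x)) has_derivative fderiv \<xi> (c + x)) (at x)"
    by (rule has_derivative_compose[OF _ test_function_has_derivative[OF assms]])
      (auto intro!: derivative_eq_intros)
  then show "fderiv (\<lambda>x. \<xi> (c + x)) x = fderiv \<xi> (c + x)" by (rule frechet_derivative_at[symmetric])
qed

lemma nn_integral_shift:
  fixes F :: "real^'n::finite \<Rightarrow> ennreal"
  assumes [measurable]: "F \<in> borel_measurable borel"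
  shows "(\<integral>\<^sup>+x. F (c + x) \<partial>lborel) = (\<integral>\<^sup>+x. F x \<partial>lborel)"
  by (subst (2) lborel_distr_plus[of c, symmetric], subst nn_integral_distr) simp_all

text \<open>By translation invariance the integral of the modulus over \<open>x\<close> is the same for all \<open>t\<close> in the unit interval.\<close>

lemma integrable_unit_interval_product:
  fixes g :: "real^'n::finite \<Rightarrow> real"
  assumes g: "integrable lborel g"
  shows "integrable (lborel \<Otimes>\<^sub>M lborel) (\<lambda>(t, x). indicator {0..1::real} t * g (t *\<^sub>R h + x))"
proof (rule lborel_pair.Fubini_integrable)
  have [measurable]: "g \<in> borel_measurable borel" using borel_measurable_integrable[OF g] by simp
  show "(\<lambda>(t, x). indicator {0..1::real} t * g (t *\<^sub>R h + x)) \<in> borel_measurable (lborel \<Otimes>\<^sub>M lborel)" by measurable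
  have eq: "(\<integral>x. norm (indicator {0..1::real} t * g (t *\<^sub>R h + x)) \<partial>lborel) = indicator {0..1} t * (\<integral>x. \<bar>g x\<bar> \<partial>lborel)" for t
    using lborel_integral_shift[of "\<lambda>x. \<bar>g x\<bar>" "t *\<^sub>R h"] by (simp add: abs_mult)
  show "integrable lborel (\<lambda>t. \<integral>x. norm (case (t, x) of (t, x) \<Rightarrow> indicator {0..1::real} t * g (t *\<^sub>R h + x)) \<partial>lborel)"
    by (simp only: prod.case eq, intro integrable_mult_left integrable_real_indicator) auto
  show "AE t in lborel. integrable lborel (\<lambda>x. case (t, x) of (t, x) \<Rightarrow> indicator {0..1::real} t * g (t *\<^sub>R h + x))"
    using lborel_integrable_shift[OF g] by auto
qed

text \<open>Both sides have the same integral against every test function, because \<open>g\<close> is the weak derivative of \<open>G\<close> in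
  direction \<open>h\<close> and the fundamental theorem of calculus holds for the test function.\<close>

lemma difference_eq_integral_weak_derivative:
  fixes G g :: "real^'n::finite \<Rightarrow> real"
  assumes G: "integrable lborel G" and g: "integrable lborel g"
    and w: "\<And>\<xi>. \<xi> \<in> test_functions UNIV \<Longrightarrow>
      (\<integral>x. G x * fderiv \<xi> x h \<partial>lborel) = - (\<integral>x. g x * \<xi> x \<partial>lborel)"
  shows "AE x in lborel. integrable lborel (\<lambda>t. indicator {0..1} t * g (t *\<^sub>R h + x)) \<and>
    G (h + x) - G x = (\<integral>t. indicator {0..1} t * g (t *\<^sub>R h + x) \<partial>lborel)"
proof -
  note [measurable] = borel_measurable_integrable[OF g, simplified] borel_measurable_integrable[OF G, simplified]
  let ?i = "indicator {0..1::real} :: real \<Rightarrow> real"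
  let ?f = "\<lambda>t x. ?i t * g (t *\<^sub>R h + x)"
  have f: "integrable (lborel \<Otimes>\<^sub>M lborel) (\<lambda>(t, x). ?f t x)" by (rule integrable_unit_interval_product[OF g])
  let ?F = "\<lambda>x. \<integral>t. ?f t x \<partial>lborel"
  have iF: "integrable lborel ?F" by (rule lborel_pair.integrable_snd[OF f])
  let ?w = "\<lambda>x. G (h + x) - G x - ?F x"
  have iw: "integrable lborel ?w" by (intro Bochner_Integration.integrable_diff lborel_integrable_shift G iF)
  have "AE x in lborel. x \<in> UNIV \<longrightarrow> ?w x = 0"
  proof (rule fundamental_lemma[OF open_UNIV])
    show "locally_integrable UNIV ?w" by (rule integrable_imp_locally_integrable[OF iw])
    fix \<xi> :: "real^'n \<Rightarrow> real" assume \<xi>: "\<xi> \<in> test_functions UNIV"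
    note [measurable] = test_function_measurable[OF \<xi>]
    obtain B where B: "B > 0" "\<And>x. \<bar>\<xi> x\<bar> \<le> B" by (rule test_function_bounded[OF \<xi>]) (rule that)
    let ?d = "\<lambda>x. fderiv \<xi> x h"
    have d: "?d \<in> test_functions UNIV" by (rule test_functions_directional[OF \<xi>])
    note [measurable] = test_function_measurable[OF d]
    obtain B' where B': "B' > 0" "\<And>x. \<bar>?d x\<bar> \<le> B'" by (rule test_function_bounded[OF d]) (rule that)
    have bnd: "integrable lborel (\<lambda>x. u x * \<xi> (c + x))" if u: "integrable lborel u" for u c
    proof (rule Bochner_Integration.integrable_bound[of _ "\<lambda>x. B * u x"])
      show "(\<lambda>x. u x * \<xi> (c + x)) \<in> borel_measurable lborel" using borel_measurable_integrable[OF u] by measurable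
      show "AE x in lborel. norm (u x * \<xi> (c + x)) \<le> norm (B * u x)"
        using B by (auto simp: abs_mult mult.commute[of B] intro!: mult_left_mono)
    qed (use u in simp)
    have f1: "integrable (lborel \<Otimes>\<^sub>M lborel) (\<lambda>(t, x). ?f t x * \<xi> x)"
    proof (rule Bochner_Integration.integrable_bound[of _ "\<lambda>z. B * (case z of (t, x) \<Rightarrow> ?f t x)"])
      show "integrable (lborel \<Otimes>\<^sub>M lborel) (\<lambda>z. B * (case z of (t, x) \<Rightarrow> ?f t x))" using f by (intro integrable_mult_right)
      show "(\<lambda>(t, x). ?f t x * \<xi> x) \<in> borel_measurable (lborel \<Otimes>\<^sub>M lborel)" by measurable
      show "AE z in lborel \<Otimes>\<^sub>M lborel. norm (case z of (t, x) \<Rightarrow> ?f t x * \<xi> x) \<le> norm (B * (case z of (t, x) \<Rightarrow> ?f t x))"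
        using B by (intro AE_I2) (auto simp: abs_mult mult.commute[of B] split: prod.split intro!: mult_left_mono)
    qed
    have f2: "integrable (lborel \<Otimes>\<^sub>M lborel) (\<lambda>(t, x). ?i t * (G x * ?d (- t *\<^sub>R h + x)))"
    proof (rule Bochner_Integration.integrable_bound[of _ "\<lambda>z. B' * (case z of (t, x) \<Rightarrow> ?i t * G (t *\<^sub>R 0 + x))"])
      show "integrable (lborel \<Otimes>\<^sub>M lborel) (\<lambda>z. B' * (case z of (t, x) \<Rightarrow> ?i t * G (t *\<^sub>R 0 + x)))"
        by (intro integrable_mult_right integrable_unit_interval_product G)
      show "(\<lambda>(t, x). ?i t * (G x * ?d (- t *\<^sub>R h + x))) \<in> borel_measurable (lborel \<Otimes>\<^sub>M lborel)" by measurable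
      show "AE z in lborel \<Otimes>\<^sub>M lborel. norm (case z of (t, x) \<Rightarrow> ?i t * (G x * ?d (- t *\<^sub>R h + x))) \<le>
          norm (B' * (case z of (t, x) \<Rightarrow> ?i t * G (t *\<^sub>R 0 + x)))"
        using B' by (intro AE_I2) (auto simp: abs_mult mult.commute[of B'] indicator_def split: prod.split intro!: mult_left_mono)
    qed
    have ftc: "(\<integral>t. ?i t * ?d (- t *\<^sub>R h + x) \<partial>lborel) = \<xi> x - \<xi> (- h + x)" for x
    proof -
      have "(\<integral>t. ?i t *\<^sub>R (- ?d (- t *\<^sub>R h + x)) \<partial>lborel) = \<xi> (- 1 *\<^sub>R h + x) - \<xi> (- 0 *\<^sub>R h + x)"
      proof (rule integral_FTC_atLeastAtMost)
        fix t :: real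
        have "((\<lambda>t. \<xi> (- t *\<^sub>R h + x)) has_derivative (\<lambda>s. fderiv \<xi> (- t *\<^sub>R h + x) (- s *\<^sub>R h))) (at t within {0..1})"
          by (rule has_derivative_compose[OF _ test_function_has_derivative[OF \<xi>]])
            (auto intro!: derivative_eq_intros)
        moreover have "fderiv \<xi> y (- s *\<^sub>R h) = s *\<^sub>R (- ?d y)" for y s
          using has_derivative_linear[OF test_function_has_derivative[OF \<xi>, of y]]
          by (metis linear_scale mult_minus_left mult_minus_right real_scaleR_def)
        ultimately show "((\<lambda>t. \<xi> (- t *\<^sub>R h + x)) has_vector_derivative - ?d (- t *\<^sub>R h + x)) (at t within {0..1})"
          by (simp add: has_vector_derivative_def)
        have "continuous_on UNIV ?d" using test_functionsD(1)[OF d] by (rule smooth_on_imp_continuous_on)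
        then show "continuous_on {0..1} (\<lambda>t. - ?d (- t *\<^sub>R h + x))"
          by (intro continuous_on_minus continuous_on_compose2[of UNIV ?d _ "\<lambda>t. - t *\<^sub>R h + x"] subset_UNIV)
            (rule continuous_intros | assumption)+
      qed simp
      then show ?thesis by simp
    qed
    have "(\<integral>x. ?F x * \<xi> x \<partial>lborel) = (\<integral>x. (\<integral>t. ?f t x * \<xi> x \<partial>lborel) \<partial>lborel)" by (simp only: integral_mult_left_zero)
    also have "\<dots> = (\<integral>t. (\<integral>x. ?f t x * \<xi> x \<partial>lborel) \<partial>lborel)" by (rule lborel_pair.Fubini_integral[OF f1])
    also have "\<dots> = (\<integral>t. - (\<integral>x. ?i t * (G x * ?d (- t *\<^sub>R h + x)) \<partial>lborel) \<partial>lborel)"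
    proof (rule Bochner_Integration.integral_cong[OF refl])
      fix t
      let ?\<xi> = "\<lambda>x. \<xi> (- t *\<^sub>R h + x)"
      have "(\<integral>x. ?f t x * \<xi> x \<partial>lborel) = ?i t * (\<integral>x. g (t *\<^sub>R h + x) * ?\<xi> (t *\<^sub>R h + x) \<partial>lborel)"
        by (simp add: mult.assoc)
      also have "(\<integral>x. g (t *\<^sub>R h + x) * ?\<xi> (t *\<^sub>R h + x) \<partial>lborel) = (\<integral>x. g x * ?\<xi> x \<partial>lborel)"
        by (rule lborel_integral_shift) measurable
      also have "\<dots> = - (\<integral>x. G x * ?d (- t *\<^sub>R h + x) \<partial>lborel)"
        using w[OF test_functions_shift(1)[OF \<xi>, of "- t *\<^sub>R h"]] by (simp only: test_functions_shift(2)[OF \<xi>])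
      finally show "(\<integral>x. ?f t x * \<xi> x \<partial>lborel) = - (\<integral>x. ?i t * (G x * ?d (- t *\<^sub>R h + x)) \<partial>lborel)" by simp
    qed
    also have "\<dots> = - (\<integral>t. (\<integral>x. ?i t * (G x * ?d (- t *\<^sub>R h + x)) \<partial>lborel) \<partial>lborel)" by simp
    also have "(\<integral>t. (\<integral>x. ?i t * (G x * ?d (- t *\<^sub>R h + x)) \<partial>lborel) \<partial>lborel) =
        (\<integral>x. (\<integral>t. ?i t * (G x * ?d (- t *\<^sub>R h + x)) \<partial>lborel) \<partial>lborel)"
      by (rule lborel_pair.Fubini_integral[OF f2, symmetric])
    also have "\<dots> = (\<integral>x. G x * (\<xi> x - \<xi> (- h + x)) \<partial>lborel)"
      by (simp only: ftc[symmetric] mult.left_commute[of "?i _"] integral_mult_right_zero)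
    finally have 1: "(\<integral>x. ?F x * \<xi> x \<partial>lborel) = (\<integral>x. G x * \<xi> (- h + x) - G x * \<xi> (0 + x) \<partial>lborel)"
      by (simp add: right_diff_distrib flip: Bochner_Integration.integral_minus)
    have "(\<integral>x. G (h + x) * \<xi> x \<partial>lborel) = (\<integral>x. G (h + x) * \<xi> (- h + (h + x)) \<partial>lborel)" by simp
    also have "\<dots> = (\<integral>x. G x * \<xi> (- h + x) \<partial>lborel)" by (rule lborel_integral_shift) measurable
    finally have 2: "(\<integral>x. G (h + x) * \<xi> x \<partial>lborel) = (\<integral>x. G x * \<xi> (- h + x) \<partial>lborel)" .
    have "(\<integral>x. ?w x * \<xi> x \<partial>lborel) = (\<integral>x. G (h + x) * \<xi> (0 + x) - G x * \<xi> (0 + x) - ?F x * \<xi> (0 + x) \<partial>lborel)"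
      by (simp add: left_diff_distrib)
    also have "\<dots> = (\<integral>x. G (h + x) * \<xi> (0 + x) \<partial>lborel) - (\<integral>x. G x * \<xi> (0 + x) \<partial>lborel) - (\<integral>x. ?F x * \<xi> (0 + x) \<partial>lborel)"
      using bnd[OF G, of 0] bnd[OF lborel_integrable_shift[OF G, of h], of 0] bnd[OF iF, of 0] by simp
    also have "\<dots> = 0" using 1 2 bnd[OF G, of "- h"] bnd[OF G, of 0] by simp
    finally show "(LINT x:UNIV|lborel. ?w x * \<xi> x) = 0" by (simp add: set_lebesgue_integral_def)
  qed
  moreover have "AE x in lborel. integrable lborel (\<lambda>t. ?f t x)" by (rule lborel_pair.AE_integrable_snd[OF f])
  ultimately show ?thesis by eventually_elim simp
qed

definition integrable_weak_gradient :: "(real^'n::finite \<Rightarrow> real) \<Rightarrow> ('n \<Rightarrow> real^'n \<Rightarrow> real) \<Rightarrow> bool"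
  where "integrable_weak_gradient G D \<longleftrightarrow> integrable lborel G \<and> (\<forall>j. integrable lborel (D j)) \<and>
    (\<forall>j. \<forall>\<xi>\<in>test_functions UNIV. (\<integral>x. G x * pderiv1 j \<xi> x \<partial>lborel) = - (\<integral>x. D j x * \<xi> x \<partial>lborel))"

lemma Lp_int_difference_le:
  fixes G :: "real^'n::finite \<Rightarrow> real" and D :: "'n \<Rightarrow> real^'n \<Rightarrow> real"
  assumes p: "1 < p" and GD: "integrable_weak_gradient G D"
  shows "Lp_int p UNIV (\<lambda>x. G (h + x) - G x)
    \<le> ennreal (real CARD('n) powr p * norm h powr p) * (\<Sum>j\<in>UNIV. Lp_int p UNIV (D j))"
proof -
  have G: "integrable lborel G" and D: "\<And>j. integrable lborel (D j)" and w: "\<And>j \<xi>. \<xi> \<in> test_functions UNIV \<Longrightarrow>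
      (\<integral>x. G x * pderiv1 j \<xi> x \<partial>lborel) = - (\<integral>x. D j x * \<xi> x \<partial>lborel)"
    using GD by (auto simp: integrable_weak_gradient_def)
  define g where "g x = (\<Sum>j\<in>UNIV. h $ j * D j x)" for x
  note [measurable] = borel_measurable_integrable[OF D, simplified]
  have g: "integrable lborel g" unfolding g_def by (intro Bochner_Integration.integrable_sum integrable_mult_right D)
  note [measurable] = borel_measurable_integrable[OF g, simplified]
  have w': "(\<integral>x. G x * fderiv \<xi> x h \<partial>lborel) = - (\<integral>x. g x * \<xi> x \<partial>lborel)"
    if \<xi>: "\<xi> \<in> test_functions UNIV" for \<xi>
  proof -
    note i = set_integrable_mult_test(1)[OF integrable_imp_locally_integrable[OF G] test_functions_pderiv1[OF \<xi>]]
      set_integrable_mult_test(1)[OF integrable_imp_locally_integrable[OF D] \<xi>]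
    have "(\<integral>x. G x * fderiv \<xi> x h \<partial>lborel) = (\<integral>x. (\<Sum>j\<in>UNIV. h $ j * (G x * pderiv1 j \<xi> x)) \<partial>lborel)"
      by (subst frechet_derivative_vec_sum[OF test_functionsD(1)[OF \<xi>]])
        (simp only: sum_distrib_left mult.left_commute)
    also have "\<dots> = (\<Sum>j\<in>UNIV. h $ j * (\<integral>x. G x * pderiv1 j \<xi> x \<partial>lborel))"
      using i by (subst Bochner_Integration.integral_sum) auto
    also have "\<dots> = - (\<Sum>j\<in>UNIV. h $ j * (\<integral>x. D j x * \<xi> x \<partial>lborel))" by (simp add: w[OF \<xi>] sum_negf)
    also have "(\<Sum>j\<in>UNIV. h $ j * (\<integral>x. D j x * \<xi> x \<partial>lborel)) = (\<integral>x. (\<Sum>j\<in>UNIV. h $ j * (D j x * \<xi> x)) \<partial>lborel)"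
      using i by (subst Bochner_Integration.integral_sum) auto
    finally show ?thesis by (simp add: g_def sum_distrib_right mult.assoc)
  qed
  have "Lp_int p UNIV (\<lambda>x. G (h + x) - G x) \<le> (\<integral>\<^sup>+x. (\<integral>\<^sup>+t\<in>{0..1}. ennreal (\<bar>g (t *\<^sub>R h + x)\<bar> powr p) \<partial>lborel) \<partial>lborel)"
  proof (rule nn_integral_mono_AE)
    show "AE x in lborel. ennreal (\<bar>G (h + x) - G x\<bar> powr p) * indicator UNIV x
        \<le> (\<integral>\<^sup>+t\<in>{0..1}. ennreal (\<bar>g (t *\<^sub>R h + x)\<bar> powr p) \<partial>lborel)"
    proof (rule AE_mp[OF difference_eq_integral_weak_derivative[OF G g]], rule w', assumption, intro AE_I2 impI)
      fix x assume "integrable lborel (\<lambda>t. indicator {0..1} t * g (t *\<^sub>R h + x)) \<and>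
        G (h + x) - G x = (\<integral>t. indicator {0..1} t * g (t *\<^sub>R h + x) \<partial>lborel)"
      then show "ennreal (\<bar>G (h + x) - G x\<bar> powr p) * indicator UNIV x
        \<le> (\<integral>\<^sup>+t\<in>{0..1}. ennreal (\<bar>g (t *\<^sub>R h + x)\<bar> powr p) \<partial>lborel)"
        using jensen_unit_interval[OF p, of "\<lambda>t. g (t *\<^sub>R h + x)"] by simp
    qed
  qed
  also have "\<dots> = (\<integral>\<^sup>+t. (\<integral>\<^sup>+x. ennreal (\<bar>g (t *\<^sub>R h + x)\<bar> powr p) * indicator {0..1} t \<partial>lborel) \<partial>lborel)"
    by (rule lborel_pair.Fubini') measurable
  also have "\<dots> = (\<integral>\<^sup>+t. Lp_int p UNIV g * indicator {0..1::real} t \<partial>lborel)" by (intro nn_integral_cong)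
      (simp add: nn_integral_multc nn_integral_shift[of "\<lambda>x. ennreal (\<bar>g x\<bar> powr p)"])
  also have "\<dots> = Lp_int p UNIV g" by (simp add: nn_integral_cmult_indicator)
  also have "\<dots> \<le> ennreal (real CARD('n) powr p) * (\<Sum>j\<in>UNIV. Lp_int p UNIV (\<lambda>x. h $ j * D j x))"
    unfolding g_def by (intro Lp_int_sum_le p) auto
  also have "\<dots> \<le> ennreal (real CARD('n) powr p) * (\<Sum>j\<in>UNIV. ennreal (norm h powr p) * Lp_int p UNIV (D j))"
  proof (intro mult_left_mono sum_mono)
    fix j
    have "Lp_int p UNIV (\<lambda>x. h $ j * D j x) \<le> (\<integral>\<^sup>+x. ennreal (norm h powr p) * ennreal (\<bar>D j x\<bar> powr p) \<partial>lborel)"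
    proof (intro nn_integral_mono)
      fix x
      have "\<bar>h $ j\<bar> powr p \<le> norm h powr p" using p component_le_norm_cart[of h j] by (intro powr_mono2) auto
      then show "ennreal (\<bar>h $ j * D j x\<bar> powr p) * indicator UNIV x \<le> ennreal (norm h powr p) * ennreal (\<bar>D j x\<bar> powr p)"
        by (auto simp: abs_mult powr_mult ennreal_mult[symmetric] intro!: ennreal_leI mult_right_mono)
    qed
    then show "Lp_int p UNIV (\<lambda>x. h $ j * D j x) \<le> ennreal (norm h powr p) * Lp_int p UNIV (D j)"
      by (simp add: nn_integral_cmult)
  qed simp
  also have "\<dots> = ennreal (real CARD('n) powr p * norm h powr p) * (\<Sum>j\<in>UNIV. Lp_int p UNIV (D j))"
    by (simp add: sum_distrib_left ennreal_mult mult.assoc)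
  finally show ?thesis .
qed

lemma divide_powr: "a / b powr s = b powr (- s) * (a :: real)"
  by (simp add: powr_minus divide_inverse)

lemma slob_int_eq_shift:
  fixes G :: "real^'n::finite \<Rightarrow> real" and \<theta> p :: real
  assumes [measurable]: "G \<in> borel_measurable borel"
  shows "slob_int \<theta> p UNIV G = (\<integral>\<^sup>+h. ennreal (norm h powr (- (CARD('n) + \<theta> * p))) *
    Lp_int p UNIV (\<lambda>x. G (h + x) - G x) \<partial>lborel)"
proof -
  let ?k = "\<lambda>h::real^'n. ennreal (norm h powr (- (CARD('n) + \<theta> * p)))"
  have "(\<integral>\<^sup>+y\<in>UNIV. ennreal (\<bar>G x - G y\<bar> powr p / norm (x - y) powr (real CARD('n) + \<theta> * p)) \<partial>lborel)
      = (\<integral>\<^sup>+h. ?k h * ennreal (\<bar>G (h + x) - G x\<bar> powr p) \<partial>lborel)" for x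
  proof -
    have "(\<integral>\<^sup>+y\<in>UNIV. ennreal (\<bar>G x - G y\<bar> powr p / norm (x - y) powr (real CARD('n) + \<theta> * p)) \<partial>lborel)
        = (\<integral>\<^sup>+h. ennreal (\<bar>G x - G (x + h)\<bar> powr p / norm (x - (x + h)) powr (real CARD('n) + \<theta> * p)) \<partial>lborel)"
      by (subst nn_integral_shift[where F = "\<lambda>y. ennreal (\<bar>G x - G y\<bar> powr p / norm (x - y) powr (real CARD('n) + \<theta> * p))"])
        simp_all
    also have "\<dots> = (\<integral>\<^sup>+h. ?k h * ennreal (\<bar>G (h + x) - G x\<bar> powr p) \<partial>lborel)"
    proof (intro nn_integral_cong)
      fix h
      have "x - (x + h) = - h" "\<bar>G x - G (x + h)\<bar> = \<bar>G (h + x) - G x\<bar>" by (simp_all add: add.commute abs_minus_commute)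
      then show "ennreal (\<bar>G x - G (x + h)\<bar> powr p / norm (x - (x + h)) powr (real CARD('n) + \<theta> * p)) =
          ?k h * ennreal (\<bar>G (h + x) - G x\<bar> powr p)"
        by (simp only: divide_powr norm_minus_cancel) (simp add: ennreal_mult)
    qed
    finally show ?thesis .
  qed
  then have "slob_int \<theta> p UNIV G = (\<integral>\<^sup>+x. (\<integral>\<^sup>+h. ?k h * ennreal (\<bar>G (h + x) - G x\<bar> powr p) \<partial>lborel) \<partial>lborel)" by simp
  also have "\<dots> = (\<integral>\<^sup>+h. (\<integral>\<^sup>+x. ?k h * ennreal (\<bar>G (h + x) - G x\<bar> powr p) \<partial>lborel) \<partial>lborel)"
    by (rule lborel_pair.Fubini') measurable
  finally show ?thesis by (simp add: nn_integral_cmult)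
qed

text \<open>In the integral over the shift \<open>h\<close>, the difference of \<open>G\<close> is bounded by the norm of \<open>G\<close> for \<open>\<bar>h\<bar> \<ge> 1\<close> and by \<open>\<bar>h\<bar>\<close>
  times the norm of the gradient for \<open>\<bar>h\<bar> < 1\<close>. The remaining powers of \<open>\<bar>h\<bar>\<close> are integrable there,
  because \<open>\<theta> > 0\<close> and \<open>\<theta> < 1\<close> respectively.\<close>

lemma slob_int_le_weak_derivatives:
  fixes \<theta> p :: real
  assumes p: "1 < p" and \<theta>: "0 < \<theta>" "\<theta> < 1"
  shows "\<exists>C\<ge>0. \<forall>(G :: real^'n::finite \<Rightarrow> real) (D :: 'n \<Rightarrow> real^'n \<Rightarrow> real). integrable_weak_gradient G D \<longrightarrow>
    slob_int \<theta> p UNIV G \<le> ennreal C * (Lp_int p UNIV G + (\<Sum>j\<in>UNIV. Lp_int p UNIV (D j)))"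
proof -
  let ?s = "- (CARD('n) + \<theta> * p)"
  define \<kappa>1 where "\<kappa>1 = (\<integral>\<^sup>+h\<in>{h :: real^'n. 1 \<le> norm h}. ennreal (norm h powr ?s) \<partial>lborel)"
  define \<kappa>2 where "\<kappa>2 = (\<integral>\<^sup>+h\<in>ball (0 :: real^'n) 1. ennreal (norm h powr (p * (1 - \<theta>) - CARD('n))) \<partial>lborel)"
  have \<kappa>: "\<kappa>1 < \<infinity>" "\<kappa>2 < \<infinity>"
    unfolding \<kappa>1_def \<kappa>2_def using kernel_outside_ball_finite[of 1 "\<theta> * p"] kernel_ball_finite[of 1 "p * (1 - \<theta>)"] p \<theta>
    by (simp_all add: mult_pos_pos)
  obtain k1 where k1: "\<kappa>1 = ennreal k1" "0 \<le> k1" using \<kappa>(1) by (cases \<kappa>1) auto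
  obtain k2 where k2: "\<kappa>2 = ennreal k2" "0 \<le> k2" using \<kappa>(2) by (cases \<kappa>2) auto
  define c1 where "c1 = 2 powr p * 2"
  define c2 where "c2 = real CARD('n) powr p"
  have c: "0 \<le> c1" "0 \<le> c2" by (auto simp: c1_def c2_def)
  define C where "C = k1 * c1 + k2 * c2"
  have C: "0 \<le> C" "k1 * c1 \<le> C" "k2 * c2 \<le> C" using k1 k2 c by (auto simp: C_def)
  have main: "slob_int \<theta> p UNIV G \<le> ennreal C * (Lp_int p UNIV G + (\<Sum>j\<in>UNIV. Lp_int p UNIV (D j)))"
    if GD: "integrable_weak_gradient G D" for G :: "real^'n \<Rightarrow> real" and D :: "'n \<Rightarrow> real^'n \<Rightarrow> real"
  proof -
    have G: "integrable lborel G" using GD by (simp add: integrable_weak_gradient_def)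
    note [measurable] = borel_measurable_integrable[OF G, simplified]
    let ?A = "Lp_int p UNIV G" and ?B = "\<Sum>j\<in>UNIV. Lp_int p UNIV (D j)"
    let ?d = "\<lambda>h. Lp_int p UNIV (\<lambda>x. G (h + x) - G x)"
    have d1: "?d h \<le> ennreal c1 * ?A" for h
    proof -
      have "?d h \<le> (\<integral>\<^sup>+x. ennreal (2 powr p) * (ennreal (\<bar>G (h + x)\<bar> powr p) + ennreal (\<bar>G x\<bar> powr p)) \<partial>lborel)"
        using abs_diff_powr_le[OF p] by (intro nn_integral_mono) (simp add: ennreal_plus[symmetric] ennreal_mult[symmetric] ennreal_leI del: ennreal_plus)
      also have "\<dots> = ennreal (2 powr p) * (?A + ?A)"
        by (simp add: nn_integral_cmult nn_integral_add nn_integral_shift[of "\<lambda>x. ennreal (\<bar>G x\<bar> powr p)"])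
      also have "\<dots> = ennreal c1 * ?A" by (simp add: c1_def ennreal_mult mult_2 mult.assoc flip: mult_2)
      finally show ?thesis .
    qed
    have d2: "?d h \<le> ennreal (c2 * norm h powr p) * ?B" for h unfolding c2_def by (rule Lp_int_difference_le[OF p GD])
    have [measurable]: "{h :: real^'n. 1 \<le> norm h} \<in> sets borel" "ball (0 :: real^'n) 1 \<in> sets borel"
      by (auto intro!: borel_closed closed_Collect_le continuous_intros)
    have "slob_int \<theta> p UNIV G \<le>
        (\<integral>\<^sup>+h. (ennreal c1 * ?A) * (ennreal (norm h powr ?s) * indicator {h :: real^'n. 1 \<le> norm h} h) +
          (ennreal c2 * ?B) * (ennreal (norm h powr (p * (1 - \<theta>) - CARD('n))) * indicator (ball 0 1) h) \<partial>lborel)"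
      unfolding slob_int_eq_shift[OF \<open>G \<in> borel_measurable borel\<close>]
    proof (intro nn_integral_mono)
      fix h :: "real^'n"
      show "ennreal (norm h powr ?s) * ?d h \<le>
          (ennreal c1 * ?A) * (ennreal (norm h powr ?s) * indicator {h :: real^'n. 1 \<le> norm h} h) +
          (ennreal c2 * ?B) * (ennreal (norm h powr (p * (1 - \<theta>) - CARD('n))) * indicator (ball 0 1) h)"
      proof (cases "1 \<le> norm h")
        case True
        then show ?thesis using mult_left_mono[OF d1[of h], of "ennreal (norm h powr ?s)"] by (simp add: ac_simps)
      next
        case False
        have "ennreal (norm h powr ?s) * ?d h \<le> ennreal (norm h powr ?s) * (ennreal (c2 * norm h powr p) * ?B)"
          using d2 by (intro mult_left_mono) auto
        also have "\<dots> = ennreal c2 * ?B * ennreal (norm h powr p * norm h powr ?s)"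
          using c by (simp add: ennreal_mult ac_simps)
        also have "norm h powr p * norm h powr ?s = norm h powr (p * (1 - \<theta>) - CARD('n))"
          by (simp add: powr_add[symmetric] algebra_simps)
        finally show ?thesis using False by simp
      qed
    qed
    also have "\<dots> = (ennreal c1 * ?A) * \<kappa>1 + (ennreal c2 * ?B) * \<kappa>2"
      unfolding \<kappa>1_def \<kappa>2_def by (simp add: nn_integral_add nn_integral_cmult)
    also have "\<dots> = ennreal (k1 * c1) * ?A + ennreal (k2 * c2) * ?B" using k1 k2 c by (simp add: ennreal_mult ac_simps)
    also have "\<dots> \<le> ennreal C * ?A + ennreal C * ?B" using C by (intro add_mono mult_right_mono ennreal_leI) auto
    finally show ?thesis by (simp add: distrib_left)
  qed
  then show ?thesis using C(1) by blast
qed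


section \<open>Localised change of variables in Lebesgue and Slobodeckij norms\<close>

lemma diffeo_jac_det_pos:
  assumes d: "diffeo W W' \<Phi> \<Psi>" and x: "x \<in> W"
  shows "0 < jac_det \<Phi> x"
proof -
  have D: "(\<Phi> has_derivative fderiv \<Phi> x) (at x)"
    "(\<Psi> has_derivative fderiv \<Psi> (\<Phi> x)) (at (\<Phi> x))"
    using d x by (auto simp: diffeo_def intro!: smooth_on_differentiable(2))
  have "((\<lambda>y. \<Psi> (\<Phi> y)) has_derivative (\<lambda>h. fderiv \<Psi> (\<Phi> x) (fderiv \<Phi> x h))) (at x)"
    by (rule has_derivative_compose[OF D])
  moreover have "((\<lambda>y. \<Psi> (\<Phi> y)) has_derivative (\<lambda>h. h)) (at x)"
    by (rule has_derivative_transform_within_open[OF has_derivative_ident, of W]) (use d x in \<open>auto simp: diffeo_def\<close>)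
  ultimately have "(\<lambda>h. fderiv \<Psi> (\<Phi> x) (fderiv \<Phi> x h)) = (\<lambda>h. h)" by (rule has_derivative_unique)
  then have "fderiv \<Psi> (\<Phi> x) \<circ> fderiv \<Phi> x = id" by (auto simp: o_def id_def)
  then have "matrix (fderiv \<Psi> (\<Phi> x)) ** matrix (fderiv \<Phi> x) = mat 1"
    using matrix_compose[OF has_derivative_linear[OF D(1)] has_derivative_linear[OF D(2)]] by (simp add: matrix_id_mat_1)
  then have "det (matrix (fderiv \<Psi> (\<Phi> x))) * det (matrix (fderiv \<Phi> x)) = 1" by (metis det_I det_mul)
  then show ?thesis by auto
qed

text \<open>On a compact set the Jacobian determinant is bounded below by a positive number.\<close>

lemma diffeo_nn_integral_compact_le:
  assumes d: "diffeo W W' \<Phi> \<Psi>" and L: "compact L" "L \<subseteq> W"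
  obtains m where "0 < m" "\<And>h :: real^'n::finite \<Rightarrow> ennreal. (\<lambda>y. h y * indicator W' y) \<in> borel_measurable borel \<Longrightarrow>
    (\<integral>\<^sup>+x\<in>L. h (\<Phi> x) \<partial>lborel) \<le> ennreal m * (\<integral>\<^sup>+y\<in>W'. h y \<partial>lborel)"
proof -
  have "\<exists>m>0. \<forall>x\<in>L. m \<le> jac_det \<Phi> x"
  proof (cases "L = {}")
    case False
    have "continuous_on L (\<lambda>x. jac_det \<Phi> x)" using d smooth_on_imp_continuous_on[OF smooth_on_det_derivative]
      by (intro continuous_on_subset[OF _ L(2)] continuous_on_rabs) (auto simp: diffeo_def)
    then obtain z where "z \<in> L" "\<And>x. x \<in> L \<Longrightarrow> jac_det \<Phi> z \<le> jac_det \<Phi> x"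
      using continuous_attains_inf[OF L(1) False] by blast
    then show ?thesis using diffeo_jac_det_pos[OF d, of z] L(2) by blast
  qed (auto intro: exI[of _ 1])
  then obtain m where m: "m > 0" "\<And>x. x \<in> L \<Longrightarrow> m \<le> jac_det \<Phi> x" by blast
  have "(\<integral>\<^sup>+x\<in>L. h (\<Phi> x) \<partial>lborel) \<le> ennreal (1 / m) * (\<integral>\<^sup>+y\<in>W'. h y \<partial>lborel)"
    if h: "(\<lambda>y. h y * indicator W' y) \<in> borel_measurable borel" for h :: "real^'n \<Rightarrow> ennreal"
  proof -
    have W: "W \<in> sets borel" using d by (auto simp: diffeo_def)
    have "ennreal m * (\<integral>\<^sup>+x\<in>L. h (\<Phi> x) \<partial>lborel) = (\<integral>\<^sup>+x. ennreal m * (h (\<Phi> x) * indicator L x) \<partial>lborel)"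
    proof (rule nn_integral_cmult[symmetric])
      have "(\<lambda>x. (h (indicator W x *\<^sub>R \<Phi> x) * indicator W' (indicator W x *\<^sub>R \<Phi> x)) * indicator L x) \<in> borel_measurable borel"
        using measurable_compose[OF diffeo_measurable(1)[OF d] h] L borel_compact[OF L(1)] by measurable
      moreover have "(h (indicator W x *\<^sub>R \<Phi> x) * indicator W' (indicator W x *\<^sub>R \<Phi> x)) * indicator L x = h (\<Phi> x) * indicator L x" for x
        using L(2) d by (auto simp: indicator_def diffeo_def)
      ultimately show "(\<lambda>x. h (\<Phi> x) * indicator L x) \<in> borel_measurable lborel" by simp
    qed
    also have "\<dots> \<le> (\<integral>\<^sup>+x\<in>W. ennreal (jac_det \<Phi> x) * h (\<Phi> x) \<partial>lborel)"
      using m L(2) by (intro nn_integral_mono) (auto simp: indicator_def intro!: mult_right_mono ennreal_leI)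
    also have "\<dots> = (\<integral>\<^sup>+y\<in>W'. h y \<partial>lborel)" by (rule nn_integral_diffeo[OF d h])
    finally have "ennreal (1 / m) * (ennreal m * (\<integral>\<^sup>+x\<in>L. h (\<Phi> x) \<partial>lborel)) \<le> ennreal (1 / m) * (\<integral>\<^sup>+y\<in>W'. h y \<partial>lborel)"
      by (intro mult_left_mono) auto
    then show ?thesis using m(1) by (simp add: mult.assoc[symmetric] ennreal_mult[symmetric])
  qed
  then show ?thesis using that[of "1 / m"] m(1) by simp
qed

lemma pullback_indicator:
  assumes "diffeo W W' \<Phi> \<Psi>"
  shows "pullback W b \<Phi> (\<lambda>y. indicator W' y * g y) = pullback W b \<Phi> g"
  using assms by (auto simp: pullback_def diffeo_def fun_eq_iff)

lemma Lp_int_indicator: "1 < p \<Longrightarrow> Lp_int p \<Omega> (\<lambda>y. indicator \<Omega> y * g y) = Lp_int p \<Omega> g"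
  by (intro nn_integral_cong) (simp add: indicator_def)

lemma slob_int_indicator: "slob_int \<theta> p \<Omega> (\<lambda>y. indicator \<Omega> y * g y) = slob_int \<theta> p \<Omega> g"
  by (intro nn_integral_cong) (auto simp: indicator_def intro!: nn_integral_cong)

lemma pullback_borel:
  assumes d: "diffeo W W' \<Phi> \<Psi>" and b: "b \<in> test_functions W" 
    and g: "borel_on W' g"
  shows "pullback W b \<Phi> g \<in> borel_measurable borel"
proof -
  note [measurable] = test_function_measurable[OF b] 
  have "(\<lambda>x. b x * (indicator W' (indicator W x *\<^sub>R \<Phi> x) * g (indicator W x *\<^sub>R \<Phi> x))) \<in> borel_measurable borel"
    using measurable_compose[OF diffeo_measurable(1)[OF d] g] by measurable
  moreover have "b x * (indicator W' (indicator W x *\<^sub>R \<Phi> x) * g (indicator W x *\<^sub>R \<Phi> x)) = pullback W b \<Phi> g x" for x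
    using d test_functionsD(4)[OF b, of x] by (auto simp: pullback_def indicator_def diffeo_def)
  ultimately show ?thesis by simp
qed

lemma Lp_int_pullback_le:
  assumes d: "diffeo W W' \<Phi> \<Psi>" and b: "b \<in> test_functions W" and p: "1 < p"
  shows "\<exists>C\<ge>0. \<forall>g. borel_on W' g \<longrightarrow>
    Lp_int p UNIV (pullback W b \<Phi> g) \<le> ennreal C * Lp_int p W' g"
proof -
  let ?K = "supp b"
  obtain m where m: "0 < m" "\<And>h :: real^'a \<Rightarrow> ennreal. (\<lambda>y. h y * indicator W' y) \<in> borel_measurable borel \<Longrightarrow>
    (\<integral>\<^sup>+x\<in>?K. h (\<Phi> x) \<partial>lborel) \<le> ennreal m * (\<integral>\<^sup>+y\<in>W'. h y \<partial>lborel)"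
    by (rule diffeo_nn_integral_compact_le[OF d test_functionsD(2,3)[OF b]]) (rule that)
  obtain B where B: "B > 0" "\<And>x. \<bar>b x\<bar> \<le> B" by (rule test_function_bounded[OF b]) (rule that)
  have "Lp_int p UNIV (pullback W b \<Phi> g) \<le> ennreal (B powr p * m) * Lp_int p W' g"
    if g: "borel_on W' g" for g
  proof -
    have eq: "ennreal (\<bar>g y\<bar> powr p) * indicator W' y = ennreal (\<bar>indicator W' y * g y\<bar> powr p)" for y
      using p by (simp add: indicator_def)
    have me: "(\<lambda>y. ennreal (\<bar>indicator W' y * g y\<bar> powr p)) \<in> borel_measurable lborel" using g by measurable
    have meas: "(\<lambda>y. ennreal (B powr p) * ennreal (\<bar>g y\<bar> powr p) * indicator W' y) \<in> borel_measurable borel"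
      unfolding mult.assoc eq using g by measurable
    have "Lp_int p UNIV (pullback W b \<Phi> g) \<le> (\<integral>\<^sup>+x\<in>?K. ennreal (B powr p) * ennreal (\<bar>g (\<Phi> x)\<bar> powr p) \<partial>lborel)"
    proof (rule nn_integral_mono)
      fix x
      have "\<bar>b x * g (\<Phi> x)\<bar> powr p \<le> B powr p * \<bar>g (\<Phi> x)\<bar> powr p"
        using B p by (auto simp: abs_mult powr_mult intro!: mult_right_mono powr_mono2)
      then show "ennreal (\<bar>pullback W b \<Phi> g x\<bar> powr p) * indicator UNIV x
          \<le> ennreal (B powr p) * ennreal (\<bar>g (\<Phi> x)\<bar> powr p) * indicator ?K x"
        using p closure_subset[of "{x. b x \<noteq> 0}"]
        by (cases "b x = 0") (auto simp: pullback_def ennreal_mult[symmetric] intro!: ennreal_leI)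
    qed
    also have "\<dots> \<le> ennreal m * (\<integral>\<^sup>+y\<in>W'. ennreal (B powr p) * ennreal (\<bar>g y\<bar> powr p) \<partial>lborel)" by (rule m(2)[OF meas])
    also have "(\<integral>\<^sup>+y\<in>W'. ennreal (B powr p) * ennreal (\<bar>g y\<bar> powr p) \<partial>lborel) = ennreal (B powr p) * Lp_int p W' g"
      unfolding mult.assoc eq by (rule nn_integral_cmult[OF me])
    finally show ?thesis using m(1) by (simp add: ennreal_mult mult.assoc mult.left_commute)
  qed
  then show ?thesis using m(1) by (intro exI[of _ "B powr p * m"]) auto
qed

lemma compact_UN_cball:
  fixes K :: "'a::euclidean_space set"
  assumes "compact K"
  shows "compact (\<Union>x\<in>K. cball x \<delta>)"
proof -
  have "(\<Union>x\<in>K. cball x \<delta>) = {x + y | x y. x \<in> K \<and> y \<in> cball 0 \<delta>}"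
  proof (intro equalityI subsetI)
    fix z assume "z \<in> (\<Union>x\<in>K. cball x \<delta>)"
    then obtain x where "x \<in> K" "dist x z \<le> \<delta>" by auto
    then show "z \<in> {x + y | x y. x \<in> K \<and> y \<in> cball 0 \<delta>}"
      by (intro CollectI exI[of _ x] exI[of _ "z - x"]) (auto simp: dist_norm norm_minus_commute)
  qed (auto simp: dist_norm intro!: bexI)
  then show ?thesis by (simp only: compact_sums[OF assms compact_cball])
qed

text \<open>The derivative is bounded on the compact \<open>\<delta>\<close>-neighbourhood of \<open>K\<close>, which contains the segment from \<open>x\<close> to \<open>y\<close>.\<close>

lemma smooth_locally_lipschitz:
  fixes f :: "real^'n::finite \<Rightarrow> 'b::real_normed_vector"
  assumes W: "open W" and f: "smooth_on W f" and K: "compact K" and \<delta>: "(\<Union>x\<in>K. cball x \<delta>) \<subseteq> W"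
  obtains \<Lambda> where "0 < \<Lambda>" "\<And>x y. x \<in> K \<Longrightarrow> dist x y < \<delta> \<Longrightarrow> norm (f x - f y) \<le> \<Lambda> * norm (x - y)"
proof -
  let ?L = "\<Union>x\<in>K. cball x \<delta>"
  have L: "compact ?L" by (rule compact_UN_cball[OF K])
  have "\<exists>B>0. \<forall>x\<in>?L. norm (fderiv f x (axis j 1)) \<le> B" for j
  proof -
    have "continuous_on ?L (\<lambda>x. fderiv f x (axis j 1))"
      by (intro continuous_on_subset[OF _ \<delta>] smooth_on_imp_continuous_on smooth_on_frechet_derivative W f)
    from compact_imp_bounded[OF compact_continuous_image[OF this L]]
    show ?thesis by (auto simp: bounded_pos)
  qed
  then obtain B where B: "\<And>j. B j > 0" "\<And>j x. x \<in> ?L \<Longrightarrow> norm (fderiv f x (axis j 1)) \<le> B j" by metis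
  define \<Lambda> where "\<Lambda> = (\<Sum>j\<in>UNIV. B j)"
  have \<Lambda>: "0 < \<Lambda>" unfolding \<Lambda>_def using B(1) by (intro sum_pos) auto
  have on: "onorm (fderiv f x) \<le> \<Lambda>" if x: "x \<in> ?L" for x
  proof (rule onorm_bound)
    fix h :: "real^'n"
    have lin: "linear (fderiv f x)"
      by (rule has_derivative_linear[OF smooth_on_differentiable(2)[OF f subsetD[OF \<delta> x]]])
    have h: "h = (\<Sum>j\<in>UNIV. h $ j *\<^sub>R axis j 1)" by (auto simp: vec_eq_iff axis_def if_distrib cong: if_cong)
    have "fderiv f x h = (\<Sum>j\<in>UNIV. h $ j *\<^sub>R fderiv f x (axis j 1))"
      by (subst h) (simp only: linear_sum[OF lin] linear_scale[OF lin])
    also have "norm \<dots> \<le> (\<Sum>j\<in>UNIV. norm h * B j)" using B(1) B(2)[OF x] component_le_norm_cart[of h]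
      by (intro sum_norm_le) (auto intro!: mult_mono simp: less_imp_le)
    finally show "norm (fderiv f x h) \<le> \<Lambda> * norm h" by (simp add: \<Lambda>_def sum_distrib_left mult.commute)
  qed (use \<Lambda> in simp)
  show ?thesis
  proof (rule that[OF \<Lambda>])
  fix x y assume x: "x \<in> K" "dist x y < \<delta>"
  show "norm (f x - f y) \<le> \<Lambda> * norm (x - y)"
  proof (rule differentiable_bound[where S = "cball x \<delta>" and f' = "\<lambda>x. fderiv f x"])
    fix z assume "z \<in> cball x \<delta>"
    then have z: "z \<in> ?L" using x(1) by (rule UN_I[rotated])
    show "(f has_derivative fderiv f z) (at z within cball x \<delta>)"
      by (rule has_derivative_at_withinI, rule smooth_on_differentiable(2)[OF f subsetD[OF \<delta> z]])
    show "onorm (fderiv f z) \<le> \<Lambda>" by (rule on[OF z])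
  qed (use order_trans[OF zero_le_dist less_imp_le[OF x(2)]] x in simp_all)
  qed
qed

text \<open>Points at distance at least \<open>\<delta>\<close> are controlled by the kernel away from the origin. For close
  points at least one of which lies in the support of \<open>b\<close>, the product rule for differences reduces
  the quotient to that of \<open>g\<close>, by the Lipschitz bound for \<open>\<Phi>\<close>, and to an integrable kernel.\<close>

lemma slob_int_pullback_le:
  fixes W W' :: "(real^'n::finite) set" and \<theta> p :: real
  assumes d: "diffeo W W' \<Phi> \<Psi>" and b: "b \<in> test_functions W" and p: "1 < p" and \<theta>: "0 < \<theta>" "\<theta> < 1"
  shows "\<exists>C\<ge>0. \<forall>g. borel_on W' g \<longrightarrow>
    slob_int \<theta> p UNIV (pullback W b \<Phi> g) \<le> ennreal C * (Lp_int p W' g + slob_int \<theta> p W' g)"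
proof -
  let ?K = "supp b"
  have W: "open W" "open W'" "smooth_on W \<Phi>" using d by (auto simp: diffeo_def)
  have b0: "x \<in> ?K" if "b x \<noteq> 0" for x using that closure_subset[of "{x. b x \<noteq> 0}"] by auto
  note K = test_functionsD(2,3)[OF b]
  obtain \<delta> where \<delta>: "\<delta> > 0" "(\<Union>x\<in>?K. cball x \<delta>) \<subseteq> W"
    using compact_subset_open_imp_cball_epsilon_subset[OF K(1) W(1) K(2)] by metis
  obtain \<Lambda> where \<Lambda>: "0 < \<Lambda>" "\<And>x y. x \<in> ?K \<Longrightarrow> dist x y < \<delta> \<Longrightarrow> norm (\<Phi> x - \<Phi> y) \<le> \<Lambda> * norm (x - y)"
    by (rule smooth_locally_lipschitz[OF W(1,3) K(1) \<delta>(2)]) (rule that)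
  have bW: "smooth_on W b" using test_functionsD(1)[OF b] by (rule smooth_on_subset) simp
  obtain \<Lambda>' where \<Lambda>': "0 < \<Lambda>'" "\<And>x y. x \<in> ?K \<Longrightarrow> dist x y < \<delta> \<Longrightarrow> norm (b x - b y) \<le> \<Lambda>' * norm (x - y)"
    by (rule smooth_locally_lipschitz[OF W(1) bW K(1) \<delta>(2)]) (rule that)
  obtain B where B: "B > 0" "\<And>x. \<bar>b x\<bar> \<le> B" by (rule test_function_bounded[OF b]) (rule that)
  define L where "L = (\<Union>x\<in>?K. cball x \<delta>)"
  have LI: "y \<in> L" if "x \<in> ?K" "dist x y \<le> \<delta>" for x y using that by (auto simp: L_def)
  have L: "compact L" "L \<subseteq> W" using compact_UN_cball[OF K(1)] \<delta>(2) by (simp_all add: L_def)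
  obtain m where m: "0 < m" "\<And>h :: real^'n \<Rightarrow> ennreal. (\<lambda>y. h y * indicator W' y) \<in> borel_measurable borel \<Longrightarrow>
    (\<integral>\<^sup>+x\<in>L. h (\<Phi> x) \<partial>lborel) \<le> ennreal m * (\<integral>\<^sup>+y\<in>W'. h y \<partial>lborel)"
    by (rule diffeo_nn_integral_compact_le[OF d L]) (rule that)
  obtain C0 where C0: "0 \<le> C0" "\<And>g. borel_on W' g \<Longrightarrow>
      Lp_int p UNIV (pullback W b \<Phi> g) \<le> ennreal C0 * Lp_int p W' g" using Lp_int_pullback_le[OF d b p] by blast
  define s where "s = real CARD('n) + \<theta> * p"
  \<comment> \<open>the kernels for distant and for close pairs of points\<close>
  define k1 where "k1 z = ennreal (norm z powr (- s)) * indicator {z. \<delta> \<le> norm z} z" for z :: "real^'n"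
  define k2 where "k2 z = ennreal (norm z powr (p - s)) * indicator (ball 0 \<delta>) z" for z :: "real^'n"
  have [measurable]: "{z :: real^'n. \<delta> \<le> norm z} \<in> sets borel" "ball (0 :: real^'n) \<delta> \<in> sets borel" "L \<in> sets borel" "W' \<in> sets borel"
    using L(1) W(2) by (auto intro!: borel_closed closed_Collect_le continuous_intros borel_compact)
  have [measurable]: "k1 \<in> borel_measurable borel" "k2 \<in> borel_measurable borel" unfolding k1_def k2_def by measurable
  have "integral\<^sup>N lborel k1 < \<infinity>"
    using kernel_outside_ball_finite[OF \<delta>(1), of "\<theta> * p", where 'n = 'n] p \<theta> by (simp add: k1_def[abs_def] s_def)
  then obtain \<kappa>1 where \<kappa>1: "integral\<^sup>N lborel k1 = ennreal \<kappa>1" "0 \<le> \<kappa>1" by (cases "integral\<^sup>N lborel k1") auto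
  have "integral\<^sup>N lborel k2 < \<infinity>"
    using kernel_ball_finite[OF \<delta>(1), of "p * (1 - \<theta>)", where 'n = 'n] p \<theta> by (simp add: k2_def[abs_def] s_def algebra_simps)
  then obtain \<kappa>2 where \<kappa>2: "integral\<^sup>N lborel k2 = ennreal \<kappa>2" "0 \<le> \<kappa>2" by (cases "integral\<^sup>N lborel k2") auto
  have ksym: "k1 (- x + y) = k1 (- y + x)" "k2 (- x + y) = k2 (- y + x)" for x y
    using norm_minus_commute[of x y] by (simp_all add: k1_def k2_def indicator_def)
  have kint: "(\<integral>\<^sup>+y. k1 (- x + y) \<partial>lborel) = ennreal \<kappa>1" "(\<integral>\<^sup>+y. k2 (- x + y) \<partial>lborel) = ennreal \<kappa>2" for x
    using \<kappa>1 \<kappa>2 nn_integral_shift[of k1 "- x"] nn_integral_shift[of k2 "- x"] by simp_all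
  have kint': "(\<integral>\<^sup>+x. k1 (- x + y) \<partial>lborel) = ennreal \<kappa>1" "(\<integral>\<^sup>+x. k2 (- x + y) \<partial>lborel) = ennreal \<kappa>2" for y
    by (subst ksym, rule kint)+
  note kint = kint[simplified] kint'[simplified]
  define c1 where "c1 = 2 powr p"
  define c2 where "c2 = 2 powr p * B powr p * \<Lambda> powr s"
  define c3 where "c3 = 2 powr p * \<Lambda>' powr p"
  have c: "0 \<le> c1" "0 \<le> c2" "0 \<le> c3" by (auto simp: c1_def c2_def c3_def)
  have s: "s > 0" using p \<theta> by (simp add: s_def add_pos_pos)
  define C where "C = c1 * \<kappa>1 * C0 + (c1 * \<kappa>1 * C0 + (c3 * \<kappa>2 * m + c2 * (m * m)))"
  have main: "slob_int \<theta> p UNIV (pullback W b \<Phi> g) \<le> ennreal C * (Lp_int p W' g + slob_int \<theta> p W' g)"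
    if g: "borel_on W' g" and gb: "g \<in> borel_measurable borel" for g
  proof -
    note [measurable] = gb diffeo_measurable(1)[OF d]
    let ?u = "pullback W b \<Phi> g" and ?\<Phi> = "\<lambda>x. indicator W x *\<^sub>R \<Phi> x"
    have [measurable]: "?u \<in> borel_measurable borel" by (rule pullback_borel[OF d b g])
    define U where "U x = ennreal (\<bar>?u x\<bar> powr p)" for x
    define Q where "Q x y = ennreal (\<bar>g x - g y\<bar> powr p / norm (x - y) powr s)" for x y
    define H where "H y = ennreal (\<bar>g (?\<Phi> y)\<bar> powr p) * indicator L y" for y
    have [measurable]: "U \<in> borel_measurable borel" "H \<in> borel_measurable borel"
      "(\<lambda>(x, y). Q x y) \<in> borel_measurable (borel \<Otimes>\<^sub>M borel)" unfolding U_def H_def Q_def by measurable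
    have \<Phi>L: "?\<Phi> x = \<Phi> x" if "x \<in> L" for x using that L(2) by auto
    have ux: "?u x = b x * g (?\<Phi> x)" for x
      using test_functionsD(4)[OF b, of x] by (auto simp: pullback_def indicator_def)
    \<comment> \<open>The first two terms dominate the quotient for distant points, the last two for close ones.\<close>
    let ?E = "\<lambda>x y. ennreal c1 * (U x * k1 (- x + y)) + (ennreal c1 * (U y * k1 (- x + y)) +
      (ennreal c3 * (H y * k2 (- x + y)) + ennreal c2 * (indicator L x * (indicator L y * Q (?\<Phi> x) (?\<Phi> y)))))"
    have pointwise: "ennreal (\<bar>?u x - ?u y\<bar> powr p / norm (x - y) powr s) \<le> ?E x y" for x y
    proof (cases "\<delta> \<le> norm (x - y)")
      case True
      then have k: "k1 (- x + y) = ennreal (norm (x - y) powr (- s))"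
        using norm_minus_commute[of x y] by (simp add: k1_def)
      have "\<bar>?u x - ?u y\<bar> powr p / norm (x - y) powr s \<le> c1 * (\<bar>?u x\<bar> powr p + \<bar>?u y\<bar> powr p) * norm (x - y) powr (- s)"
        unfolding divide_powr c1_def using abs_diff_powr_le[OF p, of "?u x" "?u y"]
        by (subst mult.commute) (intro mult_right_mono, auto)
      then have "ennreal (\<bar>?u x - ?u y\<bar> powr p / norm (x - y) powr s)
          \<le> ennreal (c1 * (\<bar>?u x\<bar> powr p + \<bar>?u y\<bar> powr p) * norm (x - y) powr (- s))" by (rule ennreal_leI)
      also have "\<dots> = ennreal c1 * (U x * k1 (- x + y)) + ennreal c1 * (U y * k1 (- x + y))"
        unfolding k U_def using c by (simp add: ennreal_mult distrib_left distrib_right mult.assoc)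
      also have "\<dots> \<le> ?E x y" by (simp add: add.assoc[symmetric] add_increasing2)
      finally show ?thesis .
    next
      case False
      then have near: "dist x y < \<delta>" "dist y x < \<delta>" by (auto simp: dist_norm norm_minus_commute)
      show ?thesis
      proof (cases "x \<in> ?K \<or> y \<in> ?K")
        case False
        then have "?u x = 0" "?u y = 0" using b0 ux by auto
        then show ?thesis using p by simp
      next
        case True
        then have xy: "x \<in> L" "y \<in> L"
          using LI[of x x] LI[of x y] LI[of y x] LI[of y y] near \<delta>(1) by (auto simp: less_imp_le)
        have lip: "norm (\<Phi> x - \<Phi> y) \<le> \<Lambda> * norm (x - y)" "\<bar>b x - b y\<bar> \<le> \<Lambda>' * norm (x - y)"
          using True \<Lambda>(2)[of x y] \<Lambda>(2)[of y x] \<Lambda>'(2)[of x y] \<Lambda>'(2)[of y x] near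
          by (auto simp: norm_minus_commute abs_minus_commute)
        have k: "k2 (- x + y) = ennreal (norm (x - y) powr (p - s))"
          using near norm_minus_commute[of x y] by (simp add: k2_def dist_norm)
        have "?u x - ?u y = b x * (g (\<Phi> x) - g (\<Phi> y)) + (b x - b y) * g (\<Phi> y)"
          unfolding ux \<Phi>L[OF xy(1)] \<Phi>L[OF xy(2)] by (simp add: algebra_simps)
        then have "\<bar>?u x - ?u y\<bar> powr p \<le> 2 powr p * (\<bar>b x * (g (\<Phi> x) - g (\<Phi> y))\<bar> powr p + \<bar>(b x - b y) * g (\<Phi> y)\<bar> powr p)"
          using abs_add_powr_le[OF p] by metis
        also have "\<dots> \<le> 2 powr p * (B powr p * \<bar>g (\<Phi> x) - g (\<Phi> y)\<bar> powr p + (\<Lambda>' * norm (x - y)) powr p * \<bar>g (\<Phi> y)\<bar> powr p)"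
        proof (intro mult_left_mono add_mono)
          have "\<bar>b x\<bar> powr p \<le> B powr p" "\<bar>b x - b y\<bar> powr p \<le> (\<Lambda>' * norm (x - y)) powr p"
            using B p lip by (auto intro!: powr_mono2)
          then show "\<bar>b x * (g (\<Phi> x) - g (\<Phi> y))\<bar> powr p \<le> B powr p * \<bar>g (\<Phi> x) - g (\<Phi> y)\<bar> powr p"
            "\<bar>(b x - b y) * g (\<Phi> y)\<bar> powr p \<le> (\<Lambda>' * norm (x - y)) powr p * \<bar>g (\<Phi> y)\<bar> powr p" unfolding abs_mult
            by (subst powr_mult, simp_all add: mult_right_mono)+
        qed simp
        finally have "norm (x - y) powr (- s) * \<bar>?u x - ?u y\<bar> powr p \<le> norm (x - y) powr (- s) *
            (2 powr p * (B powr p * \<bar>g (\<Phi> x) - g (\<Phi> y)\<bar> powr p + (\<Lambda>' * norm (x - y)) powr p * \<bar>g (\<Phi> y)\<bar> powr p))"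
          by (intro mult_left_mono) auto
        also have "\<dots> = 2 powr p * B powr p * (norm (x - y) powr (- s) * \<bar>g (\<Phi> x) - g (\<Phi> y)\<bar> powr p) +
            c3 * (\<bar>g (\<Phi> y)\<bar> powr p * norm (x - y) powr (p - s))"
        proof -
          have "norm (x - y) powr (p - s) = norm (x - y) powr p * norm (x - y) powr (- s)"
            by (simp add: powr_add[symmetric])
          then show ?thesis using \<Lambda>'(1) by (simp add: c3_def powr_mult algebra_simps)
        qed
        also have "\<dots> \<le> 2 powr p * B powr p * (\<Lambda> powr s * (norm (\<Phi> x - \<Phi> y) powr (- s) * \<bar>g (\<Phi> x) - g (\<Phi> y)\<bar> powr p)) +
            c3 * (\<bar>g (\<Phi> y)\<bar> powr p * norm (x - y) powr (p - s))"
        proof (intro add_mono order_refl mult_left_mono)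
          show "norm (x - y) powr (- s) * \<bar>g (\<Phi> x) - g (\<Phi> y)\<bar> powr p
              \<le> \<Lambda> powr s * (norm (\<Phi> x - \<Phi> y) powr (- s) * \<bar>g (\<Phi> x) - g (\<Phi> y)\<bar> powr p)"
          proof (cases "\<Phi> x = \<Phi> y")
            case True
            then show ?thesis using p by simp
          next
            case ne: False
            then have n0: "norm (\<Phi> x - \<Phi> y) > 0" by simp
            then have "x \<noteq> y" by auto
            have "norm (x - y) powr (- s) = \<Lambda> powr s * (\<Lambda> * norm (x - y)) powr (- s)"
              using \<Lambda>(1) by (simp add: powr_mult powr_minus field_simps)
            also have "\<dots> \<le> \<Lambda> powr s * norm (\<Phi> x - \<Phi> y) powr (- s)"
              using n0 lip(1) s by (intro mult_left_mono powr_mono2') auto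
            finally show ?thesis by (simp add: mult.assoc[symmetric] mult_right_mono)
          qed
        qed auto
        finally have "ennreal (\<bar>?u x - ?u y\<bar> powr p / norm (x - y) powr s) \<le> 
            ennreal (c2 * (norm (\<Phi> x - \<Phi> y) powr (- s) * \<bar>g (\<Phi> x) - g (\<Phi> y)\<bar> powr p) +
              c3 * (\<bar>g (\<Phi> y)\<bar> powr p * norm (x - y) powr (p - s)))"
          unfolding divide_powr by (intro ennreal_leI) (simp add: c2_def mult.assoc)
        also have "\<dots> = ennreal c3 * (H y * k2 (- x + y)) + ennreal c2 * (indicator L x * (indicator L y * Q (?\<Phi> x) (?\<Phi> y)))"
          unfolding k H_def Q_def divide_powr \<Phi>L[OF xy(1)] \<Phi>L[OF xy(2)] using c xy
          by (simp add: ennreal_plus ennreal_mult add.commute)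
        also have "\<dots> \<le> ?E x y" by (simp add: add_increasing)
        finally show ?thesis .
      qed
    qed
    have "slob_int \<theta> p UNIV ?u \<le> (\<integral>\<^sup>+x. (\<integral>\<^sup>+y. ?E x y \<partial>lborel) \<partial>lborel)"
      using pointwise by (intro nn_integral_mono) (auto intro!: nn_integral_mono simp: s_def)
    also have "\<dots> = (\<integral>\<^sup>+x. (\<integral>\<^sup>+y. ennreal c1 * (U x * k1 (- x + y)) \<partial>lborel) \<partial>lborel)
        + ((\<integral>\<^sup>+x. (\<integral>\<^sup>+y. ennreal c1 * (U y * k1 (- x + y)) \<partial>lborel) \<partial>lborel)
        + ((\<integral>\<^sup>+x. (\<integral>\<^sup>+y. ennreal c3 * (H y * k2 (- x + y)) \<partial>lborel) \<partial>lborel)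
        + (\<integral>\<^sup>+x. (\<integral>\<^sup>+y. ennreal c2 * (indicator L x * (indicator L y * Q (?\<Phi> x) (?\<Phi> y))) \<partial>lborel) \<partial>lborel)))"
      by (simp add: nn_integral_add)
    also have "(\<integral>\<^sup>+x. (\<integral>\<^sup>+y. ennreal c1 * (U x * k1 (- x + y)) \<partial>lborel) \<partial>lborel) = ennreal (c1 * \<kappa>1) * Lp_int p UNIV ?u"
      using c \<kappa>1 by (simp add: nn_integral_cmult nn_integral_multc kint U_def[symmetric] ennreal_mult mult_ac)
    also have "(\<integral>\<^sup>+x. (\<integral>\<^sup>+y. ennreal c1 * (U y * k1 (- x + y)) \<partial>lborel) \<partial>lborel) =
        (\<integral>\<^sup>+y. (\<integral>\<^sup>+x. ennreal c1 * (U y * k1 (- x + y)) \<partial>lborel) \<partial>lborel)" by (rule lborel_pair.Fubini') measurable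
    also have "\<dots> = ennreal (c1 * \<kappa>1) * Lp_int p UNIV ?u" using c \<kappa>1
      by (simp add: nn_integral_cmult nn_integral_multc kint U_def[symmetric] ennreal_mult mult_ac)
    also have "(\<integral>\<^sup>+x. (\<integral>\<^sup>+y. ennreal c3 * (H y * k2 (- x + y)) \<partial>lborel) \<partial>lborel) =
        (\<integral>\<^sup>+y. (\<integral>\<^sup>+x. ennreal c3 * (H y * k2 (- x + y)) \<partial>lborel) \<partial>lborel)" by (rule lborel_pair.Fubini') measurable
    also have "\<dots> = ennreal (c3 * \<kappa>2) * (\<integral>\<^sup>+y. H y \<partial>lborel)" using c \<kappa>2
      by (simp add: nn_integral_cmult nn_integral_multc kint ennreal_mult mult_ac)
    also have "(\<integral>\<^sup>+x. (\<integral>\<^sup>+y. ennreal c2 * (indicator L x * (indicator L y * Q (?\<Phi> x) (?\<Phi> y))) \<partial>lborel) \<partial>lborel)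
        = ennreal c2 * (\<integral>\<^sup>+x\<in>L. (\<integral>\<^sup>+y\<in>L. Q (\<Phi> x) (\<Phi> y) \<partial>lborel) \<partial>lborel)"
    proof -
      have "(\<integral>\<^sup>+x. (\<integral>\<^sup>+y. ennreal c2 * (indicator L x * (indicator L y * Q (?\<Phi> x) (?\<Phi> y))) \<partial>lborel) \<partial>lborel)
          = ennreal c2 * (\<integral>\<^sup>+x\<in>L. (\<integral>\<^sup>+y\<in>L. Q (?\<Phi> x) (?\<Phi> y) \<partial>lborel) \<partial>lborel)"
        by (simp add: nn_integral_cmult mult.commute)
      also have "(\<integral>\<^sup>+x\<in>L. (\<integral>\<^sup>+y\<in>L. Q (?\<Phi> x) (?\<Phi> y) \<partial>lborel) \<partial>lborel) = (\<integral>\<^sup>+x\<in>L. (\<integral>\<^sup>+y\<in>L. Q (\<Phi> x) (\<Phi> y) \<partial>lborel) \<partial>lborel)"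
        using L(2) by (intro nn_integral_cong) (auto simp: indicator_def intro!: nn_integral_cong)
      finally show ?thesis .
    qed
    finally have e: "slob_int \<theta> p UNIV ?u \<le> ennreal (c1 * \<kappa>1) * Lp_int p UNIV ?u +
        (ennreal (c1 * \<kappa>1) * Lp_int p UNIV ?u + (ennreal (c3 * \<kappa>2) * (\<integral>\<^sup>+y. H y \<partial>lborel) +
        ennreal c2 * (\<integral>\<^sup>+x\<in>L. (\<integral>\<^sup>+y\<in>L. Q (\<Phi> x) (\<Phi> y) \<partial>lborel) \<partial>lborel)))" .
    have "(\<integral>\<^sup>+x\<in>L. (\<integral>\<^sup>+y\<in>L. Q (\<Phi> x) (\<Phi> y) \<partial>lborel) \<partial>lborel)
        \<le> (\<integral>\<^sup>+x\<in>L. ennreal m * (\<integral>\<^sup>+y\<in>W'. Q (\<Phi> x) y \<partial>lborel) \<partial>lborel)"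
      using W(2) by (intro nn_integral_mono mult_right_mono m(2)) auto
    also have "\<dots> \<le> ennreal m * (\<integral>\<^sup>+x\<in>W'. ennreal m * (\<integral>\<^sup>+y\<in>W'. Q x y \<partial>lborel) \<partial>lborel)"
      using W(2) by (intro m(2)) measurable
    also have "(\<integral>\<^sup>+x\<in>W'. ennreal m * (\<integral>\<^sup>+y\<in>W'. Q x y \<partial>lborel) \<partial>lborel) = ennreal m * slob_int \<theta> p W' g"
      using W(2) by (simp add: nn_integral_cmult mult.assoc Q_def s_def)
    finally have i1: "(\<integral>\<^sup>+x\<in>L. (\<integral>\<^sup>+y\<in>L. Q (\<Phi> x) (\<Phi> y) \<partial>lborel) \<partial>lborel) \<le> ennreal m * (ennreal m * slob_int \<theta> p W' g)" .
    have "(\<integral>\<^sup>+y. H y \<partial>lborel) = (\<integral>\<^sup>+y\<in>L. ennreal (\<bar>g (\<Phi> y)\<bar> powr p) \<partial>lborel)"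
      using \<Phi>L by (intro nn_integral_cong) (auto simp: H_def indicator_def)
    also have "\<dots> \<le> ennreal m * Lp_int p W' g" using W(2) by (intro m(2)) measurable
    finally have i2: "(\<integral>\<^sup>+y. H y \<partial>lborel) \<le> ennreal m * Lp_int p W' g" .
    let ?S = "Lp_int p W' g + slob_int \<theta> p W' g"
    have u: "Lp_int p UNIV ?u \<le> ennreal C0 * ?S" by (rule order_trans[OF C0(2)[OF g] mult_left_mono]) simp_all
    have H: "(\<integral>\<^sup>+y. H y \<partial>lborel) \<le> ennreal m * ?S" by (rule order_trans[OF i2 mult_left_mono]) simp_all
    have "ennreal m * (ennreal m * slob_int \<theta> p W' g) \<le> ennreal (m * m) * ?S"
      using m(1) by (intro ennreal_bound_cmult mult_left_mono) simp_all
    with i1 have "(\<integral>\<^sup>+x\<in>L. (\<integral>\<^sup>+y\<in>L. Q (\<Phi> x) (\<Phi> y) \<partial>lborel) \<partial>lborel) \<le> ennreal (m * m) * ?S" by (rule order_trans)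
    with u H show ?thesis unfolding C_def using c \<kappa>1(2) \<kappa>2(2) m(1) C0(1)
      by (intro order_trans[OF e] ennreal_bound_add ennreal_bound_cmult add_nonneg_nonneg mult_nonneg_nonneg) simp_all
  qed
  have "slob_int \<theta> p UNIV (pullback W b \<Phi> g) \<le> ennreal C * (Lp_int p W' g + slob_int \<theta> p W' g)"
    if g: "borel_on W' g" for g
  proof -
    let ?g = "\<lambda>y. indicator W' y * g y"
    have "indicator W' y * ?g y = ?g y" for y by (simp add: indicator_def)
    then have g': "borel_on W' ?g" using g by simp
    show ?thesis using main[OF g' g] unfolding pullback_indicator[OF d] Lp_int_indicator[OF p] slob_int_indicator .
  qed
  moreover have "0 \<le> C" using c \<kappa>1(2) \<kappa>2(2) m(1) C0(1) by (simp add: C_def)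
  ultimately show ?thesis by blast
qed


section \<open>Weak derivatives of localised pull-backs\<close>

lemma pderiv1_sum_list:
  fixes f :: "'z \<Rightarrow> real^'n::finite \<Rightarrow> real"
  assumes "\<And>z. z \<in> set L \<Longrightarrow> smooth_on UNIV (f z)"
  shows "smooth_on UNIV (\<lambda>x. \<Sum>z\<leftarrow>L. f z x) \<and> pderiv1 j (\<lambda>x. \<Sum>z\<leftarrow>L. f z x) = (\<lambda>x. \<Sum>z\<leftarrow>L. pderiv1 j (f z) x)"
  using assms
proof (induction L)
  case Nil
  then show ?case using pderiv1_cmult[of "\<lambda>_. 0" 0 j] by simp
next
  case (Cons z L)
  then show ?case by (simp add: smooth_on_add pderiv1_add fun_eq_iff)
qed

lemma pullback_cmult_coeff: "pullback W (\<lambda>x. c * b x) \<Phi> f = (\<lambda>x. c * pullback W b \<Phi> f x)"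
  by (auto simp: pullback_def)

lemma pullback_add: "pullback W b \<Phi> (\<lambda>x. f x + g x) = (\<lambda>x. pullback W b \<Phi> f x + pullback W b \<Phi> g x)"
  by (auto simp: pullback_def distrib_left)

lemma pullback_cmult: "pullback W b \<Phi> (\<lambda>x. c * f x) = (\<lambda>x. c * pullback W b \<Phi> f x)"
  by (auto simp: pullback_def)

lemma pullback_test:
  assumes d: "diffeo W W' \<Phi> \<Psi>" and b: "b \<in> test_functions W" and f: "smooth_on UNIV f"
  shows "pullback W b \<Phi> f \<in> test_functions W"
  using d by (intro test_functions_pullback[where W' = W'] b smooth_on_subset[OF f]) (auto simp: diffeo_def)

text \<open>In the inductive step the derivative \<open>(\<partial>\<^sub>i \<eta>) \<circ> \<Phi>\<close> is expressed by the derivatives of \<open>\<eta> \<circ> \<Phi>\<close>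
  through the inverse of the Jacobian matrix, and the coefficient is moved inside the derivative by
  the product rule.\<close>

lemma pullback_pderiv_mi:
  assumes d: "diffeo W W' \<Phi> \<Psi>" and b: "b \<in> test_functions W"
  shows "\<exists>L. (\<forall>(\<mu>, c)\<in>set L. mi_order \<mu> \<le> mi_order \<nu> \<and> c \<in> test_functions W) \<and>
    (\<forall>\<xi>. smooth_on UNIV \<xi> \<longrightarrow>
      pullback W b \<Phi> (pderiv_mi \<nu> \<xi>) = (\<lambda>x. \<Sum>(\<mu>, c)\<leftarrow>L. pderiv_mi \<mu> (pullback W c \<Phi> \<xi>) x))" using b
proof (induction \<nu> arbitrary: b rule: mi_induct)
  case zero
  then show ?case by (intro exI[of _ "[(\<lambda>_. 0, b)]"]) auto
next
  case (inc \<nu> i)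
  have W: "open W" "open W'" "smooth_on W \<Phi>" "smooth_on W' \<Psi>" "\<Phi> ` W \<subseteq> W'" using d by (auto simp: diffeo_def)
  \<comment> \<open>an entry of the inverse Jacobian matrix; \<open>B0\<close> below collects the terms of the product rule in which
    the coefficients are differentiated\<close>
  define M where "M j x = fderiv \<Psi> (\<Phi> x) (axis i 1) $ j" for j x
  have M: "smooth_on W (M j)" for j unfolding M_def
    by (intro smooth_on_vec_nth W smooth_on_compose[OF W(3) _ W(1,2,5)] smooth_on_frechet_derivative)
  define B where "B j x = M j x * b x" for j x
  have B: "B j \<in> test_functions W" for j unfolding B_def by (rule test_functions_mult_smooth[OF W(1) M inc.prems])
  define B0 where "B0 x = (\<Sum>j\<in>UNIV. (- 1) * pderiv1 j (B j) x)" for x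
  have B0: "B0 \<in> test_functions W"
    unfolding B0_def by (intro test_functions_sum test_functions_cmult test_functions_pderiv1 B)
  have IH: "\<forall>j. \<exists>L. (\<forall>(\<mu>, c)\<in>set L. mi_order \<mu> \<le> mi_order \<nu> \<and> c \<in> test_functions W) \<and>
    (\<forall>\<xi>. smooth_on UNIV \<xi> \<longrightarrow>
      pullback W (B j) \<Phi> (pderiv_mi \<nu> \<xi>) = (\<lambda>x. \<Sum>(\<mu>, c)\<leftarrow>L. pderiv_mi \<mu> (pullback W c \<Phi> \<xi>) x))"
    using inc.IH[OF B] by blast
  obtain L where L': "\<forall>j. (\<forall>(\<mu>, c)\<in>set (L j). mi_order \<mu> \<le> mi_order \<nu> \<and> c \<in> test_functions W) \<and>
    (\<forall>\<xi>. smooth_on UNIV \<xi> \<longrightarrow>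
      pullback W (B j) \<Phi> (pderiv_mi \<nu> \<xi>) = (\<lambda>x. \<Sum>(\<mu>, c)\<leftarrow>L j. pderiv_mi \<mu> (pullback W c \<Phi> \<xi>) x))"
    using choice[OF IH] by blast
  then have L: "\<And>j \<mu> c. (\<mu>, c) \<in> set (L j) \<Longrightarrow> mi_order \<mu> \<le> mi_order \<nu> \<and> c \<in> test_functions W"
    "\<And>j \<xi>. smooth_on UNIV \<xi> \<Longrightarrow> pullback W (B j) \<Phi> (pderiv_mi \<nu> \<xi>) =
      (\<lambda>x. \<Sum>(\<mu>, c)\<leftarrow>L j. pderiv_mi \<mu> (pullback W c \<Phi> \<xi>) x)" by fast+
  obtain L0 where L0: "\<And>\<mu> c. (\<mu>, c) \<in> set L0 \<Longrightarrow> mi_order \<mu> \<le> mi_order \<nu> \<and> c \<in> test_functions W"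
    "\<And>\<xi>. smooth_on UNIV \<xi> \<Longrightarrow> pullback W B0 \<Phi> (pderiv_mi \<nu> \<xi>) =
      (\<lambda>x. \<Sum>(\<mu>, c)\<leftarrow>L0. pderiv_mi \<mu> (pullback W c \<Phi> \<xi>) x)" using inc.IH[OF B0] by blast
  obtain js :: "'a list" where js: "set js = UNIV" "distinct js" using finite_distinct_list[OF finite_class.finite_UNIV] by blast
  let ?L = "concat (map (\<lambda>j. map (\<lambda>(\<mu>, c). (mi_inc \<mu> j, c)) (L j)) js) @ L0"
  have "pullback W b \<Phi> (pderiv_mi (mi_inc \<nu> i) \<xi>) = (\<lambda>x. \<Sum>(\<mu>, c)\<leftarrow>?L. pderiv_mi \<mu> (pullback W c \<Phi> \<xi>) x)"
    if \<xi>: "smooth_on UNIV \<xi>" for \<xi>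
  proof
    fix x
    let ?\<eta> = "pderiv_mi \<nu> \<xi>"
    have \<eta>: "smooth_on UNIV ?\<eta>" by (rule smooth_on_pderiv_mi[OF \<xi>])
    have sm: "smooth_on UNIV (pullback W (B j) \<Phi> ?\<eta>)" for j using test_functionsD(1)[OF pullback_test[OF d B \<eta>]] .
    have step: "pullback W b \<Phi> (pderiv_mi (mi_inc \<nu> i) \<xi>) x =
      (\<Sum>j\<in>UNIV. pderiv1 j (pullback W (B j) \<Phi> ?\<eta>) x) + pullback W B0 \<Phi> ?\<eta> x"
    proof (cases "x \<in> W")
      case True
      have D\<Phi>: "(\<Phi> has_derivative fderiv \<Phi> x) (at x)" using smooth_on_differentiable(2)[OF W(3) True] .
      have D\<eta>: "(?\<eta> has_derivative fderiv ?\<eta> y) (at y)" for y using smooth_on_differentiable(2)[OF \<eta>] by simp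
      have Dc: "((\<lambda>y. ?\<eta> (\<Phi> y)) has_derivative (\<lambda>h. fderiv ?\<eta> (\<Phi> x) (fderiv \<Phi> x h))) (at x)"
        by (rule has_derivative_compose[OF D\<Phi> D\<eta>])
      have DB: "(B j has_derivative fderiv (B j) x) (at x)" for j
        using smooth_on_differentiable(2)[OF test_functionsD(1)[OF B]] by simp
      have "pderiv1 j (pullback W (B j) \<Phi> ?\<eta>) x =
          B j x * fderiv ?\<eta> (\<Phi> x) (fderiv \<Phi> x (axis j 1)) + pderiv1 j (B j) x * ?\<eta> (\<Phi> x)" for j
      proof -
        have "((\<lambda>y. B j y * ?\<eta> (\<Phi> y)) has_derivative (\<lambda>h. B j x * fderiv ?\<eta> (\<Phi> x) (fderiv \<Phi> x h)
            + fderiv (B j) x h * ?\<eta> (\<Phi> x))) (at x)" by (rule has_derivative_mult[OF DB Dc])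
        then have "(pullback W (B j) \<Phi> ?\<eta> has_derivative (\<lambda>h. B j x * fderiv ?\<eta> (\<Phi> x) (fderiv \<Phi> x h)
            + fderiv (B j) x h * ?\<eta> (\<Phi> x))) (at x)"
          by (rule has_derivative_transform_within_open[OF _ W(1) True]) (simp add: pullback_def)
        from fun_cong[OF frechet_derivative_at[OF this], of "axis j 1"] show ?thesis by simp
      qed
      moreover have "pullback W B0 \<Phi> ?\<eta> x = - (\<Sum>j\<in>UNIV. pderiv1 j (B j) x * ?\<eta> (\<Phi> x))"
        using True by (simp add: pullback_def B0_def sum_negf sum_distrib_right)
      moreover have "(\<Sum>j\<in>UNIV. B j x * fderiv ?\<eta> (\<Phi> x) (fderiv \<Phi> x (axis j 1)))
          = b x * fderiv ?\<eta> (\<Phi> x) (axis i 1)"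
      proof -
        have D\<Psi>: "(\<Psi> has_derivative fderiv \<Psi> (\<Phi> x)) (at (\<Phi> x))"
          using smooth_on_differentiable(2)[OF W(4), of "\<Phi> x"] True W(5) by blast
        have "((\<lambda>y. \<Phi> (\<Psi> y)) has_derivative (\<lambda>h. fderiv \<Phi> x (fderiv \<Psi> (\<Phi> x) h))) (at (\<Phi> x))"
          using has_derivative_compose[OF D\<Psi>, of \<Phi> "fderiv \<Phi> x"] D\<Phi> d True by (simp add: diffeo_def)
        moreover have "((\<lambda>y. \<Phi> (\<Psi> y)) has_derivative (\<lambda>h. h)) (at (\<Phi> x))"
          by (rule has_derivative_transform_within_open[OF has_derivative_ident W(2)])
            (use d True in \<open>auto simp: diffeo_def\<close>)
        ultimately have inv: "fderiv \<Phi> x (fderiv \<Psi> (\<Phi> x) h) = h" for h using has_derivative_unique by metis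
        let ?v = "fderiv \<Psi> (\<Phi> x) (axis i 1)"
        let ?T = "\<lambda>h. fderiv ?\<eta> (\<Phi> x) (fderiv \<Phi> x h)"
        have lin: "linear ?T" using Dc by (rule has_derivative_linear)
        have v: "?v = (\<Sum>j\<in>UNIV. (?v $ j) *\<^sub>R axis j 1)" by (auto simp: vec_eq_iff axis_def if_distrib cong: if_cong)
        have "fderiv ?\<eta> (\<Phi> x) (axis i 1) = ?T ?v" by (simp add: inv)
        also have "\<dots> = (\<Sum>j\<in>UNIV. M j x * ?T (axis j 1))"
          by (subst v) (simp only: linear_sum[OF lin] linear_scale[OF lin] real_scaleR_def M_def)
        finally show ?thesis by (simp add: B_def sum_distrib_left mult_ac)
      qed
      ultimately show ?thesis using True by (simp add: pullback_def[of W b] pderiv_mi_inc(1)[OF \<xi>] sum.distrib)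
    next
      case False
      have "x \<notin> closure {x. pullback W (B j) \<Phi> ?\<eta> x \<noteq> 0}" for j
        using False test_functionsD(3)[OF pullback_test[OF d B \<eta>]] by blast
      then have "pderiv1 j (pullback W (B j) \<Phi> ?\<eta>) x = 0" for j
        using pderiv_mi_support[of "mi_inc (\<lambda>_. 0) j" "pullback W (B j) \<Phi> ?\<eta>" x] pderiv_mi_unit[OF sm] by metis
      then show ?thesis using False by (simp add: pullback_def)
    qed
    have "pderiv1 j (pullback W (B j) \<Phi> ?\<eta>) x = (\<Sum>(\<mu>, c)\<leftarrow>L j. pderiv_mi (mi_inc \<mu> j) (pullback W c \<Phi> \<xi>) x)" for j
    proof -
      have s: "smooth_on UNIV (case z of (\<mu>, c) \<Rightarrow> pderiv_mi \<mu> (pullback W c \<Phi> \<xi>))" if "z \<in> set (L j)" for z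
        using L(1)[of "fst z" "snd z" j] that
        by (cases z) (auto intro!: smooth_on_pderiv_mi test_functionsD(1)[OF pullback_test[OF d _ \<xi>]])
      have "pullback W (B j) \<Phi> ?\<eta> = (\<lambda>x. \<Sum>z\<leftarrow>L j. (case z of (\<mu>, c) \<Rightarrow> pderiv_mi \<mu> (pullback W c \<Phi> \<xi>)) x)"
        unfolding L(2)[OF \<xi>] by (intro ext arg_cong[where f = sum_list] map_cong) (auto split: prod.split)
      then have "pderiv1 j (pullback W (B j) \<Phi> ?\<eta>) x =
          (\<Sum>z\<leftarrow>L j. pderiv1 j (case z of (\<mu>, c) \<Rightarrow> pderiv_mi \<mu> (pullback W c \<Phi> \<xi>)) x)"
        using pderiv1_sum_list[of "L j" "\<lambda>z. case z of (\<mu>, c) \<Rightarrow> pderiv_mi \<mu> (pullback W c \<Phi> \<xi>)" j] s by metis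
      also have "\<dots> = (\<Sum>(\<mu>, c)\<leftarrow>L j. pderiv_mi (mi_inc \<mu> j) (pullback W c \<Phi> \<xi>) x)"
      proof (intro arg_cong[where f = sum_list] map_cong refl)
        fix z assume z: "z \<in> set (L j)"
        obtain \<mu> c where zz: "z = (\<mu>, c)" by (cases z)
        have "smooth_on UNIV (pullback W c \<Phi> \<xi>)"
          using L(1)[of \<mu> c j] z zz by (auto intro!: test_functionsD(1)[OF pullback_test[OF d _ \<xi>]])
        then show "pderiv1 j (case z of (\<mu>, c) \<Rightarrow> pderiv_mi \<mu> (pullback W c \<Phi> \<xi>)) x =
            (case z of (\<mu>, c) \<Rightarrow> pderiv_mi (mi_inc \<mu> j) (pullback W c \<Phi> \<xi>) x)" by (simp add: zz pderiv_mi_inc(1))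
      qed
      finally show ?thesis .
    qed
    then have "(\<Sum>j\<in>UNIV. pderiv1 j (pullback W (B j) \<Phi> ?\<eta>) x) =
        (\<Sum>j\<leftarrow>js. \<Sum>(\<mu>, c)\<leftarrow>L j. pderiv_mi (mi_inc \<mu> j) (pullback W c \<Phi> \<xi>) x)"
      using js by (simp add: sum.distinct_set_conv_list[OF js(2), symmetric])
    also have "\<dots> = (\<Sum>(\<mu>, c)\<leftarrow>concat (map (\<lambda>j. map (\<lambda>(\<mu>, c). (mi_inc \<mu> j, c)) (L j)) js). pderiv_mi \<mu> (pullback W c \<Phi> \<xi>) x)"
      by (induction js) (simp_all add: o_def case_prod_unfold)
    finally show "pullback W b \<Phi> (pderiv_mi (mi_inc \<nu> i) \<xi>) x = (\<Sum>(\<mu>, c)\<leftarrow>?L. pderiv_mi \<mu> (pullback W c \<Phi> \<xi>) x)"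
      using step L0(2)[OF \<xi>] by simp
  qed
  moreover have "mi_order \<mu> \<le> mi_order (mi_inc \<nu> i) \<and> c \<in> test_functions W" if "(\<mu>, c) \<in> set ?L" for \<mu> c
    using that L(1) L0(1) by (auto simp: mi_order_inc le_SucI)
  ultimately show ?case by (intro exI[of _ ?L]) blast
qed

text \<open>The weight of the transpose of a localised pull-back, which is a localised pull-back by the inverse map.\<close>

definition adjoint_weight ::
  "(real^'n::finite) set \<Rightarrow> (real^'n \<Rightarrow> real^'n) \<Rightarrow> (real^'n \<Rightarrow> real) \<Rightarrow> real^'n \<Rightarrow> real"
  where "adjoint_weight W' \<Psi> a y = (if y \<in> W' then a (\<Psi> y) * jac_det \<Psi> y else 0)"

lemma test_functions_adjoint_weight:
  assumes d: "diffeo W W' \<Phi> \<Psi>" and a: "a \<in> test_functions W"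
  shows "adjoint_weight W' \<Psi> a \<in> test_functions W'"
proof (rule test_functionsI)
  let ?K = "supp a"
  have W: "open W'" "open W" "smooth_on W' \<Psi>" "\<Psi> ` W' \<subseteq> W" "smooth_on W \<Phi>" using d by (auto simp: diffeo_def)
  have K: "compact (\<Phi> ` ?K)" "\<Phi> ` ?K \<subseteq> W'"
    using d test_functionsD(2,3)[OF a] continuous_on_subset[OF smooth_on_imp_continuous_on[OF W(5)]]
    by (auto intro!: compact_continuous_image simp: diffeo_def)
  then show "compact (\<Phi> ` ?K)" "\<Phi> ` ?K \<subseteq> W'" by auto
  show supp: "y \<in> \<Phi> ` ?K" if "adjoint_weight W' \<Psi> a y \<noteq> 0" for y using that d closure_subset[of "{x. a x \<noteq> 0}"]
    by (intro image_eqI[of _ _ "\<Psi> y"]) (auto simp: adjoint_weight_def diffeo_def split: if_splits)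
  have "smooth_on W' (\<lambda>y. a (\<Psi> y) * jac_det \<Psi> y)" using diffeo_jac_det_pos[OF diffeo_sym[OF d]] 
    by (intro smooth_on_mult smooth_on_abs smooth_on_det_derivative W smooth_on_compose[OF W(3) _ W(1,2,4)]
        smooth_on_subset[OF test_functionsD(1)[OF a]]) auto
  then have "smooth_on W' (adjoint_weight W' \<Psi> a)"
    by (rule smooth_on_cong[OF W(1), rotated]) (simp add: adjoint_weight_def)
  then show "smooth_on UNIV (adjoint_weight W' \<Psi> a)"
    by (rule smooth_on_extend_zero[OF W(1) compact_imp_closed[OF K(1)] K(2)]) (use supp in blast)
qed

lemma integral_pullback_adjoint:
  assumes d: "diffeo W W' \<Phi> \<Psi>" and a: "a \<in> test_functions W"
    and f: "borel_on W' f" and g: "g \<in> borel_measurable borel"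
  shows "(\<integral>x. pullback W a \<Phi> f x * g x \<partial>lborel) = (\<integral>y. f y * pullback W' (adjoint_weight W' \<Psi> a) \<Psi> g y \<partial>lborel)"
proof -
  let ?h = "\<lambda>x. pullback W a \<Phi> f x * g x"
  have "(\<lambda>x. indicator W x * ?h x) = ?h" by (auto simp: pullback_def indicator_def)
  then have "(LINT y:W'|lborel. jac_det \<Psi> y * ?h (\<Psi> y)) = (LINT x:W|lborel. ?h x)"
    using pullback_borel[OF d a f] g by (intro set_integral_diffeo[OF diffeo_sym[OF d]]) simp
  moreover have "(LINT x:W|lborel. ?h x) = (\<integral>x. ?h x \<partial>lborel)" unfolding set_lebesgue_integral_def
    by (intro Bochner_Integration.integral_cong) (auto simp: pullback_def indicator_def)
  moreover have "(LINT y:W'|lborel. jac_det \<Psi> y * ?h (\<Psi> y)) =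
      (\<integral>y. f y * pullback W' (adjoint_weight W' \<Psi> a) \<Psi> g y \<partial>lborel)" unfolding set_lebesgue_integral_def using d
    by (intro Bochner_Integration.integral_cong) (auto simp: pullback_def indicator_def adjoint_weight_def diffeo_def)
  ultimately show ?thesis by simp
qed

text \<open>The pull-back only sees the values of \<open>g\<close> on the compact image of the support of \<open>b\<close>.\<close>

lemma integrable_pullback:
  assumes d: "diffeo W W' \<Phi> \<Psi>" and b: "b \<in> test_functions W" and g: "locally_integrable W' g"
  shows "integrable lborel (pullback W b \<Phi> g)"
proof -
  let ?K = "supp b"
  have W: "open W'" "smooth_on W \<Phi>" using d by (auto simp: diffeo_def)
  note K = test_functionsD(2,3)[OF b]
  have gm: "borel_on W' g" by (rule locally_integrable_measurable[OF W(1) g])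
  obtain B where B: "B > 0" "\<And>x. \<bar>b x\<bar> \<le> B" by (rule test_function_bounded[OF b]) (rule that)
  obtain m where m: "0 < m" "\<And>h :: real^'a \<Rightarrow> ennreal. (\<lambda>y. h y * indicator W' y) \<in> borel_measurable borel \<Longrightarrow>
    (\<integral>\<^sup>+x\<in>?K. h (\<Phi> x) \<partial>lborel) \<le> ennreal m * (\<integral>\<^sup>+y\<in>W'. h y \<partial>lborel)"
    by (rule diffeo_nn_integral_compact_le[OF d K]) (rule that)
  have im: "compact (\<Phi> ` ?K)" "\<Phi> ` ?K \<subseteq> W'" using d K continuous_on_subset[OF smooth_on_imp_continuous_on[OF W(2)]]
    by (auto intro!: compact_continuous_image simp: diffeo_def)
  let ?h = "\<lambda>y. ennreal \<bar>indicator (\<Phi> ` ?K) y * g y\<bar>"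
  have gi: "integrable lborel (\<lambda>y. indicator (\<Phi> ` ?K) y * g y)"
    using g im by (auto simp: locally_integrable_def set_integrable_def)
  have hm: "(\<lambda>y. ennreal B * ?h y * indicator W' y) \<in> borel_measurable borel"
    using borel_measurable_integrable[OF gi] borel_open[OF W(1)] by measurable
  show ?thesis
  proof (rule integrableI_bounded)
    show "pullback W b \<Phi> g \<in> borel_measurable lborel" using pullback_borel[OF d b gm] by simp
    have "(\<integral>\<^sup>+x. ennreal (norm (pullback W b \<Phi> g x)) \<partial>lborel) \<le> (\<integral>\<^sup>+x\<in>?K. ennreal B * ?h (\<Phi> x) \<partial>lborel)"
    proof (rule nn_integral_mono)
      fix x
      show "ennreal (norm (pullback W b \<Phi> g x)) \<le> ennreal B * ?h (\<Phi> x) * indicator ?K x"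
      proof (cases "b x = 0")
        case False
        then have "x \<in> ?K" using closure_subset[of "{x. b x \<noteq> 0}"] by auto
        moreover have "\<bar>b x * g (\<Phi> x)\<bar> \<le> B * \<bar>g (\<Phi> x)\<bar>" using B by (auto simp: abs_mult intro!: mult_right_mono)
        ultimately show ?thesis using B(1) by (auto simp: pullback_def ennreal_mult[symmetric] intro!: ennreal_leI)
      qed (simp add: pullback_def)
    qed
    also have "\<dots> \<le> ennreal m * (\<integral>\<^sup>+y\<in>W'. ennreal B * ?h y \<partial>lborel)" by (rule m(2)[OF hm])
    also have "\<dots> \<le> ennreal m * (\<integral>\<^sup>+y. ennreal B * ?h y \<partial>lborel)"
      by (intro mult_left_mono nn_integral_mono) (auto simp: indicator_def)
    also have "\<dots> = ennreal m * (ennreal B * (\<integral>\<^sup>+y. ?h y \<partial>lborel))"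
      using borel_measurable_integrable[OF gi] by (subst nn_integral_cmult) auto
    also have "\<dots> < \<infinity>" using gi by (auto simp: integrable_iff_bounded ennreal_mult_less_top)
    finally show "(\<integral>\<^sup>+x. ennreal (norm (pullback W b \<Phi> g x)) \<partial>lborel) < \<infinity>" .
  qed
qed

text \<open>The pull-back is transposed onto the test function, where the preceding expansion applies, and each term
  of the expansion is transposed back. The coefficients depend on the map and the weight alone, so they
  are chosen before \<open>f\<close>.\<close>

lemma weak_derivs_pullback:
  assumes d: "diffeo W W' \<Phi> \<Psi>" and a: "a \<in> test_functions W" and W: "W' \<subseteq> \<Omega>'"
  shows "\<exists>(N :: nat) \<mu> e. (\<forall>i<N. mi_order (\<mu> i) \<le> mi_order \<nu> \<and> e i \<in> test_functions W) \<and>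
    (\<forall>f F. locally_integrable \<Omega>' f \<longrightarrow> (\<forall>i<N. F i \<in> weak_derivs \<Omega>' (\<mu> i) f) \<longrightarrow>
      (\<lambda>x. \<Sum>i<N. pullback W (e i) \<Phi> (F i) x) \<in> weak_derivs \<Omega> \<nu> (pullback W a \<Phi> f))"
proof -
  note d' = diffeo_sym[OF d]
  let ?a = "adjoint_weight W' \<Psi> a"
  have a': "?a \<in> test_functions W'" by (rule test_functions_adjoint_weight[OF d a])
  obtain L where L: "\<And>\<mu> c. (\<mu>, c) \<in> set L \<Longrightarrow> mi_order \<mu> \<le> mi_order \<nu> \<and> c \<in> test_functions W'"
    "\<And>\<xi>. smooth_on UNIV \<xi> \<Longrightarrow> pullback W' ?a \<Psi> (pderiv_mi \<nu> \<xi>) = (\<lambda>x. \<Sum>(\<mu>, c)\<leftarrow>L. pderiv_mi \<mu> (pullback W' c \<Psi> \<xi>) x)"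
    using pullback_pderiv_mi[OF d' a', of \<nu>] by blast
  define \<mu> where "\<mu> i = fst (L ! i)" for i
  define c where "c i = snd (L ! i)" for i
  define e where "e i x = (-1) ^ mi_order \<nu> * (-1) ^ mi_order (\<mu> i) * adjoint_weight W \<Phi> (c i) x" for i x
  have Li: "mi_order (\<mu> i) \<le> mi_order \<nu>" "c i \<in> test_functions W'" if "i < length L" for i
    using L(1)[of "\<mu> i" "c i"] nth_mem[OF that] by (simp_all add: \<mu>_def c_def)
  have e: "e i \<in> test_functions W" if "i < length L" for i
    unfolding e_def by (intro test_functions_cmult test_functions_adjoint_weight[OF d' Li(2)[OF that]])
  have "(\<lambda>x. \<Sum>i<length L. pullback W (e i) \<Phi> (F i) x) \<in> weak_derivs \<Omega> \<nu> (pullback W a \<Phi> f)"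
    if f: "locally_integrable \<Omega>' f" and F: "\<And>i. i < length L \<Longrightarrow> F i \<in> weak_derivs \<Omega>' (\<mu> i) f" for f F
  proof -
    have fm: "borel_on W' u" if "locally_integrable \<Omega>' u" for u
      using d locally_integrable_measurable[OF _ locally_integrable_subset[OF that W]] by (simp add: diffeo_def)
    have Fi: "integrable lborel (pullback W (e i) \<Phi> (F i))" if "i < length L" for i
      by (rule integrable_pullback[OF d e[OF that] locally_integrable_subset[OF weak_derivsD[OF F[OF that]] W]])
    have "locally_integrable \<Omega> (pullback W a \<Phi> f)"
      by (rule integrable_imp_locally_integrable[OF integrable_pullback[OF d a locally_integrable_subset[OF f W]]])
    moreover have "locally_integrable \<Omega> (\<lambda>x. \<Sum>i<length L. pullback W (e i) \<Phi> (F i) x)"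
      using Fi by (intro integrable_imp_locally_integrable Bochner_Integration.integrable_sum) auto
    moreover have "(\<integral>x. pullback W a \<Phi> f x * pderiv_mi \<nu> \<xi> x \<partial>lborel) =
        (-1) ^ mi_order \<nu> * (\<integral>x. (\<Sum>i<length L. pullback W (e i) \<Phi> (F i) x) * \<xi> x \<partial>lborel)"
      if \<xi>: "\<xi> \<in> test_functions \<Omega>" for \<xi>
    proof -
      note s\<xi> = test_functionsD(1)[OF \<xi>]
      have t: "pullback W' (c i) \<Psi> \<xi> \<in> test_functions \<Omega>'" if "i < length L" for i
        by (rule test_functions_mono[OF W pullback_test[OF d' Li(2)[OF that] s\<xi>]])
      have "(\<integral>x. pullback W a \<Phi> f x * pderiv_mi \<nu> \<xi> x \<partial>lborel) = (\<integral>y. f y * pullback W' ?a \<Psi> (pderiv_mi \<nu> \<xi>) y \<partial>lborel)"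
        by (rule integral_pullback_adjoint[OF d a fm[OF f] test_function_measurable[OF test_functions_pderiv_mi[OF \<xi>]]])
      also have "\<dots> = (\<integral>y. (\<Sum>i<length L. f y * pderiv_mi (\<mu> i) (pullback W' (c i) \<Psi> \<xi>) y) \<partial>lborel)"
        unfolding L(2)[OF s\<xi>]
        by (simp add: sum_list_sum_nth atLeast0LessThan case_prod_unfold \<mu>_def c_def sum_distrib_left)
      also have "\<dots> = (\<Sum>i<length L. \<integral>y. f y * pderiv_mi (\<mu> i) (pullback W' (c i) \<Psi> \<xi>) y \<partial>lborel)"
        by (intro Bochner_Integration.integral_sum set_integrable_mult_test(1)[OF f] test_functions_pderiv_mi t) simp
      also have "\<dots> = (\<Sum>i<length L. (-1) ^ mi_order \<nu> * (\<integral>x. pullback W (e i) \<Phi> (F i) x * \<xi> x \<partial>lborel))"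
      proof (intro sum.cong refl)
        fix i assume "i \<in> {..<length L}"
        then have i: "i < length L" by simp
        have "(\<integral>y. f y * pderiv_mi (\<mu> i) (pullback W' (c i) \<Psi> \<xi>) y \<partial>lborel) =
            (-1) ^ mi_order (\<mu> i) * (\<integral>y. F i y * pullback W' (c i) \<Psi> \<xi> y \<partial>lborel)"
          using F[OF i] t[OF i] by (simp add: weak_derivs_iff[OF f])
        also have "(\<integral>y. F i y * pullback W' (c i) \<Psi> \<xi> y \<partial>lborel) = (\<integral>y. pullback W' (c i) \<Psi> \<xi> y * F i y \<partial>lborel)"
          by (simp add: mult.commute)
        also have "(\<integral>y. pullback W' (c i) \<Psi> \<xi> y * F i y \<partial>lborel) =
            (\<integral>y. pullback W' (c i) \<Psi> \<xi> y * (indicator W' y * F i y) \<partial>lborel)"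
          by (intro Bochner_Integration.integral_cong) (auto simp: pullback_def)
        also have "\<dots> = (\<integral>x. \<xi> x * pullback W (adjoint_weight W \<Phi> (c i)) \<Phi> (\<lambda>y. indicator W' y * F i y) x \<partial>lborel)"
        proof (rule integral_pullback_adjoint[OF d' Li(2)[OF i] _ fm[OF weak_derivsD[OF F[OF i]]]])
          have "W \<in> sets borel" using d by (auto simp: diffeo_def)
          then show "borel_on W \<xi>" using test_function_measurable[OF \<xi>] by measurable
        qed
        also have "pullback W (adjoint_weight W \<Phi> (c i)) \<Phi> (\<lambda>y. indicator W' y * F i y) = pullback W (adjoint_weight W \<Phi> (c i)) \<Phi> (F i)"
          by (rule pullback_indicator[OF d])
        finally show "(\<integral>y. f y * pderiv_mi (\<mu> i) (pullback W' (c i) \<Psi> \<xi>) y \<partial>lborel) =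
            (-1) ^ mi_order \<nu> * (\<integral>x. pullback W (e i) \<Phi> (F i) x * \<xi> x \<partial>lborel)"
          unfolding e_def[abs_def] pullback_cmult_coeff
          by (simp add: mult.assoc mult.commute[of "\<xi> _"] minus_one_power_iff)
      qed
      also have "\<dots> = (-1) ^ mi_order \<nu> * (\<Sum>i<length L. \<integral>x. pullback W (e i) \<Phi> (F i) x * \<xi> x \<partial>lborel)"
        by (simp add: sum_distrib_left)
      also have "(\<Sum>i<length L. \<integral>x. pullback W (e i) \<Phi> (F i) x * \<xi> x \<partial>lborel) =
          (\<integral>x. (\<Sum>i<length L. pullback W (e i) \<Phi> (F i) x * \<xi> x) \<partial>lborel)"
        using Fi by (intro Bochner_Integration.integral_sum[symmetric] set_integrable_mult_test(1)[OF integrable_imp_locally_integrable \<xi>]) simp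
      finally show ?thesis by (simp add: sum_distrib_right)
    qed
    ultimately show ?thesis by (simp add: weak_derivs_iff)
  qed
  then show ?thesis using Li(1) e by (intro exI[of _ "length L"] exI[of _ \<mu>] exI[of _ e]) blast
qed


section \<open>Boundedness of localised pull-backs on Sobolev spaces\<close>

lemma ennreal_root_add_le:
  assumes "0 < p" "0 \<le> c" "I \<le> ennreal c * (A + B)"
  shows "ennreal_root p I \<le> ennreal (((c + 1) * 3) powr (1 / p)) * (ennreal_root p A + ennreal_root p B)"
  using ennreal_root_sum_le[OF assms(1) finite_class.finite_UNIV assms(2), of I "\<lambda>b. if b then A else B"] assms(3)
  by (simp add: UNIV_bool add.commute)

lemma ennreal_root_finite_iff: "ennreal_root p a < \<infinity> \<longleftrightarrow> a < \<infinity>"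
  by (auto simp: ennreal_root_def less_top[symmetric])

lemma Lp_norm_mono_set: "0 < p \<Longrightarrow> \<Omega> \<subseteq> \<Omega>' \<Longrightarrow> Lp_norm p \<Omega> f \<le> Lp_norm p \<Omega>' f"
  unfolding Lp_norm_def by (intro ennreal_root_mono nn_integral_mono) (auto simp: indicator_def)

lemma slob_int_mono_set: "\<Omega> \<subseteq> \<Omega>' \<Longrightarrow> slob_int \<theta> p \<Omega> f \<le> slob_int \<theta> p \<Omega>' f"
  by (intro nn_integral_mono mult_mono) (auto simp: indicator_def intro!: nn_integral_mono)

lemma slobodeckij_mono_set: "0 < p \<Longrightarrow> \<Omega> \<subseteq> \<Omega>' \<Longrightarrow> slobodeckij \<theta> p \<Omega> f \<le> slobodeckij \<theta> p \<Omega>' f"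
  unfolding slobodeckij_def by (intro ennreal_root_mono slob_int_mono_set)

text \<open>On a compact set, \<open>\<bar>f\<bar> \<le> 1 + \<bar>f\<bar>\<^sup>p\<close> is integrable.\<close>

lemma Lp_space_locally_integrable:
  assumes p: "1 < p" and f: "f \<in> Lp_space p \<Omega>"
  shows "locally_integrable \<Omega> f"
  unfolding locally_integrable_def set_integrable_def
proof (intro allI impI, elim conjE)
  fix K assume K: "compact K" "K \<subseteq> \<Omega>"
  have m: "borel_on \<Omega> f" using f by (simp add: Lp_space_def set_borel_measurable_def)
  have "(\<lambda>x. indicator K x * (indicator \<Omega> x * f x)) \<in> borel_measurable borel"
    using m borel_compact[OF K(1)] by measurable
  moreover have "(\<lambda>x. indicator K x * (indicator \<Omega> x * f x)) = (\<lambda>x. indicator K x *\<^sub>R f x)"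
    using K(2) by (auto simp: indicator_def fun_eq_iff)
  ultimately have mK: "(\<lambda>x. indicator K x *\<^sub>R f x) \<in> borel_measurable lborel" by simp
  have eq: "ennreal (\<bar>f x\<bar> powr p) * indicator \<Omega> x = ennreal (\<bar>indicator \<Omega> x * f x\<bar> powr p)" for x
    using p by (simp add: indicator_def)
  have "(\<integral>\<^sup>+x. ennreal (norm (indicator K x *\<^sub>R f x)) \<partial>lborel) \<le>
      (\<integral>\<^sup>+x. indicator K x + ennreal (\<bar>f x\<bar> powr p) * indicator \<Omega> x \<partial>lborel)"
  proof (rule nn_integral_mono)
    fix x
    have "\<bar>f x\<bar> \<le> 1 + \<bar>f x\<bar> powr p"
    proof (cases "\<bar>f x\<bar> \<le> 1")
      case False
      then have "\<bar>f x\<bar> powr 1 \<le> \<bar>f x\<bar> powr p" using p by (intro powr_mono) auto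
      then show ?thesis using False by simp
    qed (simp add: add_increasing2)
    then have "ennreal \<bar>f x\<bar> \<le> ennreal (1 + \<bar>f x\<bar> powr p)" by (rule ennreal_leI)
    then have "ennreal \<bar>f x\<bar> \<le> 1 + ennreal (\<bar>f x\<bar> powr p)" by simp
    then show "ennreal (norm (indicator K x *\<^sub>R f x)) \<le> indicator K x + ennreal (\<bar>f x\<bar> powr p) * indicator \<Omega> x"
      using K(2) by (auto simp: indicator_def)
  qed
  also have "\<dots> = emeasure lborel K + Lp_int p \<Omega> f"
    unfolding eq using m borel_compact[OF K(1)] by (subst nn_integral_add) auto
  also have "\<dots> < \<infinity>" using f emeasure_compact_finite[OF K(1)]
    by (auto simp: Lp_space_def Lp_norm_def ennreal_root_finite_iff[unfolded infinity_ennreal_def])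
  finally show "integrable lborel (\<lambda>x. indicator K x *\<^sub>R f x)" by (rule integrableI_bounded[OF mK])
qed

lemma Lp_norm_sum_le:
  assumes p: "1 < p" and S: "finite S" and m: "\<And>i. i \<in> S \<Longrightarrow> borel_on \<Omega> (f i)"
  shows "Lp_norm p \<Omega> (\<lambda>x. \<Sum>i\<in>S. f i x) \<le>
    ennreal (((real (card S) powr p + 1) * (card S + 1)) powr (1 / p)) * (\<Sum>i\<in>S. Lp_norm p \<Omega> (f i))"
  unfolding Lp_norm_def using p by (intro ennreal_root_sum_le Lp_int_sum_le S m) auto

lemma slob_int_sum_le:
  fixes f :: "'i \<Rightarrow> real^'n::finite \<Rightarrow> real" and \<theta> p :: real
  assumes p: "1 < p" and S: "finite S" and \<Omega>: "\<Omega> \<in> sets borel" and m: "\<And>i. i \<in> S \<Longrightarrow> f i \<in> borel_measurable borel"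
  shows "slob_int \<theta> p \<Omega> (\<lambda>x. \<Sum>i\<in>S. f i x) \<le> ennreal (real (card S) powr p) * (\<Sum>i\<in>S. slob_int \<theta> p \<Omega> (f i))"
proof -
  let ?q = "\<lambda>g x y. ennreal (\<bar>g x - g y\<bar> powr p / norm (x - y) powr (real CARD('n) + \<theta> * p))"
  let ?c = "real (card S) powr p"
  note [measurable] = \<Omega>
  have 1: "?q (\<lambda>x. \<Sum>i\<in>S. f i x) x y \<le> ennreal ?c * (\<Sum>i\<in>S. ?q (f i) x y)" for x y
  proof -
    have "\<bar>(\<Sum>i\<in>S. f i x) - (\<Sum>i\<in>S. f i y)\<bar> powr p \<le> ?c * (\<Sum>i\<in>S. \<bar>f i x - f i y\<bar> powr p)"
      unfolding sum_subtractf[symmetric] by (rule abs_sum_powr_le[OF p S])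
    then have "\<bar>(\<Sum>i\<in>S. f i x) - (\<Sum>i\<in>S. f i y)\<bar> powr p / norm (x - y) powr (real CARD('n) + \<theta> * p)
        \<le> ?c * (\<Sum>i\<in>S. \<bar>f i x - f i y\<bar> powr p) / norm (x - y) powr (real CARD('n) + \<theta> * p)"
      by (rule divide_right_mono) simp
    also have "\<dots> = ?c * (\<Sum>i\<in>S. \<bar>f i x - f i y\<bar> powr p / norm (x - y) powr (real CARD('n) + \<theta> * p))"
      by (simp only: times_divide_eq_right[symmetric] sum_divide_distrib)
    finally have "ennreal (\<bar>(\<Sum>i\<in>S. f i x) - (\<Sum>i\<in>S. f i y)\<bar> powr p / norm (x - y) powr (real CARD('n) + \<theta> * p))
        \<le> ennreal (?c * (\<Sum>i\<in>S. \<bar>f i x - f i y\<bar> powr p / norm (x - y) powr (real CARD('n) + \<theta> * p)))"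
      by (rule ennreal_leI)
    then show ?thesis by (subst sum_ennreal, simp) (subst ennreal_mult[symmetric], auto intro!: sum_nonneg)
  qed
  have my: "(\<lambda>y. ?q (f i) x y * indicator \<Omega> y) \<in> borel_measurable lborel"
    and mx: "(\<lambda>x. (\<integral>\<^sup>+y\<in>\<Omega>. ?q (f i) x y \<partial>lborel) * indicator \<Omega> x) \<in> borel_measurable lborel"
    if i: "i \<in> S" for i x
  proof -
    note [measurable] = m[OF i]
    show "(\<lambda>y. ?q (f i) x y * indicator \<Omega> y) \<in> borel_measurable lborel"
      "(\<lambda>x. (\<integral>\<^sup>+y\<in>\<Omega>. ?q (f i) x y \<partial>lborel) * indicator \<Omega> x) \<in> borel_measurable lborel" by measurable
  qed
  have 2: "(\<integral>\<^sup>+y\<in>\<Omega>. ?q (\<lambda>x. \<Sum>i\<in>S. f i x) x y \<partial>lborel) \<le> ennreal ?c * (\<Sum>i\<in>S. \<integral>\<^sup>+y\<in>\<Omega>. ?q (f i) x y \<partial>lborel)" for x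
  proof -
    have "(\<integral>\<^sup>+y\<in>\<Omega>. ?q (\<lambda>x. \<Sum>i\<in>S. f i x) x y \<partial>lborel) \<le> (\<integral>\<^sup>+y. ennreal ?c * (\<Sum>i\<in>S. ?q (f i) x y * indicator \<Omega> y) \<partial>lborel)"
      using 1 by (intro nn_integral_mono) (auto simp: indicator_def)
    also have "\<dots> = ennreal ?c * (\<integral>\<^sup>+y. (\<Sum>i\<in>S. ?q (f i) x y * indicator \<Omega> y) \<partial>lborel)"
      by (intro nn_integral_cmult borel_measurable_sum my)
    also have "(\<integral>\<^sup>+y. (\<Sum>i\<in>S. ?q (f i) x y * indicator \<Omega> y) \<partial>lborel) = (\<Sum>i\<in>S. \<integral>\<^sup>+y\<in>\<Omega>. ?q (f i) x y \<partial>lborel)"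
      by (intro nn_integral_sum my)
    finally show ?thesis .
  qed
  have "slob_int \<theta> p \<Omega> (\<lambda>x. \<Sum>i\<in>S. f i x) \<le>
      (\<integral>\<^sup>+x. ennreal ?c * (\<Sum>i\<in>S. (\<integral>\<^sup>+y\<in>\<Omega>. ?q (f i) x y \<partial>lborel) * indicator \<Omega> x) \<partial>lborel)"
    using 2 by (intro nn_integral_mono) (auto simp: indicator_def)
  also have "\<dots> = ennreal ?c * (\<integral>\<^sup>+x. (\<Sum>i\<in>S. (\<integral>\<^sup>+y\<in>\<Omega>. ?q (f i) x y \<partial>lborel) * indicator \<Omega> x) \<partial>lborel)"
    by (intro nn_integral_cmult borel_measurable_sum mx)
  also have "(\<integral>\<^sup>+x. (\<Sum>i\<in>S. (\<integral>\<^sup>+y\<in>\<Omega>. ?q (f i) x y \<partial>lborel) * indicator \<Omega> x) \<partial>lborel) = (\<Sum>i\<in>S. slob_int \<theta> p \<Omega> (f i))"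
    by (intro nn_integral_sum mx)
  finally show ?thesis .
qed

lemma slobodeckij_sum_le:
  fixes f :: "'i \<Rightarrow> real^'n::finite \<Rightarrow> real"
  assumes p: "1 < p" and S: "finite S" and \<Omega>: "\<Omega> \<in> sets borel" and m: "\<And>i. i \<in> S \<Longrightarrow> f i \<in> borel_measurable borel"
  shows "slobodeckij \<theta> p \<Omega> (\<lambda>x. \<Sum>i\<in>S. f i x) \<le>
    ennreal (((real (card S) powr p + 1) * (card S + 1)) powr (1 / p)) * (\<Sum>i\<in>S. slobodeckij \<theta> p \<Omega> (f i))"
  unfolding slobodeckij_def using p by (intro ennreal_root_sum_le slob_int_sum_le S m \<Omega>) auto

lemma Lp_norm_pullback_le:
  assumes d: "diffeo W W' \<Phi> \<Psi>" and b: "b \<in> test_functions W" and p: "1 < p" and W: "W' \<subseteq> \<Omega>'"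
  shows "\<exists>C\<ge>0. \<forall>g. locally_integrable \<Omega>' g \<longrightarrow> Lp_norm p \<Omega> (pullback W b \<Phi> g) \<le> ennreal C * Lp_norm p \<Omega>' g"
proof -
  have "open W'" using d by (simp add: diffeo_def)
  obtain C where C: "0 \<le> C" "\<And>g. borel_on W' g \<Longrightarrow>
      Lp_int p UNIV (pullback W b \<Phi> g) \<le> ennreal C * Lp_int p W' g" using Lp_int_pullback_le[OF d b p] by blast
  have "Lp_norm p \<Omega> (pullback W b \<Phi> g) \<le> ennreal (((C + 1) * 2) powr (1 / p)) * Lp_norm p \<Omega>' g"
    if g: "locally_integrable \<Omega>' g" for g
  proof -
    have "Lp_norm p \<Omega> (pullback W b \<Phi> g) \<le> Lp_norm p UNIV (pullback W b \<Phi> g)" using p by (intro Lp_norm_mono_set) auto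
    also have "\<dots> \<le> ennreal (((C + 1) * 2) powr (1 / p)) * Lp_norm p W' g"
      using ennreal_root_sum_le[of p "{()}" C "Lp_int p UNIV (pullback W b \<Phi> g)" "\<lambda>_. Lp_int p W' g"]
        C(2)[OF locally_integrable_measurable[OF \<open>open W'\<close> locally_integrable_subset[OF g W]]] C(1) p
      by (simp add: Lp_norm_def)
    also have "\<dots> \<le> ennreal (((C + 1) * 2) powr (1 / p)) * Lp_norm p \<Omega>' g"
      using p W by (intro mult_left_mono Lp_norm_mono_set) auto
    finally show ?thesis .
  qed
  then show ?thesis by (intro exI[of _ "((C + 1) * 2) powr (1 / p)"]) auto
qed

lemma slobodeckij_pullback_le:
  assumes d: "diffeo W W' \<Phi> \<Psi>" and b: "b \<in> test_functions W" and p: "1 < p" and \<theta>: "0 < \<theta>" "\<theta> < 1"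
    and W: "W' \<subseteq> \<Omega>'"
  shows "\<exists>C\<ge>0. \<forall>g. locally_integrable \<Omega>' g \<longrightarrow>
    slobodeckij \<theta> p \<Omega> (pullback W b \<Phi> g) \<le> ennreal C * (Lp_norm p \<Omega>' g + slobodeckij \<theta> p \<Omega>' g)"
proof -
  have "open W'" using d by (simp add: diffeo_def)
  obtain C where C: "0 \<le> C" "\<And>g. borel_on W' g \<Longrightarrow>
      slob_int \<theta> p UNIV (pullback W b \<Phi> g) \<le> ennreal C * (Lp_int p W' g + slob_int \<theta> p W' g)"
    using slob_int_pullback_le[OF d b p \<theta>] by blast
  let ?C = "((C + 1) * 3) powr (1 / p)"
  have "slobodeckij \<theta> p \<Omega> (pullback W b \<Phi> g) \<le> ennreal ?C * (Lp_norm p \<Omega>' g + slobodeckij \<theta> p \<Omega>' g)"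
    if g: "locally_integrable \<Omega>' g" for g
  proof -
    have "slobodeckij \<theta> p \<Omega> (pullback W b \<Phi> g) \<le> slobodeckij \<theta> p UNIV (pullback W b \<Phi> g)"
      using p by (intro slobodeckij_mono_set) auto
    also have "\<dots> \<le> ennreal ?C * (Lp_norm p W' g + slobodeckij \<theta> p W' g)" unfolding Lp_norm_def slobodeckij_def using p
      by (intro ennreal_root_add_le C(1) C(2)[OF locally_integrable_measurable[OF \<open>open W'\<close> locally_integrable_subset[OF g W]]]) auto
    also have "\<dots> \<le> ennreal ?C * (Lp_norm p \<Omega>' g + slobodeckij \<theta> p \<Omega>' g)"
      using p W by (intro mult_left_mono add_mono Lp_norm_mono_set slobodeckij_mono_set) auto
    finally show ?thesis .
  qed
  then show ?thesis by (intro exI[of _ ?C]) auto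
qed

text \<open>The constants are uniform in the parameter \<open>z\<close>, which will stand for a function together with a choice of
  its weak derivatives.\<close>

lemma uniform_bound_sum:
  assumes "finite J" "\<And>j. j \<in> J \<Longrightarrow> \<exists>C\<ge>0. \<forall>z. Q z \<longrightarrow> A j z \<le> ennreal C * N z"
  shows "\<exists>C\<ge>0. \<forall>z. Q z \<longrightarrow> (\<Sum>j\<in>J. A j z) \<le> ennreal C * N z"
proof -
  have "\<exists>C. \<forall>j\<in>J. 0 \<le> C j \<and> (\<forall>z. Q z \<longrightarrow> A j z \<le> ennreal (C j) * N z)" by (rule bchoice) (use assms(2) in blast)
  then obtain C where C: "\<And>j. j \<in> J \<Longrightarrow> 0 \<le> C j" "\<And>j z. j \<in> J \<Longrightarrow> Q z \<Longrightarrow> A j z \<le> ennreal (C j) * N z" by blast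
  then show ?thesis by (intro exI[of _ "\<Sum>j\<in>J. C j"] conjI sum_nonneg allI impI ennreal_bound_sum)
qed

lemma diffeo_id: "open W \<Longrightarrow> diffeo W W (\<lambda>x. x) (\<lambda>x. x)"
  by (simp add: diffeo_def smooth_on_ident)

text \<open>Multiplication by a test function is the localised pull-back along the identity.\<close>

lemma Lp_int_test_mult_le:
  assumes \<Omega>: "open \<Omega>" and p: "1 < p" and \<eta>: "\<eta> \<in> test_functions \<Omega>"
  shows "\<exists>C\<ge>0. \<forall>g. locally_integrable \<Omega> g \<longrightarrow> Lp_int p UNIV (\<lambda>x. g x * \<eta> x) \<le> ennreal C * Lp_int p \<Omega> g"
proof -
  have "pullback \<Omega> \<eta> (\<lambda>x. x) g = (\<lambda>x. g x * \<eta> x)" for g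
    using test_functionsD(4)[OF \<eta>] by (auto simp: pullback_def fun_eq_iff)
  then show ?thesis using Lp_int_pullback_le[OF diffeo_id[OF \<Omega>] \<eta> p] locally_integrable_measurable[OF \<Omega>] by auto
qed

lemma Lp_int_add_le:
  assumes p: "1 < p" and m: "f \<in> borel_measurable borel" "g \<in> borel_measurable borel"
  shows "Lp_int p UNIV (\<lambda>x. f x + g x) \<le> ennreal (2 powr p) * (Lp_int p UNIV f + Lp_int p UNIV g)"
  using Lp_int_sum_le[OF p finite_class.finite_UNIV, of UNIV "\<lambda>b. if b then f else g"] m
  by (simp add: UNIV_bool add.commute)

text \<open>The function \<open>g\<close> is a derivative of lower than the top order and has first weak derivatives \<open>D j\<close>. Replacing \<open>g\<close> by
  \<open>\<eta> g\<close>, with a cut-off function \<open>\<eta>\<close> that is \<open>1\<close> on the image of the support of \<open>b\<close>, does not change the pull-back.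
  Since \<open>\<eta> g\<close> has an integrable weak gradient on the whole space, its Slobodeckij seminorm is bounded by its
  first order norm.\<close>

lemma slobodeckij_pullback_lower_le:
  fixes W W' \<Omega> \<Omega>' :: "(real^'n::finite) set" and \<theta> p :: real
  assumes d: "diffeo W W' \<Phi> \<Psi>" and b: "b \<in> test_functions W" and p: "1 < p" and \<theta>: "0 < \<theta>" "\<theta> < 1"
    and W: "W' \<subseteq> \<Omega>'" and \<Omega>': "open \<Omega>'"
  shows "\<exists>C\<ge>0. \<forall>f \<mu> g D. locally_integrable \<Omega>' f \<longrightarrow> g \<in> weak_derivs \<Omega>' \<mu> f \<longrightarrow>
    (\<forall>j. D j \<in> weak_derivs \<Omega>' (mi_inc \<mu> j) f) \<longrightarrow>
    slobodeckij \<theta> p \<Omega> (pullback W b \<Phi> g) \<le> ennreal C * (Lp_norm p \<Omega>' g + (\<Sum>j\<in>UNIV. Lp_norm p \<Omega>' (D j)))"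
proof -
  let ?K = "supp b"
  have oW: "open W'" "smooth_on W \<Phi>" using d by (auto simp: diffeo_def)
  have im: "compact (\<Phi> ` ?K)" "\<Phi> ` ?K \<subseteq> W'"
    using d test_functionsD(2,3)[OF b] continuous_on_subset[OF smooth_on_imp_continuous_on[OF oW(2)]]
    by (auto intro!: compact_continuous_image simp: diffeo_def)
  obtain \<eta> V where \<eta>W: "\<eta> \<in> test_functions W'" and \<eta>1: "\<Phi> ` ?K \<subseteq> V" "\<And>x. x \<in> V \<Longrightarrow> \<eta> x = 1"
    using smooth_cutoff[OF im(1) oW(1) im(2)] by metis
  have \<eta>: "\<eta> \<in> test_functions \<Omega>'" by (rule test_functions_mono[OF W \<eta>W])
  note s\<eta> = test_functionsD(1)[OF \<eta>]
  obtain Ce where Ce: "0 \<le> Ce" "\<And>g. locally_integrable \<Omega>' g \<Longrightarrow> Lp_int p UNIV (\<lambda>x. g x * \<eta> x) \<le> ennreal Ce * Lp_int p \<Omega>' g"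
    using Lp_int_test_mult_le[OF \<Omega>' p \<eta>] by blast
  have "\<forall>j. \<exists>C\<ge>0. \<forall>g. locally_integrable \<Omega>' g \<longrightarrow> Lp_int p UNIV (\<lambda>x. g x * pderiv1 j \<eta> x) \<le> ennreal C * Lp_int p \<Omega>' g"
    using Lp_int_test_mult_le[OF \<Omega>' p test_functions_pderiv1[OF \<eta>]] by blast
  from choice[OF this] obtain Cd where Cd: "\<And>j. 0 \<le> Cd j"
    "\<And>j g. locally_integrable \<Omega>' g \<Longrightarrow> Lp_int p UNIV (\<lambda>x. g x * pderiv1 j \<eta> x) \<le> ennreal (Cd j) * Lp_int p \<Omega>' g" by blast
  obtain Cp where Cp: "0 \<le> Cp" "\<And>g. borel_on W' g \<Longrightarrow>
      slob_int \<theta> p UNIV (pullback W b \<Phi> g) \<le> ennreal Cp * (Lp_int p W' g + slob_int \<theta> p W' g)"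
    using slob_int_pullback_le[OF d b p \<theta>] by blast
  obtain Cs where Cs: "0 \<le> Cs" "\<forall>(G :: real^'n \<Rightarrow> real) (D :: 'n \<Rightarrow> real^'n \<Rightarrow> real). integrable_weak_gradient G D \<longrightarrow>
    slob_int \<theta> p UNIV G \<le> ennreal Cs * (Lp_int p UNIV G + (\<Sum>j\<in>UNIV. Lp_int p UNIV (D j)))"
    using slob_int_le_weak_derivatives[OF p \<theta>, where 'n = 'n] by (elim exE conjE) (rule that)
  define Cj where "Cj j = 2 powr p * (Ce + Cd j)" for j
  have Cj: "0 \<le> Cj j" for j using Ce Cd by (simp add: Cj_def)
  define C where "C = Cp * (Ce + Cs * (Ce + (\<Sum>j\<in>UNIV. Cj j)))"
  have SCj: "0 \<le> (\<Sum>j\<in>UNIV. Cj j)" using Cj by (simp add: sum_nonneg)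
  have C: "0 \<le> C" using Cp(1) Ce(1) Cs(1) SCj by (simp add: C_def)
  let ?C = "((C + 1) * (card (UNIV :: 'n option set) + 1)) powr (1 / p)"
  have "slobodeckij \<theta> p \<Omega> (pullback W b \<Phi> g) \<le> ennreal ?C * (Lp_norm p \<Omega>' g + (\<Sum>j\<in>UNIV. Lp_norm p \<Omega>' (D j)))"
    if f: "locally_integrable \<Omega>' f" and g: "g \<in> weak_derivs \<Omega>' \<mu> f" and D: "\<And>j. D j \<in> weak_derivs \<Omega>' (mi_inc \<mu> j) f" for f \<mu> g D
  proof -
    note lg = weak_derivsD[OF g] and lD = weak_derivsD[OF D]
    define G where "G x = g x * \<eta> x" for x
    define H where "H j x = D j x * \<eta> x + g x * pderiv1 j \<eta> x" for j x
    have iG: "integrable lborel G" unfolding G_def by (rule set_integrable_mult_test(1)[OF lg \<eta>])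
    note iD = set_integrable_mult_test(1)[OF lD \<eta>] and ig = set_integrable_mult_test(1)[OF lg test_functions_pderiv1[OF \<eta>]]
    have iH: "integrable lborel (H j)" for j unfolding H_def by (rule Bochner_Integration.integrable_add[OF iD ig])
    have weak: "(\<integral>x. G x * pderiv1 j \<xi> x \<partial>lborel) = - (\<integral>x. H j x * \<xi> x \<partial>lborel)" if \<xi>: "\<xi> \<in> test_functions UNIV" for j \<xi>
    proof -
      note s\<xi> = test_functionsD(1)[OF \<xi>]
      have \<zeta>: "(\<lambda>x. \<xi> x * \<eta> x) \<in> test_functions \<Omega>'"
        by (rule test_functions_mult_smooth[OF \<Omega>' _ \<eta>]) (rule smooth_on_subset[OF s\<xi> subset_UNIV])
      have z2: "(\<lambda>x. \<xi> x * pderiv1 j \<eta> x) \<in> test_functions \<Omega>'"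
        by (rule test_functions_mult_smooth[OF \<Omega>' _ test_functions_pderiv1[OF \<eta>]]) (rule smooth_on_subset[OF s\<xi> subset_UNIV])
      let ?\<zeta> = "\<lambda>x. \<xi> x * \<eta> x"
      note s\<zeta> = test_functionsD(1)[OF \<zeta>]
      have "(-1) ^ mi_order \<mu> * (\<integral>x. g x * pderiv1 j ?\<zeta> x \<partial>lborel) = (\<integral>x. f x * pderiv_mi \<mu> (pderiv1 j ?\<zeta>) x \<partial>lborel)"
        using g test_functions_pderiv1[OF \<zeta>] by (simp add: weak_derivs_iff[OF f])
      also have "\<dots> = (-1) ^ mi_order (mi_inc \<mu> j) * (\<integral>x. D j x * ?\<zeta> x \<partial>lborel)"
        using D[of j] \<zeta> unfolding pderiv_mi_inc(2)[OF s\<zeta>, symmetric] by (simp add: weak_derivs_iff[OF f])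
      finally have 1: "(\<integral>x. g x * pderiv1 j ?\<zeta> x \<partial>lborel) = - (\<integral>x. D j x * ?\<zeta> x \<partial>lborel)"
        by (simp add: mi_order_inc minus_one_power_iff split: if_splits)
      have "(\<integral>x. G x * pderiv1 j \<xi> x \<partial>lborel) = (\<integral>x. g x * pderiv1 j ?\<zeta> x - g x * (\<xi> x * pderiv1 j \<eta> x) \<partial>lborel)"
      proof (intro Bochner_Integration.integral_cong refl)
        fix x
        have "pderiv1 j ?\<zeta> x = \<xi> x * pderiv1 j \<eta> x + pderiv1 j \<xi> x * \<eta> x"
          using fun_cong[OF pderiv1_mult[OF s\<xi> s\<eta>, of j], of x] by simp
        then show "G x * pderiv1 j \<xi> x = g x * pderiv1 j ?\<zeta> x - g x * (\<xi> x * pderiv1 j \<eta> x)"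
          by (simp add: G_def algebra_simps)
      qed
      also have "\<dots> = (\<integral>x. g x * pderiv1 j ?\<zeta> x \<partial>lborel) - (\<integral>x. g x * (\<xi> x * pderiv1 j \<eta> x) \<partial>lborel)"
        by (rule Bochner_Integration.integral_diff[OF set_integrable_mult_test(1)[OF lg test_functions_pderiv1[OF \<zeta>]]
              set_integrable_mult_test(1)[OF lg z2]])
      also have "\<dots> = - ((\<integral>x. D j x * ?\<zeta> x \<partial>lborel) + (\<integral>x. g x * (\<xi> x * pderiv1 j \<eta> x) \<partial>lborel))" by (simp add: 1)
      also have "(\<integral>x. D j x * ?\<zeta> x \<partial>lborel) + (\<integral>x. g x * (\<xi> x * pderiv1 j \<eta> x) \<partial>lborel) =
          (\<integral>x. D j x * ?\<zeta> x + g x * (\<xi> x * pderiv1 j \<eta> x) \<partial>lborel)"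
        by (rule Bochner_Integration.integral_add[OF set_integrable_mult_test(1)[OF lD \<zeta>]
              set_integrable_mult_test(1)[OF lg z2], symmetric])
      finally show ?thesis by (simp add: H_def algebra_simps)
    qed
    define S where "S = Lp_int p \<Omega>' g + (\<Sum>j\<in>UNIV. Lp_int p \<Omega>' (D j))"
    have gS: "Lp_int p \<Omega>' g \<le> S" unfolding S_def by simp
    have DS: "Lp_int p \<Omega>' (D j) \<le> S" for j
      unfolding S_def by (rule order_trans[OF member_le_sum[of j UNIV "\<lambda>j. Lp_int p \<Omega>' (D j)"]]) auto
    have G1: "Lp_int p UNIV G \<le> ennreal Ce * S"
      unfolding G_def by (rule order_trans[OF Ce(2)[OF lg] mult_left_mono[OF gS]]) simp
    have H1: "Lp_int p UNIV (H j) \<le> ennreal (Cj j) * S" for j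
    proof -
      have "Lp_int p UNIV (H j) \<le> ennreal (2 powr p) * (Lp_int p UNIV (\<lambda>x. D j x * \<eta> x) + Lp_int p UNIV (\<lambda>x. g x * pderiv1 j \<eta> x))"
        unfolding H_def using borel_measurable_integrable[OF iD] borel_measurable_integrable[OF ig] by (intro Lp_int_add_le p) simp_all
      also have "\<dots> \<le> ennreal (2 powr p * (Ce + Cd j)) * S"
        using Ce(1) Cd(1) by (intro ennreal_bound_cmult ennreal_bound_add order_trans[OF Ce(2)[OF lD] mult_left_mono[OF DS]]
            order_trans[OF Cd(2)[OF lg] mult_left_mono[OF gS]]) auto
      finally show ?thesis by (simp add: Cj_def)
    qed
    have "slob_int \<theta> p UNIV G \<le> ennreal Cs * (Lp_int p UNIV G + (\<Sum>j\<in>UNIV. Lp_int p UNIV (H j)))"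
      using iG iH weak by (intro Cs(2)[rule_format]) (simp add: integrable_weak_gradient_def)
    also have "\<dots> \<le> ennreal (Cs * (Ce + (\<Sum>j\<in>UNIV. Cj j))) * S"
      using Cs(1) Ce(1) Cj SCj by (intro ennreal_bound_cmult ennreal_bound_add ennreal_bound_sum G1 H1) auto
    finally have sG: "slob_int \<theta> p UNIV G \<le> ennreal (Cs * (Ce + (\<Sum>j\<in>UNIV. Cj j))) * S" .
    have "pullback W b \<Phi> g = pullback W b \<Phi> G"
    proof
      fix x
      have "\<eta> (\<Phi> x) = 1" if "b x \<noteq> 0" using \<eta>1 that closure_subset[of "{x. b x \<noteq> 0}"] by blast
      then show "pullback W b \<Phi> g x = pullback W b \<Phi> G x" by (auto simp: pullback_def G_def)
    qed
    then have "slob_int \<theta> p UNIV (pullback W b \<Phi> g) \<le> ennreal Cp * (Lp_int p W' G + slob_int \<theta> p W' G)"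
      using Cp(2)[of G] borel_measurable_integrable[OF iG] borel_open[OF oW(1)] by simp
    also have "\<dots> \<le> ennreal Cp * (Lp_int p UNIV G + slob_int \<theta> p UNIV G)"
      by (intro mult_left_mono add_mono slob_int_mono_set nn_integral_mono) (auto simp: indicator_def)
    also have "\<dots> \<le> ennreal C * S"
      unfolding C_def using Cp(1) Ce(1) Cs(1) SCj by (intro ennreal_bound_cmult ennreal_bound_add G1 sG) auto
    finally have I: "slob_int \<theta> p \<Omega> (pullback W b \<Phi> g) \<le> ennreal C * S"
      by (rule order_trans[OF slob_int_mono_set[OF subset_UNIV]])
    then show ?thesis
      unfolding slobodeckij_def Lp_norm_def S_def by (rule ennreal_root_add_sum_le[rotated 2]) (use p C in auto)
  qed
  then show ?thesis by (intro exI[of _ ?C]) auto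
qed

section \<open>Sobolev norms in terms of chosen weak derivatives\<close>

lemma Lp_norm_cong_AE:
  assumes "AE x in lborel. x \<in> \<Omega> \<longrightarrow> f x = g x"
  shows "Lp_norm p \<Omega> f = Lp_norm p \<Omega> g"
proof -
  have "Lp_int p \<Omega> f = Lp_int p \<Omega> g" using assms by (intro nn_integral_cong_AE) (auto simp: indicator_def)
  then show ?thesis by (simp add: Lp_norm_def)
qed

lemma slobodeckij_cong_AE:
  assumes ae: "AE x in lborel. x \<in> \<Omega> \<longrightarrow> f x = g x"
  shows "slobodeckij \<theta> p \<Omega> f = slobodeckij \<theta> p \<Omega> g"
proof -
  have "slob_int \<theta> p \<Omega> f = slob_int \<theta> p \<Omega> g"
  proof (rule nn_integral_cong_AE, rule AE_mp[OF ae], intro AE_I2 impI)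
    fix x assume x: "x \<in> \<Omega> \<longrightarrow> f x = g x"
    show "(\<integral>\<^sup>+y\<in>\<Omega>. ennreal (\<bar>f x - f y\<bar> powr p / norm (x - y) powr (real CARD('a) + \<theta> * p)) \<partial>lborel) * indicator \<Omega> x =
      (\<integral>\<^sup>+y\<in>\<Omega>. ennreal (\<bar>g x - g y\<bar> powr p / norm (x - y) powr (real CARD('a) + \<theta> * p)) \<partial>lborel) * indicator \<Omega> x"
    proof (cases "x \<in> \<Omega>")
      case True
      have "(\<integral>\<^sup>+y\<in>\<Omega>. ennreal (\<bar>f x - f y\<bar> powr p / norm (x - y) powr (real CARD('a) + \<theta> * p)) \<partial>lborel) =
        (\<integral>\<^sup>+y\<in>\<Omega>. ennreal (\<bar>g x - g y\<bar> powr p / norm (x - y) powr (real CARD('a) + \<theta> * p)) \<partial>lborel)"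
        by (rule nn_integral_cong_AE, rule AE_mp[OF ae]) (use x True in \<open>auto simp: indicator_def\<close>)
      then show ?thesis by simp
    qed simp
  qed
  then show ?thesis by (simp add: slobodeckij_def)
qed

text \<open>Weak derivatives are unique almost everywhere, so the infimum is over equal values.\<close>

lemma INF_weak_derivs:
  assumes \<Omega>: "open \<Omega>" and g: "g \<in> weak_derivs \<Omega> \<nu> f"
  shows "(INF g\<in>weak_derivs \<Omega> \<nu> f. Lp_norm p \<Omega> g) = Lp_norm p \<Omega> g"
    and "(INF g\<in>weak_derivs \<Omega> \<nu> f. slobodeckij \<theta> p \<Omega> g) = slobodeckij \<theta> p \<Omega> g"
proof -
  have eq: "Lp_norm p \<Omega> h = Lp_norm p \<Omega> g" "slobodeckij \<theta> p \<Omega> h = slobodeckij \<theta> p \<Omega> g" if "h \<in> weak_derivs \<Omega> \<nu> f" for h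
    by (rule Lp_norm_cong_AE[OF weak_derivs_unique[OF \<Omega> that g]],
        rule slobodeckij_cong_AE[OF weak_derivs_unique[OF \<Omega> that g]])
  have ne: "weak_derivs \<Omega> \<nu> f \<noteq> {}" using g by blast
  show "(INF g\<in>weak_derivs \<Omega> \<nu> f. Lp_norm p \<Omega> g) = Lp_norm p \<Omega> g" by (rule INF_eq_const[OF ne eq(1)])
  show "(INF g\<in>weak_derivs \<Omega> \<nu> f. slobodeckij \<theta> p \<Omega> g) = slobodeckij \<theta> p \<Omega> g" by (rule INF_eq_const[OF ne eq(2)])
qed

lemma sobolev_norm_eq:
  assumes \<Omega>: "open \<Omega>" and F: "\<And>\<mu>. mi_order \<mu> \<le> nat \<lfloor>s\<rfloor> \<Longrightarrow> F \<mu> \<in> weak_derivs \<Omega> \<mu> f"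
  shows "sobolev_norm s p \<Omega> f = (\<Sum>\<mu> | mi_order \<mu> \<le> nat \<lfloor>s\<rfloor>. Lp_norm p \<Omega> (F \<mu>)) +
    (if frac s = 0 then 0 else \<Sum>\<mu> | mi_order \<mu> = nat \<lfloor>s\<rfloor>. slobodeckij (frac s) p \<Omega> (F \<mu>))"
  unfolding sobolev_norm_def Let_def
  by (intro arg_cong2[where f = "(+)"] sum.cong if_cong refl) (auto intro!: INF_weak_derivs[OF \<Omega> F])

lemma sobolev_norm_finite_weak_derivs:
  assumes "sobolev_norm s p \<Omega> f < \<infinity>" "mi_order \<mu> \<le> nat \<lfloor>s\<rfloor>"
  shows "weak_derivs \<Omega> \<mu> f \<noteq> {}"
proof
  assume "weak_derivs \<Omega> \<mu> f = {}"
  then have "(INF g\<in>weak_derivs \<Omega> \<mu> f. Lp_norm p \<Omega> g) = \<infinity>" by simp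
  then have "\<infinity> \<le> (\<Sum>\<nu> | mi_order \<nu> \<le> nat \<lfloor>s\<rfloor>. INF g\<in>weak_derivs \<Omega> \<nu> f. Lp_norm p \<Omega> g)"
    using member_le_sum[of \<mu> "{\<nu>. mi_order \<nu> \<le> nat \<lfloor>s\<rfloor>}" "\<lambda>\<nu>. INF g\<in>weak_derivs \<Omega> \<nu> f. Lp_norm p \<Omega> g"]
      assms(2) finite_mi_order_le by auto
  then show False using assms(1) by (auto simp: sobolev_norm_def Let_def top_unique)
qed

text \<open>The weak derivatives of the pull-back are sums of pull-backs of weak derivatives \<open>F \<mu>\<close> of \<open>f\<close>. Each term
  is bounded in \<open>L\<^sup>p\<close>; for the Slobodeckij seminorm the order of \<open>\<mu>\<close> decides which of the two estimates is used.\<close>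

theorem sobolev_norm_pullback_le:
  fixes W W' \<Omega> \<Omega>' :: "(real^'n::finite) set" and s p :: real
  assumes d: "diffeo W W' \<Phi> \<Psi>" and a: "a \<in> test_functions W" and p: "1 < p"
    and W: "W \<subseteq> \<Omega>" "W' \<subseteq> \<Omega>'" and \<Omega>: "open \<Omega>" "open \<Omega>'"
  shows "\<exists>C>0. \<forall>f. locally_integrable \<Omega>' f \<longrightarrow>
    sobolev_norm s p \<Omega> (pullback W a \<Phi> f) \<le> ennreal C * sobolev_norm s p \<Omega>' f"
proof -
  define k where "k = nat \<lfloor>s\<rfloor>"
  define \<theta> where "\<theta> = frac s"
  have \<theta>1: "0 \<le> \<theta>" "\<theta> < 1" by (auto simp: \<theta>_def frac_lt_1)
  have oW': "open W'" using d by (simp add: diffeo_def)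
  have \<Omega>m: "\<Omega> \<in> sets borel" using \<Omega> by auto
  \<comment> \<open>A function and a choice of its weak derivatives; the constants must be uniform in both.\<close>
  let ?Q = "\<lambda>(f, F). locally_integrable \<Omega>' f \<and> (\<forall>\<mu>. mi_order \<mu> \<le> k \<longrightarrow> F \<mu> \<in> weak_derivs \<Omega>' \<mu> f)"
  let ?N = "\<lambda>(f :: real^'n \<Rightarrow> real, F :: 'n multi_index \<Rightarrow> real^'n \<Rightarrow> real). sobolev_norm s p \<Omega>' f"
  have L: "Lp_norm p \<Omega>' (F \<mu>) \<le> sobolev_norm s p \<Omega>' f" if "?Q (f, F)" "mi_order \<mu> \<le> k" for f F \<mu>
  proof -
    have "Lp_norm p \<Omega>' (F \<mu>) \<le> (\<Sum>\<mu> | mi_order \<mu> \<le> k. Lp_norm p \<Omega>' (F \<mu>))"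
      using that finite_mi_order_le by (intro member_le_sum) auto
    then show ?thesis using sobolev_norm_eq[OF \<Omega>(2), of s F f p] that(1) by (auto simp: k_def intro: order_trans)
  qed
  have S: "slobodeckij \<theta> p \<Omega>' (F \<mu>) \<le> sobolev_norm s p \<Omega>' f" if "?Q (f, F)" "mi_order \<mu> = k" "\<theta> \<noteq> 0" for f F \<mu>
  proof -
    have "slobodeckij \<theta> p \<Omega>' (F \<mu>) \<le> (\<Sum>\<mu> | mi_order \<mu> = k. slobodeckij \<theta> p \<Omega>' (F \<mu>))"
      using that finite_mi_order_eq by (intro member_le_sum) auto
    then show ?thesis
      using sobolev_norm_eq[OF \<Omega>(2), of s F f p] that(1,3) by (auto simp: k_def \<theta>_def intro: order_trans)
  qed
  have 1: "\<exists>C\<ge>0. \<forall>z. ?Q z \<longrightarrow> (INF g\<in>weak_derivs \<Omega> \<nu> (pullback W a \<Phi> (fst z)). Lp_norm p \<Omega> g) \<le> ennreal C * ?N z"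
    and 2: "\<theta> \<noteq> 0 \<Longrightarrow> \<exists>C\<ge>0. \<forall>z. ?Q z \<longrightarrow> (INF g\<in>weak_derivs \<Omega> \<nu> (pullback W a \<Phi> (fst z)). slobodeckij \<theta> p \<Omega> g) \<le> ennreal C * ?N z"
    if \<nu>: "mi_order \<nu> \<le> k" for \<nu>
  proof -
    obtain N :: nat and \<mu> e where e: "\<And>i. i < N \<Longrightarrow> mi_order (\<mu> i) \<le> mi_order \<nu> \<and> e i \<in> test_functions W"
      "\<And>f F. locally_integrable \<Omega>' f \<Longrightarrow> (\<forall>i<N. F i \<in> weak_derivs \<Omega>' (\<mu> i) f) \<Longrightarrow>
      (\<lambda>x. \<Sum>i<N. pullback W (e i) \<Phi> (F i) x) \<in> weak_derivs \<Omega> \<nu> (pullback W a \<Phi> f)"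
      using weak_derivs_pullback[OF d a W(2), of \<nu> \<Omega>] by blast
    have wd: "(\<lambda>x. \<Sum>i<N. pullback W (e i) \<Phi> (F (\<mu> i)) x) \<in> weak_derivs \<Omega> \<nu> (pullback W a \<Phi> f)" if "?Q (f, F)" for f F
      using that e(1) \<nu> by (intro e(2)[of f "\<lambda>i. F (\<mu> i)"]) (auto intro: order_trans)
    have meas: "pullback W (e i) \<Phi> (F (\<mu> i)) \<in> borel_measurable borel" if "?Q (f, F)" "i < N" for f F i
    proof -
      have "F (\<mu> i) \<in> weak_derivs \<Omega>' (\<mu> i) f" using that e(1)[of i] \<nu> by auto
      then show ?thesis using e(1)[OF that(2)] by (intro pullback_borel[OF d] locally_integrable_measurable[OF oW']
            locally_integrable_subset[OF _ W(2)] weak_derivsD) auto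
    qed
    let ?c = "((real (card {..<N}) powr p + 1) * (card {..<N} + 1)) powr (1 / p)"
    let ?G = "\<lambda>i z. pullback W (e i) \<Phi> (snd z (\<mu> i))"
    have *: "\<exists>C\<ge>0. \<forall>z. ?Q z \<longrightarrow> (INF g\<in>weak_derivs \<Omega> \<nu> (pullback W a \<Phi> (fst z)). n g) \<le> ennreal C * ?N z"
      if sum: "\<And>f. (\<And>i. i < N \<Longrightarrow> f i \<in> borel_measurable borel) \<Longrightarrow> n (\<lambda>x. \<Sum>i<N. f i x) \<le> ennreal ?c * (\<Sum>i<N. n (f i))"
        and each: "\<And>i. e i \<in> test_functions W \<Longrightarrow> mi_order (\<mu> i) \<le> k \<Longrightarrow> \<exists>C\<ge>0. \<forall>z. ?Q z \<longrightarrow> n (?G i z) \<le> ennreal C * ?N z"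
      for n :: "(real^'n \<Rightarrow> real) \<Rightarrow> ennreal"
    proof -
      have "\<exists>C\<ge>0. \<forall>z. ?Q z \<longrightarrow> (\<Sum>i<N. n (?G i z)) \<le> ennreal C * ?N z"
      proof (rule uniform_bound_sum)
        fix i assume "i \<in> {..<N}"
        then have "e i \<in> test_functions W" "mi_order (\<mu> i) \<le> k" using e(1)[of i] \<nu> by auto
        then show "\<exists>C\<ge>0. \<forall>z. ?Q z \<longrightarrow> n (?G i z) \<le> ennreal C * ?N z" by (rule each)
      qed simp
      then obtain C where C: "0 \<le> C" "\<And>z. ?Q z \<Longrightarrow> (\<Sum>i<N. n (?G i z)) \<le> ennreal C * ?N z" by blast
      show ?thesis
      proof (intro exI[of _ "?c * C"] conjI allI impI)
        fix z assume z: "?Q z"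
        obtain f F where zz: "z = (f, F)" by (cases z)
        note Q = z[unfolded zz]
        have "(INF g\<in>weak_derivs \<Omega> \<nu> (pullback W a \<Phi> f). n g) \<le> n (\<lambda>x. \<Sum>i<N. pullback W (e i) \<Phi> (F (\<mu> i)) x)"
          by (rule INF_lower[OF wd[OF Q]])
        also have "\<dots> \<le> ennreal ?c * (\<Sum>i<N. n (pullback W (e i) \<Phi> (F (\<mu> i))))" by (rule sum[OF meas[OF Q]])
        also have "\<dots> \<le> ennreal (?c * C) * ?N z" using C(1) C(2)[OF z] by (intro ennreal_bound_cmult) (simp_all add: zz)
        finally show "(INF g\<in>weak_derivs \<Omega> \<nu> (pullback W a \<Phi> (fst z)). n g) \<le> ennreal (?c * C) * ?N z" by (simp add: zz)
      qed (use C in simp)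
    qed
    show "\<exists>C\<ge>0. \<forall>z. ?Q z \<longrightarrow> (INF g\<in>weak_derivs \<Omega> \<nu> (pullback W a \<Phi> (fst z)). Lp_norm p \<Omega> g) \<le> ennreal C * ?N z"
    proof (rule *)
      show "Lp_norm p \<Omega> (\<lambda>x. \<Sum>i<N. f i x) \<le> ennreal ?c * (\<Sum>i<N. Lp_norm p \<Omega> (f i))"
        if "\<And>i. i < N \<Longrightarrow> f i \<in> borel_measurable borel" for f using that \<Omega>m by (intro Lp_norm_sum_le p) auto
      fix i assume i: "e i \<in> test_functions W" "mi_order (\<mu> i) \<le> k"
      obtain C where C: "0 \<le> C" "\<And>g. locally_integrable \<Omega>' g \<Longrightarrow> Lp_norm p \<Omega> (pullback W (e i) \<Phi> g) \<le> ennreal C * Lp_norm p \<Omega>' g"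
        using Lp_norm_pullback_le[OF d i(1) p W(2)] by blast
      show "\<exists>C\<ge>0. \<forall>z. ?Q z \<longrightarrow> Lp_norm p \<Omega> (?G i z) \<le> ennreal C * ?N z"
      proof (intro exI[of _ C] conjI C(1) allI impI)
        fix z assume z: "?Q z"
        obtain f F where zz: "z = (f, F)" by (cases z)
        then have "F (\<mu> i) \<in> weak_derivs \<Omega>' (\<mu> i) f" using z i by auto
        then show "Lp_norm p \<Omega> (?G i z) \<le> ennreal C * ?N z"
          using order_trans[OF C(2) mult_left_mono[OF L[OF z[unfolded zz] i(2)]]] zz by (simp add: weak_derivsD)
      qed
    qed
    show "\<exists>C\<ge>0. \<forall>z. ?Q z \<longrightarrow> (INF g\<in>weak_derivs \<Omega> \<nu> (pullback W a \<Phi> (fst z)). slobodeckij \<theta> p \<Omega> g) \<le> ennreal C * ?N z"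
      if \<theta>0: "\<theta> \<noteq> 0"
    proof (rule *)
      have \<theta>: "0 < \<theta>" "\<theta> < 1" using \<theta>1 \<theta>0 by auto
      show "slobodeckij \<theta> p \<Omega> (\<lambda>x. \<Sum>i<N. f i x) \<le> ennreal ?c * (\<Sum>i<N. slobodeckij \<theta> p \<Omega> (f i))"
        if "\<And>i. i < N \<Longrightarrow> f i \<in> borel_measurable borel" for f using that \<Omega>m by (intro slobodeckij_sum_le p) auto
      fix i assume i: "e i \<in> test_functions W" "mi_order (\<mu> i) \<le> k"
      show "\<exists>C\<ge>0. \<forall>z. ?Q z \<longrightarrow> slobodeckij \<theta> p \<Omega> (?G i z) \<le> ennreal C * ?N z"
      proof (cases "mi_order (\<mu> i) = k")
        case True
        obtain C where C: "0 \<le> C" "\<And>g. locally_integrable \<Omega>' g \<Longrightarrow>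
          slobodeckij \<theta> p \<Omega> (pullback W (e i) \<Phi> g) \<le> ennreal C * (Lp_norm p \<Omega>' g + slobodeckij \<theta> p \<Omega>' g)"
          using slobodeckij_pullback_le[OF d i(1) p \<theta> W(2)] by blast
        show ?thesis
        proof (intro exI[of _ "C * (1 + 1)"] conjI allI impI)
          fix z assume z: "?Q z"
          obtain f F where zz: "z = (f, F)" by (cases z)
          note Q = z[unfolded zz]
          have "F (\<mu> i) \<in> weak_derivs \<Omega>' (\<mu> i) f" using Q i by auto
          then have "slobodeckij \<theta> p \<Omega> (pullback W (e i) \<Phi> (F (\<mu> i))) \<le> ennreal C * (Lp_norm p \<Omega>' (F (\<mu> i)) + slobodeckij \<theta> p \<Omega>' (F (\<mu> i)))"
            by (intro C(2) weak_derivsD)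
          also have "\<dots> \<le> ennreal (C * (1 + 1)) * sobolev_norm s p \<Omega>' f"
            using C(1) L[OF Q i(2)] S[OF Q True \<theta>0] by (intro ennreal_bound_cmult ennreal_bound_add) simp_all
          finally show "slobodeckij \<theta> p \<Omega> (?G i z) \<le> ennreal (C * (1 + 1)) * ?N z" by (simp add: zz)
        qed (use C in simp)
      next
        case False
        then have lt: "mi_order (\<mu> i) < k" using i(2) by simp
        obtain C where C: "0 \<le> C" "\<And>f \<mu> g D. locally_integrable \<Omega>' f \<Longrightarrow> g \<in> weak_derivs \<Omega>' \<mu> f \<Longrightarrow>
          (\<forall>j. D j \<in> weak_derivs \<Omega>' (mi_inc \<mu> j) f) \<Longrightarrow>
          slobodeckij \<theta> p \<Omega> (pullback W (e i) \<Phi> g) \<le> ennreal C * (Lp_norm p \<Omega>' g + (\<Sum>j\<in>UNIV. Lp_norm p \<Omega>' (D j)))"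
          using slobodeckij_pullback_lower_le[OF d i(1) p \<theta> W(2) \<Omega>(2), of \<Omega>] by blast
        let ?C = "C * (1 + (\<Sum>j\<in>(UNIV :: 'n set). 1))"
        show ?thesis
        proof (intro exI[of _ ?C] conjI allI impI)
          fix z assume z: "?Q z"
          obtain f F where zz: "z = (f, F)" by (cases z)
          note Q = z[unfolded zz]
          have inc: "mi_order (mi_inc (\<mu> i) j) \<le> k" for j using lt by (simp add: mi_order_inc)
          have "slobodeckij \<theta> p \<Omega> (pullback W (e i) \<Phi> (F (\<mu> i))) \<le>
              ennreal C * (Lp_norm p \<Omega>' (F (\<mu> i)) + (\<Sum>j\<in>UNIV. Lp_norm p \<Omega>' (F (mi_inc (\<mu> i) j))))"
            using Q i inc by (intro C(2)[of f _ "\<mu> i"]) auto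
          also have "\<dots> \<le> ennreal ?C * sobolev_norm s p \<Omega>' f" using C(1) L[OF Q i(2)] L[OF Q inc]
            by (intro ennreal_bound_cmult ennreal_bound_add ennreal_bound_sum) simp_all
          finally show "slobodeckij \<theta> p \<Omega> (?G i z) \<le> ennreal ?C * ?N z" by (simp add: zz)
        qed (use C in simp)
      qed
    qed
  qed
  have "\<exists>C\<ge>0. \<forall>z. ?Q z \<longrightarrow>
      (\<Sum>\<nu> | mi_order \<nu> \<le> k. INF g\<in>weak_derivs \<Omega> \<nu> (pullback W a \<Phi> (fst z)). Lp_norm p \<Omega> g) \<le> ennreal C * ?N z"
    by (rule uniform_bound_sum[OF finite_mi_order_le], rule 1) simp
  then obtain C1 where C1: "0 \<le> C1" "\<And>z. ?Q z \<Longrightarrow>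
      (\<Sum>\<nu> | mi_order \<nu> \<le> k. INF g\<in>weak_derivs \<Omega> \<nu> (pullback W a \<Phi> (fst z)). Lp_norm p \<Omega> g) \<le> ennreal C1 * ?N z"
    by blast
  have "\<exists>C\<ge>0. \<forall>z. \<theta> \<noteq> 0 \<and> ?Q z \<longrightarrow>
      (\<Sum>\<nu> | mi_order \<nu> = k. INF g\<in>weak_derivs \<Omega> \<nu> (pullback W a \<Phi> (fst z)). slobodeckij \<theta> p \<Omega> g) \<le> ennreal C * ?N z"
  proof (rule uniform_bound_sum[OF finite_mi_order_eq])
    fix \<nu> :: "'n multi_index" assume "\<nu> \<in> {\<nu>. mi_order \<nu> = k}"
    then have "mi_order \<nu> \<le> k" by simp
    from 2[OF this] show "\<exists>C\<ge>0. \<forall>z. \<theta> \<noteq> 0 \<and> ?Q z \<longrightarrow>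
      (INF g\<in>weak_derivs \<Omega> \<nu> (pullback W a \<Phi> (fst z)). slobodeckij \<theta> p \<Omega> g) \<le> ennreal C * ?N z"
      by (cases "\<theta> = 0") (auto intro: exI[of _ 0])
  qed
  then obtain C2 where C2: "0 \<le> C2" "\<And>z. \<theta> \<noteq> 0 \<and> ?Q z \<Longrightarrow>
      (\<Sum>\<nu> | mi_order \<nu> = k. INF g\<in>weak_derivs \<Omega> \<nu> (pullback W a \<Phi> (fst z)). slobodeckij \<theta> p \<Omega> g) \<le> ennreal C2 * ?N z"
    by blast
  \<comment> \<open>The summand \<open>1\<close> makes the constant positive, so the bound also holds if the norm on the right is infinite.\<close>
  have "sobolev_norm s p \<Omega> (pullback W a \<Phi> f) \<le> ennreal (C1 + C2 + 1) * sobolev_norm s p \<Omega>' f"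
    if f: "locally_integrable \<Omega>' f" for f
  proof (cases "sobolev_norm s p \<Omega>' f < \<infinity>")
    case True
    define F where "F \<mu> = (SOME g. g \<in> weak_derivs \<Omega>' \<mu> f)" for \<mu>
    have "F \<mu> \<in> weak_derivs \<Omega>' \<mu> f" if "mi_order \<mu> \<le> k" for \<mu>
      unfolding F_def some_in_eq using sobolev_norm_finite_weak_derivs[OF True] that by (simp add: k_def)
    then have Q: "?Q (f, F)" using f by simp
    have "sobolev_norm s p \<Omega> (pullback W a \<Phi> f) \<le> ennreal (C1 + C2) * sobolev_norm s p \<Omega>' f"
      unfolding sobolev_norm_def[of _ _ \<Omega>] Let_def k_def[symmetric] \<theta>_def[symmetric]
    proof (intro ennreal_bound_add C1(1) C2(1))
      show "(\<Sum>\<nu> | mi_order \<nu> \<le> k. INF g\<in>weak_derivs \<Omega> \<nu> (pullback W a \<Phi> f). Lp_norm p \<Omega> g) \<le> ennreal C1 * sobolev_norm s p \<Omega>' f"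
        using C1(2)[OF Q] by simp
      show "(if \<theta> = 0 then 0 else \<Sum>\<nu> | mi_order \<nu> = k. INF g\<in>weak_derivs \<Omega> \<nu> (pullback W a \<Phi> f). slobodeckij \<theta> p \<Omega> g)
          \<le> ennreal C2 * sobolev_norm s p \<Omega>' f" using C2(2)[OF conjI[OF _ Q]] by simp
    qed
    also have "\<dots> \<le> ennreal (C1 + C2 + 1) * sobolev_norm s p \<Omega>' f" by (intro mult_right_mono ennreal_leI) auto
    finally show ?thesis .
  next
    case False
    then have "sobolev_norm s p \<Omega>' f = \<infinity>" by (simp add: less_top[symmetric])
    then show ?thesis using C1(1) C2(1) by (simp add: ennreal_mult_top)
  qed
  then show ?thesis using C1(1) C2(1) by (intro exI[of _ "C1 + C2 + 1"]) auto
qed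


section \<open>Localised pull-backs of distributions\<close>

lemma ennreal_le_cmult_Inf:
  assumes "0 < C" "\<And>s. s \<in> S \<Longrightarrow> x \<le> ennreal C * s"
  shows "x \<le> ennreal C * Inf S"
proof -
  have 1: "ennreal (1 / C) * ennreal C = 1" using assms(1) by (simp flip: ennreal_mult)
  have "ennreal (1 / C) * x \<le> Inf S"
  proof (rule Inf_greatest)
    fix s assume "s \<in> S"
    then have "ennreal (1 / C) * x \<le> ennreal (1 / C) * (ennreal C * s)" using assms(2) by (intro mult_left_mono) auto
    then show "ennreal (1 / C) * x \<le> s" by (simp add: mult.assoc[symmetric] 1)
  qed
  then have "ennreal C * (ennreal (1 / C) * x) \<le> ennreal C * Inf S" by (intro mult_left_mono) auto
  then show ?thesis using 1 by (simp add: mult.assoc[symmetric] mult.commute[of "ennreal C"])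
qed

lemma ennreal_le_INF_add:
  fixes f :: "'i \<Rightarrow> ennreal"
  assumes "\<And>a. a \<in> A \<Longrightarrow> x \<le> f a + c"
  shows "x \<le> (INF a\<in>A. f a) + c"
proof (cases "c = top")
  case False
  have "x - c \<le> (INF a\<in>A. f a)" using assms False by (intro INF_greatest) (simp add: ennreal_minus_le_iff add.commute)
  then show ?thesis using False by (simp add: ennreal_minus_le_iff add.commute)
qed simp

lemma ennreal_le_INF_add_INF:
  fixes f :: "'i \<Rightarrow> ennreal"
  assumes "\<And>a b. a \<in> A \<Longrightarrow> b \<in> B \<Longrightarrow> x \<le> f a + g b"
  shows "x \<le> (INF a\<in>A. f a) + (INF b\<in>B. g b)"
proof (rule ennreal_le_INF_add)
  fix a assume a: "a \<in> A"
  have "x \<le> (INF b\<in>B. g b) + f a" by (rule ennreal_le_INF_add) (use assms[OF a] in \<open>simp add: add.commute\<close>)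
  then show "x \<le> f a + (INF b\<in>B. g b)" by (simp add: add.commute)
qed

lemma Lp_spaceI:
  assumes "borel_on \<Omega> f" "Lp_norm p \<Omega> f < \<infinity>"
  shows "f \<in> Lp_space p \<Omega>"
  using assms by (simp add: Lp_space_def set_borel_measurable_def)

lemma Lp_space_pullback:
  assumes d: "diffeo W W' \<Phi> \<Psi>" and b: "b \<in> test_functions W" and p: "1 < p" and W: "W' \<subseteq> \<Omega>'"
    and \<Omega>: "open \<Omega>" and f: "f \<in> Lp_space p \<Omega>'"
  shows "pullback W b \<Phi> f \<in> Lp_space p \<Omega>"
proof (rule Lp_spaceI)
  note l = Lp_space_locally_integrable[OF p f]
  have oW': "open W'" using d by (simp add: diffeo_def)
  show "(\<lambda>x. indicator \<Omega> x * pullback W b \<Phi> f x) \<in> borel_measurable borel"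
    using pullback_borel[OF d b locally_integrable_measurable[OF oW' locally_integrable_subset[OF l W]]] borel_open[OF \<Omega>]
    by measurable
  obtain C where "\<And>g. locally_integrable \<Omega>' g \<Longrightarrow> Lp_norm p \<Omega> (pullback W b \<Phi> g) \<le> ennreal C * Lp_norm p \<Omega>' g"
    using Lp_norm_pullback_le[OF d b p W] by blast
  from this[OF l] show "Lp_norm p \<Omega> (pullback W b \<Phi> f) < \<infinity>"
    using f by (auto simp: Lp_space_def ennreal_mult_less_top intro: le_less_trans)
qed

lemma locally_integrable_test: "\<xi> \<in> test_functions \<Omega>' \<Longrightarrow> locally_integrable \<Omega> \<xi>"
  by (intro integrable_imp_locally_integrable test_function_integrable)

text \<open>Pull-backs of approximating test functions are test functions, and they approximate the pull-back by the
  norm bound.\<close>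

lemma sobolev_space0_pullback:
  assumes d: "diffeo W W' \<Phi> \<Psi>" and b: "b \<in> test_functions W" and p: "1 < p" and W: "W \<subseteq> \<Omega>" "W' \<subseteq> \<Omega>'"
    and \<Omega>: "open \<Omega>" and C: "0 < C" "\<And>f. locally_integrable \<Omega>' f \<Longrightarrow>
      sobolev_norm s p \<Omega> (pullback W b \<Phi> f) \<le> ennreal C * sobolev_norm s p \<Omega>' f"
    and f: "f \<in> sobolev_space0 s p \<Omega>'"
  shows "pullback W b \<Phi> f \<in> sobolev_space0 s p \<Omega>"
proof -
  have f': "f \<in> Lp_space p \<Omega>'" "sobolev_norm s p \<Omega>' f < \<infinity>" using f by (auto simp: sobolev_space0_def sobolev_space_def)
  note l = Lp_space_locally_integrable[OF p f'(1)]
  have "\<exists>\<xi>\<in>test_functions \<Omega>. sobolev_norm s p \<Omega> (\<lambda>x. pullback W b \<Phi> f x - \<xi> x) < ennreal \<epsilon>" if \<epsilon>: "\<epsilon> > 0" for \<epsilon>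
  proof -
    obtain \<xi> where \<xi>: "\<xi> \<in> test_functions \<Omega>'" "sobolev_norm s p \<Omega>' (\<lambda>x. f x - \<xi> x) < ennreal (\<epsilon> / C)"
    proof -
      have "\<epsilon> / C > 0" using \<epsilon> C(1) by simp
      moreover have "\<forall>\<epsilon>>0. \<exists>\<xi>\<in>test_functions \<Omega>'. sobolev_norm s p \<Omega>' (\<lambda>x. f x - \<xi> x) < ennreal \<epsilon>"
        using f by (simp add: sobolev_space0_def)
      ultimately show ?thesis using that by blast
    qed
    have "locally_integrable \<Omega>' (\<lambda>x. f x + (- 1) * \<xi> x)"
      by (intro locally_integrable_add l locally_integrable_cmult locally_integrable_test[OF \<xi>(1)])
    then have "sobolev_norm s p \<Omega> (pullback W b \<Phi> (\<lambda>x. f x - \<xi> x)) \<le> ennreal C * sobolev_norm s p \<Omega>' (\<lambda>x. f x - \<xi> x)"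
      by (intro C(2)) simp
    also have "\<dots> < ennreal C * ennreal (\<epsilon> / C)" using \<xi>(2) C(1) by (intro ennreal_mult_strict_left_mono) auto
    also have "\<dots> = ennreal \<epsilon>" using C(1) \<epsilon> by (simp flip: ennreal_mult)
    finally have "sobolev_norm s p \<Omega> (\<lambda>x. pullback W b \<Phi> f x - pullback W b \<Phi> \<xi> x) < ennreal \<epsilon>"
      by (simp add: pullback_def if_distrib right_diff_distrib cong: if_cong)
    moreover have "pullback W b \<Phi> \<xi> \<in> test_functions \<Omega>"
      by (rule test_functions_mono[OF W(1) pullback_test[OF d b test_functionsD(1)[OF \<xi>(1)]]])
    ultimately show ?thesis by blast
  qed
  moreover have "sobolev_norm s p \<Omega> (pullback W b \<Phi> f) < \<infinity>"
    using C(2)[OF l] f'(2) by (auto simp: ennreal_mult_less_top intro: le_less_trans)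
  ultimately show ?thesis
    using Lp_space_pullback[OF d b p W(2) \<Omega> f'(1)] by (simp add: sobolev_space0_def sobolev_space_def)
qed

text \<open>For \<open>e \<ge> 0\<close> the pull-back is moved from the test function to the function that represents the
  distribution; for \<open>e < 0\<close> it acts on the predual.\<close>

theorem distr_norm_pullback_le:
  fixes W W' \<Omega> \<Omega>' :: "(real^'n::finite) set" and e p :: real
  assumes d: "diffeo W W' \<Phi> \<Psi>" and a: "a \<in> test_functions W" and p: "1 < p"
    and W: "W \<subseteq> \<Omega>" "W' \<subseteq> \<Omega>'" and \<Omega>: "open \<Omega>" "open \<Omega>'"
  shows "\<exists>C>0. \<forall>T. distr_norm e p \<Omega>' (\<lambda>\<xi>. T (pullback W a \<Phi> \<xi>)) \<le> ennreal C * distr_norm e p \<Omega> T"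
proof (cases "0 \<le> e")
  case True
  note d' = diffeo_sym[OF d]
  let ?a = "adjoint_weight W' \<Psi> a"
  have a': "?a \<in> test_functions W'" by (rule test_functions_adjoint_weight[OF d a])
  obtain C where C: "C > 0" "\<And>f. locally_integrable \<Omega> f \<Longrightarrow>
    sobolev_norm e p \<Omega>' (pullback W' ?a \<Psi> f) \<le> ennreal C * sobolev_norm e p \<Omega> f"
    using sobolev_norm_pullback_le[OF d' a' p W(2,1) \<Omega>(2,1)] by blast
  have "distr_norm e p \<Omega>' (\<lambda>\<xi>. T (pullback W a \<Phi> \<xi>)) \<le> ennreal C * distr_norm e p \<Omega> T" for T
  proof -
    have "distr_norm e p \<Omega>' (\<lambda>\<xi>. T (pullback W a \<Phi> \<xi>)) \<le> ennreal C * sobolev_norm e p \<Omega> f"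
      if f: "f \<in> Lp_space p \<Omega>" and T: "\<And>\<xi>. \<xi> \<in> test_functions \<Omega> \<Longrightarrow> T \<xi> = regular_distribution \<Omega> f \<xi>" for f
    proof -
      note l = Lp_space_locally_integrable[OF p f]
      let ?g = "pullback W' ?a \<Psi> f"
      have "T (pullback W a \<Phi> \<xi>) = regular_distribution \<Omega>' ?g \<xi>" if \<xi>: "\<xi> \<in> test_functions \<Omega>'" for \<xi>
      proof -
        have t: "pullback W a \<Phi> \<xi> \<in> test_functions \<Omega>"
          by (rule test_functions_mono[OF W(1) pullback_test[OF d a test_functionsD(1)[OF \<xi>]]])
        let ?f = "\<lambda>x. indicator \<Omega> x * f x"
        have "T (pullback W a \<Phi> \<xi>) = (\<integral>x. f x * pullback W a \<Phi> \<xi> x \<partial>lborel)"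
          using T[OF t] set_integrable_mult_test(2)[OF l t] by (simp add: regular_distribution_def)
        also have "\<dots> = (\<integral>x. pullback W a \<Phi> \<xi> x * ?f x \<partial>lborel)"
          using W(1) by (intro Bochner_Integration.integral_cong) (auto simp: pullback_def indicator_def)
        also have "\<dots> = (\<integral>y. \<xi> y * pullback W' ?a \<Psi> ?f y \<partial>lborel)"
        proof (rule integral_pullback_adjoint[OF d a _ locally_integrable_measurable[OF \<Omega>(1) l]])
          have "W' \<in> sets borel" using d by (auto simp: diffeo_def)
          then show "borel_on W' \<xi>" using test_function_measurable[OF \<xi>] by measurable
        qed
        also have "pullback W' ?a \<Psi> ?f = ?g"
          using d W(1) by (auto simp: pullback_def diffeo_def indicator_def fun_eq_iff)
        also have "(\<integral>y. \<xi> y * ?g y \<partial>lborel) = regular_distribution \<Omega>' ?g \<xi>"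
          using set_integrable_mult_test(2)[OF integrable_imp_locally_integrable[OF
              integrable_pullback[OF d' a' locally_integrable_subset[OF l W(1)]]] \<xi>]
          by (simp add: regular_distribution_def mult.commute)
        finally show ?thesis .
      qed
      moreover have "?g \<in> Lp_space p \<Omega>'" by (rule Lp_space_pullback[OF d' a' p W(1) \<Omega>(2) f])
      ultimately have "distr_norm e p \<Omega>' (\<lambda>\<xi>. T (pullback W a \<Phi> \<xi>)) \<le> sobolev_norm e p \<Omega>' ?g"
        using True unfolding distr_norm_def by (auto intro!: Inf_lower)
      then show ?thesis using C(2)[OF l] by (rule order_trans)
    qed
    then show ?thesis using True unfolding distr_norm_def[of e p \<Omega>] by (auto intro!: ennreal_le_cmult_Inf C(1))
  qed
  then show ?thesis using C(1) by blast
next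
  case False
  define p' where "p' = p / (p - 1)"
  have p': "1 < p'" using p by (simp add: p'_def)
  obtain C where C: "C > 0" "\<And>f. locally_integrable \<Omega>' f \<Longrightarrow>
    sobolev_norm (- e) p' \<Omega> (pullback W a \<Phi> f) \<le> ennreal C * sobolev_norm (- e) p' \<Omega>' f"
    using sobolev_norm_pullback_le[OF d a p' W \<Omega>] by blast
  let ?D = "sobolev_space0 (- e) p' \<Omega>" and ?D' = "sobolev_space0 (- e) p' \<Omega>'"
  have maps: "pullback W a \<Phi> f \<in> ?D" if "f \<in> ?D'" for f by (rule sobolev_space0_pullback[OF d a p' W \<Omega>(1) C that])
  have "distr_norm e p \<Omega>' (\<lambda>\<xi>. T (pullback W a \<Phi> \<xi>)) \<le> ennreal C * distr_norm e p \<Omega> T" for T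
  proof -
    have "distr_norm e p \<Omega>' (\<lambda>\<xi>. T (pullback W a \<Phi> \<xi>)) \<le> ennreal C * ennreal c"
      if c: "0 \<le> c" and lin: "linear_functional_on ?D F"
        and bnd: "\<And>f. f \<in> ?D \<Longrightarrow> ennreal \<bar>F f\<bar> \<le> ennreal c * sobolev_norm (- e) p' \<Omega> f"
        and F: "\<And>\<xi>. \<xi> \<in> test_functions \<Omega> \<Longrightarrow> F \<xi> = T \<xi>" for c F
    proof -
      let ?F = "\<lambda>f. F (pullback W a \<Phi> f)"
      have "linear_functional_on ?D' ?F"
        using lin maps by (simp add: linear_functional_on_def pullback_add pullback_cmult)
      moreover have "ennreal \<bar>?F f\<bar> \<le> ennreal (c * C) * sobolev_norm (- e) p' \<Omega>' f" if f: "f \<in> ?D'" for f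
      proof -
        have l: "locally_integrable \<Omega>' f"
          using f by (intro Lp_space_locally_integrable[OF p']) (simp add: sobolev_space0_def sobolev_space_def)
        have "ennreal \<bar>?F f\<bar> \<le> ennreal c * sobolev_norm (- e) p' \<Omega> (pullback W a \<Phi> f)" by (rule bnd[OF maps[OF f]])
        also have "\<dots> \<le> ennreal (c * C) * sobolev_norm (- e) p' \<Omega>' f"
          using c C(1) by (intro ennreal_bound_cmult C(2)[OF l]) auto
        finally show ?thesis .
      qed
      moreover have "?F \<xi> = T (pullback W a \<Phi> \<xi>)" if \<xi>: "\<xi> \<in> test_functions \<Omega>'" for \<xi>
        by (rule F[OF test_functions_mono[OF W(1) pullback_test[OF d a test_functionsD(1)[OF \<xi>]]]])
      ultimately have "distr_norm e p \<Omega>' (\<lambda>\<xi>. T (pullback W a \<Phi> \<xi>)) \<le> ennreal (c * C)"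
        using False c C(1) unfolding distr_norm_def Let_def p'_def[symmetric]
        by (simp, intro Inf_lower CollectI exI[of _ "c * C"] exI[of _ ?F] conjI refl) auto
      then show ?thesis using c C(1) by (simp add: ennreal_mult mult.commute)
    qed
    then show ?thesis using False unfolding distr_norm_def[of e p \<Omega>] Let_def p'_def[symmetric]
      by (auto intro!: ennreal_le_cmult_Inf C(1))
  qed
  then show ?thesis using C(1) by blast
qed

lemma distr_norm_cong:
  assumes "\<And>\<xi>. \<xi> \<in> test_functions \<Omega> \<Longrightarrow> T \<xi> = T' \<xi>"
  shows "distr_norm e p \<Omega> T = distr_norm e p \<Omega> T'"
  using assms by (simp add: distr_norm_def cong: ball_cong)

lemma Lp_norm_add_le:
  assumes p: "1 < p" and \<Omega>: "open \<Omega>" and l: "locally_integrable \<Omega> f" "locally_integrable \<Omega> g"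
  shows "Lp_norm p \<Omega> (\<lambda>x. f x + g x) \<le> ennreal (((2 powr p + 1) * 3) powr (1 / p)) * (Lp_norm p \<Omega> f + Lp_norm p \<Omega> g)"
  using Lp_norm_sum_le[OF p finite_class.finite_UNIV, of \<Omega> "\<lambda>b. if b then f else g"]
    locally_integrable_measurable[OF \<Omega> l(1)] locally_integrable_measurable[OF \<Omega> l(2)]
  by (simp add: UNIV_bool add.commute)

text \<open>A quasi-triangle inequality: \<open>Lp_norm_sum_le\<close> and \<open>slobodeckij_sum_le\<close> are applied to the sums of the chosen weak
  derivatives.\<close>

lemma sobolev_norm_add_le:
  fixes \<Omega> :: "(real^'n::finite) set" and s p :: real
  assumes p: "1 < p" and \<Omega>: "open \<Omega>"
  shows "\<exists>C>0. \<forall>f g. locally_integrable \<Omega> f \<longrightarrow> locally_integrable \<Omega> g \<longrightarrow>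
    sobolev_norm s p \<Omega> (\<lambda>x. f x + g x) \<le> ennreal C * (sobolev_norm s p \<Omega> f + sobolev_norm s p \<Omega> g)"
proof -
  define c where "c = ((2 powr p + 1) * 3) powr (1 / p)"
  have "0 < (2 powr p + 1) * (3 :: real)" by (simp add: add_pos_pos)
  then have c: "c > 0" unfolding c_def by (simp only: powr_gt_zero)
  define k where "k = nat \<lfloor>s\<rfloor>"
  have \<Omega>m: "\<Omega> \<in> sets borel" using \<Omega> by auto
  note Lp = Lp_norm_add_le[OF p \<Omega>, folded c_def]
  have sl: "slobodeckij \<theta> p \<Omega> (\<lambda>x. f x + g x) \<le> ennreal c * (slobodeckij \<theta> p \<Omega> f + slobodeckij \<theta> p \<Omega> g)"
    if "locally_integrable \<Omega> f" "locally_integrable \<Omega> g" for f g \<theta>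
  proof -
    let ?i = "\<lambda>f x. indicator \<Omega> x * f x"
    have i: "slobodeckij \<theta> p \<Omega> (?i f) = slobodeckij \<theta> p \<Omega> f" for f by (simp add: slobodeckij_def slob_int_indicator)
    have "slobodeckij \<theta> p \<Omega> (\<lambda>x. ?i f x + ?i g x) \<le> ennreal c * (slobodeckij \<theta> p \<Omega> (?i f) + slobodeckij \<theta> p \<Omega> (?i g))"
      using slobodeckij_sum_le[OF p finite_class.finite_UNIV \<Omega>m, of "\<lambda>b. if b then ?i f else ?i g" \<theta>]
        locally_integrable_measurable[OF \<Omega> that(1)] locally_integrable_measurable[OF \<Omega> that(2)]
      by (simp add: UNIV_bool c_def add.commute)
    moreover have "(\<lambda>x. ?i f x + ?i g x) = ?i (\<lambda>x. f x + g x)" by (simp add: distrib_left)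
    ultimately show ?thesis by (simp only: i)
  qed
  have "sobolev_norm s p \<Omega> (\<lambda>x. f x + g x) \<le> ennreal c * (sobolev_norm s p \<Omega> f + sobolev_norm s p \<Omega> g)"
    if f: "locally_integrable \<Omega> f" and g: "locally_integrable \<Omega> g" for f g
  proof (cases "sobolev_norm s p \<Omega> f < \<infinity> \<and> sobolev_norm s p \<Omega> g < \<infinity>")
    case True
    define F where "F h \<mu> = (SOME u. u \<in> weak_derivs \<Omega> \<mu> h)" for h \<mu>
    have F: "F f \<mu> \<in> weak_derivs \<Omega> \<mu> f" "F g \<mu> \<in> weak_derivs \<Omega> \<mu> g" if "mi_order \<mu> \<le> k" for \<mu>
      unfolding F_def some_in_eq using sobolev_norm_finite_weak_derivs True that unfolding k_def by blast+
    have FG: "(\<lambda>x. F f \<mu> x + F g \<mu> x) \<in> weak_derivs \<Omega> \<mu> (\<lambda>x. f x + g x)" if "mi_order \<mu> \<le> k" for \<mu>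
      by (rule weak_derivs_add[OF f g F[OF that]])
    have A: "(\<Sum>\<mu> | mi_order \<mu> \<le> k. Lp_norm p \<Omega> (\<lambda>x. F f \<mu> x + F g \<mu> x)) \<le>
        ennreal c * ((\<Sum>\<mu> | mi_order \<mu> \<le> k. Lp_norm p \<Omega> (F f \<mu>)) + (\<Sum>\<mu> | mi_order \<mu> \<le> k. Lp_norm p \<Omega> (F g \<mu>)))"
      unfolding sum.distrib[symmetric] sum_distrib_left
      by (intro sum_mono Lp weak_derivsD[OF F(1)] weak_derivsD[OF F(2)]) auto
    have B: "(\<Sum>\<mu> | mi_order \<mu> = k. slobodeckij (frac s) p \<Omega> (\<lambda>x. F f \<mu> x + F g \<mu> x)) \<le>
        ennreal c * ((\<Sum>\<mu> | mi_order \<mu> = k. slobodeckij (frac s) p \<Omega> (F f \<mu>)) + (\<Sum>\<mu> | mi_order \<mu> = k. slobodeckij (frac s) p \<Omega> (F g \<mu>)))"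
      unfolding sum.distrib[symmetric] sum_distrib_left
      by (intro sum_mono sl weak_derivsD[OF F(1)] weak_derivsD[OF F(2)]) auto
    have "sobolev_norm s p \<Omega> (\<lambda>x. f x + g x) \<le>
      ennreal c * ((\<Sum>\<mu> | mi_order \<mu> \<le> k. Lp_norm p \<Omega> (F f \<mu>)) + (\<Sum>\<mu> | mi_order \<mu> \<le> k. Lp_norm p \<Omega> (F g \<mu>))) +
      (if frac s = 0 then 0 else ennreal c * ((\<Sum>\<mu> | mi_order \<mu> = k. slobodeckij (frac s) p \<Omega> (F f \<mu>)) + (\<Sum>\<mu> | mi_order \<mu> = k. slobodeckij (frac s) p \<Omega> (F g \<mu>))))"
    proof -
      have "sobolev_norm s p \<Omega> (\<lambda>x. f x + g x) = (\<Sum>\<mu> | mi_order \<mu> \<le> k. Lp_norm p \<Omega> (\<lambda>x. F f \<mu> x + F g \<mu> x)) +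
        (if frac s = 0 then 0 else \<Sum>\<mu> | mi_order \<mu> = k. slobodeckij (frac s) p \<Omega> (\<lambda>x. F f \<mu> x + F g \<mu> x))"
        unfolding k_def by (rule sobolev_norm_eq[OF \<Omega>, where F = "\<lambda>\<mu> x. F f \<mu> x + F g \<mu> x"]) (rule FG[unfolded k_def])
      then show ?thesis using A B by (auto intro: add_mono)
    qed
    also have "\<dots> = ennreal c * (sobolev_norm s p \<Omega> f + sobolev_norm s p \<Omega> g)"
      using sobolev_norm_eq[OF \<Omega>, of s "F f" f p] sobolev_norm_eq[OF \<Omega>, of s "F g" g p] F
      by (simp add: distrib_left add_ac k_def)
    finally show ?thesis .
  next
    case False
    then have "sobolev_norm s p \<Omega> f + sobolev_norm s p \<Omega> g = \<infinity>" by (auto simp: less_top[symmetric])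
    then have "ennreal c * (sobolev_norm s p \<Omega> f + sobolev_norm s p \<Omega> g) = top"
      unfolding infinity_ennreal_def by (simp only: ennreal_mult_top) (use c in simp)
    then show ?thesis by simp
  qed
  then show ?thesis using c by blast
qed

text \<open>Representing functions add up if \<open>e \<ge> 0\<close>, and bounded extensions to the zero-trace space add up if \<open>e < 0\<close>.\<close>

lemma distr_norm_add_le:
  assumes p: "1 < p" and \<Omega>: "open \<Omega>"
  shows "\<exists>C>0. \<forall>T T'. distr_norm e p \<Omega> (\<lambda>\<xi>. T \<xi> + T' \<xi>) \<le> ennreal C * (distr_norm e p \<Omega> T + distr_norm e p \<Omega> T')"
proof (cases "0 \<le> e")
  case True
  obtain C where C: "C > 0" "\<And>f g. locally_integrable \<Omega> f \<Longrightarrow> locally_integrable \<Omega> g \<Longrightarrow>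
    sobolev_norm e p \<Omega> (\<lambda>x. f x + g x) \<le> ennreal C * (sobolev_norm e p \<Omega> f + sobolev_norm e p \<Omega> g)"
    using sobolev_norm_add_le[OF p \<Omega>, of e] by blast
  let ?R = "\<lambda>T. {f \<in> Lp_space p \<Omega>. \<forall>\<xi>\<in>test_functions \<Omega>. T \<xi> = regular_distribution \<Omega> f \<xi>}"
  have N: "distr_norm e p \<Omega> T = (INF f\<in>?R T. sobolev_norm e p \<Omega> f)" for T
    using True unfolding distr_norm_def by (auto intro!: arg_cong[where f = Inf])
  have "distr_norm e p \<Omega> (\<lambda>\<xi>. T \<xi> + T' \<xi>) \<le> ennreal C * (distr_norm e p \<Omega> T + distr_norm e p \<Omega> T')" for T T'
  proof -
    have *: "distr_norm e p \<Omega> (\<lambda>\<xi>. T \<xi> + T' \<xi>) \<le> ennreal C * (sobolev_norm e p \<Omega> f + sobolev_norm e p \<Omega> g)"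
      if f: "f \<in> ?R T" and g: "g \<in> ?R T'" for f g
    proof -
      have l: "locally_integrable \<Omega> f" "locally_integrable \<Omega> g" using f g Lp_space_locally_integrable[OF p] by auto
      have "(\<lambda>x. f x + g x) \<in> Lp_space p \<Omega>"
      proof (rule Lp_spaceI)
        show "(\<lambda>x. indicator \<Omega> x * (f x + g x)) \<in> borel_measurable borel"
          by (rule locally_integrable_measurable[OF \<Omega> locally_integrable_add[OF l]])
        have "Lp_norm p \<Omega> (\<lambda>x. f x + g x) \<le> ennreal (((2 powr p + 1) * 3) powr (1 / p)) * (Lp_norm p \<Omega> f + Lp_norm p \<Omega> g)"
          by (rule Lp_norm_add_le[OF p \<Omega> l])
        also have "\<dots> < \<infinity>" using f g by (auto simp: Lp_space_def ennreal_mult_less_top)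
        finally show "Lp_norm p \<Omega> (\<lambda>x. f x + g x) < \<infinity>" .
      qed
      moreover have "T \<xi> + T' \<xi> = regular_distribution \<Omega> (\<lambda>x. f x + g x) \<xi>" if \<xi>: "\<xi> \<in> test_functions \<Omega>" for \<xi>
        using f g \<xi> set_integrable_mult_test[OF l(1) \<xi>] set_integrable_mult_test[OF l(2) \<xi>]
          set_integrable_mult_test(2)[OF locally_integrable_add[OF l] \<xi>]
        by (simp add: regular_distribution_def distrib_right)
      ultimately have "distr_norm e p \<Omega> (\<lambda>\<xi>. T \<xi> + T' \<xi>) \<le> sobolev_norm e p \<Omega> (\<lambda>x. f x + g x)"
        unfolding N by (intro INF_lower) auto
      then show ?thesis using C(2)[OF l] by (rule order_trans)
    qed
    have "distr_norm e p \<Omega> (\<lambda>\<xi>. T \<xi> + T' \<xi>) \<le> ennreal C * (INF z\<in>?R T \<times> ?R T'. sobolev_norm e p \<Omega> (fst z) + sobolev_norm e p \<Omega> (snd z))"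
      using * by (intro ennreal_le_cmult_Inf C(1)) auto
    also have "\<dots> \<le> ennreal C * (distr_norm e p \<Omega> T + distr_norm e p \<Omega> T')"
    proof (rule mult_left_mono)
      show "(INF z\<in>?R T \<times> ?R T'. sobolev_norm e p \<Omega> (fst z) + sobolev_norm e p \<Omega> (snd z)) \<le> distr_norm e p \<Omega> T + distr_norm e p \<Omega> T'"
      unfolding N
    proof (rule ennreal_le_INF_add_INF)
      fix f g assume "f \<in> ?R T" "g \<in> ?R T'"
      then show "(INF z\<in>?R T \<times> ?R T'. sobolev_norm e p \<Omega> (fst z) + sobolev_norm e p \<Omega> (snd z))
          \<le> sobolev_norm e p \<Omega> f + sobolev_norm e p \<Omega> g" by (intro INF_lower2[of "(f, g)"]) auto
    qed
    qed simp
    finally show ?thesis .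
  qed
  then show ?thesis using C(1) by blast
next
  case False
  let ?p' = "p / (p - 1)"
  let ?W = "sobolev_space0 (- e) ?p' \<Omega>"
  let ?R = "\<lambda>T. {c. 0 \<le> c \<and> (\<exists>F. linear_functional_on ?W F \<and> (\<forall>f\<in>?W. ennreal \<bar>F f\<bar> \<le> ennreal c * sobolev_norm (- e) ?p' \<Omega> f) \<and>
    (\<forall>\<xi>\<in>test_functions \<Omega>. F \<xi> = T \<xi>))}"
  have N: "distr_norm e p \<Omega> T = (INF c\<in>?R T. ennreal c)" for T
    using False unfolding distr_norm_def Let_def by (auto intro!: arg_cong[where f = Inf])
  have "distr_norm e p \<Omega> (\<lambda>\<xi>. T \<xi> + T' \<xi>) \<le> distr_norm e p \<Omega> T + distr_norm e p \<Omega> T'" for T T'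
  proof -
    have *: "distr_norm e p \<Omega> (\<lambda>\<xi>. T \<xi> + T' \<xi>) \<le> ennreal c + ennreal c'" if c: "c \<in> ?R T" and c': "c' \<in> ?R T'" for c c'
    proof -
      obtain F where F: "linear_functional_on ?W F" "\<And>f. f \<in> ?W \<Longrightarrow> ennreal \<bar>F f\<bar> \<le> ennreal c * sobolev_norm (- e) ?p' \<Omega> f"
        "\<And>\<xi>. \<xi> \<in> test_functions \<Omega> \<Longrightarrow> F \<xi> = T \<xi>" using c by blast
      obtain F' where F': "linear_functional_on ?W F'" "\<And>f. f \<in> ?W \<Longrightarrow> ennreal \<bar>F' f\<bar> \<le> ennreal c' * sobolev_norm (- e) ?p' \<Omega> f"
        "\<And>\<xi>. \<xi> \<in> test_functions \<Omega> \<Longrightarrow> F' \<xi> = T' \<xi>" using c' by blast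
      have "linear_functional_on ?W (\<lambda>f. F f + F' f)"
        using F(1) F'(1) by (simp add: linear_functional_on_def distrib_left)
      moreover have "ennreal \<bar>F f + F' f\<bar> \<le> ennreal (c + c') * sobolev_norm (- e) ?p' \<Omega> f" if f: "f \<in> ?W" for f
      proof -
        have "ennreal \<bar>F f + F' f\<bar> \<le> ennreal (\<bar>F f\<bar> + \<bar>F' f\<bar>)" by (intro ennreal_leI) simp
        also have "\<dots> = ennreal \<bar>F f\<bar> + ennreal \<bar>F' f\<bar>" by simp
        also have "\<dots> \<le> ennreal (c + c') * sobolev_norm (- e) ?p' \<Omega> f"
          using c c' by (intro ennreal_bound_add F(2)[OF f] F'(2)[OF f]) auto
        finally show ?thesis .
      qed
      ultimately have "c + c' \<in> ?R (\<lambda>\<xi>. T \<xi> + T' \<xi>)"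
        using c c' F(3) F'(3) by (intro CollectI conjI exI[of _ "\<lambda>f. F f + F' f"]) auto
      then have "distr_norm e p \<Omega> (\<lambda>\<xi>. T \<xi> + T' \<xi>) \<le> ennreal (c + c')" unfolding N by (rule INF_lower)
      then show ?thesis using c c' by simp
    qed
    show ?thesis unfolding N[of T] N[of T'] by (rule ennreal_le_INF_add_INF[OF *])
  qed
  then show ?thesis by (intro exI[of _ 1]) simp
qed

lemma distr_norm_sum_le:
  assumes p: "1 < p" and \<Omega>: "open \<Omega>" and I: "finite I" "I \<noteq> {}"
  shows "\<exists>C>0. \<forall>T. distr_norm e p \<Omega> (\<lambda>\<xi>. \<Sum>i\<in>I. T i \<xi>) \<le> ennreal C * (\<Sum>i\<in>I. distr_norm e p \<Omega> (T i))"
  using I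
proof (induction I rule: finite_ne_induct)
  case (singleton i)
  then show ?case by (intro exI[of _ 1]) simp
next
  case (insert i I)
  obtain C where C: "C > 0" "\<And>T. distr_norm e p \<Omega> (\<lambda>\<xi>. \<Sum>i\<in>I. T i \<xi>) \<le> ennreal C * (\<Sum>i\<in>I. distr_norm e p \<Omega> (T i))"
    using insert.IH by blast
  obtain D where D: "D > 0" "\<And>T T'. distr_norm e p \<Omega> (\<lambda>\<xi>. T \<xi> + T' \<xi>) \<le> ennreal D * (distr_norm e p \<Omega> T + distr_norm e p \<Omega> T')"
    using distr_norm_add_le[OF p \<Omega>, of e] by blast
  have "distr_norm e p \<Omega> (\<lambda>\<xi>. \<Sum>i\<in>insert i I. T i \<xi>) \<le> ennreal (D * (1 + C)) * (\<Sum>i\<in>insert i I. distr_norm e p \<Omega> (T i))" for T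
  proof -
    let ?S = "\<Sum>i\<in>insert i I. distr_norm e p \<Omega> (T i)"
    have S: "distr_norm e p \<Omega> (T i) \<le> ?S" "(\<Sum>i\<in>I. distr_norm e p \<Omega> (T i)) \<le> ?S" using insert by simp_all
    have "distr_norm e p \<Omega> (\<lambda>\<xi>. \<Sum>i\<in>insert i I. T i \<xi>) \<le> ennreal D * (distr_norm e p \<Omega> (T i) + distr_norm e p \<Omega> (\<lambda>\<xi>. \<Sum>i\<in>I. T i \<xi>))"
      using insert D(2) by simp
    also have "\<dots> \<le> ennreal (D * (1 + C)) * ?S" using C(1) D(1) S(1) order_trans[OF C(2) mult_left_mono[OF S(2)]]
      by (intro ennreal_bound_cmult ennreal_bound_add) auto
    finally show ?thesis .
  qed
  then show ?case using C(1) D(1) by (intro exI[of _ "D * (1 + C)"]) (simp add: add_pos_pos)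
qed


section \<open>Functionals of finite Sobolev norm are distributions\<close>

abbreviation sup_pderiv :: "'n::finite multi_index \<Rightarrow> (real^'n \<Rightarrow> real) \<Rightarrow> real"
  where "sup_pderiv \<nu> \<xi> \<equiv> SUP x. \<bar>pderiv_mi \<nu> \<xi> x\<bar>"

lemma pderiv_mi_le_sup:
  assumes "\<xi> \<in> test_functions \<Omega>"
  shows "\<bar>pderiv_mi \<nu> \<xi> x\<bar> \<le> sup_pderiv \<nu> \<xi>" "0 \<le> sup_pderiv \<nu> \<xi>"
proof -
  obtain B where "\<And>x. \<bar>pderiv_mi \<nu> \<xi> x\<bar> \<le> B"
    by (rule test_function_bounded[OF test_functions_pderiv_mi[OF assms]]) (rule that)
  then have bdd: "bdd_above (range (\<lambda>x. \<bar>pderiv_mi \<nu> \<xi> x\<bar>))" by (intro bdd_aboveI2)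
  show "\<bar>pderiv_mi \<nu> \<xi> x\<bar> \<le> sup_pderiv \<nu> \<xi>" for x by (rule cSUP_upper[OF UNIV_I bdd])
  from order_trans[OF abs_ge_zero this] show "0 \<le> sup_pderiv \<nu> \<xi>" .
qed

lemma test_functions_inD:
  assumes "\<xi> \<in> test_functions_in K" "compact K"
  shows "\<xi> \<in> test_functions UNIV" "\<And>\<Omega>. K \<subseteq> \<Omega> \<Longrightarrow> \<xi> \<in> test_functions \<Omega>" "\<And>x. \<xi> x \<noteq> 0 \<Longrightarrow> x \<in> K"
    "pderiv_mi \<nu> \<xi> \<in> test_functions_in K"
proof -
  show "\<xi> \<in> test_functions \<Omega>" if "K \<subseteq> \<Omega>" for \<Omega> using assms that by (auto simp: test_functions_def)
  then show "\<xi> \<in> test_functions UNIV" by simp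
  show "x \<in> K" if "\<xi> x \<noteq> 0" for x
    using assms(1) that closure_subset[of "{x. \<xi> x \<noteq> 0}"] by (auto simp: test_functions_in_def)
  have "{x. pderiv_mi \<nu> \<xi> x \<noteq> 0} \<subseteq> supp \<xi>" using pderiv_mi_support by blast
  then have "closure {x. pderiv_mi \<nu> \<xi> x \<noteq> 0} \<subseteq> supp \<xi>" by (simp add: closure_minimal)
  then show "pderiv_mi \<nu> \<xi> \<in> test_functions_in K"
    using assms(1) smooth_on_pderiv_mi by (auto simp: test_functions_in_def)
qed

lemma Lp_norm_test_le:
  assumes p: "1 < p" and K: "compact K"
  shows "\<exists>C\<ge>0. \<forall>\<xi>\<in>test_functions_in K. \<forall>B\<ge>0. (\<forall>x. \<bar>\<xi> x\<bar> \<le> B) \<longrightarrow> Lp_norm p UNIV \<xi> \<le> ennreal (C * B)"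
proof -
  obtain v where v: "emeasure lborel K = ennreal v" "0 \<le> v"
    using emeasure_compact_finite[OF K] by (cases "emeasure lborel K") auto
  have "Lp_norm p UNIV \<xi> \<le> ennreal (v powr (1 / p) * B)"
    if \<xi>: "\<xi> \<in> test_functions_in K" and B: "0 \<le> B" "\<And>x. \<bar>\<xi> x\<bar> \<le> B" for \<xi> B
  proof -
    have "Lp_int p UNIV \<xi> \<le> (\<integral>\<^sup>+x. ennreal (B powr p) * indicator K x \<partial>lborel)"
    proof (rule nn_integral_mono)
      fix x
      have "\<bar>\<xi> x\<bar> powr p \<le> B powr p" using B p by (intro powr_mono2) auto
      then show "ennreal (\<bar>\<xi> x\<bar> powr p) * indicator UNIV x \<le> ennreal (B powr p) * indicator K x"
        using test_functions_inD(3)[OF \<xi> K, of x] p by (cases "\<xi> x = 0") (auto intro: ennreal_leI)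
    qed
    also have "\<dots> = ennreal (B powr p * v)"
      using borel_compact[OF K] v by (simp add: nn_integral_cmult_indicator ennreal_mult)
    finally have "Lp_norm p UNIV \<xi> \<le> ennreal_root p (ennreal (B powr p * v))"
      unfolding Lp_norm_def using p by (intro ennreal_root_mono) auto
    also have "\<dots> = ennreal (v powr (1 / p) * B)"
      using p B(1) v(2) by (simp add: ennreal_root_def powr_mult powr_powr mult.commute)
    finally show ?thesis .
  qed
  then show ?thesis by (intro exI[of _ "v powr (1 / p)"]) auto
qed

text \<open>The Slobodeckij seminorms of order \<open>\<lfloor>s\<rfloor>\<close> are estimated by derivatives of one order more, hence the successor in
  the bound.\<close>

lemma sobolev_norm_test_le:
  fixes K :: "(real^'n::finite) set" and s p :: real
  assumes p: "1 < p" and K: "compact K" "K \<subseteq> \<Omega>" and \<Omega>: "open \<Omega>"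
  shows "\<exists>C\<ge>0. \<forall>\<xi>\<in>test_functions_in K.
    sobolev_norm s p \<Omega> \<xi> \<le> ennreal (C * (\<Sum>\<nu> | mi_order \<nu> \<le> Suc (nat \<lfloor>s\<rfloor>). sup_pderiv \<nu> \<xi>))"
proof -
  define k where "k = nat \<lfloor>s\<rfloor>"
  let ?M = "{\<nu> :: 'n multi_index. mi_order \<nu> \<le> Suc k}"
  let ?N = "\<lambda>\<xi>. ennreal (\<Sum>\<nu>\<in>?M. sup_pderiv \<nu> \<xi>)"
  obtain C0 where C0: "0 \<le> C0" "\<And>\<xi> B. \<xi> \<in> test_functions_in K \<Longrightarrow> 0 \<le> B \<Longrightarrow> (\<And>x. \<bar>\<xi> x\<bar> \<le> B) \<Longrightarrow> Lp_norm p UNIV \<xi> \<le> ennreal (C0 * B)"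
    using Lp_norm_test_le[OF p K(1)] by blast
  have Lp: "Lp_norm p UNIV (pderiv_mi \<nu> \<xi>) \<le> ennreal C0 * ?N \<xi>" if \<xi>: "\<xi> \<in> test_functions_in K" and \<nu>: "\<nu> \<in> ?M" for \<xi> \<nu>
  proof -
    note t = test_functions_inD(1)[OF \<xi> K(1)]
    have "sup_pderiv \<nu> \<xi> \<le> (\<Sum>\<nu>\<in>?M. sup_pderiv \<nu> \<xi>)"
      using \<nu> finite_mi_order_le pderiv_mi_le_sup(2)[OF t] by (intro member_le_sum) auto
    then have "ennreal (C0 * sup_pderiv \<nu> \<xi>) \<le> ennreal (C0 * (\<Sum>\<nu>\<in>?M. sup_pderiv \<nu> \<xi>))"
      using C0(1) by (intro ennreal_leI mult_left_mono)
    also have "\<dots> = ennreal C0 * ?N \<xi>" using C0(1) pderiv_mi_le_sup(2)[OF t] by (intro ennreal_mult sum_nonneg) auto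
    finally show ?thesis
      using C0(2)[OF test_functions_inD(4)[OF \<xi> K(1), of \<nu>] pderiv_mi_le_sup(2)[OF t] pderiv_mi_le_sup(1)[OF t]] by (rule order_trans[rotated])
  qed
  have "\<exists>C\<ge>0. \<forall>\<xi>. \<xi> \<in> test_functions_in K \<longrightarrow> (\<Sum>\<nu> | mi_order \<nu> \<le> k. Lp_norm p \<Omega> (pderiv_mi \<nu> \<xi>)) \<le> ennreal C * ?N \<xi>"
  proof (rule uniform_bound_sum[OF finite_mi_order_le])
    fix \<nu> :: "'n multi_index" assume "\<nu> \<in> {\<nu>. mi_order \<nu> \<le> k}"
    then have "\<nu> \<in> ?M" by simp
    then show "\<exists>C\<ge>0. \<forall>\<xi>. \<xi> \<in> test_functions_in K \<longrightarrow> Lp_norm p \<Omega> (pderiv_mi \<nu> \<xi>) \<le> ennreal C * ?N \<xi>"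
      using C0(1) p order_trans[OF Lp_norm_mono_set[of p \<Omega> UNIV] Lp] by (intro exI[of _ C0]) auto
  qed
  then obtain C1 where C1: "0 \<le> C1" "\<And>\<xi>. \<xi> \<in> test_functions_in K \<Longrightarrow> (\<Sum>\<nu> | mi_order \<nu> \<le> k. Lp_norm p \<Omega> (pderiv_mi \<nu> \<xi>)) \<le> ennreal C1 * ?N \<xi>"
    by blast
  have "\<exists>C\<ge>0. \<forall>\<xi>. frac s \<noteq> 0 \<and> \<xi> \<in> test_functions_in K \<longrightarrow> (\<Sum>\<nu> | mi_order \<nu> = k. slobodeckij (frac s) p \<Omega> (pderiv_mi \<nu> \<xi>)) \<le> ennreal C * ?N \<xi>"
  proof (cases "frac s = 0")
    case False
    then have \<theta>: "0 < frac s" "frac s < 1" using frac_lt_1[of s] frac_ge_0[of s] by linarith+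
    obtain Cs where Cs: "0 \<le> Cs" "\<forall>(G :: real^'n \<Rightarrow> real) (D :: 'n \<Rightarrow> real^'n \<Rightarrow> real). integrable_weak_gradient G D \<longrightarrow>
      slob_int (frac s) p UNIV G \<le> ennreal Cs * (Lp_int p UNIV G + (\<Sum>j\<in>UNIV. Lp_int p UNIV (D j)))"
      using slob_int_le_weak_derivatives[OF p \<theta>, where 'n = 'n] by (elim exE conjE) (rule that)
    let ?C = "((Cs + 1) * (card (UNIV :: 'n option set) + 1)) powr (1 / p)"
    have "\<exists>C\<ge>0. \<forall>\<xi>. \<xi> \<in> test_functions_in K \<longrightarrow> (\<Sum>\<nu> | mi_order \<nu> = k. slobodeckij (frac s) p \<Omega> (pderiv_mi \<nu> \<xi>)) \<le> ennreal C * ?N \<xi>"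
    proof (rule uniform_bound_sum[OF finite_mi_order_eq])
      fix \<nu> :: "'n multi_index" assume "\<nu> \<in> {\<nu>. mi_order \<nu> = k}"
      then have \<nu>: "\<nu> \<in> ?M" "\<And>j. mi_inc \<nu> j \<in> ?M" by (auto simp: mi_order_inc)
      show "\<exists>C\<ge>0. \<forall>\<xi>. \<xi> \<in> test_functions_in K \<longrightarrow> slobodeckij (frac s) p \<Omega> (pderiv_mi \<nu> \<xi>) \<le> ennreal C * ?N \<xi>"
      proof (rule exI[of _ "?C * (C0 + (\<Sum>j\<in>(UNIV :: 'n set). C0))"], intro conjI allI impI)
        show "0 \<le> ?C * (C0 + (\<Sum>j\<in>(UNIV :: 'n set). C0))" using C0(1) by simp
        fix \<xi> assume \<xi>: "\<xi> \<in> test_functions_in K"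
        note t = test_functions_inD(1)[OF \<xi> K(1)]
        let ?g = "pderiv_mi \<nu> \<xi>"
        have "slob_int (frac s) p UNIV ?g \<le> ennreal Cs * (Lp_int p UNIV ?g + (\<Sum>j\<in>UNIV. Lp_int p UNIV (pderiv_mi (mi_inc \<nu> j) \<xi>)))"
        proof (intro Cs(2)[rule_format], unfold integrable_weak_gradient_def, intro conjI allI ballI)
          show "integrable lborel ?g" "integrable lborel (pderiv_mi (mi_inc \<nu> j) \<xi>)" for j
            by (intro test_function_integrable[OF test_functions_pderiv_mi[OF t]])+
          fix j \<zeta> assume \<zeta>: "\<zeta> \<in> test_functions (UNIV :: (real^'n) set)"
          show "(\<integral>x. ?g x * pderiv1 j \<zeta> x \<partial>lborel) = - (\<integral>x. pderiv_mi (mi_inc \<nu> j) \<xi> x * \<zeta> x \<partial>lborel)"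
            unfolding pderiv_mi_inc(1)[OF test_functionsD(1)[OF t]]
            by (rule integral_by_parts[OF smooth_on_pderiv_mi[OF test_functionsD(1)[OF t]] \<zeta>])
        qed
        then have "slobodeckij (frac s) p UNIV ?g \<le> ennreal ?C * (Lp_norm p UNIV ?g + (\<Sum>j\<in>UNIV. Lp_norm p UNIV (pderiv_mi (mi_inc \<nu> j) \<xi>)))"
          unfolding slobodeckij_def Lp_norm_def by (rule ennreal_root_add_sum_le[rotated 2]) (use p Cs(1) in auto)
        also have "\<dots> \<le> ennreal (?C * (C0 + (\<Sum>j\<in>(UNIV :: 'n set). C0))) * ?N \<xi>"
          using C0(1) Lp[OF \<xi>] \<nu> by (intro ennreal_bound_cmult ennreal_bound_add ennreal_bound_sum) auto
        finally show "slobodeckij (frac s) p \<Omega> ?g \<le> ennreal (?C * (C0 + (\<Sum>j\<in>(UNIV :: 'n set). C0))) * ?N \<xi>"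
          by (rule order_trans[rotated], intro slobodeckij_mono_set) (use p in auto)
      qed
    qed
    then show ?thesis by blast
  qed auto
  then obtain C2 where C2: "0 \<le> C2" "\<And>\<xi>. frac s \<noteq> 0 \<and> \<xi> \<in> test_functions_in K \<Longrightarrow> (\<Sum>\<nu> | mi_order \<nu> = k. slobodeckij (frac s) p \<Omega> (pderiv_mi \<nu> \<xi>)) \<le> ennreal C2 * ?N \<xi>"
    by blast
  show ?thesis
  proof (intro exI[of _ "C1 + C2"] conjI ballI)
    show "0 \<le> C1 + C2" using C1 C2 by simp
    fix \<xi> assume \<xi>: "\<xi> \<in> test_functions_in K"
    note t = test_functions_inD(1)[OF \<xi> K(1)]
    have "sobolev_norm s p \<Omega> \<xi> = (\<Sum>\<nu> | mi_order \<nu> \<le> k. Lp_norm p \<Omega> (pderiv_mi \<nu> \<xi>)) +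
      (if frac s = 0 then 0 else \<Sum>\<nu> | mi_order \<nu> = k. slobodeckij (frac s) p \<Omega> (pderiv_mi \<nu> \<xi>))"
      unfolding k_def by (rule sobolev_norm_eq[OF \<Omega>]) (rule weak_derivs_smooth[OF test_functionsD(1)[OF t]])
    also have "\<dots> \<le> ennreal (C1 + C2) * ?N \<xi>"
      using C1(1) C2(1) C1(2)[OF \<xi>] C2(2)[of \<xi>] \<xi> by (intro ennreal_bound_add) auto
    also have "\<dots> = ennreal ((C1 + C2) * (\<Sum>\<nu>\<in>?M. sup_pderiv \<nu> \<xi>))"
      using C1(1) C2(1) pderiv_mi_le_sup(2)[OF t] by (intro ennreal_mult[symmetric] sum_nonneg) auto
    finally show "sobolev_norm s p \<Omega> \<xi> \<le> ennreal ((C1 + C2) * (\<Sum>\<nu> | mi_order \<nu> \<le> Suc (nat \<lfloor>s\<rfloor>). sup_pderiv \<nu> \<xi>))"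
      by (simp add: k_def)
  qed
qed

lemma test_functions_in_sub:
  assumes "f \<in> test_functions_in K" "g \<in> test_functions_in K" "compact K"
  shows "(\<lambda>x. f x - g x) \<in> test_functions_in K"
proof -
  have "(\<lambda>x. f x + (-1) * g x) \<in> test_functions K"
    using assms by (intro test_functions_add test_functions_cmult test_functions_inD(2)[OF _ assms(3)]) auto
  then show ?thesis by (simp add: test_functions_iff test_functions_in_def)
qed

text \<open>The set where the modulus of \<open>T\<close> is less than \<open>\<epsilon>\<close> is one of the convex balanced sets that generate the
  topology: its trace on every \<open>D\<^sub>K\<close> is open, because finitely many seminorms bound \<open>T\<close> there.\<close>

lemma distributionsI:
  fixes T :: "(real^'n::finite \<Rightarrow> real) \<Rightarrow> real"
  assumes lin: "linear_functional_on (test_functions \<Omega>) T"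
    and bnd: "\<And>K. compact K \<Longrightarrow> K \<subseteq> \<Omega> \<Longrightarrow> \<exists>C\<ge>0. \<exists>k. \<forall>\<xi>\<in>test_functions_in K. \<bar>T \<xi>\<bar> \<le> C * (\<Sum>\<nu> | mi_order \<nu> \<le> k. sup_pderiv \<nu> \<xi>)"
  shows "T \<in> distributions \<Omega>"
proof -
  let ?DD = "{test_functions_in K | K. compact K \<and> K \<subseteq> \<Omega>}"
  let ?P = "range (\<lambda>\<nu> \<xi>. sup_pderiv \<nu> \<xi>) :: ((real^'n \<Rightarrow> real) \<Rightarrow> real) set"
  have DD: "\<Union>?DD = test_functions \<Omega>" by (simp add: test_functions_def)
  have add: "T (\<lambda>x. f x + g x) = T f + T g" and scale: "T (\<lambda>x. c * f x) = c * T f"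
    if "f \<in> test_functions \<Omega>" "g \<in> test_functions \<Omega>" for f g c using lin that by (auto simp: linear_functional_on_def)
  define W where "W \<epsilon> = {\<eta> \<in> test_functions \<Omega>. \<bar>T \<eta>\<bar> < \<epsilon>}" for \<epsilon>
  have cb: "convex_balanced (W \<epsilon>)" for \<epsilon> unfolding convex_balanced_def
  proof (intro conjI ballI allI impI)
    fix f g and t :: real assume fg: "f \<in> W \<epsilon>" "g \<in> W \<epsilon>" and t: "t \<in> {0..1}"
    have f: "f \<in> test_functions \<Omega>" "\<bar>T f\<bar> < \<epsilon>" and g: "g \<in> test_functions \<Omega>" "\<bar>T g\<bar> < \<epsilon>" using fg by (auto simp: W_def)
    have "T (\<lambda>x. (1 - t) * f x + t * g x) = (1 - t) * T f + t * T g"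
      using add[OF test_functions_cmult[OF f(1)] test_functions_cmult[OF g(1)]] scale[OF f(1,1)] scale[OF g(1,1)] by simp
    moreover have "\<bar>(1 - t) * T f + t * T g\<bar> < \<epsilon>" using convex_bound_lt[of "\<bar>T f\<bar>" \<epsilon> "\<bar>T g\<bar>" "1 - t" t] f g t
        abs_triangle_ineq[of "(1 - t) * T f" "t * T g"] by (simp add: abs_mult)
    ultimately show "(\<lambda>x. (1 - t) * f x + t * g x) \<in> W \<epsilon>"
      using f g by (auto simp: W_def intro!: test_functions_add test_functions_cmult)
  next
    fix f and t :: real assume "f \<in> W \<epsilon>" and t: "\<bar>t\<bar> \<le> 1"
    then have f: "f \<in> test_functions \<Omega>" "\<bar>T f\<bar> < \<epsilon>" by (auto simp: W_def)
    have "\<bar>t * T f\<bar> \<le> \<bar>T f\<bar>" using t by (simp add: abs_mult mult_left_le_one_le)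
    then show "(\<lambda>x. t * f x) \<in> W \<epsilon>" using f scale[OF f(1,1)] by (auto simp: W_def intro!: test_functions_cmult)
  qed
  have op: "openin (seminorm_topology S ?P) (W \<epsilon> \<inter> S)" if "S \<in> ?DD" for S \<epsilon>
  proof -
    obtain K where K: "compact K" "K \<subseteq> \<Omega>" and S: "S = test_functions_in K" using \<open>S \<in> ?DD\<close> by blast
    obtain C k where C: "0 \<le> C" "\<And>\<xi>. \<xi> \<in> S \<Longrightarrow> \<bar>T \<xi>\<bar> \<le> C * (\<Sum>\<nu> | mi_order \<nu> \<le> k. sup_pderiv \<nu> \<xi>)"
      using bnd[OF K] S by blast
    let ?M = "{\<nu> :: 'n multi_index. mi_order \<nu> \<le> k}"
    have S\<Omega>: "S \<subseteq> test_functions \<Omega>" using K S by (auto simp: test_functions_def)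
    show ?thesis
    proof (subst openin_subopen, intro ballI)
      fix f assume f: "f \<in> W \<epsilon> \<inter> S"
      \<comment> \<open>Each of the \<open>card ?M\<close> seminorms of \<open>g - f\<close> may contribute \<open>C \<delta>\<close> to \<open>\<bar>T g - T f\<bar>\<close>.\<close>
      define \<delta> where "\<delta> = (\<epsilon> - \<bar>T f\<bar>) / (C * card ?M + 1)"
      have Cc: "0 \<le> C * real (card ?M)" using C(1) by simp
      have \<delta>: "\<delta> > 0" using f Cc by (auto simp: \<delta>_def W_def intro!: divide_pos_pos)
      define N where "N = (\<Inter>\<nu>\<in>?M. {g \<in> S. sup_pderiv \<nu> (\<lambda>x. g x - f x) < \<delta>})"
      have "openin (seminorm_topology S ?P) N" unfolding N_def
      proof (rule openin_INT2)
        show "finite ?M" by (rule finite_mi_order_le)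
        have "(\<lambda>_. 0) \<in> ?M" by simp
        then show "?M \<noteq> {}" by blast
        fix \<nu> :: "'n multi_index"
        show "openin (seminorm_topology S ?P) {g \<in> S. sup_pderiv \<nu> (\<lambda>x. g x - f x) < \<delta>}"
          unfolding seminorm_topology_def
          by (rule topology_generated_by_Basis, intro CollectI exI[of _ f] exI[of _ "sup_pderiv \<nu>"] exI[of _ \<delta>])
            (use f \<delta> in auto)
      qed
      moreover have "f \<in> N"
      proof -
        have "pderiv_mi \<nu> (\<lambda>x. 0) = (\<lambda>x. 0)" for \<nu> :: "'n multi_index" using pderiv_mi_cmult[of "\<lambda>_. 0" \<nu> 0] by simp
        then show ?thesis using f \<delta> by (auto simp: N_def)
      qed
      moreover have "N \<subseteq> W \<epsilon> \<inter> S"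
      proof
        fix g assume g: "g \<in> N"
        have "(\<lambda>_. 0) \<in> ?M" by simp
        then have gS: "g \<in> S" using g unfolding N_def by blast
        have fS: "f \<in> S" "f \<in> test_functions \<Omega>" "g \<in> test_functions \<Omega>" using f gS S\<Omega> by auto
        let ?h = "\<lambda>x. g x - f x"
        have h: "?h \<in> S" using gS fS(1) K(1) unfolding S by (intro test_functions_in_sub)
        have "T g = T (\<lambda>x. f x + ?h x)" by simp
        also have "\<dots> = T f + T ?h" using fS(2) h S\<Omega> by (intro add) auto
        finally have "\<bar>T g\<bar> \<le> \<bar>T f\<bar> + \<bar>T ?h\<bar>" by simp
        also have "\<bar>T ?h\<bar> \<le> C * (\<Sum>\<nu>\<in>?M. \<delta>)"
          using g by (intro order_trans[OF C(2)[OF h] mult_left_mono[OF sum_mono]] C(1)) (auto simp: N_def less_imp_le)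
        also have "\<bar>T f\<bar> + C * (\<Sum>\<nu>\<in>?M. \<delta>) < \<epsilon>"
        proof -
          have "C * card ?M * \<delta> < (C * card ?M + 1) * \<delta>" using \<delta> by (simp add: distrib_right)
          also have "\<dots> = \<epsilon> - \<bar>T f\<bar>" using Cc by (simp add: \<delta>_def add_nonneg_eq_0_iff)
          finally show ?thesis by (simp add: mult.assoc)
        qed
        finally show "g \<in> W \<epsilon> \<inter> S" using gS fS(3) by (simp add: W_def)
      qed
      ultimately show "\<exists>N. openin (seminorm_topology S ?P) N \<and> f \<in> N \<and> N \<subseteq> W \<epsilon> \<inter> S" by blast
    qed
  qed
  have gen: "openin (test_topology ?DD ?P) {(\<lambda>x. f x + w x) | w. w \<in> W \<epsilon>}" if f: "f \<in> test_functions \<Omega>" for f \<epsilon>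
  proof -
    have "W \<epsilon> \<subseteq> \<Union>?DD" unfolding DD by (auto simp: W_def)
    then show ?thesis unfolding test_topology_def using f cb[of \<epsilon>] op DD
      by (intro topology_generated_by_Basis CollectI exI[of _ f] exI[of _ "W \<epsilon>"]) auto
  qed
  have top: "topspace (test_topology ?DD ?P) \<subseteq> test_functions \<Omega>"
    unfolding test_topology_def topology_generated_by_topspace DD by (auto intro!: test_functions_add)
  have "continuous_map (test_topology ?DD ?P) euclideanreal T" unfolding continuous_map_def
  proof (intro conjI allI impI)
    fix U :: "real set" assume "openin euclideanreal U"
    then have U: "open U" by simp
    show "openin (test_topology ?DD ?P) {f \<in> topspace (test_topology ?DD ?P). T f \<in> U}"
    proof (subst openin_subopen, intro ballI)
      fix f assume f: "f \<in> {f \<in> topspace (test_topology ?DD ?P). T f \<in> U}"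
      then have ft: "f \<in> test_functions \<Omega>" using top by auto
      obtain \<epsilon> where \<epsilon>: "\<epsilon> > 0" "\<And>y. \<bar>y - T f\<bar> < \<epsilon> \<Longrightarrow> y \<in> U"
        using U f unfolding open_dist by (auto simp: dist_real_def)
      let ?O = "{(\<lambda>x. f x + w x) | w. w \<in> W \<epsilon>}"
      have o: "openin (test_topology ?DD ?P) ?O" by (rule gen[OF ft])
      have zero: "(\<lambda>_. 0) \<in> test_functions \<Omega>" by (simp add: test_functions_iff)
      have "T (\<lambda>_. 0) = 0" using scale[OF zero zero, of 0] by simp
      then have "f \<in> ?O" using zero \<epsilon>(1) by (auto simp: W_def intro!: exI[of _ "\<lambda>_. 0"])
      moreover have "?O \<subseteq> {f \<in> topspace (test_topology ?DD ?P). T f \<in> U}"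
      proof
        fix h assume h: "h \<in> ?O"
        then obtain w where w: "h = (\<lambda>x. f x + w x)" "w \<in> test_functions \<Omega>" "\<bar>T w\<bar> < \<epsilon>" by (auto simp: W_def)
        then have "T h \<in> U" using add[OF ft w(2)] by (intro \<epsilon>(2)) simp
        moreover have "h \<in> topspace (test_topology ?DD ?P)" using openin_subset[OF o] h by blast
        ultimately show "h \<in> {f \<in> topspace (test_topology ?DD ?P). T f \<in> U}" by simp
      qed
      ultimately show "\<exists>N. openin (test_topology ?DD ?P) N \<and> f \<in> N \<and> N \<subseteq> {f \<in> topspace (test_topology ?DD ?P). T f \<in> U}"
        using o by blast
    qed
  qed simp
  then show ?thesis using lin DD by (simp add: distributions_def topological_dual_def)
qed

text \<open>If the norm is finite then there is a representing function, respectively a bounded extension to the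
  zero-trace space; either bounds \<open>T\<close> on \<open>D\<^sub>K\<close> by suprema of finitely many derivatives.\<close>

lemma finite_distr_norm_distributions:
  fixes \<Omega> :: "(real^'n::finite) set"
  assumes p: "1 < p" and \<Omega>: "open \<Omega>" and lin: "linear_functional_on (test_functions \<Omega>) T"
    and fin: "distr_norm e p \<Omega> T < \<infinity>"
  shows "T \<in> distributions \<Omega>"
proof (rule distributionsI[OF lin])
  fix K :: "(real^'n) set" assume K: "compact K" "K \<subseteq> \<Omega>"
  show "\<exists>C\<ge>0. \<exists>k. \<forall>\<xi>\<in>test_functions_in K. \<bar>T \<xi>\<bar> \<le> C * (\<Sum>\<nu> | mi_order \<nu> \<le> k. sup_pderiv \<nu> \<xi>)"
  proof (cases "0 \<le> e")
    case True
    let ?S = "{sobolev_norm e p \<Omega> f | f. f \<in> Lp_space p \<Omega> \<and> (\<forall>\<xi>\<in>test_functions \<Omega>. T \<xi> = regular_distribution \<Omega> f \<xi>)}"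
    have "?S \<noteq> {}"
    proof
      assume "?S = {}"
      then have "distr_norm e p \<Omega> T = \<infinity>" using True by (simp only: distr_norm_def if_True) (simp only: Inf_empty infinity_ennreal_def)
      then show False using fin by simp
    qed
    then obtain f where f: "f \<in> Lp_space p \<Omega>" "\<And>\<xi>. \<xi> \<in> test_functions \<Omega> \<Longrightarrow> T \<xi> = regular_distribution \<Omega> f \<xi>" by blast
    note l = Lp_space_locally_integrable[OF p f(1)]
    have fK: "integrable lborel (\<lambda>x. indicator K x * f x)"
      using l K by (auto simp: locally_integrable_def set_integrable_def)
    define C where "C = (\<integral>x. \<bar>indicator K x * f x\<bar> \<partial>lborel)"
    have "\<bar>T \<xi>\<bar> \<le> C * (\<Sum>\<nu> | mi_order \<nu> \<le> 0. sup_pderiv \<nu> \<xi>)" if \<xi>: "\<xi> \<in> test_functions_in K" for \<xi>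
    proof -
      note t = test_functions_inD(2)[OF \<xi> K(1,2)]
      have z: "{\<nu> :: 'n multi_index. mi_order \<nu> \<le> 0} = {\<lambda>_. 0}" by auto
      let ?B = "sup_pderiv (\<lambda>_. 0) \<xi>"
      have B: "\<bar>\<xi> x\<bar> \<le> ?B" for x using pderiv_mi_le_sup(1)[OF t, of "\<lambda>_. 0" x] by simp
      have "\<bar>T \<xi>\<bar> = \<bar>\<integral>x. f x * \<xi> x \<partial>lborel\<bar>"
        using f(2)[OF t] set_integrable_mult_test(2)[OF l t] by (simp add: regular_distribution_def)
      also have "\<dots> \<le> (\<integral>x. \<bar>f x * \<xi> x\<bar> \<partial>lborel)" by (rule integral_abs_bound)
      also have "\<dots> \<le> (\<integral>x. \<bar>indicator K x * f x\<bar> * ?B \<partial>lborel)"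
      proof (rule integral_mono)
        show "integrable lborel (\<lambda>x. \<bar>f x * \<xi> x\<bar>)" using set_integrable_mult_test(1)[OF l t] by (rule integrable_abs)
        show "integrable lborel (\<lambda>x. \<bar>indicator K x * f x\<bar> * ?B)" using integrable_abs[OF fK] by (rule integrable_mult_left)
        fix x
        show "\<bar>f x * \<xi> x\<bar> \<le> \<bar>indicator K x * f x\<bar> * ?B"
        proof (cases "\<xi> x = 0")
          case False
          then have "x \<in> K" by (rule test_functions_inD(3)[OF \<xi> K(1)])
          then show ?thesis using B[of x] by (auto simp: abs_mult intro!: mult_left_mono)
        qed (use pderiv_mi_le_sup(2)[OF t, of "\<lambda>_. 0"] in simp)
      qed
      also have "\<dots> = C * ?B" by (simp add: C_def)
      finally show ?thesis unfolding z by simp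
    qed
    moreover have "0 \<le> C" unfolding C_def by (intro integral_nonneg_AE) auto
    ultimately show ?thesis by blast
  next
    case False
    let ?p' = "p / (p - 1)"
    have p': "1 < ?p'" using p by simp
    let ?W = "sobolev_space0 (- e) ?p' \<Omega>"
    let ?S = "{ennreal C | C F. 0 \<le> C \<and> linear_functional_on ?W F \<and> (\<forall>f\<in>?W. ennreal \<bar>F f\<bar> \<le> ennreal C * sobolev_norm (- e) ?p' \<Omega> f) \<and>
      (\<forall>\<xi>\<in>test_functions \<Omega>. F \<xi> = T \<xi>)}"
    have "?S \<noteq> {}"
    proof
      assume "?S = {}"
      then have "distr_norm e p \<Omega> T = \<infinity>" using False by (simp only: distr_norm_def if_False Let_def) (simp only: Inf_empty infinity_ennreal_def)
      then show False using fin by simp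
    qed
    then obtain c F where c: "0 \<le> c" and F: "\<And>f. f \<in> ?W \<Longrightarrow> ennreal \<bar>F f\<bar> \<le> ennreal c * sobolev_norm (- e) ?p' \<Omega> f"
      "\<And>\<xi>. \<xi> \<in> test_functions \<Omega> \<Longrightarrow> F \<xi> = T \<xi>" by blast
    obtain C where C: "0 \<le> C" "\<And>\<xi>. \<xi> \<in> test_functions_in K \<Longrightarrow>
      sobolev_norm (- e) ?p' \<Omega> \<xi> \<le> ennreal (C * (\<Sum>\<nu> | mi_order \<nu> \<le> Suc (nat \<lfloor>- e\<rfloor>). sup_pderiv \<nu> \<xi>))"
      using sobolev_norm_test_le[OF p' K \<Omega>, of "- e"] by blast
    have "\<bar>T \<xi>\<bar> \<le> c * C * (\<Sum>\<nu> | mi_order \<nu> \<le> Suc (nat \<lfloor>- e\<rfloor>). sup_pderiv \<nu> \<xi>)" if \<xi>: "\<xi> \<in> test_functions_in K" for \<xi>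
    proof -
      note t = test_functions_inD(2)[OF \<xi> K(1,2)]
      let ?N = "\<Sum>\<nu> | mi_order \<nu> \<le> Suc (nat \<lfloor>- e\<rfloor>). sup_pderiv \<nu> \<xi>"
      have N: "0 \<le> ?N" using pderiv_mi_le_sup(2)[OF t] by (intro sum_nonneg) auto
      have "Lp_norm ?p' UNIV \<xi> < \<infinity>"
      proof -
        obtain B where B: "B > 0" "\<And>x. \<bar>\<xi> x\<bar> \<le> B" by (rule test_function_bounded[OF t]) (rule that)
        obtain D where "Lp_norm ?p' UNIV \<xi> \<le> ennreal (D * B)"
          using Lp_norm_test_le[OF p' K(1)] \<xi> B by (meson less_imp_le)
        then show ?thesis using ennreal_less_top le_less_trans by (metis infinity_ennreal_def)
      qed
      then have "Lp_norm ?p' \<Omega> \<xi> < \<infinity>" using Lp_norm_mono_set[of ?p' \<Omega> UNIV \<xi>] p' by (simp add: le_less_trans)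
      then have "\<xi> \<in> Lp_space ?p' \<Omega>"
        using locally_integrable_measurable[OF \<Omega> locally_integrable_test[OF t]] by (intro Lp_spaceI)
      moreover have "sobolev_norm (- e) ?p' \<Omega> \<xi> < \<infinity>" using C(2)[OF \<xi>] by (auto intro: le_less_trans)
      moreover have "sobolev_norm (- e) ?p' \<Omega> (\<lambda>x. \<xi> x - \<xi> x) < ennreal \<epsilon>" if "\<epsilon> > 0" for \<epsilon>
      proof -
        have "(\<lambda>_. 0) \<in> test_functions_in K" by (simp add: test_functions_in_def)
        moreover have "pderiv_mi \<nu> (\<lambda>x. 0) = (\<lambda>x. 0)" for \<nu> :: "'n multi_index"
          using pderiv_mi_cmult[of "\<lambda>_. 0" \<nu> 0] by simp
        ultimately show ?thesis using C(2)[of "\<lambda>_. 0"] that by simp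
      qed
      ultimately have "\<xi> \<in> ?W" using t unfolding sobolev_space0_def sobolev_space_def by blast
      then have "ennreal \<bar>T \<xi>\<bar> \<le> ennreal c * ennreal (C * ?N)"
        using F(1)[of \<xi>] F(2)[OF t] order_trans[OF _ mult_left_mono[OF C(2)[OF \<xi>]]] by simp
      also have "\<dots> = ennreal (c * C * ?N)" using c C(1) N by (simp add: ennreal_mult[symmetric] mult.assoc)
      finally show ?thesis using c C(1) N by (simp add: ennreal_le_iff)
    qed
    then show ?thesis using c C(1) by (intro exI[of _ "c * C"]) auto
  qed
qed


section \<open>Charts, tangent vectors and frames\<close>

abbreviation chart_inv :: "('m, 'a) chart \<Rightarrow> 'a \<Rightarrow> 'm"
  where "chart_inv c \<equiv> inv_into (fst c) (snd c)"

lemma chart_onD: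
  fixes c :: "('m, 'a::euclidean_space) chart"
  assumes "chart_on X c"
  shows "openin X (fst c)" "inj_on (snd c) (fst c)" "fst c \<subseteq> topspace X"
    and "openin X W \<Longrightarrow> open (snd c ` (fst c \<inter> W))"
    and "K \<subseteq> fst c \<Longrightarrow> compactin X K \<Longrightarrow> compact (snd c ` K)"
    and "L \<subseteq> snd c ` fst c \<Longrightarrow> compact L \<Longrightarrow> compactin X (chart_inv c ` L)"
proof -
  have o: "openin X (fst c)" and oi: "open (snd c ` fst c)"
    and h: "homeomorphic_map (subtopology X (fst c)) (top_of_set (snd c ` fst c)) (snd c)"
    using assms by (auto simp: chart_on_def)
  show "openin X (fst c)" by (rule o)
  show sub: "fst c \<subseteq> topspace X" using o by (rule openin_subset)
  have ts: "topspace (subtopology X (fst c)) = fst c" using sub by auto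
  show inj: "inj_on (snd c) (fst c)" using homeomorphic_imp_injective_map[OF h] by (simp only: ts)
  have cm: "continuous_map (subtopology X (fst c)) (top_of_set (snd c ` fst c)) (snd c)"
    using h by (rule homeomorphic_imp_continuous_map)
  have om: "open_map (subtopology X (fst c)) (top_of_set (snd c ` fst c)) (snd c)"
    using h by (rule homeomorphic_imp_open_map)
  show "open (snd c ` (fst c \<inter> W))" if "openin X W"
  proof -
    have "openin (subtopology X (fst c)) (fst c \<inter> W)" using that by (simp add: openin_subtopology_Int2)
    then have "openin (top_of_set (snd c ` fst c)) (snd c ` (fst c \<inter> W))" using om by (simp add: open_map_def)
    then show ?thesis using oi by (rule openin_open_trans)
  qed
  show "compact (snd c ` K)" if "K \<subseteq> fst c" "compactin X K"
  proof -
    have "compactin (subtopology X (fst c)) K" using that by (simp add: compactin_subtopology)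
    then have "compactin (top_of_set (snd c ` fst c)) (snd c ` K)" using cm by (rule image_compactin)
    then show ?thesis by (simp add: compactin_subtopology)
  qed
  have "homeomorphic_map (top_of_set (snd c ` fst c)) (subtopology X (fst c)) (chart_inv c)"
  proof -
    obtain g where g: "homeomorphic_maps (subtopology X (fst c)) (top_of_set (snd c ` fst c)) (snd c) g"
      using h by (auto simp: homeomorphic_map_maps)
    then have g': "homeomorphic_map (top_of_set (snd c ` fst c)) (subtopology X (fst c)) g"
      using homeomorphic_map_maps homeomorphic_maps_sym by blast
    have "g y = chart_inv c y" if "y \<in> snd c ` fst c" for y
      using g that inj ts by (auto simp: homeomorphic_maps_def inv_into_f_f)
    then show ?thesis by (intro homeomorphic_map_eq[OF g']) auto
  qed
  then have ci: "continuous_map (top_of_set (snd c ` fst c)) (subtopology X (fst c)) (chart_inv c)"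
    by (rule homeomorphic_imp_continuous_map)
  show "compactin X (chart_inv c ` L)" if "L \<subseteq> snd c ` fst c" "compact L"
  proof -
    have "compactin (top_of_set (snd c ` fst c)) L" using that by (simp add: compactin_subtopology)
    then have "compactin (subtopology X (fst c)) (chart_inv c ` L)" using ci by (rule image_compactin)
    then show ?thesis by (simp add: compactin_subtopology)
  qed
qed

lemma smooth_chartD: "smooth_chart M c \<Longrightarrow> chart_on (mtop M) c"
  by (simp add: smooth_chart_def)

lemma chart_inv_eq: "smooth_chart M c \<Longrightarrow> x \<in> fst c \<Longrightarrow> chart_inv c (snd c x) = x"
  using chart_onD(2)[OF smooth_chartD] by (rule inv_into_f_f)

lemma chart_domain_open: "smooth_chart M c \<Longrightarrow> openin (mtop M) (fst c)"
  by (rule chart_onD(1)[OF smooth_chartD])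

lemma chart_range_open: "smooth_chart M c \<Longrightarrow> openin (mtop M) W \<Longrightarrow> open (snd c ` (fst c \<inter> W))"
  by (rule chart_onD(4)[OF smooth_chartD])

lemma atlas_smooth_chart: "smooth_manifold M \<Longrightarrow> b \<in> atlas M \<Longrightarrow> smooth_chart M b"
  by (auto simp: smooth_manifold_def smooth_chart_def)

text \<open>Near each point a smooth chart differs from a chart of the atlas by a smooth change of coordinates.\<close>

lemma smooth_in_chart:
  fixes f :: "'m \<Rightarrow> 'b::euclidean_space" and M :: "('m, 'a::euclidean_space) manifold"
  assumes M: "smooth_manifold M" and c: "smooth_chart M c" and W: "openin (mtop M) W"
    and f: "\<And>b. b \<in> atlas M \<Longrightarrow> smooth_on (snd b ` (fst b \<inter> W)) (\<lambda>y. f (chart_inv b y))"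
  shows "smooth_on (snd c ` (fst c \<inter> W)) (\<lambda>y. f (chart_inv c y))"
proof (rule smooth_on_local)
  fix y assume "y \<in> snd c ` (fst c \<inter> W)"
  then obtain x where x: "x \<in> fst c" "x \<in> W" "y = snd c x" by auto
  have "x \<in> \<Union>(fst ` atlas M)" using M x(1) chart_onD(3)[OF smooth_chartD[OF c]] by (auto simp: smooth_manifold_def)
  then obtain b where b: "b \<in> atlas M" "x \<in> fst b" by auto
  note sb = atlas_smooth_chart[OF M b(1)]
  let ?U = "snd c ` (fst c \<inter> (fst b \<inter> W))" and ?T = "snd b ` (fst b \<inter> W)"
  have oU: "open ?U" and oT: "open ?T"
    using W chart_domain_open[OF sb] by (auto intro!: chart_range_open[OF c] chart_range_open[OF sb])
  have "smooth_on (snd c ` (fst c \<inter> fst b)) (transition c b)"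
    using c b(1) by (auto simp: smooth_chart_def compatible_def)
  then have s: "smooth_on ?U (transition c b)" by (rule smooth_on_subset) auto
  have "smooth_on ?U (\<lambda>y. f (chart_inv b (transition c b y)))"
    by (rule smooth_on_compose[OF s f[OF b(1)] oU oT]) (auto simp: transition_def chart_inv_eq[OF c])
  then have "smooth_on ?U (\<lambda>y. f (chart_inv c y))"
    by (rule smooth_on_cong[OF oU, rotated]) (auto simp: transition_def chart_inv_eq[OF c] chart_inv_eq[OF sb])
  then show "\<exists>U. y \<in> U \<and> open U \<and> smooth_on U (\<lambda>y. f (chart_inv c y))" using x b oU by (intro exI[of _ ?U]) auto
qed

lemma smooth_real_in_chart:
  fixes f :: "'m \<Rightarrow> real" and M :: "('m, 'a::euclidean_space) manifold"
  assumes M: "smooth_manifold M" and c: "smooth_chart M c" and f: "smooth_map_on M (points M) euclidean_manifold f"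
  shows "smooth_on (snd c ` fst c) (\<lambda>y. f (chart_inv c y))"
proof -
  have "smooth_on (snd b ` (fst b \<inter> points M)) (\<lambda>y. f (chart_inv b y))" if "b \<in> atlas M" for b
    using f that by (cases b) (auto simp: smooth_map_on_def euclidean_manifold_def o_def)
  from smooth_in_chart[OF M c openin_topspace this]
  show ?thesis using chart_onD(3)[OF smooth_chartD[OF c]] by (simp add: Int_absorb2)
qed

lemma transition_smooth:
  assumes M: "smooth_manifold M" and c: "smooth_chart M c" and d: "smooth_chart M d"
  shows "smooth_on (snd c ` (fst c \<inter> fst d)) (transition c d)"
proof -
  have "smooth_on (snd c ` (fst c \<inter> fst d)) (\<lambda>y. snd d (chart_inv c y))"
    using d by (intro smooth_in_chart[OF M c chart_domain_open[OF d]])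
      (auto simp: smooth_chart_def compatible_def transition_def o_def Int_commute)
  then show ?thesis by (simp add: transition_def o_def)
qed

lemma transition_diffeo:
  fixes M :: "('m, real^'n::finite) manifold"
  assumes M: "smooth_manifold M" and c: "smooth_chart M c" and d: "smooth_chart M d"
  shows "diffeo (snd c ` (fst c \<inter> fst d)) (snd d ` (fst c \<inter> fst d)) (transition c d) (transition d c)"
  unfolding diffeo_def using transition_smooth[OF M c d] transition_smooth[OF M d c]
    chart_range_open[OF c chart_domain_open[OF d]] chart_range_open[OF d chart_domain_open[OF c]]
  by (auto simp: transition_def chart_inv_eq[OF c] chart_inv_eq[OF d] Int_commute)

lemma charts_at_iff: "c \<in> charts_at M x \<longleftrightarrow> smooth_chart M c \<and> x \<in> fst c"
  by (simp add: charts_at_def)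

abbreviation tr_deriv :: "'m \<Rightarrow> ('m, real^'n) chart \<Rightarrow> ('m, real^'n) chart \<Rightarrow> real^'n \<Rightarrow> real^'n::finite"
  where "tr_deriv x c d \<equiv> fderiv (transition c d) (snd c x)"

lemma transition_differentiable:
  fixes M :: "('m, real^'n::finite) manifold"
  assumes M: "smooth_manifold M" and c: "c \<in> charts_at M x" and d: "d \<in> charts_at M x"
  shows "transition c d differentiable (at (snd c x))"
  using transition_smooth[OF M, of c d] chart_range_open[of M c "fst d"] chart_domain_open[of M d] c d
  by (intro smooth_on_differentiable(1)[of "snd c ` (fst c \<inter> fst d)"]) (auto simp: charts_at_iff)

lemma tr_deriv_linear:
  assumes "smooth_manifold M" "c \<in> charts_at M x" "d \<in> charts_at M x"
  shows "linear (tr_deriv x c d)"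
  by (rule linear_frechet_derivative[OF transition_differentiable[OF assms]])

lemma tr_deriv_chain:
  fixes M :: "('m, real^'n::finite) manifold"
  assumes M: "smooth_manifold M" and c: "c \<in> charts_at M x" and d: "d \<in> charts_at M x" and e: "e \<in> charts_at M x"
  shows "tr_deriv x d e (tr_deriv x c d w) = tr_deriv x c e w"
proof -
  have x: "x \<in> fst c" "x \<in> fst d" "x \<in> fst e" and s: "smooth_chart M c" "smooth_chart M d" "smooth_chart M e"
    using c d e by (auto simp: charts_at_iff)
  have t: "transition c d (snd c x) = snd d x" using x by (simp add: transition_def chart_inv_eq[OF s(1)])
  have "tr_deriv x c e = fderiv (transition d e \<circ> transition c d) (snd c x)"
  proof (rule frechet_derivative_cong_open)
    show "open (snd c ` (fst c \<inter> fst d))" using s by (intro chart_range_open chart_domain_open)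
    show "snd c x \<in> snd c ` (fst c \<inter> fst d)" using x by auto
  qed (auto simp: transition_def chart_inv_eq[OF s(1)] chart_inv_eq[OF s(2)])
  also have "\<dots> = tr_deriv x d e \<circ> tr_deriv x c d"
    using transition_differentiable[OF M c d] transition_differentiable[OF M d e]
    by (subst frechet_derivative_compose) (simp_all add: t)
  finally show ?thesis by simp
qed

lemma tangent_of_coords_in:
  fixes M :: "('m, real^'n::finite) manifold"
  assumes M: "smooth_manifold M" and c: "c \<in> charts_at M x"
  shows "tangent_of_coords M x c w \<in> tangent_space M x"
  using tr_deriv_chain[OF M c] by (auto simp: tangent_space_def tangent_of_coords_def)

lemma tangent_spaceD:
  "v \<in> tangent_space M x \<Longrightarrow> c \<in> charts_at M x \<Longrightarrow> d \<in> charts_at M x \<Longrightarrow> v d = tr_deriv x c d (v c)"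
  unfolding tangent_space_def by blast

text \<open>The matrix with rows \<open>L (u i)\<close> is the product of the matrix with rows \<open>u i\<close> and the transpose of \<open>L\<close>.\<close>

lemma det_rows_linear:
  fixes L :: "real^'n::finite \<Rightarrow> real^'n"
  assumes "linear L"
  shows "det (\<chi> i. L (u i)) = det (matrix L) * det (\<chi> i. u i)"
proof -
  have L: "L x $ j = (\<Sum>k\<in>UNIV. matrix L $ j $ k * x $ k)" for x j
    using fun_cong[OF matrix_vector_mul(2)[OF assms], of x] by (simp add: matrix_vector_mult_def vec_eq_iff)
  have "(\<chi> i. L (u i)) = (\<chi> i. u i) ** transpose (matrix L)"
    by (simp add: vec_eq_iff L matrix_matrix_mult_def transpose_def mult.commute)
  then show ?thesis by (simp add: det_mul mult.commute)
qed

text \<open>Over a point of \<open>U\<close>, the inverse of the diffeomorphism \<open>(\<pi>, \<rho>)\<close> is the inverse of \<open>\<rho>\<close> on the fibre.\<close>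

lemma local_trivialization_inverse:
  assumes "local_trivialization E U \<rho>" "x \<in> U"
  shows "inv_into (bundle_over E U) (\<lambda>a. (proj E a, \<rho> a)) (x, w) = inv_into (fibre E x) \<rho> w"
    and "inv_into (fibre E x) \<rho> w \<in> fibre E x" "\<rho> (inv_into (fibre E x) \<rho> w) = w"
proof -
  have b: "bij_betw \<rho> (fibre E x) UNIV" using assms by (auto simp: local_trivialization_def)
  have w: "w \<in> \<rho> ` fibre E x" using b by (auto simp: bij_betw_def)
  show 1: "inv_into (fibre E x) \<rho> w \<in> fibre E x" using w by (rule inv_into_into)
  show 2: "\<rho> (inv_into (fibre E x) \<rho> w) = w" using w by (rule f_inv_into_f)
  have i: "inj_on (\<lambda>a. (proj E a, \<rho> a)) (bundle_over E U)"
    using assms(1) by (auto simp: local_trivialization_def diffeomorphism_on_def bij_betw_def)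
  show "inv_into (bundle_over E U) (\<lambda>a. (proj E a, \<rho> a)) (x, w) = inv_into (fibre E x) \<rho> w"
    using 1 2 assms(2) by (intro inv_into_f_eq[OF i]) (auto simp: fibre_def bundle_over_def)
qed

text \<open>The function is \<open>\<rho>'\<close> composed with the inverse \<open>G\<close> of \<open>(\<pi>, \<rho>)\<close>, restricted to the slice \<open>w = const\<close>. Near a point, the composition is
  factored through a chart \<open>k\<close> of the total space.\<close>

lemma frame_transition_smooth:
  fixes E :: "('e, 'm, 'n::finite, 'r::finite) vector_bundle"
  assumes E: "smooth_vector_bundle E" and \<rho>: "local_trivialization E U \<rho>" and \<rho>': "local_trivialization E U' \<rho>'"
    and U: "openin (mtop (base E)) U" "openin (mtop (base E)) U'" and c: "smooth_chart (base E) c"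
  shows "smooth_on (snd c ` (fst c \<inter> (U \<inter> U')))
    (\<lambda>y. \<rho>' (inv_into (fibre E (chart_inv c y)) \<rho> w))"
proof (rule smooth_in_chart[OF _ c, where f = "\<lambda>x. \<rho>' (inv_into (fibre E x) \<rho> w)"])
  show M: "smooth_manifold (base E)" using E by (simp add: smooth_vector_bundle_def)
  have T: "smooth_manifold (total E)" using E by (simp add: smooth_vector_bundle_def)
  show "openin (mtop (base E)) (U \<inter> U')" using U by blast
  define G where "G = inv_into (bundle_over E U) (\<lambda>a. (proj E a, \<rho> a))"
  have G: "G (x, w) = inv_into (fibre E x) \<rho> w" "G (x, w) \<in> fibre E x" if "x \<in> U" for x w
    using local_trivialization_inverse[OF \<rho> that] by (auto simp: G_def)
  have sG: "smooth_map_on (prod_manifold (base E) euclidean_manifold) (U \<times> UNIV) (total E) G"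
    using \<rho> by (auto simp: local_trivialization_def diffeomorphism_on_def G_def)
  have s\<rho>': "smooth_map_on (total E) (bundle_over E U') euclidean_manifold \<rho>'"
    using \<rho>' by (auto simp: local_trivialization_def)
  have oE: "openin (mtop (total E)) (bundle_over E U')"
  proof -
    have "continuous_map (mtop (total E)) (mtop (base E)) (proj E)"
      using E by (auto simp: smooth_vector_bundle_def smooth_map_on_def)
    then show ?thesis using openin_continuous_map_preimage[OF _ U(2)] by (auto simp: bundle_over_def)
  qed
  fix b assume b: "b \<in> atlas (base E)"
  note sb = atlas_smooth_chart[OF M b]
  show "smooth_on (snd b ` (fst b \<inter> (U \<inter> U'))) (\<lambda>y. \<rho>' (inv_into (fibre E (chart_inv b y)) \<rho> w))"
  proof (rule smooth_on_local)
    fix y assume "y \<in> snd b ` (fst b \<inter> (U \<inter> U'))"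
    then obtain x where x: "x \<in> fst b" "x \<in> U" "x \<in> U'" "y = snd b x" by auto
    have "G (x, w) \<in> \<Union>(fst ` atlas (total E))" using T G(2)[OF x(2)] by (auto simp: smooth_manifold_def fibre_def)
    then obtain k where k: "k \<in> atlas (total E)" "G (x, w) \<in> fst k" by auto
    note sk = atlas_smooth_chart[OF T k(1)]
    \<comment> \<open>the domain, in coordinates, of \<open>G\<close> between the product chart of \<open>b\<close> and the chart \<open>k\<close>\<close>
    define D where "D = map_prod (snd b) id ` ((fst b \<times> UNIV) \<inter> (U \<times> UNIV) \<inter> G -` fst k)"
    have pinv: "inv_into (fst b \<times> UNIV) (map_prod (snd b) id) (y, w) = (chart_inv b y, w)" if "y \<in> snd b ` fst b" for y and w :: "real^'r"
    proof (rule inv_into_f_eq)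
      show "inj_on (map_prod (snd b) id) (fst b \<times> (UNIV :: (real^'r) set))"
        using chart_onD(2)[OF smooth_chartD[OF sb]] by (auto simp: inj_on_def)
    qed (use that in \<open>auto simp: inv_into_into f_inv_into_f\<close>)
    have sD: "smooth_on D (snd k \<circ> G \<circ> inv_into (fst b \<times> UNIV) (map_prod (snd b) id))"
    proof -
      have "(fst b \<times> UNIV, map_prod (snd b) id) \<in> atlas (prod_manifold (base E) euclidean_manifold)"
        using b by (cases b) (auto simp: prod_manifold_def euclidean_manifold_def)
      then show ?thesis using sG k(1) unfolding smooth_map_on_def D_def by (cases k) fastforce
    qed
    have oD: "open D" unfolding open_prod_def
    proof (intro ballI)
      fix p assume "p \<in> D"
      then obtain z v where z: "z \<in> fst b" "z \<in> U" "G (z, v) \<in> fst k" "p = (snd b z, v)" by (auto simp: D_def)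
      have "continuous_map (subtopology (prod_topology (mtop (base E)) euclidean) (U \<times> UNIV)) (mtop (total E)) G"
        using sG by (simp add: smooth_map_on_def prod_manifold_def euclidean_manifold_def)
      from openin_continuous_map_preimage[OF this chart_domain_open[OF sk]]
      have "openin (subtopology (prod_topology (mtop (base E)) euclidean) (U \<times> UNIV)) {p \<in> U \<times> UNIV. G p \<in> fst k}"
        using openin_subset[OF U(1)] by (simp add: Int_absorb1 Times_Int_Times topspace_subtopology Sigma_mono Int_def[symmetric] inf.absorb2)
      then have "openin (prod_topology (mtop (base E)) euclidean) {p \<in> U \<times> UNIV. G p \<in> fst k}"
        using openin_trans_full[of "prod_topology (mtop (base E)) euclidean" "U \<times> UNIV"] U(1)
        by (simp add: openin_prod_Times_iff)
      then obtain A B where AB: "openin (mtop (base E)) A" "open B" "z \<in> A" "v \<in> B" "A \<times> B \<subseteq> {p \<in> U \<times> UNIV. G p \<in> fst k}"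
      proof -
        have "(z, v) \<in> {p \<in> U \<times> UNIV. G p \<in> fst k}" using z by simp
        with \<open>openin (prod_topology (mtop (base E)) euclidean) {p \<in> U \<times> UNIV. G p \<in> fst k}\<close>
        show ?thesis unfolding openin_prod_topology_alt open_openin[symmetric] by (elim allE impE exE conjE) (assumption, rule that)
      qed
      have "snd b ` (fst b \<inter> A) \<times> B \<subseteq> D"
      proof clarify
        fix z' v' assume *: "z' \<in> fst b" "z' \<in> A" "v' \<in> B"
        then have "(z', v') \<in> {p \<in> U \<times> UNIV. G p \<in> fst k}" using AB(5) by blast
        then have "(z', v') \<in> (fst b \<times> UNIV) \<inter> (U \<times> UNIV) \<inter> G -` fst k" using *(1) by simp
        from imageI[OF this, of "map_prod (snd b) id"] show "(snd b z', v') \<in> D" by (simp add: D_def)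
      qed
      moreover have "p \<in> snd b ` (fst b \<inter> A) \<times> B" using z AB(3,4) by auto
      ultimately show "\<exists>A B. open A \<and> open B \<and> p \<in> A \<times> B \<and> A \<times> B \<subseteq> D"
        using chart_range_open[OF sb AB(1)] AB(2) by blast
    qed
    \<comment> \<open>its slice over the fixed fibre coordinate \<open>w\<close>\<close>
    define S where "S = snd b ` (fst b \<inter> (U \<inter> U')) \<inter> (\<lambda>y. (y, w)) -` D"
    have "open (snd b ` (fst b \<inter> (U \<inter> U')))" using U by (intro chart_range_open[OF sb]) blast
    moreover have "open ((\<lambda>y. (y, w)) -` D)" by (rule open_vimage[OF oD]) (intro continuous_intros)
    ultimately have oS: "open S" by (auto simp: S_def)
    have yS: "y \<in> S" using x k(2) by (force simp: S_def D_def)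
    have S_G: "G (chart_inv b z, w) \<in> fst k \<and> chart_inv b z \<in> U \<and> chart_inv b z \<in> U' \<and> z \<in> snd b ` fst b" if "z \<in> S" for z
    proof -
      obtain x' where x': "x' \<in> fst b" "x' \<in> U" "x' \<in> U'" "z = snd b x'" using \<open>z \<in> S\<close> by (auto simp: S_def)
      obtain x'' where x'': "x'' \<in> fst b" "G (x'', w) \<in> fst k" "z = snd b x''" using \<open>z \<in> S\<close> by (auto simp: S_def D_def)
      have "x' = x''" using inj_onD[OF chart_onD(2)[OF smooth_chartD[OF sb]]] x' x'' by metis
      then show ?thesis using x' x'' by (auto simp: chart_inv_eq[OF sb])
    qed
    have 1: "smooth_on S (\<lambda>y. (snd k \<circ> G \<circ> inv_into (fst b \<times> UNIV) (map_prod (snd b) id)) (y, w))"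
    proof (rule smooth_on_compose[OF _ sD oS oD])
      show "smooth_on S (\<lambda>y. (y, w))" by (intro smooth_on_Pair oS smooth_on_ident smooth_on_const)
    qed (auto simp: S_def)
    have 2: "smooth_on S (\<lambda>y. snd k (G (chart_inv b y, w)))"
      using S_G by (intro smooth_on_cong[OF oS _ 1]) (auto simp: pinv)
    have 3: "smooth_on (snd k ` (fst k \<inter> bundle_over E U')) (\<lambda>z. \<rho>' (chart_inv k z))"
      using s\<rho>' k(1) by (cases k) (auto simp: smooth_map_on_def euclidean_manifold_def o_def)
    have "smooth_on S (\<lambda>y. \<rho>' (chart_inv k (snd k (G (chart_inv b y, w)))))"
    proof (intro smooth_on_compose[OF 2 3 oS chart_range_open[OF sk oE]] image_subsetI imageI IntI)
      fix z assume "z \<in> S"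
      note g = S_G[OF this]
      then show "G (chart_inv b z, w) \<in> fst k" by simp
      show "G (chart_inv b z, w) \<in> bundle_over E U'" using G(2)[of "chart_inv b z" w] g by (simp add: bundle_over_def fibre_def)
    qed
    then have "smooth_on S (\<lambda>y. \<rho>' (inv_into (fibre E (chart_inv b y)) \<rho> w))"
      by (rule smooth_on_cong[OF oS, rotated]) (use S_G in \<open>simp add: chart_inv_eq[OF sk] G(1)[symmetric]\<close>)
    then show "\<exists>S. y \<in> S \<and> open S \<and> smooth_on S (\<lambda>y. \<rho>' (inv_into (fibre E (chart_inv b y)) \<rho> w))"
      using yS oS by blast
  qed
qed


section \<open>Locality of functionals on test functions\<close>

lemma linear_functional_onD:
  assumes "linear_functional_on D u" "f \<in> D"
  shows "g \<in> D \<Longrightarrow> u (\<lambda>x. f x + g x) = u f + u g" "u (\<lambda>x. c * f x) = c * u f"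
  using assms by (simp_all add: linear_functional_on_def)

lemma linear_functional_on_sum:
  assumes lin: "linear_functional_on D u" and I: "finite I" "I \<noteq> {}" and f: "\<And>i. i \<in> I \<Longrightarrow> f i \<in> D"
    and D: "\<And>g h. g \<in> D \<Longrightarrow> h \<in> D \<Longrightarrow> (\<lambda>x. g x + h x) \<in> D"
  shows "(\<lambda>x. \<Sum>i\<in>I. f i x) \<in> D \<and> u (\<lambda>x. \<Sum>i\<in>I. f i x) = (\<Sum>i\<in>I. u (f i))"
  using I f
proof (induction I rule: finite_ne_induct)
  case (insert i I)
  then have IH: "(\<lambda>x. \<Sum>i\<in>I. f i x) \<in> D" "u (\<lambda>x. \<Sum>i\<in>I. f i x) = (\<Sum>i\<in>I. u (f i))" by auto
  have fi: "f i \<in> D" using insert.prems by simp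
  have "u (\<lambda>x. f i x + (\<Sum>i\<in>I. f i x)) = u (f i) + u (\<lambda>x. \<Sum>i\<in>I. f i x)"
    by (rule linear_functional_onD(1)[OF lin fi IH(1)])
  then show ?case using insert.hyps D[OF fi IH(1)] IH(2) by simp
qed simp

text \<open>Split \<open>\<zeta> = \<eta> \<zeta> + (1 - \<eta>) \<zeta>\<close> with a cut-off function \<open>\<eta>\<close> on \<open>O1\<close> that is \<open>1\<close> near the part of the support outside \<open>O2\<close>.\<close>

lemma linear_vanish_Un:
  assumes lin: "linear_functional_on (test_functions \<Omega>) T" and O: "open O1" "O1 \<subseteq> \<Omega>" "open O2" "O2 \<subseteq> \<Omega>"
    and v: "\<And>\<zeta>. \<zeta> \<in> test_functions O1 \<Longrightarrow> T \<zeta> = 0" "\<And>\<zeta>. \<zeta> \<in> test_functions O2 \<Longrightarrow> T \<zeta> = 0"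
    and z: "\<zeta> \<in> test_functions (O1 \<union> O2)"
  shows "T \<zeta> = 0"
proof -
  let ?K = "supp \<zeta>"
  have K: "compact ?K" "?K \<subseteq> O1 \<union> O2" and s: "smooth_on UNIV \<zeta>" using z by (auto simp: test_functions_iff)
  obtain \<eta> V where e: "\<eta> \<in> test_functions O1" "open V" "?K - O2 \<subseteq> V" "\<And>x. x \<in> V \<Longrightarrow> \<eta> x = 1"
  proof (rule smooth_cutoff[of "?K - O2" O1])
    show "compact (?K - O2)" using K(1) O(3) by (rule compact_diff)
  qed (use K O in auto)
  have 1: "(\<lambda>x. \<eta> x * \<zeta> x) \<in> test_functions O1"
    by (rule test_functions_smooth_mult[OF O(1) smooth_on_subset[OF s] e(1)]) auto
  have 2: "(\<lambda>x. (1 - \<eta> x) * \<zeta> x) \<in> test_functions O2"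
  proof (rule test_functionsI)
    show "smooth_on UNIV (\<lambda>x. (1 - \<eta> x) * \<zeta> x)"
      using s test_functionsD(1)[OF e(1)] by (intro smooth_on_mult smooth_on_diff) auto
    show "compact (?K - V)" using K(1) e(2) by (rule compact_diff)
    show "?K - V \<subseteq> O2" using e(3) by blast
    show "x \<in> ?K - V" if "(1 - \<eta> x) * \<zeta> x \<noteq> 0" for x using that e(4)[of x] closure_subset[of "{x. \<zeta> x \<noteq> 0}"] by auto
  qed
  have "T \<zeta> = T (\<lambda>x. \<eta> x * \<zeta> x + (1 - \<eta> x) * \<zeta> x)" by (simp add: algebra_simps)
  also have "\<dots> = T (\<lambda>x. \<eta> x * \<zeta> x) + T (\<lambda>x. (1 - \<eta> x) * \<zeta> x)"
    by (rule linear_functional_onD(1)[OF lin test_functions_mono[OF O(2) 1] test_functions_mono[OF O(4) 2]])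
  finally show ?thesis using v 1 2 by simp
qed

text \<open>Finitely many of the sets \<open>B\<close> cover the support, and the preceding lemma passes to their union.\<close>

lemma linear_vanish_cover:
  assumes lin: "linear_functional_on (test_functions \<Omega>) T" and z: "\<zeta> \<in> test_functions \<Omega>"
    and loc: "\<And>x. x \<in> supp \<zeta> \<Longrightarrow>
      \<exists>B. x \<in> B \<and> open B \<and> B \<subseteq> \<Omega> \<and> (\<forall>\<xi>\<in>test_functions B. T \<xi> = 0)"
  shows "T \<zeta> = 0"
proof -
  let ?F = "{B. open B \<and> B \<subseteq> \<Omega> \<and> (\<forall>\<xi>\<in>test_functions B. T \<xi> = 0)}"
  have K: "compact (supp \<zeta>)" and s: "smooth_on UNIV \<zeta>" using z by (auto simp: test_functions_iff)
  have Un: "O1 \<union> O2 \<in> ?F" if "O1 \<in> ?F" "O2 \<in> ?F" for O1 O2 using that linear_vanish_Un[OF lin, of O1 O2] by blast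
  have T0: "T \<xi> = 0" if "\<xi> \<in> test_functions {}" for \<xi>
  proof -
    have "\<xi> = (\<lambda>x. 0)" using that closure_subset[of "{x. \<xi> x \<noteq> 0}"] unfolding test_functions_iff by blast
    moreover have "T (\<lambda>x. 0 * \<zeta> x) = 0 * T \<zeta>" by (rule linear_functional_onD(2)[OF lin z])
    ultimately show ?thesis by simp
  qed
  have fin: "\<Union>G \<in> ?F" if "finite G" "G \<subseteq> ?F" for G using that
  proof (induction G rule: finite_induct)
    case empty then show ?case using T0 by simp
  next
    case (insert x G) then show ?case using Un[of x "\<Union>G"] by simp
  qed
  have "supp \<zeta> \<subseteq> \<Union>?F" using loc by blast
  then obtain G where G: "G \<subseteq> ?F" "finite G" "supp \<zeta> \<subseteq> \<Union>G" by (rule compactE[OF K]) auto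
  then have "\<zeta> \<in> test_functions (\<Union>G)" using z by (simp add: test_functions_iff)
  then show ?thesis using fin[OF G(2,1)] by blast
qed


section \<open>Test sections\<close>

abbreviation tchart :: "('e, 'm, 'n::finite, 'r::finite) aug_triv \<Rightarrow> ('m, real^'n) chart"
  where "tchart \<tau> \<equiv> (tdomain \<tau>, tcoord \<tau>)"

abbreviation triv_of :: "('e, 'm, 'n::finite, 'r::finite) vector_bundle \<Rightarrow> ('e, 'm, 'n, 'r) aug_triv \<Rightarrow> bool"
  where "triv_of E \<tau> \<equiv> total_triv_triple E (tdomain \<tau>) (tcoord \<tau>) (tfibre \<tau>)"

abbreviation all_test_sections :: "('e, 'm, 'n::finite, 'r::finite) vector_bundle \<Rightarrow> ('e, 'm, 'n) dual_section set"
  where "all_test_sections E \<equiv> \<Union>{test_sections_in E K | K. compactin (mtop (base E)) K}"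

text \<open>The determinant of the components in \<open>c\<close> is that of the components in another chart times the Jacobian
  determinant of the transition, so an endomorphism contributes the modulus of its determinant.\<close>

lemma density_of_chart:
  fixes M :: "('a, real^'n::finite) manifold"
  assumes M: "smooth_manifold M" and c: "c \<in> charts_at M x"
  shows "(\<lambda>v. if \<forall>i. v i \<in> tangent_space M x then k * \<bar>det (\<chi> i. v i c)\<bar> else 0) \<in> density_space M x"
  unfolding density_space_def
proof (intro CollectI conjI ballI allI impI)
  fix d and A :: "real^'n^'n" and v :: "'n \<Rightarrow> ('a, 'n) tvec"
  assume d: "d \<in> charts_at M x" and v: "\<forall>i. v i \<in> tangent_space M x"
  let ?v = "\<lambda>i. tangent_of_coords M x d (A *v v i d)"
  have lA: "linear ((*v) A)" by (rule matrix_vector_mul_linear)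
  have "(\<chi> i. ?v i c) = (\<chi> i. tr_deriv x d c (A *v v i d))" using c by (simp add: tangent_of_coords_def)
  then have "det (\<chi> i. ?v i c) = det (matrix (tr_deriv x d c)) * (det A * det (\<chi> i. v i d))"
    using det_rows_linear[OF tr_deriv_linear[OF M d c], of "\<lambda>i. A *v v i d"] det_rows_linear[OF lA, of "\<lambda>i. v i d"]
    by (simp add: matrix_of_matrix_vector_mul)
  moreover have "det (\<chi> i. v i c) = det (matrix (tr_deriv x d c)) * det (\<chi> i. v i d)"
  proof -
    have "(\<chi> i. v i c) = (\<chi> i. tr_deriv x d c (v i d))" using v tangent_spaceD[OF _ d c] by (simp add: vec_eq_iff)
    then show ?thesis using det_rows_linear[OF tr_deriv_linear[OF M d c], of "\<lambda>i. v i d"] by simp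
  qed
  ultimately show "(if \<forall>i. ?v i \<in> tangent_space M x then k * \<bar>det (\<chi> i. ?v i c)\<bar> else 0) =
      \<bar>det A\<bar> * (if \<forall>i. v i \<in> tangent_space M x then k * \<bar>det (\<chi> i. v i c)\<bar> else 0)"
    using v tangent_of_coords_in[OF M d] by (simp add: abs_mult)
qed auto

lemma density_space_0: "(\<lambda>v. 0) \<in> density_space M x"
  by (simp add: density_space_def)

lemma density_space_add:
  "\<mu> \<in> density_space M x \<Longrightarrow> \<mu>' \<in> density_space M x \<Longrightarrow> (\<lambda>v. \<mu> v + \<mu>' v) \<in> density_space M x"
  by (simp add: density_space_def distrib_left)

lemma density_space_cmult: "\<mu> \<in> density_space M x \<Longrightarrow> (\<lambda>v. k * \<mu> v) \<in> density_space M x"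
  by (simp add: density_space_def mult.left_commute)

lemma triv_charts_at: "total_triv_triple E U \<phi> \<rho> \<Longrightarrow> x \<in> U \<Longrightarrow> (U, \<phi>) \<in> charts_at (base E) x"
  by (simp add: total_triv_triple_def charts_at_iff)

lemma fibre_closed:
  assumes "smooth_vector_bundle E" "x \<in> points (base E)" "a \<in> fibre E x"
  shows "b \<in> fibre E x \<Longrightarrow> fadd E a b \<in> fibre E x" "fscale E s a \<in> fibre E x"
  using assms by (auto simp: smooth_vector_bundle_def real_vector_space_on_def)

lemma local_test_section_dual:
  assumes E: "smooth_vector_bundle E" and t: "triv_of E \<tau>"
  shows "local_test_section E \<tau> l \<xi> \<in> dual_sections E"
proof -
  have M: "smooth_manifold (base E)" using E by (simp add: smooth_vector_bundle_def)
  have sub: "tdomain \<tau> \<subseteq> points (base E)"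
    using t chart_onD(3)[OF smooth_chartD, of "base E" "tchart \<tau>"] by (simp add: total_triv_triple_def)
  have 1: "(\<lambda>v. local_test_section E \<tau> l \<xi> (x, a, v)) \<in> density_space (base E) x" if "a \<in> fibre E x" for x a
  proof (cases "x \<in> tdomain \<tau>")
    case True
    show ?thesis
      using density_of_chart[OF M triv_charts_at[OF t True], of "\<xi> (tcoord \<tau> x) * (tfibre \<tau> a $ l)"] True that
      by (simp add: local_test_section_def cong: if_cong)
  qed (simp add: local_test_section_def density_space_0)
  have 2: "fibre_linear E x (\<lambda>a. local_test_section E \<tau> l \<xi> (x, a, v))" if x: "x \<in> points (base E)" for x v
  proof (cases "x \<in> tdomain \<tau>")
    case True
    then have "fibre_linear E x (tfibre \<tau>)" using t by (auto simp: total_triv_triple_def local_trivialization_def)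
    then show ?thesis using fibre_closed[OF E x]
      by (cases "\<forall>i. v i \<in> tangent_space (base E) x") (auto simp: fibre_linear_def local_test_section_def algebra_simps)
  qed (simp add: local_test_section_def fibre_linear_def)
  show ?thesis using 1 2 sub by (auto simp: dual_sections_def local_test_section_def)
qed

text \<open>The coordinate vectors of the chart \<open>\<phi>'\<close> have the columns of the Jacobian matrix of the transition as components in
  the chart of \<open>\<tau>\<close>.\<close>

lemma dual_component_local_test_section:
  fixes \<rho>' :: "'e \<Rightarrow> real^'r::finite" and \<tau> :: "('e, 'm, 'n::finite, 'r) aug_triv"
  assumes E: "smooth_vector_bundle E" and t: "triv_of E \<tau>" and t': "total_triv_triple E U' \<phi>' \<rho>'" and x: "x \<in> U'"
  shows "dual_component E U' \<phi>' \<rho>' l' (local_test_section E \<tau> l \<xi>) (\<phi>' x) =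
    (if x \<in> tdomain \<tau> then \<xi> (tcoord \<tau> x) * (tfibre \<tau> (inv_into (fibre E x) \<rho>' (axis l' 1)) $ l) *
      jac_det (transition (U', \<phi>') (tchart \<tau>)) (\<phi>' x) else 0)"
proof -
  have M: "smooth_manifold (base E)" using E by (simp add: smooth_vector_bundle_def)
  have l: "local_trivialization E U' \<rho>'" and s: "smooth_chart (base E) (U', \<phi>')"
    using t' by (auto simp: total_triv_triple_def)
  note c' = triv_charts_at[OF t' x]
  have xi: "inv_into U' \<phi>' (\<phi>' x) = x" using chart_inv_eq[OF s, of x] x by simp
  have det1: "det (\<chi> i. tangent_of_coords (base E) x (U', \<phi>') (axis i 1) (tchart \<tau>)) =
      det (matrix (tr_deriv x (U', \<phi>') (tchart \<tau>)))" if "x \<in> tdomain \<tau>"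
  proof -
    note c = triv_charts_at[OF t that]
    have "((\<chi> i. axis i 1) :: real^'n^'n) = mat 1" by (auto simp: vec_eq_iff axis_def mat_def)
    then show ?thesis
      using c det_rows_linear[OF tr_deriv_linear[OF M c' c], of "\<lambda>i. axis i 1"] by (simp add: tangent_of_coords_def)
  qed
  show ?thesis using local_trivialization_inverse(2)[OF l x, of "axis l' 1"] tangent_of_coords_in[OF M c'] det1
    by (simp add: dual_component_def Let_def xi local_test_section_def)
qed

text \<open>On the overlap of two charts the components are given by the transformation law; off the compact set
  that corresponds to the support of \<open>\<xi>\<close> they vanish. This set is closed since the manifold is Hausdorff, so that both
  regions are open.\<close>

lemma local_test_section_smooth:
  assumes E: "smooth_vector_bundle E" and t: "triv_of E \<tau>" and xi: "\<xi> \<in> test_functions (coord_range \<tau>)"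
  shows "compactin (mtop (base E)) (chart_inv (tchart \<tau>) ` supp \<xi>) \<and>
    local_test_section E \<tau> l \<xi> \<in> test_sections_in E (chart_inv (tchart \<tau>) ` supp \<xi>)"
proof -
  let ?X = "mtop (base E)" and ?c = "tchart \<tau>" and ?S = "supp \<xi>"
  let ?K = "chart_inv ?c ` ?S" and ?\<eta> = "local_test_section E \<tau> l \<xi>"
  have M: "smooth_manifold (base E)" using E by (simp add: smooth_vector_bundle_def)
  then have H: "Hausdorff_space ?X" by (simp add: smooth_manifold_def)
  have sc: "smooth_chart (base E) ?c" and lt: "local_trivialization E (tdomain \<tau>) (tfibre \<tau>)"
    using t by (auto simp: total_triv_triple_def)
  have S: "compact ?S" "?S \<subseteq> coord_range \<tau>" and s\<xi>: "smooth_on UNIV \<xi>" using xi by (auto simp: test_functions_iff)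
  have K: "compactin ?X ?K" using chart_onD(6)[OF smooth_chartD[OF sc], of ?S] S by simp
  then have clK: "closedin ?X ?K" using H by (rule compactin_imp_closedin[rotated])
  have inK: "x \<in> ?K" if "x \<in> tdomain \<tau>" "\<xi> (tcoord \<tau> x) \<noteq> 0" for x
  proof -
    have "tcoord \<tau> x \<in> ?S" by (rule subsetD[OF closure_subset]) (use that(2) in simp)
    moreover have "chart_inv ?c (tcoord \<tau> x) = x" using chart_inv_eq[OF sc, of x] that(1) by simp
    ultimately show ?thesis using imageI[of "tcoord \<tau> x" ?S "chart_inv ?c"] by (simp only:)
  qed
  have supp: "section_support E ?\<eta> \<subseteq> ?K" unfolding section_support_def
  proof (rule closure_of_minimal[OF _ clK], clarify)
    fix x a v assume "?\<eta> (x, a, v) \<noteq> 0"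
    then have "x \<in> tdomain \<tau> \<and> \<xi> (tcoord \<tau> x) \<noteq> 0" by (simp add: local_test_section_def split: if_splits)
    then show "x \<in> ?K" by (intro inK) auto
  qed
  have smooth: "smooth_on (\<phi>' ` U') (dual_component E U' \<phi>' \<rho>' l' ?\<eta>)" if t': "total_triv_triple E U' \<phi>' \<rho>'" for U' \<phi>' \<rho>' l'
  proof -
    let ?d = "(U', \<phi>')"
    have sd: "smooth_chart (base E) ?d" and lt': "local_trivialization E U' \<rho>'" using t' by (auto simp: total_triv_triple_def)
    let ?W = "\<phi>' ` (U' \<inter> tdomain \<tau>)" and ?Z = "\<phi>' ` (U' \<inter> (topspace ?X - ?K))"
    note dom = chart_domain_open[OF sc, simplified] chart_domain_open[OF sd, simplified]
    have o: "open ?W" "open ?Z"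
      using chart_range_open[OF sd dom(1)] chart_range_open[OF sd openin_diff[OF openin_topspace clK]] by auto
    have inv: "inv_into U' \<phi>' (\<phi>' x) = x" and tr: "transition ?d ?c (\<phi>' x) = tcoord \<tau> x" if "x \<in> U'" for x
      using chart_inv_eq[OF sd, of x] that by (simp_all add: transition_def)
    note dc = dual_component_local_test_section[OF E t t']
    have df: "diffeo ?W (tcoord \<tau> ` (U' \<inter> tdomain \<tau>)) (transition ?d ?c) (transition ?c ?d)"
      using transition_diffeo[OF M sd sc] by simp
    have str: "smooth_on ?W (transition ?d ?c)" using df by (simp add: diffeo_def)
    have "smooth_on ?W (\<lambda>y. \<xi> (transition ?d ?c y))" by (rule smooth_on_compose[OF str s\<xi> o(1)]) auto
    moreover have "smooth_on ?W (\<lambda>y. tfibre \<tau> (inv_into (fibre E (chart_inv ?d y)) \<rho>' (axis l' 1)) $ l)"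
      using frame_transition_smooth[OF E lt' lt dom(2,1) sd]
      by (intro smooth_on_vec_nth[OF o(1)]) (simp add: Int_absorb1)
    moreover have "smooth_on ?W (jac_det (transition ?d ?c))"
      using diffeo_jac_det_pos[OF df] by (intro smooth_on_abs[OF o(1) smooth_on_det_derivative[OF o(1) str]]) fastforce
    ultimately have "smooth_on ?W (\<lambda>y. \<xi> (transition ?d ?c y) *
        (tfibre \<tau> (inv_into (fibre E (chart_inv ?d y)) \<rho>' (axis l' 1)) $ l) * jac_det (transition ?d ?c) y)"
      by (intro smooth_on_mult[OF o(1)])
    then have 1: "smooth_on ?W (dual_component E U' \<phi>' \<rho>' l' ?\<eta>)"
      by (rule smooth_on_cong[OF o(1), rotated]) (auto simp: dc inv tr)
    have 2: "smooth_on ?Z (dual_component E U' \<phi>' \<rho>' l' ?\<eta>)"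
      using inK by (intro smooth_on_cong[OF o(2) _ smooth_on_const[of _ 0]]) (auto simp: dc)
    have "\<phi>' ` U' = ?W \<union> ?Z"
    proof -
      have "?K \<subseteq> tdomain \<tau>" using S(2) by (auto intro!: inv_into_into)
      moreover have "U' \<subseteq> topspace ?X" using dom(2) by (rule openin_subset)
      ultimately show ?thesis by blast
    qed
    then show ?thesis using smooth_on_Un[OF o 1 2] by simp
  qed
  show ?thesis using K supp smooth local_test_section_dual[OF E t] by (auto simp: test_sections_in_def smooth_dual_sections_def)
qed

lemma local_test_section_all:
  assumes "smooth_vector_bundle E" "triv_of E \<tau>" "\<xi> \<in> test_functions (coord_range \<tau>)"
  shows "local_test_section E \<tau> l \<xi> \<in> all_test_sections E"
  using local_test_section_smooth[OF assms, of l] by blast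

lemma test_sections_mult:
  assumes E: "smooth_vector_bundle E" and \<psi>: "smooth_map_on (base E) (points (base E)) euclidean_manifold \<psi>"
    and h: "\<eta> \<in> all_test_sections E"
  shows "(\<lambda>(x, a, v). \<psi> x * \<eta> (x, a, v)) \<in> all_test_sections E"
proof -
  let ?\<zeta> = "\<lambda>(x, a, v). \<psi> x * \<eta> (x, a, v)"
  have M: "smooth_manifold (base E)" using E by (simp add: smooth_vector_bundle_def)
  obtain K where K: "compactin (mtop (base E)) K" "\<eta> \<in> test_sections_in E K" using h by auto
  then have d: "\<eta> \<in> dual_sections E" and sup: "section_support E \<eta> \<subseteq> K"
    and sm: "\<And>U \<phi> \<rho> l. total_triv_triple E U \<phi> \<rho> \<Longrightarrow> smooth_on (\<phi> ` U) (dual_component E U \<phi> \<rho> l \<eta>)"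
    by (auto simp: test_sections_in_def smooth_dual_sections_def)
  have "?\<zeta> \<in> dual_sections E"
    using d by (auto simp: dual_sections_def fibre_linear_def distrib_left intro!: density_space_cmult)
  moreover have "section_support E ?\<zeta> \<subseteq> K"
    using closure_of_mono[of "{x. \<exists>a v. ?\<zeta> (x, a, v) \<noteq> 0}" "{x. \<exists>a v. \<eta> (x, a, v) \<noteq> 0}" "mtop (base E)"] sup
    unfolding section_support_def by fastforce
  moreover have "smooth_on (\<phi> ` U) (dual_component E U \<phi> \<rho> l ?\<zeta>)" if t: "total_triv_triple E U \<phi> \<rho>" for U \<phi> \<rho> l
  proof -
    have sc: "smooth_chart (base E) (U, \<phi>)" using t by (simp add: total_triv_triple_def)
    have o: "open (\<phi> ` U)" using smooth_chartD[OF sc] by (simp add: chart_on_def)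
    have "smooth_on (\<phi> ` U) (\<lambda>y. \<psi> (inv_into U \<phi> y) * dual_component E U \<phi> \<rho> l \<eta> y)"
      using smooth_real_in_chart[OF M sc \<psi>] by (intro smooth_on_mult[OF o] sm[OF t]) simp
    then show ?thesis by (simp add: dual_component_def Let_def)
  qed
  ultimately have "?\<zeta> \<in> test_sections_in E K" by (simp add: test_sections_in_def smooth_dual_sections_def)
  then show ?thesis using K(1) by blast
qed

lemma test_sections_add:
  assumes "\<eta> \<in> all_test_sections E" "\<zeta> \<in> all_test_sections E"
  shows "(\<lambda>z. \<eta> z + \<zeta> z) \<in> all_test_sections E"
proof -
  let ?X = "mtop (base E)" and ?s = "\<lambda>z. \<eta> z + \<zeta> z"
  obtain K K' where K: "compactin ?X K" "\<eta> \<in> test_sections_in E K" "compactin ?X K'" "\<zeta> \<in> test_sections_in E K'"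
    using assms by auto
  have d: "\<eta> \<in> dual_sections E" "\<zeta> \<in> dual_sections E" using K by (auto simp: test_sections_in_def smooth_dual_sections_def)
  then have "?s \<in> dual_sections E"
    by (auto simp: dual_sections_def fibre_linear_def distrib_left intro!: density_space_add)
  moreover have "section_support E ?s \<subseteq> K \<union> K'"
  proof -
    have "section_support E ?s \<subseteq> ?X closure_of ({x. \<exists>a v. \<eta> (x, a, v) \<noteq> 0} \<union> {x. \<exists>a v. \<zeta> (x, a, v) \<noteq> 0})"
      unfolding section_support_def
    proof (rule closure_of_mono, clarify)
      fix x a v assume "\<eta> (x, a, v) + \<zeta> (x, a, v) \<noteq> 0" and "\<nexists>a v. \<zeta> (x, a, v) \<noteq> 0"
      then have "\<eta> (x, a, v) \<noteq> 0" by simp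
      then show "\<exists>a v. \<eta> (x, a, v) \<noteq> 0" by blast
    qed
    then show ?thesis using K(2,4) by (auto simp: closure_of_Un test_sections_in_def section_support_def)
  qed
  moreover have "smooth_on (\<phi> ` U) (dual_component E U \<phi> \<rho> l ?s)" if t: "total_triv_triple E U \<phi> \<rho>" for U \<phi> \<rho> l
  proof -
    have "smooth_chart (base E) (U, \<phi>)" using t by (simp add: total_triv_triple_def)
    then have o: "open (\<phi> ` U)" using smooth_chartD[of "base E" "(U, \<phi>)"] by (simp add: chart_on_def)
    have "smooth_on (\<phi> ` U) (\<lambda>y. dual_component E U \<phi> \<rho> l \<eta> y + dual_component E U \<phi> \<rho> l \<zeta> y)"
      using K(2,4) t by (intro smooth_on_add[OF o]) (auto simp: test_sections_in_def smooth_dual_sections_def)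
    then show ?thesis by (simp add: dual_component_def Let_def)
  qed
  ultimately have "?s \<in> test_sections_in E (K \<union> K')" by (simp add: test_sections_in_def smooth_dual_sections_def)
  then show ?thesis using compactin_Un[OF K(1,3)] by blast
qed

lemma bundle_distribution_linear:
  "u \<in> bundle_distributions E \<Longrightarrow> linear_functional_on (all_test_sections E) u"
  by (simp add: bundle_distributions_def topological_dual_def)

lemma local_rep_linear:
  assumes E: "smooth_vector_bundle E" and t: "triv_of E \<tau>" and u: "u \<in> bundle_distributions E"
  shows "linear_functional_on (test_functions (coord_range \<tau>)) (local_rep E \<tau> u l)"
proof -
  note L = linear_functional_onD[OF bundle_distribution_linear[OF u] local_test_section_all[OF E t]]
  have "local_test_section E \<tau> l (\<lambda>x. f x + g x) = (\<lambda>z. local_test_section E \<tau> l f z + local_test_section E \<tau> l g z)" for f g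
    by (auto simp: local_test_section_def algebra_simps)
  moreover have "local_test_section E \<tau> l (\<lambda>x. c * f x) = (\<lambda>z. c * local_test_section E \<tau> l f z)" for f c
    by (auto simp: local_test_section_def)
  ultimately show ?thesis
    unfolding linear_functional_on_def local_rep_def by (simp only: L local_test_section_all[OF E t] cong: ball_cong) simp
qed

text \<open>Near each point of the support of \<open>\<zeta>\<close>, which avoids the support of \<open>u\<close>, the representation vanishes by the
  definition of the support of a distribution.\<close>

lemma local_rep_vanish:
  assumes E: "smooth_vector_bundle E" and t: "triv_of E \<tau>" and u: "u \<in> bundle_distributions E"
    and z: "\<zeta> \<in> test_functions (coord_range \<tau>)"
    and d: "\<And>x. x \<in> tdomain \<tau> \<Longrightarrow> x \<in> distribution_support E u \<Longrightarrow> tcoord \<tau> x \<notin> supp \<zeta>"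
  shows "local_rep E \<tau> u l \<zeta> = 0"
proof (rule linear_vanish_cover[OF local_rep_linear[OF E t u] z])
  have sc: "smooth_chart (base E) (tchart \<tau>)" using t by (simp add: total_triv_triple_def)
  note inv = chart_inv_eq[OF sc, simplified]
  fix y assume y: "y \<in> supp \<zeta>"
  then obtain x where x: "x \<in> tdomain \<tau>" "y = tcoord \<tau> x" using z by (auto simp: test_functions_iff)
  have "x \<notin> distribution_support E u" using d[OF x(1)] y x(2) by auto
  moreover have "x \<in> points (base E)" using openin_subset[OF chart_domain_open[OF sc]] x(1) by auto
  ultimately obtain W where W: "openin (mtop (base E)) W" "x \<in> W"
    "\<And>\<eta> K. compactin (mtop (base E)) K \<Longrightarrow> K \<subseteq> W \<Longrightarrow> \<eta> \<in> test_sections_in E K \<Longrightarrow> u \<eta> = 0"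
    unfolding distribution_support_def by blast
  let ?B = "tcoord \<tau> ` (tdomain \<tau> \<inter> W)"
  have "local_rep E \<tau> u l \<xi> = 0" if xi: "\<xi> \<in> test_functions ?B" for \<xi>
  proof -
    have xi': "\<xi> \<in> test_functions (coord_range \<tau>)" by (rule test_functions_mono[OF _ xi]) auto
    have "supp \<xi> \<subseteq> ?B" using xi by (simp add: test_functions_iff)
    then have "inv_into (tdomain \<tau>) (tcoord \<tau>) ` supp \<xi> \<subseteq> W" using inv by fastforce
    with local_test_section_smooth[OF E t xi', of l] show ?thesis
      unfolding local_rep_def by (elim conjE) (rule W(3), simp_all)
  qed
  then show "\<exists>B. y \<in> B \<and> open B \<and> B \<subseteq> coord_range \<tau> \<and> (\<forall>\<xi>\<in>test_functions B. local_rep E \<tau> u l \<xi> = 0)"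
    using x W(2) chart_range_open[OF sc W(1)] by (intro exI[of _ ?B]) auto
qed


section \<open>Change of trivialization\<close>

abbreviation overlap :: "('e, 'm, 'n::finite, 'r::finite) aug_triv \<Rightarrow> ('e, 'm, 'n, 'r) aug_triv \<Rightarrow> (real^'n) set"
  where "overlap \<tau> \<sigma> \<equiv> tcoord \<tau> ` (tdomain \<tau> \<inter> tdomain \<sigma>)"

text \<open>The weight that turns the pull-back along the coordinate change into the transformation law for the
  test sections of \<open>\<sigma>\<close> and \<open>\<tau>\<close>; \<open>\<kappa>'\<close> and \<open>\<kappa>\<close> are cut-off functions in the ranges of \<open>\<tau>\<close> and \<open>\<sigma>\<close>.\<close>

definition transition_weight ::
  "('e, 'm, 'n::finite, 'r::finite) vector_bundle \<Rightarrow> ('e, 'm, 'n, 'r) aug_triv \<Rightarrow> ('e, 'm, 'n, 'r) aug_triv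
    \<Rightarrow> (real^'n \<Rightarrow> real) \<Rightarrow> (real^'n \<Rightarrow> real) \<Rightarrow> 'r \<Rightarrow> 'r \<Rightarrow> real^'n \<Rightarrow> real"
  where "transition_weight E \<tau> \<sigma> \<kappa>' \<kappa> l i y =
    (if y \<in> overlap \<tau> \<sigma>
     then \<kappa>' y * \<kappa> (transition (tchart \<tau>) (tchart \<sigma>) y) *
       (tfibre \<sigma> (inv_into (fibre E (chart_inv (tchart \<tau>) y)) (tfibre \<tau>) (axis l 1)) $ i) *
       jac_det (transition (tchart \<tau>) (tchart \<sigma>)) y
     else 0)"

abbreviation transfer :: "('e, 'm, 'n::finite, 'r::finite) vector_bundle \<Rightarrow> ('e, 'm, 'n, 'r) aug_triv \<Rightarrow> ('e, 'm, 'n, 'r) aug_triv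
    \<Rightarrow> (real^'n \<Rightarrow> real) \<Rightarrow> (real^'n \<Rightarrow> real) \<Rightarrow> 'r \<Rightarrow> 'r \<Rightarrow> (real^'n \<Rightarrow> real) \<Rightarrow> real^'n \<Rightarrow> real"
  where "transfer E \<tau> \<sigma> \<kappa>' \<kappa> l i \<equiv>
    pullback (overlap \<tau> \<sigma>) (transition_weight E \<tau> \<sigma> \<kappa>' \<kappa> l i) (transition (tchart \<tau>) (tchart \<sigma>))"

lemma overlap_diffeo:
  assumes E: "smooth_vector_bundle E" and t: "triv_of E \<tau>" and s: "triv_of E \<sigma>"
  shows "diffeo (overlap \<tau> \<sigma>) (tcoord \<sigma> ` (tdomain \<tau> \<inter> tdomain \<sigma>))
    (transition (tchart \<tau>) (tchart \<sigma>)) (transition (tchart \<sigma>) (tchart \<tau>))"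
  using transition_diffeo[of "base E" "tchart \<tau>" "tchart \<sigma>"] assms
  by (simp add: smooth_vector_bundle_def total_triv_triple_def)

text \<open>The compact sets of points with coordinates in the supports of \<open>\<kappa>'\<close> and \<open>\<kappa>\<close> are closed in the Hausdorff space
  \<open>M\<close>; the weight lives on their intersection, a compact subset of the overlap.\<close>

lemma transition_weight_test:
  assumes E: "smooth_vector_bundle E" and t: "triv_of E \<tau>" and s: "triv_of E \<sigma>"
    and k: "\<kappa>' \<in> test_functions (coord_range \<tau>)" "\<kappa> \<in> test_functions (coord_range \<sigma>)"
  shows "transition_weight E \<tau> \<sigma> \<kappa>' \<kappa> l i \<in> test_functions (overlap \<tau> \<sigma>)"
proof -
  let ?X = "mtop (base E)" and ?W = "overlap \<tau> \<sigma>" and ?\<Phi> = "transition (tchart \<tau>) (tchart \<sigma>)"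
  have H: "Hausdorff_space ?X" using E by (simp add: smooth_vector_bundle_def smooth_manifold_def)
  have sc: "smooth_chart (base E) (tchart \<tau>)" "smooth_chart (base E) (tchart \<sigma>)"
    and lt: "local_trivialization E (tdomain \<tau>) (tfibre \<tau>)" "local_trivialization E (tdomain \<sigma>) (tfibre \<sigma>)"
    using t s by (auto simp: total_triv_triple_def)
  note dom = chart_domain_open[OF sc(1), simplified] chart_domain_open[OF sc(2), simplified]
  note d = overlap_diffeo[OF E t s]
  have o: "open ?W" and s\<Phi>: "smooth_on ?W ?\<Phi>" using d by (auto simp: diffeo_def)
  let ?P = "inv_into (tdomain \<tau>) (tcoord \<tau>) ` supp \<kappa>'"
  let ?Q = "inv_into (tdomain \<sigma>) (tcoord \<sigma>) ` supp \<kappa>"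
  have PQ: "compactin ?X ?P" "compactin ?X ?Q"
    using local_test_section_smooth[OF E t k(1)] local_test_section_smooth[OF E s k(2)] by simp_all
  have sub: "?P \<subseteq> tdomain \<tau>" "?Q \<subseteq> tdomain \<sigma>" using k by (auto simp: test_functions_iff intro!: inv_into_into)
  have inP: "x \<in> ?P" if "x \<in> tdomain \<tau>" "\<kappa>' (tcoord \<tau> x) \<noteq> 0" for x
    by (rule rev_image_eqI[OF subsetD[OF closure_subset]]) (use that chart_inv_eq[OF sc(1), of x] in auto)
  have inQ: "x \<in> ?Q" if "x \<in> tdomain \<sigma>" "\<kappa> (tcoord \<sigma> x) \<noteq> 0" for x
    by (rule rev_image_eqI[OF subsetD[OF closure_subset]]) (use that chart_inv_eq[OF sc(2), of x] in auto)
  let ?K = "tcoord \<tau> ` (?P \<inter> ?Q)"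
  have K: "compact ?K" using chart_onD(5)[OF smooth_chartD[OF sc(1)], of "?P \<inter> ?Q"] sub
      closed_Int_compactin[OF compactin_imp_closedin[OF H PQ(1)] PQ(2)] by auto
  have KW: "?K \<subseteq> ?W" using sub by auto
  have tr: "?\<Phi> (tcoord \<tau> x) = tcoord \<sigma> x" if "x \<in> tdomain \<tau>" for x
    using chart_inv_eq[OF sc(1), of x] that by (simp add: transition_def)
  have "smooth_on ?W (\<lambda>y. \<kappa> (?\<Phi> y))" by (rule smooth_on_compose[OF s\<Phi> test_functionsD(1)[OF k(2)] o]) auto
  moreover have "smooth_on ?W \<kappa>'" using test_functionsD(1)[OF k(1)] by (rule smooth_on_subset) auto
  moreover have "smooth_on ?W (\<lambda>y. tfibre \<sigma> (inv_into (fibre E (chart_inv (tchart \<tau>) y)) (tfibre \<tau>) (axis l 1)) $ i)"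
    using frame_transition_smooth[OF E lt dom sc(1)] by (intro smooth_on_vec_nth[OF o]) simp
  moreover have "smooth_on ?W (jac_det ?\<Phi>)"
    using diffeo_jac_det_pos[OF d] by (intro smooth_on_abs[OF o smooth_on_det_derivative[OF o s\<Phi>]]) fastforce
  ultimately have "smooth_on ?W (\<lambda>y. \<kappa>' y * \<kappa> (?\<Phi> y) *
      (tfibre \<sigma> (inv_into (fibre E (chart_inv (tchart \<tau>) y)) (tfibre \<tau>) (axis l 1)) $ i) * jac_det ?\<Phi> y)"
    by (intro smooth_on_mult[OF o])
  then have "smooth_on ?W (transition_weight E \<tau> \<sigma> \<kappa>' \<kappa> l i)"
    by (rule smooth_on_cong[OF o, rotated]) (simp add: transition_weight_def)
  moreover have nz: "y \<in> ?K" if y: "transition_weight E \<tau> \<sigma> \<kappa>' \<kappa> l i y \<noteq> 0" for y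
  proof -
    obtain x where x: "x \<in> tdomain \<tau>" "x \<in> tdomain \<sigma>" "y = tcoord \<tau> x"
      using y by (auto simp: transition_weight_def split: if_splits)
    have "\<kappa>' (tcoord \<tau> x) \<noteq> 0" "\<kappa> (tcoord \<sigma> x) \<noteq> 0"
      using y tr[OF x(1)] x(3) by (auto simp: transition_weight_def split: if_splits)
    then show ?thesis using inP inQ x by blast
  qed
  ultimately have "smooth_on UNIV (transition_weight E \<tau> \<sigma> \<kappa>' \<kappa> l i)"
    using K by (intro smooth_on_extend_zero[OF o _ KW]) (auto intro: compact_imp_closed)
  then show ?thesis using K KW nz by (rule test_functionsI)
qed

text \<open>\<open>\<rho>' \<circ> \<rho>\<^sup>-\<^sup>1\<close> is linear on the fibre, so it is given by its matrix.\<close>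

lemma fibre_transition_linear:
  assumes E: "smooth_vector_bundle E" and l: "local_trivialization E U \<rho>" "local_trivialization E U' \<rho>'"
    and x: "x \<in> U" "x \<in> U'" "x \<in> points (base E)" and a: "a \<in> fibre E x"
  shows "\<rho>' a $ i = (\<Sum>l\<in>UNIV. \<rho>' (inv_into (fibre E x) \<rho> (axis l 1)) $ i * \<rho> a $ l)"
proof -
  let ?s = "inv_into (fibre E x) \<rho>"
  note s = local_trivialization_inverse(2,3)[OF l(1) x(1)]
  have f: "fibre_linear E x \<rho>" "fibre_linear E x \<rho>'" and i: "inj_on \<rho> (fibre E x)"
    using l x by (auto simp: local_trivialization_def bij_betw_def)
  have "?s (w + w') = fadd E (?s w) (?s w')" for w w'
    using f(1) s fibre_closed(1)[OF E x(3) s(1) s(1)] by (intro inv_into_f_eq[OF i]) (auto simp: fibre_linear_def)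
  moreover have "?s (c *\<^sub>R w) = fscale E c (?s w)" for c w
    using f(1) s fibre_closed(2)[OF E x(3) s(1)] by (intro inv_into_f_eq[OF i]) (auto simp: fibre_linear_def)
  ultimately have lin: "linear (\<lambda>w. \<rho>' (?s w))" using f(2) s(1) by (intro linearI) (auto simp: fibre_linear_def)
  have "?s (\<rho> a) = a" using i a by (rule inv_into_f_f)
  then have "\<rho>' a = matrix (\<lambda>w. \<rho>' (?s w)) *v \<rho> a" using fun_cong[OF matrix_vector_mul(2)[OF lin], of "\<rho> a"] by simp
  then show ?thesis by (simp add: matrix_vector_mult_def matrix_def)
qed

text \<open>At points of the overlap both sides agree by linearity of the change of frames and the transformation of
  determinants. At all other points both sides vanish, since \<open>\<psi>\<close>, the value of a weight at
  \<open>x\<close>, is non-zero in the domain of \<open>\<tau>\<close> only.\<close>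

lemma local_test_section_transfer:
  assumes E: "smooth_vector_bundle E" and t: "triv_of E \<tau>" and s: "triv_of E \<sigma>"
    and \<psi>: "\<psi> \<noteq> 0 \<Longrightarrow> x \<in> tdomain \<tau> \<and> \<kappa>' (tcoord \<tau> x) = 1" and x: "x \<in> points (base E)"
  shows "\<psi> * local_test_section E \<sigma> i (\<lambda>y. \<kappa> y * \<xi> y) (x, a, v) =
    (\<Sum>l\<in>UNIV. \<psi> * local_test_section E \<tau> l (transfer E \<tau> \<sigma> \<kappa>' \<kappa> l i \<xi>) (x, a, v))"
proof (cases "\<psi> \<noteq> 0 \<and> x \<in> tdomain \<sigma> \<and> a \<in> fibre E x \<and> (\<forall>j. v j \<in> tangent_space (base E) x)")
  case False
  have 0: "local_test_section E \<tau> l (transfer E \<tau> \<sigma> \<kappa>' \<kappa> l i \<xi>) (x, a, v) = 0"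
    if "x \<notin> tdomain \<sigma>" "x \<in> tdomain \<tau>" for l
  proof -
    have "tcoord \<tau> x \<notin> overlap \<tau> \<sigma>"
    proof
      assume "tcoord \<tau> x \<in> overlap \<tau> \<sigma>"
      then obtain x' where "x' \<in> tdomain \<tau>" "x' \<in> tdomain \<sigma>" "tcoord \<tau> x = tcoord \<tau> x'" by auto
      moreover have "inj_on (tcoord \<tau>) (tdomain \<tau>)"
        using chart_onD(2)[OF smooth_chartD, of "base E" "tchart \<tau>"] t by (simp add: total_triv_triple_def)
      ultimately show False using that by (auto dest: inj_onD)
    qed
    then show ?thesis by (simp add: local_test_section_def pullback_def)
  qed
  have "\<psi> * local_test_section E \<tau> l (transfer E \<tau> \<sigma> \<kappa>' \<kappa> l i \<xi>) (x, a, v) = 0" for l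
  proof (cases "\<psi> \<noteq> 0 \<and> x \<notin> tdomain \<sigma>")
    case True then show ?thesis using 0[of l] \<psi> by simp
  next
    case f: False then show ?thesis using False by (auto simp: local_test_section_def)
  qed
  moreover have "\<psi> * local_test_section E \<sigma> i (\<lambda>y. \<kappa> y * \<xi> y) (x, a, v) = 0"
    using False by (auto simp: local_test_section_def)
  ultimately show ?thesis by (simp only: sum.neutral_const)
next
  case True
  then have xx: "x \<in> tdomain \<tau>" "\<kappa>' (tcoord \<tau> x) = 1" "x \<in> tdomain \<sigma>" "a \<in> fibre E x"
    and v: "\<And>j. v j \<in> tangent_space (base E) x" using \<psi> by auto
  have M: "smooth_manifold (base E)" using E by (simp add: smooth_vector_bundle_def)
  have lt: "local_trivialization E (tdomain \<tau>) (tfibre \<tau>)" "local_trivialization E (tdomain \<sigma>) (tfibre \<sigma>)"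
    and sc: "smooth_chart (base E) (tchart \<tau>)"
    using t s by (auto simp: total_triv_triple_def)
  note c = triv_charts_at[OF t xx(1)] triv_charts_at[OF s xx(3)]
  have inv: "inv_into (tdomain \<tau>) (tcoord \<tau>) (tcoord \<tau> x) = x" using chart_inv_eq[OF sc, of x] xx(1) by simp
  have tr: "transition (tchart \<tau>) (tchart \<sigma>) (tcoord \<tau> x) = tcoord \<sigma> x" by (simp add: transition_def inv)
  have "(\<chi> j. v j (tchart \<sigma>)) = (\<chi> j. tr_deriv x (tchart \<tau>) (tchart \<sigma>) (v j (tchart \<tau>)))"
    using tangent_spaceD[OF v c] by (simp add: vec_eq_iff)
  then have det: "\<bar>det (\<chi> j. v j (tchart \<sigma>))\<bar> =
      jac_det (transition (tchart \<tau>) (tchart \<sigma>)) (tcoord \<tau> x) * \<bar>det (\<chi> j. v j (tchart \<tau>))\<bar>"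
    using det_rows_linear[OF tr_deriv_linear[OF M c], of "\<lambda>j. v j (tchart \<tau>)"] by (simp add: abs_mult)
  have "tcoord \<tau> x \<in> overlap \<tau> \<sigma>" using xx by auto
  then have "local_test_section E \<tau> l (transfer E \<tau> \<sigma> \<kappa>' \<kappa> l i \<xi>) (x, a, v) =
      \<kappa> (tcoord \<sigma> x) * \<xi> (tcoord \<sigma> x) * (tfibre \<sigma> (inv_into (fibre E x) (tfibre \<tau>) (axis l 1)) $ i * tfibre \<tau> a $ l) *
      \<bar>det (\<chi> j. v j (tchart \<sigma>))\<bar>" for l
    using xx v by (simp add: local_test_section_def pullback_def transition_weight_def inv tr det mult_ac)
  then have "(\<Sum>l\<in>UNIV. \<psi> * local_test_section E \<tau> l (transfer E \<tau> \<sigma> \<kappa>' \<kappa> l i \<xi>) (x, a, v)) =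
      \<psi> * (\<kappa> (tcoord \<sigma> x) * \<xi> (tcoord \<sigma> x) * (tfibre \<sigma> a $ i) * \<bar>det (\<chi> j. v j (tchart \<sigma>))\<bar>)"
    unfolding fibre_transition_linear[OF E lt xx(1,3) x xx(4), of i] by (simp add: sum_distrib_left sum_distrib_right)
  then show ?thesis using xx v by (simp add: local_test_section_def)
qed


section \<open>Local representations of Sobolev sections\<close>

lemma uniform_finite_bound:
  assumes "finite I" "\<And>i. i \<in> I \<Longrightarrow> \<exists>C>0. \<forall>z. f i z \<le> ennreal C * g i z"
  obtains C where "0 < C" "\<And>i z. i \<in> I \<Longrightarrow> f i z \<le> ennreal C * g i z"
proof -
  obtain c where c: "\<And>i. i \<in> I \<Longrightarrow> c i > 0 \<and> (\<forall>z. f i z \<le> ennreal (c i) * g i z)"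
    using bchoice[of I "\<lambda>i C. C > 0 \<and> (\<forall>z. f i z \<le> ennreal C * g i z)"] assms(2) by blast
  have s: "c i \<le> (\<Sum>i\<in>I. c i) + 1" if "i \<in> I" for i
  proof -
    have "c i \<le> (\<Sum>i\<in>I. c i)" using assms(1) that c by (intro member_le_sum) (auto intro: less_imp_le)
    then show ?thesis by simp
  qed
  show ?thesis
  proof (rule that)
    show "0 < (\<Sum>i\<in>I. c i) + 1" using c by (intro add_nonneg_pos sum_nonneg) (auto intro: less_imp_le)
    show "f i z \<le> ennreal ((\<Sum>i\<in>I. c i) + 1) * g i z" if "i \<in> I" for i z
    proof -
      have "f i z \<le> ennreal (c i) * g i z" using c[OF that] by blast
      also have "\<dots> \<le> ennreal ((\<Sum>i\<in>I. c i) + 1) * g i z" by (intro mult_right_mono ennreal_leI s[OF that]) simp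
      finally show ?thesis .
    qed
  qed
qed

theorem theorem9p17:
  fixes E :: "('e, 'm, 'n::finite, 'r::finite) vector_bundle"
    and e q :: real
    and N \<beta> :: nat
    and \<Lambda> :: "nat \<Rightarrow> ('e, 'm, 'n, 'r) aug_triv"
    and V :: "'m set"
  assumes "smooth_vector_bundle E"
    and "compact_space (mtop (base E))"
    and "1 < q"
    and "aug_total_triv_atlas E N \<Lambda>"
    and "e \<notin> \<int> \<and> e < -1 \<longrightarrow> GL_compatible N \<Lambda>"
    and "\<beta> \<in> {1..N}"
    and "openin (mtop (base E)) V"
    and "mtop (base E) closure_of V \<subseteq> tdomain (\<Lambda> \<beta>)"
  shows "\<exists>C\<ge>0. \<forall>u \<in> bundle_sobolev_space e q E N \<Lambda>. distribution_support E u \<subseteq> V \<longrightarrow>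
    (\<forall>i. local_rep E (\<Lambda> \<beta>) u i \<in> sobolev_distributions e q (coord_range (\<Lambda> \<beta>)) \<and>
      distr_norm e q (coord_range (\<Lambda> \<beta>)) (local_rep E (\<Lambda> \<beta>) u i)
        \<le> ennreal C * bundle_sobolev_norm e q E N \<Lambda> u)"
proof -
  note E = assms(1)
  let ?X = "mtop (base E)" and ?\<Omega> = "\<lambda>\<alpha>. coord_range (\<Lambda> \<alpha>)" and ?I = "{1..N} \<times> (UNIV :: 'r set)"
  have t: "triv_of E (\<Lambda> \<alpha>)" and w: "smooth_map_on (base E) (points (base E)) euclidean_manifold (tweight (\<Lambda> \<alpha>))"
    and ws: "?X closure_of {x \<in> points (base E). tweight (\<Lambda> \<alpha>) x \<noteq> 0} \<subseteq> tdomain (\<Lambda> \<alpha>)" if "\<alpha> \<in> {1..N}" for \<alpha>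
    using assms(4) that by (auto simp: aug_total_triv_atlas_def)
  have w1: "(\<Sum>\<alpha>=1..N. tweight (\<Lambda> \<alpha>) x) = 1" if "x \<in> points (base E)" for x
    using assms(4) that by (auto simp: aug_total_triv_atlas_def)
  have sc: "smooth_chart (base E) (tchart (\<Lambda> \<alpha>))" if "\<alpha> \<in> {1..N}" for \<alpha>
    using t[OF that] by (simp add: total_triv_triple_def)
  have \<Omega>: "open (?\<Omega> \<alpha>)" if "\<alpha> \<in> {1..N}" for \<alpha> using smooth_chartD[OF sc[OF that]] by (simp add: chart_on_def)
  have dom: "tdomain (\<Lambda> \<alpha>) \<subseteq> points (base E)" if "\<alpha> \<in> {1..N}" for \<alpha>
    using chart_onD(3)[OF smooth_chartD[OF sc[OF that]]] by simp
  have cl: "compact (tcoord (\<Lambda> \<alpha>) ` (?X closure_of A))" if "\<alpha> \<in> {1..N}" "?X closure_of A \<subseteq> tdomain (\<Lambda> \<alpha>)" for \<alpha> A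
    using chart_onD(5)[OF smooth_chartD[OF sc[OF that(1)]], of "?X closure_of A"] that(2)
      closedin_compact_space[OF assms(2) closedin_closure_of] by simp
  have "\<exists>\<kappa>. \<kappa> \<in> test_functions (?\<Omega> \<alpha>) \<and> (\<forall>x\<in>points (base E). tweight (\<Lambda> \<alpha>) x \<noteq> 0 \<longrightarrow> \<kappa> (tcoord (\<Lambda> \<alpha>) x) = 1)"
    if a: "\<alpha> \<in> {1..N}" for \<alpha>
  proof -
    let ?A = "{x \<in> points (base E). tweight (\<Lambda> \<alpha>) x \<noteq> 0}"
    obtain \<kappa> V' where \<kappa>: "\<kappa> \<in> test_functions (?\<Omega> \<alpha>)" "tcoord (\<Lambda> \<alpha>) ` (?X closure_of ?A) \<subseteq> V'" "\<And>x. x \<in> V' \<Longrightarrow> \<kappa> x = 1"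
      by (rule smooth_cutoff[OF cl[OF a ws[OF a]] \<Omega>[OF a]]) (use ws[OF a] in auto)
    have "?A \<subseteq> ?X closure_of ?A" by (rule closure_of_subset) auto
    then show ?thesis using \<kappa> by (intro exI[of _ \<kappa>]) blast
  qed
  then have "\<forall>\<alpha>. \<exists>\<kappa>. \<alpha> \<in> {1..N} \<longrightarrow> \<kappa> \<in> test_functions (?\<Omega> \<alpha>) \<and>
      (\<forall>x\<in>points (base E). tweight (\<Lambda> \<alpha>) x \<noteq> 0 \<longrightarrow> \<kappa> (tcoord (\<Lambda> \<alpha>) x) = 1)" by blast
  then obtain \<kappa>' where \<kappa>': "\<And>\<alpha>. \<alpha> \<in> {1..N} \<Longrightarrow> \<kappa>' \<alpha> \<in> test_functions (?\<Omega> \<alpha>)"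
    "\<And>\<alpha> x. \<alpha> \<in> {1..N} \<Longrightarrow> x \<in> points (base E) \<Longrightarrow> tweight (\<Lambda> \<alpha>) x \<noteq> 0 \<Longrightarrow> \<kappa>' \<alpha> (tcoord (\<Lambda> \<alpha>) x) = 1"
    unfolding choice_iff by blast
  obtain \<kappa> V' where \<kappa>: "\<kappa> \<in> test_functions (?\<Omega> \<beta>)" "open V'" "tcoord (\<Lambda> \<beta>) ` (?X closure_of V) \<subseteq> V'" "\<And>x. x \<in> V' \<Longrightarrow> \<kappa> x = 1"
    by (rule smooth_cutoff[OF cl[OF assms(6,8)] \<Omega>[OF assms(6)]]) (use assms(8) in auto)
  have VV': "tcoord (\<Lambda> \<beta>) x \<in> V'" if "x \<in> V" for x
    using that \<kappa>(3) closure_of_subset[OF openin_subset[OF assms(7)]] by auto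
  \<comment> \<open>\<open>p = (\<alpha>, l)\<close> runs through the terms of the norm of \<open>u\<close>.\<close>
  let ?S = "\<lambda>u p. local_rep E (\<Lambda> (fst p)) (mult_distribution (tweight (\<Lambda> (fst p))) u) (snd p)"
  let ?A = "\<lambda>p i. transfer E (\<Lambda> (fst p)) (\<Lambda> \<beta>) (\<kappa>' (fst p)) \<kappa> (snd p) i"
  have tw: "transition_weight E (\<Lambda> (fst p)) (\<Lambda> \<beta>) (\<kappa>' (fst p)) \<kappa> (snd p) i \<in> test_functions (overlap (\<Lambda> (fst p)) (\<Lambda> \<beta>))"
    if "p \<in> ?I" for p i using that assms(6) by (intro transition_weight_test[OF E t t] \<kappa>' \<kappa>) auto
  have rep: "local_rep E (\<Lambda> \<beta>) u i \<xi> = (\<Sum>p\<in>?I. ?S u p (?A p i \<xi>))"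
    if u: "u \<in> bundle_distributions E" "distribution_support E u \<subseteq> V" and xi: "\<xi> \<in> test_functions (?\<Omega> \<beta>)" for u i \<xi>
  proof -
    let ?T = "local_rep E (\<Lambda> \<beta>) u i"
    have s: "smooth_on UNIV \<xi>" "smooth_on UNIV \<kappa>" using test_functionsD(1) xi \<kappa>(1) by blast+
    have 1: "(\<lambda>y. \<kappa> y * \<xi> y) \<in> test_functions (?\<Omega> \<beta>)"
      by (rule test_functions_mult_smooth[OF \<Omega>[OF assms(6)] smooth_on_subset[OF s(2)] xi]) simp
    have 2: "(\<lambda>y. (1 - \<kappa> y) * \<xi> y) \<in> test_functions (?\<Omega> \<beta>)"
      by (rule test_functions_mult_smooth[OF \<Omega>[OF assms(6)] smooth_on_subset[of UNIV] xi])
        (auto intro!: smooth_on_diff s)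
    have "?T \<xi> = ?T (\<lambda>y. \<kappa> y * \<xi> y + (1 - \<kappa> y) * \<xi> y)" by (simp add: algebra_simps)
    also have "\<dots> = ?T (\<lambda>y. \<kappa> y * \<xi> y) + ?T (\<lambda>y. (1 - \<kappa> y) * \<xi> y)"
      by (rule linear_functional_onD(1)[OF local_rep_linear[OF E t[OF assms(6)] u(1)] 1 2])
    also have "?T (\<lambda>y. (1 - \<kappa> y) * \<xi> y) = 0"
    proof (rule local_rep_vanish[OF E t[OF assms(6)] u(1) 2])
      fix x assume "x \<in> distribution_support E u"
      then have x: "tcoord (\<Lambda> \<beta>) x \<in> V'" using u(2) VV' by blast
      have "{y. (1 - \<kappa> y) * \<xi> y \<noteq> 0} \<subseteq> - V'" using \<kappa>(4) by auto
      then have "closure {y. (1 - \<kappa> y) * \<xi> y \<noteq> 0} \<subseteq> - V'" using \<kappa>(2) by (intro closure_minimal) auto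
      then show "tcoord (\<Lambda> \<beta>) x \<notin> closure {y. (1 - \<kappa> y) * \<xi> y \<noteq> 0}" using x by blast
    qed
    finally have T: "?T \<xi> = u (local_test_section E (\<Lambda> \<beta>) i (\<lambda>y. \<kappa> y * \<xi> y))" by (simp add: local_rep_def)
    let ?f = "\<lambda>p (x, a, v). tweight (\<Lambda> (fst p)) x * local_test_section E (\<Lambda> (fst p)) (snd p) (?A p i \<xi>) (x, a, v)"
    have "local_test_section E (\<Lambda> \<beta>) i (\<lambda>y. \<kappa> y * \<xi> y) = (\<lambda>z. \<Sum>p\<in>?I. ?f p z)"
    proof
      fix z :: "'m \<times> 'e \<times> ('n \<Rightarrow> ('m, 'n) tvec)"
      obtain x a v where z: "z = (x, a, v)" by (cases z) auto
      show "local_test_section E (\<Lambda> \<beta>) i (\<lambda>y. \<kappa> y * \<xi> y) z = (\<Sum>p\<in>?I. ?f p z)"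
      proof (cases "x \<in> points (base E)")
        case x: True
        have "tweight (\<Lambda> \<alpha>) x * local_test_section E (\<Lambda> \<beta>) i (\<lambda>y. \<kappa> y * \<xi> y) (x, a, v) =
            (\<Sum>l\<in>UNIV. ?f (\<alpha>, l) (x, a, v))" if a: "\<alpha> \<in> {1..N}" for \<alpha>
        proof -
          have "x \<in> tdomain (\<Lambda> \<alpha>) \<and> \<kappa>' \<alpha> (tcoord (\<Lambda> \<alpha>) x) = 1" if "tweight (\<Lambda> \<alpha>) x \<noteq> 0"
            using that \<kappa>'(2)[OF a x that] ws[OF a] x
              closure_of_subset[of "{x \<in> points (base E). tweight (\<Lambda> \<alpha>) x \<noteq> 0}" ?X] by auto
          then show ?thesis
            using local_test_section_transfer[OF E t[OF a] t[OF assms(6)] _ x, of "tweight (\<Lambda> \<alpha>) x" "\<kappa>' \<alpha>" i \<kappa> \<xi> a v] by simp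
        qed
        then have "(\<Sum>\<alpha>=1..N. tweight (\<Lambda> \<alpha>) x * local_test_section E (\<Lambda> \<beta>) i (\<lambda>y. \<kappa> y * \<xi> y) (x, a, v)) =
            (\<Sum>\<alpha>=1..N. \<Sum>l\<in>UNIV. ?f (\<alpha>, l) (x, a, v))" by (intro sum.cong refl)
        then show ?thesis using w1[OF x] by (simp add: z sum_distrib_right[symmetric] sum.cartesian_product split_def)
      next
        case False
        have "x \<notin> tdomain (\<Lambda> \<alpha>)" if "\<alpha> \<in> {1..N}" for \<alpha> using dom[OF that] False by blast
        then have "local_test_section E (\<Lambda> \<alpha>) l \<zeta> (x, a, v) = 0" if "\<alpha> \<in> {1..N}" for \<alpha> l \<zeta>
          using that by (simp add: local_test_section_def)
        note 0 = this
        have "(\<Sum>p\<in>?I. ?f p z) = 0" by (rule sum.neutral) (auto simp: z 0)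
        then show ?thesis using 0[OF assms(6)] by (simp only: z)
      qed
    qed
    moreover have "u (\<lambda>z. \<Sum>p\<in>?I. ?f p z) = (\<Sum>p\<in>?I. u (?f p))"
    proof (rule conjunct2[OF linear_functional_on_sum[OF bundle_distribution_linear[OF u(1)]]])
      show "?I \<noteq> {}" using assms(6) by auto
      show "?f p \<in> all_test_sections E" if "p \<in> ?I" for p
      proof (intro test_sections_mult[OF E] w local_test_section_all[OF E t])
        note d = overlap_diffeo[OF E t t[OF assms(6)], of "fst p"]
        show "?A p i \<xi> \<in> test_functions (?\<Omega> (fst p))"
          using that by (intro test_functions_mono[OF _ pullback_test[OF d tw[OF that] s(1)]]) auto
      qed (use that in auto)
    qed (simp, rule test_sections_add)
    moreover have "(\<Sum>p\<in>?I. u (?f p)) = (\<Sum>p\<in>?I. ?S u p (?A p i \<xi>))" by (simp add: local_rep_def mult_distribution_def)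
    ultimately show ?thesis by (simp only: T)
  qed
  obtain C1 where C1: "C1 > 0" "\<And>S. distr_norm e q (?\<Omega> \<beta>) (\<lambda>\<xi>. \<Sum>p\<in>?I. S p \<xi>) \<le> ennreal C1 * (\<Sum>p\<in>?I. distr_norm e q (?\<Omega> \<beta>) (S p))"
    using distr_norm_sum_le[OF assms(3) \<Omega>[OF assms(6)], of ?I e] assms(6) by (auto simp del: sum.cartesian_product)
  obtain C2 where C2: "C2 > 0" "\<And>j T. j \<in> ?I \<times> (UNIV :: 'r set) \<Longrightarrow>
    distr_norm e q (?\<Omega> \<beta>) (\<lambda>\<xi>. T (?A (fst j) (snd j) \<xi>)) \<le> ennreal C2 * distr_norm e q (?\<Omega> (fst (fst j))) T"
  proof (rule uniform_finite_bound[of "?I \<times> (UNIV :: 'r set)" "\<lambda>j T. distr_norm e q (?\<Omega> \<beta>) (\<lambda>\<xi>. T (?A (fst j) (snd j) \<xi>))"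
      "\<lambda>j. distr_norm e q (?\<Omega> (fst (fst j)))"])
    fix j assume j: "j \<in> ?I \<times> (UNIV :: 'r set)"
    then have a: "fst (fst j) \<in> {1..N}" and p: "fst j \<in> ?I" by auto
    show "\<exists>C>0. \<forall>T. distr_norm e q (?\<Omega> \<beta>) (\<lambda>\<xi>. T (?A (fst j) (snd j) \<xi>)) \<le> ennreal C * distr_norm e q (?\<Omega> (fst (fst j))) T"
      by (rule distr_norm_pullback_le[OF overlap_diffeo[OF E t[OF a] t[OF assms(6)]] tw[OF p] assms(3) _ _ \<Omega>[OF a] \<Omega>[OF assms(6)]]) auto
  qed (auto intro: that)
  have bound: "distr_norm e q (?\<Omega> \<beta>) (local_rep E (\<Lambda> \<beta>) u i) \<le> ennreal (C1 * C2) * bundle_sobolev_norm e q E N \<Lambda> u"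
    if "u \<in> bundle_distributions E" "distribution_support E u \<subseteq> V" for u i
  proof -
    have "distr_norm e q (?\<Omega> \<beta>) (local_rep E (\<Lambda> \<beta>) u i) = distr_norm e q (?\<Omega> \<beta>) (\<lambda>\<xi>. \<Sum>p\<in>?I. ?S u p (?A p i \<xi>))"
      by (rule distr_norm_cong) (rule rep[OF that])
    also have "\<dots> \<le> ennreal C1 * (\<Sum>p\<in>?I. distr_norm e q (?\<Omega> \<beta>) (\<lambda>\<xi>. ?S u p (?A p i \<xi>)))" by (rule C1(2))
    also have "\<dots> \<le> ennreal C1 * (\<Sum>p\<in>?I. ennreal C2 * distr_norm e q (?\<Omega> (fst p)) (?S u p))"
    proof (intro mult_left_mono sum_mono)
      fix p assume "p \<in> ?I"
      then show "distr_norm e q (?\<Omega> \<beta>) (\<lambda>\<xi>. ?S u p (?A p i \<xi>)) \<le> ennreal C2 * distr_norm e q (?\<Omega> (fst p)) (?S u p)"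
        using C2(2)[of "(p, i)" "?S u p"] by simp
    qed simp
    also have "\<dots> = ennreal (C1 * C2) * bundle_sobolev_norm e q E N \<Lambda> u"
      using C1(1) C2(1) by (simp add: bundle_sobolev_norm_def sum.cartesian_product split_def sum_distrib_left ennreal_mult mult.assoc)
    finally show ?thesis .
  qed
  show ?thesis
  proof (intro exI[of _ "C1 * C2"] conjI ballI impI allI)
    show "0 \<le> C1 * C2" using C1(1) C2(1) by simp
    fix u i assume u: "u \<in> bundle_sobolev_space e q E N \<Lambda>" and V: "distribution_support E u \<subseteq> V"
    have ud: "u \<in> bundle_distributions E" and fin: "bundle_sobolev_norm e q E N \<Lambda> u < \<infinity>"
      using u by (auto simp: bundle_sobolev_space_def)
    show b: "distr_norm e q (?\<Omega> \<beta>) (local_rep E (\<Lambda> \<beta>) u i) \<le> ennreal (C1 * C2) * bundle_sobolev_norm e q E N \<Lambda> u"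
      by (rule bound[OF ud V])
    also have "\<dots> < \<infinity>" using fin by (simp add: ennreal_mult_less_top)
    finally have f: "distr_norm e q (?\<Omega> \<beta>) (local_rep E (\<Lambda> \<beta>) u i) < \<infinity>" .
    show "local_rep E (\<Lambda> \<beta>) u i \<in> sobolev_distributions e q (?\<Omega> \<beta>)" unfolding sobolev_distributions_def
      using finite_distr_norm_distributions[OF assms(3) \<Omega>[OF assms(6)] local_rep_linear[OF E t[OF assms(6)] ud] f] f by blast
  qed
qed


end
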